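(* Let $A$ be a finite normal subgroup of a solvable group $G$ and let $H:=A\rtimes G/C_G(A)$. Suppose that (i) $\mathcal{Z}(\mathcal{U}(\mathbb{Z}[H]))\cap(1+\Delta(H)\Delta(A))$ is trivial, i.e. consists only of trivial units (it is contained in $\pm\mathcal{Z}(H)$); (ii) $G/C_G(A)$ is a cut-group. Then $\pi(A)\subseteq\{2,3,5,7\}$.
   Context: $C_G(A)$ is the centralizer of $A$ in $G$, and $H=A\rtimes G/C_G(A)$ is the semidirect product formed with respect to the action of $G/C_G(A)$ on $A$ induced by conjugation. For a group $G$, $\mathcal{U}(\mathbb{Z}[G])$ is the group of units of the integral group ring $\mathbb{Z}[G]$ and $\mathcal{Z}(\cdot)$ denotes the center of a group. A central unit of $\mathbb{Z}[G]$ is trivial if it lies in $\pm\mathcal{Z}(G)$; $G$ is called a cut-group if $\mathcal{Z}(\mathcal{U}(\mathbb{Z}[G]))=\pm\mathcal{Z}(G)$. $\Delta(H)$ denotes the augmentation ideal of $\mathbb{Z}[H]$, and $\Delta(A)\subseteq\mathbb{Z}[A]\subseteq\mathbb{Z}[H]$ that of $\mathbb{Z}[A]$; $\Delta(H)\Delta(A)$ is the additive subgroup of $\mathbb{Z}[H]$ generated by all products $xy$ with $x\in\Delta(H)$, $y\in\Delta(A)$. $\pi(A)$ is the set of primes $p$ for which $A$ contains an element of order $p$. *)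

theory Defs
  imports
    "HOL-Algebra.Solvable_Groups"
    "HOL-Algebra.Multiplicative_Group"
    "HOL-Library.Poly_Mapping"
    "HOL-Computational_Algebra.Primes"
begin

definition centralizer :: "('a, 'm) monoid_scheme \<Rightarrow> 'a set \<Rightarrow> 'a set" where
  "centralizer G A = {g \<in> carrier G. \<forall>a\<in>A. g \<otimes>\<^bsub>G\<^esub> a = a \<otimes>\<^bsub>G\<^esub> g}"

definition center :: "('a, 'm) monoid_scheme \<Rightarrow> 'a set" where
  "center G = centralizer G (carrier G)"

definition order_primes :: "('a, 'm) monoid_scheme \<Rightarrow> nat set" where
  "order_primes G = {p. prime p \<and> (\<exists>x\<in>carrier G. group.ord G x = p)}"

definition semidirect_product ::
  "('a, 'm) monoid_scheme \<Rightarrow> ('b, 'n) monoid_scheme \<Rightarrow> ('b \<Rightarrow> 'a \<Rightarrow> 'a) \<Rightarrow> ('a \<times> 'b) monoid" where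
  "semidirect_product N Q \<phi> =
     \<lparr>carrier = carrier N \<times> carrier Q,
      monoid.mult = (\<lambda>(a, q) (b, r). (a \<otimes>\<^bsub>N\<^esub> \<phi> q b, q \<otimes>\<^bsub>Q\<^esub> r)),
      one = (\<one>\<^bsub>N\<^esub>, \<one>\<^bsub>Q\<^esub>)\<rparr>"

(* The value g a g^{-1} common to all representatives g of the coset X. It is unspecified if the
   representatives disagree, which cannot happen for a coset of the centralizer of a normal
   subgroup containing a. *)
definition coset_conj :: "('a, 'm) monoid_scheme \<Rightarrow> 'a set \<Rightarrow> 'a \<Rightarrow> 'a" where
  "coset_conj G X a = the_elem ((\<lambda>g. g \<otimes>\<^bsub>G\<^esub> a \<otimes>\<^bsub>G\<^esub> inv\<^bsub>G\<^esub> g) ` X)"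

definition conj_semidirect :: "('a, 'm) monoid_scheme \<Rightarrow> 'a set \<Rightarrow> ('a \<times> 'a set) monoid" where
  "conj_semidirect G A =
     semidirect_product (G\<lparr>carrier := A\<rparr>) (G Mod centralizer G A) (coset_conj G)"

(* The canonical copy of A in conj_semidirect G A. *)
definition conj_semidirect_base :: "('a, 'm) monoid_scheme \<Rightarrow> 'a set \<Rightarrow> ('a \<times> 'a set) set" where
  "conj_semidirect_base G A = A \<times> {\<one>\<^bsub>G Mod centralizer G A\<^esub>}"

(* Finite formal sums of group elements; the product extends that of G bilinearly. For a subgroup
   K of G, int_group_ring (G(|carrier := K|)) is literally a subring of int_group_ring G. *)
definition int_group_ring :: "('a, 'm) monoid_scheme \<Rightarrow> ('a \<Rightarrow>\<^sub>0 int) ring" where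
  "int_group_ring G =
     \<lparr>carrier = {x. Poly_Mapping.keys x \<subseteq> carrier G},
      monoid.mult = (\<lambda>x y. frag_extend (\<lambda>g. frag_extend (\<lambda>h. frag_of (g \<otimes>\<^bsub>G\<^esub> h)) y) x),
      one = frag_of \<one>\<^bsub>G\<^esub>,
      zero = 0,
      add = (+)\<rparr>"

definition augmentation :: "('a \<Rightarrow>\<^sub>0 int) \<Rightarrow> int" where
  "augmentation x = (\<Sum>g\<in>Poly_Mapping.keys x. Poly_Mapping.lookup x g)"

definition augmentation_ideal :: "('a, 'm) monoid_scheme \<Rightarrow> ('a \<Rightarrow>\<^sub>0 int) set" where
  "augmentation_ideal G = {x \<in> carrier (int_group_ring G). augmentation x = 0}"

definition additive_product :: "('a, 'm) ring_scheme \<Rightarrow> 'a set \<Rightarrow> 'a set \<Rightarrow> 'a set" where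
  "additive_product R X Y = generate (add_monoid R) {x \<otimes>\<^bsub>R\<^esub> y | x y. x \<in> X \<and> y \<in> Y}"

definition central_units :: "('a, 'm) monoid_scheme \<Rightarrow> ('a \<Rightarrow>\<^sub>0 int) set" where
  "central_units G = center (units_of (int_group_ring G))"

definition trivial_central_units :: "('a, 'm) monoid_scheme \<Rightarrow> ('a \<Rightarrow>\<^sub>0 int) set" where
  "trivial_central_units G = {frag_of z | z. z \<in> center G} \<union> {- frag_of z | z. z \<in> center G}"

definition cut_group :: "('a, 'm) monoid_scheme \<Rightarrow> bool" where
  "cut_group G \<longleftrightarrow> group G \<and> central_units G = trivial_central_units G"

end

theory Submission
  imports Defs "HOL-Number_Theory.Pocklington" "HOL-Library.Function_Algebras" "HOL-Algebra.Sylow"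
    "Jordan_Normal_Form.Char_Poly" "HOL-Computational_Algebra.Fundamental_Theorem_Algebra"
begin

text \<open>Let \<open>Q = G/C_G(A)\<close>. A central unit \<open>u\<close> of \<open>\<int>[H]\<close> maps to a trivial unit of \<open>\<int>[Q]\<close>, so a power of \<open>u\<close> lies
  in \<open>1 + |A| y\<close> with \<open>y\<close> in the kernel of \<open>\<int>[H] \<rightarrow> \<int>[Q]\<close>, hence in \<open>1 + \<Delta>(H)\<Delta>(A)\<close>; therefore all central
  units of \<open>\<int>[H]\<close> are torsion. For \<open>g\<close> in \<open>H\<close> let \<open>z\<close> be the sum of the class sums of \<open>g\<close> and its inverse.
  Multiplication by \<open>z\<close> is a symmetric integer matrix: if it had an irrational eigenvalue, Dirichlet's
  argument would give a central unit of infinite order. So \<open>z\<close> is a root of a product of distinct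
  integral linear factors, \<open>z ^ l\<close> is congruent to \<open>z\<close> modulo every large prime \<open>l\<close>, and \<open>g ^ l\<close> is conjugate to \<open>g\<close> or
  to its inverse. Hence \<open>H\<close> is inverse semirational: \<open>g ^ j\<close> is conjugate to \<open>g\<close> or its inverse for all \<open>j\<close> prime to \<open>|H|\<close>.

  It remains to see that a finite solvable inverse semirational group involves only the primes 2, 3, 5, 7.
  By induction, a counterexample would yield a prime \<open>p > 7\<close> and such a group, of order composed of these primes, acting on an elementary abelian
  \<open>p\<close>-group \<open>V\<close> so that all multiples \<open>t v\<close> of \<open>v\<close> are, up to sign, conjugate to \<open>v\<close>. Let \<open>C\<close> be a stabilizer of
  maximal order, \<open>U\<close> its fixed space, \<open>p ^ n = |U|\<close>, and \<open>r\<close> the index of \<open>C\<close> in its normalizer, which acts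
  freely on \<open>U - {0}\<close>. Lifting the representation modulo a power of \<open>p\<close> turns the conjugacy of powers into
  equalities between the dimensions of eigenspaces; they bound the dimension of an eigenspace for an eigenvalue of large
  order, and counting vectors of \<open>U\<close> forces \<open>r\<close> to be large. But \<open>r\<close> divides \<open>p ^ n - 1\<close> and has
  only the prime factors 2, 3, 5, 7, so it is small.\<close>

section \<open>Matrices modulo prime powers\<close>

text \<open>Traces of the lifted representation modulo p^N take the place of characters, and N is so
  large that a congruence between dimensions is an equality. The main obstacle is the sign allowed
  by inverse semirationality: only sums over g and its inverse are stable under powers, so only the
  dimensions for t and 1/t together are controlled. The factor 2 lost in this way is regained when
  -1 is a square modulo the order of t, which settles p = 11; p = 13 and p = 19 need arguments of
  their own. The sign also decides the eigenvalue: a primitive root modulo p if p = 1 mod 4, where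
  the sign of a scalar can be corrected, and the square of one if p = 3 mod 4. Dirichlet's argument
  at a real root yields a unit of absolute value other than 1. It lives in one factor only, and to
  be glued with 1 in the other factors it must be congruent to 1 modulo a Bezout constant.\<close>

lemma cong_pow_imp_cong:
  fixes a b :: int
  assumes "[a = b] (mod q ^ N)" "N \<ge> 1"
  shows "[a = b] (mod q)"
  by (rule cong_dvd_modulus[OF assms(1)]) (use assms(2) in \<open>simp add: dvd_power\<close>)

text \<open>Since A is congruent to its own square, divisibility by q^m improves to divisibility by
  q^(m+1) as long as m < N: in each product one factor contributes q^m and the other q.\<close>

lemma idempotent_cong_zero:
  fixes A :: "'i \<Rightarrow> 'i \<Rightarrow> int" and q :: int
  assumes "finite I" "N \<ge> 1"
    and idem: "\<And>i k. i \<in> I \<Longrightarrow> k \<in> I \<Longrightarrow> [(\<Sum>j\<in>I. A i j * A j k) = A i k] (mod q ^ N)"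
    and zero: "\<And>i k. i \<in> I \<Longrightarrow> k \<in> I \<Longrightarrow> q dvd A i k"
    and "i \<in> I" "k \<in> I"
  shows "q ^ N dvd A i k"
proof -
  have "m \<ge> 1 \<Longrightarrow> m \<le> N \<Longrightarrow> \<forall>i\<in>I. \<forall>k\<in>I. q ^ m dvd A i k" for m
  proof (induction m)
    case (Suc m)
    show ?case
    proof (cases "m = 0")
      case True then show ?thesis using zero by simp
    next
      case False
      then have IH: "\<forall>i\<in>I. \<forall>k\<in>I. q ^ m dvd A i k" using Suc by simp
      show ?thesis
      proof (intro ballI)
        fix i k assume ik: "i \<in> I" "k \<in> I"
        have "q ^ Suc m dvd A i j * A j k" if "j \<in> I" for j
        proof -
          have "q ^ m * q dvd A i j * A j k" using IH zero ik that by (intro mult_dvd_mono) auto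
          then show ?thesis by (simp add: mult.commute)
        qed
        then have "q ^ Suc m dvd (\<Sum>j\<in>I. A i j * A j k)" by (rule dvd_sum)
        moreover have "[(\<Sum>j\<in>I. A i j * A j k) = A i k] (mod q ^ Suc m)"
          using idem[OF ik] Suc.prems(2) cong_dvd_modulus le_imp_power_dvd by blast
        ultimately show "q ^ Suc m dvd A i k" using cong_dvd_iff by blast
      qed
    qed
  qed simp
  then show ?thesis using assms by auto
qed

text \<open>The rank of an idempotent is visible both in its trace modulo p^N and in the number of
  its fixed vectors modulo p. Induction on the size splits off rank one: as long as some entry is a
  unit, the product of a fixed column and a row is subtracted; if there is none, the matrix vanishes
  modulo p^N. Keeping the trace modulo p^N rather than p is what later turns congruences of
  dimensions into equalities.\<close>

lemma idempotent_trace: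
  fixes A :: "'i \<Rightarrow> 'i \<Rightarrow> int" and p :: nat
  assumes "finite I" "prime p" "N \<ge> 1"
    and "\<And>i k. i \<in> I \<Longrightarrow> k \<in> I \<Longrightarrow> [(\<Sum>j\<in>I. A i j * A j k) = A i k] (mod int p ^ N)"
  shows "\<exists>r\<le>card I. [(\<Sum>i\<in>I. A i i) = int r] (mod int p ^ N) \<and>
           card {v \<in> I \<rightarrow>\<^sub>E {0..<int p}. \<forall>i\<in>I. [(\<Sum>j\<in>I. A i j * v j) = v i] (mod int p)} = p ^ r"
  using assms(1,4)
proof (induction "card I" arbitrary: I A rule: less_induct)
  case less
  note fin = less.prems(1)
  note idem = less.prems(2)
  have p0: "int p > 1" using assms(2) prime_gt_1_nat by auto
  show ?case
  proof (cases "\<forall>i\<in>I. \<forall>k\<in>I. int p dvd A i k")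
    case True
    have dv: "int p ^ N dvd A i k" if "i \<in> I" "k \<in> I" for i k
      using idempotent_cong_zero[OF fin assms(3) idem _ that] True by blast
    have "[(\<Sum>i\<in>I. A i i) = int 0] (mod int p ^ N)"
      by (simp add: cong_0_iff dv dvd_sum)
    moreover have "{v \<in> I \<rightarrow>\<^sub>E {0..<int p}. \<forall>i\<in>I. [(\<Sum>j\<in>I. A i j * v j) = v i] (mod int p)} = {\<lambda>i\<in>I. 0}"
    proof -
      have s0: "[(\<Sum>j\<in>I. A i j * v j) = 0] (mod int p)" if "i \<in> I" for i v
        using True that by (auto simp: cong_0_iff intro!: dvd_sum)
      have "v = (\<lambda>i\<in>I. 0)" if v: "v \<in> I \<rightarrow>\<^sub>E {0..<int p}" "\<forall>i\<in>I. [(\<Sum>j\<in>I. A i j * v j) = v i] (mod int p)" for v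
      proof
        fix i show "v i = (\<lambda>i\<in>I. 0) i"
        proof (cases "i \<in> I")
          case i: True
          have "[v i = 0] (mod int p)" using s0[OF i, of v] v(2) i cong_trans cong_sym by blast
          moreover have "0 \<le> v i" "v i < int p" using v(1) i by auto
          ultimately have "v i = 0" by (simp add: cong_def)
          then show ?thesis using i by simp
        next
          case False then show ?thesis using v(1) by auto
        qed
      qed
      moreover have "(\<lambda>i\<in>I. 0::int) \<in> I \<rightarrow>\<^sub>E {0..<int p}" using p0 by auto
      moreover have "\<forall>i\<in>I. [(\<Sum>j\<in>I. A i j * (\<lambda>i\<in>I. 0) j) = (\<lambda>i\<in>I. 0) i] (mod int p)"
        by simp
      ultimately show ?thesis by blast
    qed
    ultimately show ?thesis by (intro exI[of _ 0]) simp
  next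
    case False
    then obtain i j0 where i: "i \<in> I" and j0: "j0 \<in> I" and nd: "\<not> int p dvd A i j0" by blast
    have "coprime (A i j0) (int p)"
      using nd assms(2) by (simp add: coprime_commute prime_imp_coprime)
    then have "coprime (A i j0) (int p ^ N)" by simp
    then obtain u where u: "[A i j0 * u = 1] (mod int p ^ N)"
      using cong_solve_coprime_int by blast
    \<comment> \<open>Column \<open>j0\<close> of A, rescaled to have the entry 1 at
      \<open>i\<close>; a column of an idempotent is fixed by it. The entry at \<open>i\<close> is
      set to 1 exactly, not only modulo p^N, so that row \<open>i\<close> of the matrix
      \<open>B\<close> below is zero as an integer row.\<close>
    define w where "w = (\<lambda>k. if k = i then 1 else A k j0 * u)"
    have wi: "w i = 1" by (simp add: w_def)
    have w': "[A k j0 * u = w k] (mod int p ^ N)" if "k \<in> I" for k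
      using u by (auto simp: w_def)
    have Aw: "[(\<Sum>j\<in>I. A k j * w j) = w k] (mod int p ^ N)" if k: "k \<in> I" for k
    proof -
      have "[(\<Sum>j\<in>I. A k j * w j) = (\<Sum>j\<in>I. A k j * (A j j0 * u))] (mod int p ^ N)"
        by (intro cong_sum cong_mult cong_refl cong_sym[OF w'])
      also have "(\<Sum>j\<in>I. A k j * (A j j0 * u)) = (\<Sum>j\<in>I. A k j * A j j0) * u"
        by (simp add: sum_distrib_right mult.assoc)
      also have "[\<dots> = A k j0 * u] (mod int p ^ N)"
        by (intro cong_mult cong_refl idem k j0)
      also have "[A k j0 * u = w k] (mod int p ^ N)" by (rule w'[OF k])
      finally show ?thesis .
    qed
    define B where "B = (\<lambda>k l. A k l - w k * A i l)"
    define J where "J = I - {i}"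
    have fJ: "finite J" and IJ: "I = insert i J" and iJ: "i \<notin> J" using fin i by (auto simp: J_def)
    have Bi: "B i l = 0" for l by (simp add: B_def wi)
    have idB: "[(\<Sum>j\<in>J. B k j * B j l) = B k l] (mod int p ^ N)" if kl: "k \<in> J" "l \<in> J" for k l
    proof -
      have kl': "k \<in> I" "l \<in> I" using kl by (auto simp: J_def)
      have "(\<Sum>j\<in>J. B k j * B j l) = (\<Sum>j\<in>I. B k j * B j l)"
        by (simp add: IJ iJ fJ Bi)
      also have "\<dots> = (\<Sum>j\<in>I. A k j * A j l) - w k * (\<Sum>j\<in>I. A i j * A j l)
          - (\<Sum>j\<in>I. A k j * w j) * A i l + w k * (\<Sum>j\<in>I. A i j * w j) * A i l"
        by (simp add: B_def algebra_simps sum.distrib sum_subtractf sum_distrib_left sum_distrib_right)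
      also have "[\<dots> = A k l - w k * A i l - w k * A i l + w k * w i * A i l] (mod int p ^ N)"
        by (intro cong_add cong_diff cong_mult cong_refl idem Aw kl' i)
      also have "A k l - w k * A i l - w k * A i l + w k * w i * A i l = B k l"
        by (simp add: B_def wi)
      finally show ?thesis .
    qed
    have cJ: "card J < card I" unfolding J_def using fin i by (rule card_Diff1_less)
    define FB where "FB = {v \<in> J \<rightarrow>\<^sub>E {0..<int p}. \<forall>i\<in>J. [(\<Sum>j\<in>J. B i j * v j) = v i] (mod int p)}"
    define FA where "FA = {v \<in> I \<rightarrow>\<^sub>E {0..<int p}. \<forall>i\<in>I. [(\<Sum>j\<in>I. A i j * v j) = v i] (mod int p)}"
    obtain r where r: "r \<le> card J" "[(\<Sum>i\<in>J. B i i) = int r] (mod int p ^ N)" "card FB = p ^ r"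
      using less.hyps[OF cJ fJ idB] unfolding FB_def by blast
    have "[(\<Sum>k\<in>I. A k k) = int (Suc r)] (mod int p ^ N)"
    proof -
      have "(\<Sum>k\<in>J. B k k) = (\<Sum>k\<in>I. B k k)" by (simp add: IJ iJ fJ Bi)
      also have "\<dots> = (\<Sum>k\<in>I. A k k) - (\<Sum>k\<in>I. A i k * w k)"
        by (simp add: B_def sum_subtractf mult.commute)
      also have "[\<dots> = (\<Sum>k\<in>I. A k k) - w i] (mod int p ^ N)"
        by (intro cong_diff cong_refl Aw i)
      finally have "[int r = (\<Sum>k\<in>I. A k k) - 1] (mod int p ^ N)"
        using r(2) wi cong_trans cong_sym by metis
      then have "[int r + 1 = (\<Sum>k\<in>I. A k k) - 1 + 1] (mod int p ^ N)"
        by (intro cong_add cong_refl)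
      then show ?thesis by (simp add: cong_sym_eq add.commute)
    qed
    moreover have "card FA = p ^ Suc r"
    proof -
      note c1 = cong_pow_imp_cong[OF _ assms(3)]
      \<comment> \<open>The fixed space of A is the sum of the line spanned by \<open>w\<close> and
        its vectors with coordinate 0 at \<open>i\<close>; the latter are the fixed vectors of
        \<open>B\<close>.\<close>
      define f where "f = (\<lambda>v. (\<lambda>k\<in>J. (v k - w k * v i) mod int p, v i))"
      define g where "g = (\<lambda>(v, a). \<lambda>k\<in>I. if k = i then a else (v k + w k * a) mod int p :: int)"
      have r1: "f v \<in> FB \<times> {0..<int p}" if v: "v \<in> FA" for v
      proof -
        have vi: "v i \<in> {0..<int p}" and fx: "\<And>k. k \<in> I \<Longrightarrow> [(\<Sum>j\<in>I. A k j * v j) = v k] (mod int p)"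
          using v i by (auto simp: FA_def)
        have "[(\<Sum>l\<in>J. B k l * (\<lambda>k\<in>J. (v k - w k * v i) mod int p) l) = (v k - w k * v i) mod int p] (mod int p)"
          if k: "k \<in> J" for k
        proof -
          have kI: "k \<in> I" using k J_def by auto
          have "[(\<Sum>l\<in>J. B k l * (\<lambda>k\<in>J. (v k - w k * v i) mod int p) l) = (\<Sum>l\<in>J. B k l * (v l - w l * v i))] (mod int p)"
            by (intro cong_sum cong_mult cong_refl) (simp add: cong_def)
          also have "(\<Sum>l\<in>J. B k l * (v l - w l * v i)) = (\<Sum>l\<in>I. B k l * (v l - w l * v i))"
            by (simp add: IJ iJ fJ wi)
          also have "\<dots> = (\<Sum>j\<in>I. A k j * v j) - w k * (\<Sum>j\<in>I. A i j * v j)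
              - (\<Sum>j\<in>I. A k j * w j) * v i + w k * (\<Sum>j\<in>I. A i j * w j) * v i"
            by (simp add: B_def algebra_simps sum.distrib sum_subtractf sum_distrib_left sum_distrib_right)
          also have "[\<dots> = v k - w k * v i - w k * v i + w k * w i * v i] (mod int p)"
            by (intro cong_add cong_diff cong_mult cong_refl fx c1[OF Aw] kI i)
          also have "v k - w k * v i - w k * v i + w k * w i * v i = v k - w k * v i"
            by (simp add: wi)
          also have "[\<dots> = (v k - w k * v i) mod int p] (mod int p)" by (simp add: cong_def)
          finally show ?thesis .
        qed
        then show ?thesis using vi p0 by (auto simp: f_def FB_def)
      qed
      have r2: "g va \<in> FA" if va: "va \<in> FB \<times> {0..<int p}" for va
      proof -
        obtain v a where [simp]: "va = (v, a)" by (cases va)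
        have a: "a \<in> {0..<int p}" and fx: "\<And>k. k \<in> J \<Longrightarrow> [(\<Sum>j\<in>J. B k j * v j) = v k] (mod int p)"
          using va by (auto simp: FB_def)
        define v' where "v' = (\<lambda>k. if k = i then 0 else v k)"
        define b where "b = (\<Sum>j\<in>I. A i j * v' j)"
        have Av': "[(\<Sum>j\<in>I. A k j * v' j) = v' k + w k * b] (mod int p)" if k: "k \<in> I" for k
        proof (cases "k = i")
          case True then show ?thesis by (simp add: v'_def b_def wi)
        next
          case False
          then have kJ: "k \<in> J" using k J_def by auto
          have "(\<Sum>j\<in>I. A k j * v' j) = (\<Sum>j\<in>I. B k j * v' j) + w k * b"
            by (simp add: B_def b_def algebra_simps sum.distrib sum_subtractf sum_distrib_left)
          also have "(\<Sum>j\<in>I. B k j * v' j) = (\<Sum>j\<in>J. B k j * v j)"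
          proof -
            have "(\<Sum>j\<in>J. B k j * v' j) = (\<Sum>j\<in>J. B k j * v j)"
              using iJ by (intro sum.cong) (auto simp: v'_def)
            moreover have "v' i = 0" by (simp add: v'_def)
            ultimately show ?thesis using fJ iJ by (simp add: IJ)
          qed
          also have "[(\<Sum>j\<in>J. B k j * v j) + w k * b = v k + w k * b] (mod int p)"
            by (intro cong_add cong_refl fx kJ)
          finally show ?thesis using False by (simp add: v'_def)
        qed
        \<comment> \<open>Row \<open>i\<close> of A sends v' to b. Replacing A by its square turns
          this value into b + b, since A v' = v' + b w and A w has the entry 1 at
          \<open>i\<close>.\<close>
        have b0: "[b = 0] (mod int p)"
        proof -
          have "b = (\<Sum>j\<in>I. A i j * v' j)" by (simp add: b_def)
          also have "[\<dots> = (\<Sum>j\<in>I. (\<Sum>l\<in>I. A i l * A l j) * v' j)] (mod int p)"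
            by (intro cong_sum cong_mult cong_refl cong_sym[OF c1[OF idem]] i)
          also have "(\<Sum>j\<in>I. (\<Sum>l\<in>I. A i l * A l j) * v' j) = (\<Sum>l\<in>I. A i l * (\<Sum>j\<in>I. A l j * v' j))"
            unfolding sum_distrib_right sum_distrib_left by (subst sum.swap) (simp add: mult.assoc)
          also have "[\<dots> = (\<Sum>l\<in>I. A i l * (v' l + w l * b))] (mod int p)"
            by (intro cong_sum cong_mult cong_refl Av')
          also have "(\<Sum>l\<in>I. A i l * (v' l + w l * b)) = b + (\<Sum>l\<in>I. A i l * w l) * b"
            by (simp add: b_def algebra_simps sum.distrib sum_distrib_left sum_distrib_right)
          also have "[\<dots> = b + w i * b] (mod int p)"
            by (intro cong_add cong_mult cong_refl c1[OF Aw] i)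
          finally have "[b = b + b] (mod int p)" by (simp add: wi)
          then show ?thesis using cong_add_lcancel_0 cong_sym by blast
        qed
        have "[(\<Sum>j\<in>I. A k j * g va j) = g va k] (mod int p)" if k: "k \<in> I" for k
        proof -
          have gj: "[g va j = v' j + w j * a] (mod int p)" if "j \<in> I" for j
            using that by (auto simp: g_def v'_def wi cong_def)
          have "[(\<Sum>j\<in>I. A k j * g va j) = (\<Sum>j\<in>I. A k j * (v' j + w j * a))] (mod int p)"
            by (intro cong_sum cong_mult cong_refl gj)
          also have "(\<Sum>j\<in>I. A k j * (v' j + w j * a)) = (\<Sum>j\<in>I. A k j * v' j) + (\<Sum>j\<in>I. A k j * w j) * a"
            by (simp add: algebra_simps sum.distrib sum_distrib_left sum_distrib_right)
          also have "[\<dots> = (v' k + w k * b) + w k * a] (mod int p)"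
            by (intro cong_add cong_mult cong_refl c1[OF Aw] Av' k)
          also have "[(v' k + w k * b) + w k * a = (v' k + w k * 0) + w k * a] (mod int p)"
            by (intro cong_add cong_mult cong_refl b0)
          also have "[(v' k + w k * 0) + w k * a = g va k] (mod int p)"
            using gj[OF k] cong_sym by simp
          finally show ?thesis .
        qed
        then show ?thesis using a p0 by (auto simp: FA_def g_def)
      qed
      have gf: "g (f v) = v" if v: "v \<in> FA" for v
      proof
        fix k show "g (f v) k = v k"
        proof (cases "k \<in> I")
          case True
          then have "v k \<in> {0..<int p}" using v by (auto simp: FA_def)
          then show ?thesis using True by (auto simp: g_def f_def J_def mod_simps)
        next
          case False then show ?thesis using v by (auto simp: FA_def g_def f_def)
        qed
      qed
      have fg: "f (g va) = va" if va: "va \<in> FB \<times> {0..<int p}" for va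
      proof -
        obtain v a where [simp]: "va = (v, a)" by (cases va)
        have v: "v \<in> J \<rightarrow>\<^sub>E {0..<int p}" using va by (auto simp: FB_def)
        have "(\<lambda>k\<in>J. (g (v,a) k - w k * g (v,a) i) mod int p) = v"
        proof
          fix k show "(\<lambda>k\<in>J. (g (v,a) k - w k * g (v,a) i) mod int p) k = v k"
            using v i by (cases "k \<in> J") (auto simp: g_def J_def mod_simps PiE_def Pi_def extensional_def)
        qed
        then show ?thesis using i by (simp add: f_def g_def)
      qed
      have "bij_betw f FA (FB \<times> {0..<int p})"
        by (rule bij_betw_byWitness[of _ g]) (intro ballI gf fg image_subsetI r1 r2; assumption)+
      then have "card FA = card (FB \<times> {0..<int p})" by (rule bij_betw_same_card)
      then have "card FA = card FB * p" by (simp add: card_cartesian_product)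
      then show ?thesis using r(3) by simp
    qed
    moreover have "Suc r \<le> card I" using r(1) cJ by simp
    ultimately show ?thesis unfolding FA_def by blast
  qed
qed

section \<open>Integer matrices as functions, and congruences between them\<close>

type_synonym imat = "nat \<Rightarrow> nat \<Rightarrow> int"

definition mm :: "nat \<Rightarrow> imat \<Rightarrow> imat \<Rightarrow> imat" where
  "mm n A B = (\<lambda>i k. \<Sum>j<n. A i j * B j k)"

definition msc :: "int \<Rightarrow> imat \<Rightarrow> imat" where
  "msc c A = (\<lambda>i k. c * A i k)"

definition mid :: imat where
  "mid = (\<lambda>i k. if i = k then 1 else 0)"

definition mtr :: "nat \<Rightarrow> imat \<Rightarrow> int" where
  "mtr n A = (\<Sum>i<n. A i i)"

definition mdvd :: "nat \<Rightarrow> int \<Rightarrow> imat \<Rightarrow> bool" where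
  "mdvd n M A \<longleftrightarrow> (\<forall>i<n. \<forall>k<n. M dvd A i k)"

definition mcong :: "nat \<Rightarrow> int \<Rightarrow> imat \<Rightarrow> imat \<Rightarrow> bool" where
  "mcong n M A B \<longleftrightarrow> mdvd n M (A - B)"

lemma sum_fun_apply2: "(\<Sum>x\<in>S. f x) i k = (\<Sum>x\<in>S. (f x i k :: int))"
  by (induction S rule: infinite_finite_induct) auto

lemma mm_assoc: "mm n (mm n A B) C = mm n A (mm n B C)"
  unfolding mm_def sum_distrib_left sum_distrib_right
  by (intro ext, subst sum.swap) (simp add: mult.assoc)

lemma mm_add_left: "mm n (A + B) C = mm n A C + mm n B C"
  and mm_add_right: "mm n C (A + B) = mm n C A + mm n C B"
  and mm_diff_left: "mm n (A - B) C = mm n A C - mm n B C"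
  and mm_diff_right: "mm n C (A - B) = mm n C A - mm n C B"
  by (auto simp: mm_def fun_eq_iff algebra_simps sum.distrib sum_subtractf)

lemma mm_msc_left: "mm n (msc c A) B = msc c (mm n A B)"
  and mm_msc_right: "mm n A (msc c B) = msc c (mm n A B)"
  by (auto simp: mm_def msc_def fun_eq_iff sum_distrib_left algebra_simps)

lemma mm_sum_left: "mm n (\<Sum>x\<in>S. f x) A = (\<Sum>x\<in>S. mm n (f x) A)"
  and mm_sum_right: "mm n A (\<Sum>x\<in>S. f x) = (\<Sum>x\<in>S. mm n A (f x))"
  by (induction S rule: infinite_finite_induct) (auto simp: mm_add_left mm_add_right, auto simp: mm_def fun_eq_iff)

lemma msc_add: "msc c (A + B) = msc c A + msc c B"
  and msc_diff: "msc c (A - B) = msc c A - msc c B"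
  and msc_msc: "msc c (msc d A) = msc (c * d) A"
  and msc_add_scalar: "msc (c + d) A = msc c A + msc d A"
  by (auto simp: msc_def fun_eq_iff algebra_simps)

lemma msc_sum: "msc c (\<Sum>x\<in>S. f x) = (\<Sum>x\<in>S. msc c (f x))"
  by (simp add: msc_def fun_eq_iff sum_fun_apply2 sum_distrib_left)

text \<open>These are congruences and not equations because a product with the identity agrees with
  A only on indices below n; the other entries of A are not reproduced.\<close>

lemma mm_mid: "mcong n M (mm n mid A) A" "mcong n M (mm n A mid) A"
  by (auto simp: mcong_def mdvd_def mm_def mid_def if_distrib[of "\<lambda>x. _ * x"] if_distrib[of "\<lambda>x. x * _"] cong: if_cong)

lemma mtr_sum: "mtr n (\<Sum>x\<in>S. f x) = (\<Sum>x\<in>S. mtr n (f x))"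
  unfolding mtr_def by (subst sum.swap) (simp add: sum_fun_apply2)

lemma mtr_msc: "mtr n (msc c A) = c * mtr n A"
  by (simp add: mtr_def msc_def sum_distrib_left)

lemma mtr_diff: "mtr n (A - B) = mtr n A - mtr n B"
  by (simp add: mtr_def sum_subtractf)

lemma mtr_mm: "mtr n (mm n A B) = mtr n (mm n B A)"
  unfolding mtr_def mm_def by (subst sum.swap) (simp add: mult.commute)

lemma mdvd_add: "mdvd n M A \<Longrightarrow> mdvd n M B \<Longrightarrow> mdvd n M (A + B)"
  and mdvd_diff: "mdvd n M A \<Longrightarrow> mdvd n M B \<Longrightarrow> mdvd n M (A - B)"
  and mdvd_msc: "mdvd n M A \<Longrightarrow> mdvd n M (msc c A)"
  and mdvd_0: "mdvd n M 0"
  and mdvd_sum: "(\<And>x. x \<in> S \<Longrightarrow> mdvd n M (f x)) \<Longrightarrow> mdvd n M (\<Sum>x\<in>S. f x)"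
  by (auto simp: mdvd_def msc_def sum_fun_apply2 intro!: dvd_sum)

lemma mdvd_mm: "mdvd n M A \<Longrightarrow> mdvd n M' B \<Longrightarrow> mdvd n (M * M') (mm n A B)"
  by (auto simp: mdvd_def mm_def intro!: dvd_sum mult_dvd_mono)

lemma mdvd_1: "mdvd n 1 A"
  by (simp add: mdvd_def)

lemma mdvd_mm_left: "mdvd n M A \<Longrightarrow> mdvd n M (mm n A B)"
  using mdvd_mm[OF _ mdvd_1, of n M A B] by simp

lemma mdvd_mono: "mdvd n M A \<Longrightarrow> M' dvd M \<Longrightarrow> mdvd n M' A"
  unfolding mdvd_def using dvd_trans by blast

lemma mdvd_mtr: "mdvd n M A \<Longrightarrow> M dvd mtr n A"
  by (auto simp: mdvd_def mtr_def intro!: dvd_sum)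

lemma mcong_refl: "mcong n M A A"
  by (simp add: mcong_def mdvd_def)

lemma mcong_sym: "mcong n M A B \<Longrightarrow> mcong n M B A"
  by (simp add: mcong_def mdvd_def dvd_diff_commute)

lemma mcong_trans: "mcong n M A B \<Longrightarrow> mcong n M B C \<Longrightarrow> mcong n M A C"
  unfolding mcong_def using mdvd_add[of n M "A - B" "B - C"] by simp

lemma mcong_mono: "mcong n M A B \<Longrightarrow> M' dvd M \<Longrightarrow> mcong n M' A B"
  unfolding mcong_def by (rule mdvd_mono)

lemma mcong_add: "mcong n M A B \<Longrightarrow> mcong n M A' B' \<Longrightarrow> mcong n M (A + A') (B + B')"
  unfolding mcong_def using mdvd_add[of n M "A - B" "A' - B'"] by (simp add: algebra_simps)

lemma mcong_diff: "mcong n M A B \<Longrightarrow> mcong n M A' B' \<Longrightarrow> mcong n M (A - A') (B - B')"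
  unfolding mcong_def using mdvd_diff[of n M "A - B" "A' - B'"] by (simp add: algebra_simps)

lemma mcong_msc: "mcong n M A B \<Longrightarrow> mcong n M (msc c A) (msc c B)"
  unfolding mcong_def using mdvd_msc[of n M "A - B" c] by (simp add: msc_diff)

lemma mcong_msc_scalar: "[c = d] (mod M) \<Longrightarrow> mcong n M (msc c A) (msc d A)"
  by (auto simp: mcong_def mdvd_def msc_def cong_iff_dvd_diff simp flip: left_diff_distrib)

lemma mcong_sum: "(\<And>x. x \<in> S \<Longrightarrow> mcong n M (f x) (g x)) \<Longrightarrow> mcong n M (\<Sum>x\<in>S. f x) (\<Sum>x\<in>S. g x)"
  unfolding mcong_def by (simp add: sum_subtractf[symmetric] mdvd_sum del: sum_subtractf)

lemma mcong_mtr: "mcong n M A B \<Longrightarrow> [mtr n A = mtr n B] (mod M)"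
  unfolding mcong_def by (drule mdvd_mtr) (simp add: mtr_diff cong_iff_dvd_diff)

lemma mcong_entry: "mcong n M A B \<Longrightarrow> i < n \<Longrightarrow> k < n \<Longrightarrow> [A i k = B i k] (mod M)"
  by (simp add: mcong_def mdvd_def cong_iff_dvd_diff)

section \<open>Representations modulo a prime power and their lifts\<close>

definition mrep :: "('g, 'm) monoid_scheme \<Rightarrow> nat \<Rightarrow> int \<Rightarrow> ('g \<Rightarrow> imat) \<Rightarrow> bool" where
  "mrep G n M \<rho> \<longleftrightarrow> (\<forall>g\<in>carrier G. \<forall>h\<in>carrier G. mcong n M (mm n (\<rho> g) (\<rho> h)) (\<rho> (g \<otimes>\<^bsub>G\<^esub> h)))
     \<and> mcong n M (\<rho> \<one>\<^bsub>G\<^esub>) mid"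

text \<open>The defect of multiplicativity of \<open>\<rho>\<close> is a 2-cocycle; averaging it over the group shows that it is a
  coboundary, because the order of the group is invertible.\<close>

lemma mrep_lift_step:
  fixes G :: "('g, 'm) monoid_scheme" (structure)
  assumes "group G" "finite (carrier G)" "N \<ge> 1" and co: "coprime (int (Coset.order G)) q"
    and rep: "mrep G n (q ^ N) \<rho>"
  shows "\<exists>\<rho>'. mrep G n (q ^ Suc N) \<rho>' \<and> (\<forall>g\<in>carrier G. mcong n (q ^ N) (\<rho>' g) (\<rho> g))"
proof -
  interpret group G by fact
  let ?C = "carrier G"
  have "coprime (int (Coset.order G)) (q ^ Suc N)" using co by simp
  then obtain \<kappa> where \<kappa>: "[int (Coset.order G) * \<kappa> = 1] (mod q ^ Suc N)"
    using cong_solve_coprime_int by blast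
  define f where "f = (\<lambda>g h. mm n (\<rho> g) (\<rho> h) - \<rho> (g \<otimes> h))"
  \<comment> \<open>Transporting \<open>f g k\<close> back by the inverse of k and summing over k
    gives a map whose coboundary is |G| times f modulo q^(N+1); the factor \<open>\<kappa>\<close>
    then divides by |G|.\<close>
  define S where "S = (\<lambda>g. \<Sum>k\<in>?C. mm n (f g k) (\<rho> (inv k)))"
  define \<rho>' where "\<rho>' = (\<lambda>g. \<rho> g - msc \<kappa> (S g))"
  have f0: "mdvd n (q ^ N) (f g h)" if "g \<in> ?C" "h \<in> ?C" for g h
    using rep that by (auto simp: mrep_def f_def mcong_def)
  have S0: "mdvd n (q ^ N) (S g)" if "g \<in> ?C" for g
    unfolding S_def using f0 that by (intro mdvd_sum mdvd_mm_left) auto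
  \<comment> \<open>Because N is at least 1, a product of two terms divisible by q^N vanishes modulo
    q^(N+1). All quadratic error terms disappear in this way.\<close>
  have qN: "q ^ Suc N dvd q ^ N * q ^ N" using \<open>N \<ge> 1\<close> unfolding power_add[symmetric] by (intro le_imp_power_dvd) simp
  \<comment> \<open>An identity of integer matrices, without any modulus: both sides expand to the
    difference of the same two products.\<close>
  have cocycle: "mm n (\<rho> g) (f h k) - f (g \<otimes> h) k + f g (h \<otimes> k) = mm n (f g h) (\<rho> k)"
    if "g \<in> ?C" "h \<in> ?C" "k \<in> ?C" for g h k
    using that by (simp add: f_def mm_diff_left mm_diff_right mm_assoc m_assoc)
  have key: "mcong n (q ^ Suc N) (mm n (S g) (\<rho> h) + mm n (\<rho> g) (S h) - S (g \<otimes> h)) (msc (int (Coset.order G)) (f g h))"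
    if gh: "g \<in> ?C" "h \<in> ?C" for g h
  proof -
    have e1: "mm n (S g) (\<rho> h) = (\<Sum>k\<in>?C. mm n (f g k) (mm n (\<rho> (inv k)) (\<rho> h)))"
      by (simp add: S_def mm_sum_left mm_assoc)
    have e2: "mcong n (q ^ Suc N) (\<Sum>k\<in>?C. mm n (f g k) (mm n (\<rho> (inv k)) (\<rho> h)))
        (\<Sum>k\<in>?C. mm n (f g k) (\<rho> (inv k \<otimes> h)))"
    proof (rule mcong_sum)
      fix k assume k: "k \<in> ?C"
      have "mdvd n (q ^ N * q ^ N) (mm n (f g k) (f (inv k) h))"
        using f0 gh k by (intro mdvd_mm) auto
      then have "mdvd n (q ^ Suc N) (mm n (f g k) (f (inv k) h))" using qN mdvd_mono by blast
      then show "mcong n (q ^ Suc N) (mm n (f g k) (mm n (\<rho> (inv k)) (\<rho> h))) (mm n (f g k) (\<rho> (inv k \<otimes> h)))"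
        by (simp add: mcong_def f_def mm_diff_right)
    qed
    have e3: "(\<Sum>k\<in>?C. mm n (f g k) (\<rho> (inv k \<otimes> h))) = (\<Sum>k\<in>?C. mm n (f g (h \<otimes> k)) (\<rho> (inv k)))"
      by (rule sum.reindex_bij_witness[of _ "\<lambda>k. h \<otimes> k" "\<lambda>k. inv h \<otimes> k"])
         (use gh in \<open>auto simp: m_assoc[symmetric] inv_mult_group\<close>)
    have 1: "mcong n (q ^ Suc N) (mm n (S g) (\<rho> h)) (\<Sum>k\<in>?C. mm n (f g (h \<otimes> k)) (\<rho> (inv k)))"
      using e2 unfolding e1 e3 .
    have e4: "(\<Sum>k\<in>?C. mm n (f g (h \<otimes> k)) (\<rho> (inv k))) + mm n (\<rho> g) (S h) - S (g \<otimes> h)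
        = (\<Sum>k\<in>?C. mm n (mm n (\<rho> g) (f h k) - f (g \<otimes> h) k + f g (h \<otimes> k)) (\<rho> (inv k)))"
      by (simp add: S_def mm_sum_right mm_add_left mm_diff_left sum.distrib sum_subtractf mm_assoc algebra_simps)
    have e5: "\<dots> = (\<Sum>k\<in>?C. mm n (f g h) (mm n (\<rho> k) (\<rho> (inv k))))"
      by (intro sum.cong refl) (use gh in \<open>simp add: cocycle mm_assoc\<close>)
    have e6: "mcong n (q ^ Suc N) (\<Sum>k\<in>?C. mm n (f g h) (mm n (\<rho> k) (\<rho> (inv k)))) (\<Sum>k\<in>?C. f g h)"
    proof (rule mcong_sum)
      fix k assume k: "k \<in> ?C"
      have "mcong n (q ^ N) (mm n (\<rho> k) (\<rho> (inv k))) mid"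
        using rep k mcong_trans unfolding mrep_def by (metis inv_closed r_inv)
      then have "mdvd n (q ^ N * q ^ N) (mm n (f g h) (mm n (\<rho> k) (\<rho> (inv k)) - mid))"
        using f0 gh k by (intro mdvd_mm) (auto simp: mcong_def)
      then have "mdvd n (q ^ Suc N) (mm n (f g h) (mm n (\<rho> k) (\<rho> (inv k)) - mid))"
        using qN by (rule mdvd_mono)
      then have "mcong n (q ^ Suc N) (mm n (f g h) (mm n (\<rho> k) (\<rho> (inv k)))) (mm n (f g h) mid)"
        by (simp add: mcong_def mm_diff_right)
      then show "mcong n (q ^ Suc N) (mm n (f g h) (mm n (\<rho> k) (\<rho> (inv k)))) (f g h)"
        by (rule mcong_trans[OF _ mm_mid(2)])
    qed
    have e7: "(\<Sum>k\<in>?C. f g h) = msc (int (Coset.order G)) (f g h)"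
      by (simp add: fun_eq_iff sum_fun_apply2 msc_def Coset.order_def)
    have 2: "mcong n (q ^ Suc N) ((\<Sum>k\<in>?C. mm n (f g (h \<otimes> k)) (\<rho> (inv k))) + mm n (\<rho> g) (S h) - S (g \<otimes> h))
        (msc (int (Coset.order G)) (f g h))"
      unfolding e4 e5 using e6 unfolding e7 .
    show ?thesis by (rule mcong_trans[OF mcong_diff[OF mcong_add[OF 1 mcong_refl] mcong_refl] 2])
  qed
  have "mcong n (q ^ Suc N) (mm n (\<rho>' g) (\<rho>' h)) (\<rho>' (g \<otimes> h))" if gh: "g \<in> ?C" "h \<in> ?C" for g h
  proof -
    have SS: "mdvd n (q ^ Suc N) (msc (\<kappa> * \<kappa>) (mm n (S g) (S h)))"
      using mdvd_mono[OF mdvd_mm[OF S0[OF gh(1)] S0[OF gh(2)]] qN] mdvd_msc by blast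
    have k1: "mcong n (q ^ Suc N) (msc \<kappa> (mm n (S g) (\<rho> h) + mm n (\<rho> g) (S h) - S (g \<otimes> h))) (msc \<kappa> (msc (int (Coset.order G)) (f g h)))"
      by (intro mcong_msc key gh)
    have k2: "mcong n (q ^ Suc N) (msc \<kappa> (msc (int (Coset.order G)) (f g h))) (msc 1 (f g h))"
      unfolding msc_msc using \<kappa> by (intro mcong_msc_scalar) (simp add: mult.commute)
    have "msc 1 (f g h) = f g h" by (simp add: msc_def)
    then have "mcong n (q ^ Suc N) (msc \<kappa> (mm n (S g) (\<rho> h) + mm n (\<rho> g) (S h) - S (g \<otimes> h))) (f g h)"
      using mcong_trans[OF k1 k2] by simp
    then have "mdvd n (q ^ Suc N) (f g h - msc \<kappa> (mm n (S g) (\<rho> h) + mm n (\<rho> g) (S h) - S (g \<otimes> h)))"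
      using mcong_sym by (auto simp: mcong_def)
    then have "mdvd n (q ^ Suc N) (f g h - msc \<kappa> (mm n (S g) (\<rho> h) + mm n (\<rho> g) (S h) - S (g \<otimes> h)) + msc (\<kappa> * \<kappa>) (mm n (S g) (S h)))"
      using SS by (rule mdvd_add)
    moreover have "f g h - msc \<kappa> (mm n (S g) (\<rho> h) + mm n (\<rho> g) (S h) - S (g \<otimes> h)) + msc (\<kappa> * \<kappa>) (mm n (S g) (S h))
        = mm n (\<rho>' g) (\<rho>' h) - \<rho>' (g \<otimes> h)"
      by (simp add: \<rho>'_def f_def mm_diff_left mm_diff_right mm_msc_left mm_msc_right msc_msc msc_add msc_diff algebra_simps)
    ultimately show ?thesis by (simp add: mcong_def)
  qed
  moreover have near: "mcong n (q ^ N) (\<rho>' g) (\<rho> g)" if "g \<in> ?C" for g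
  proof -
    have "mdvd n (q ^ N) (msc (-\<kappa>) (S g))" using S0 that by (intro mdvd_msc) auto
    moreover have "msc (-\<kappa>) (S g) = \<rho>' g - \<rho> g" by (simp add: \<rho>'_def msc_def fun_eq_iff)
    ultimately show ?thesis by (simp add: mcong_def)
  qed
  \<comment> \<open>Multiplicativity makes \<open>D\<close> idempotent modulo q^(N+1). As
    \<open>D\<close> is 0 modulo q^N, its square vanishes modulo q^(N+1), and with it
    \<open>D\<close>.\<close>
  moreover have "mcong n (q ^ Suc N) (\<rho>' \<one>) mid"
  proof -
    define D where "D = mid - \<rho>' \<one>"
    have r11: "mcong n (q ^ Suc N) (mm n (\<rho>' \<one>) (\<rho>' \<one>)) (\<rho>' \<one>)"
      using calculation(1)[of \<one> \<one>] by simp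
    have "mcong n (q ^ N) (\<rho>' \<one>) mid" using near[of \<one>] rep mcong_trans by (auto simp: mrep_def)
    then have D0: "mdvd n (q ^ N) D" using mcong_sym by (auto simp: D_def mcong_def)
    have "mdvd n (q ^ Suc N) (mm n D D)" using mdvd_mono[OF mdvd_mm[OF D0 D0] qN] .
    moreover have "mcong n (q ^ Suc N) (mm n D D) D"
    proof -
      have "mm n D D = mm n mid mid - mm n mid (\<rho>' \<one>) - mm n (\<rho>' \<one>) mid + mm n (\<rho>' \<one>) (\<rho>' \<one>)"
        by (simp add: D_def mm_diff_left mm_diff_right)
      moreover have "mcong n (q ^ Suc N) \<dots> (mid - \<rho>' \<one> - \<rho>' \<one> + \<rho>' \<one>)"
        by (intro mcong_add mcong_diff mm_mid r11)
      ultimately show ?thesis by (simp add: D_def)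
    qed
    ultimately have "mdvd n (q ^ Suc N) D"
      using mdvd_diff[of n "q ^ Suc N" "mm n D D" "mm n D D - D"] by (simp add: mcong_def)
    then show ?thesis using mcong_sym by (auto simp: D_def mcong_def)
  qed
  ultimately show ?thesis unfolding mrep_def by blast
qed

lemma mrep_lift:
  fixes G :: "('g, 'm) monoid_scheme" (structure)
  assumes "group G" "finite (carrier G)" "coprime (int (Coset.order G)) q" "mrep G n q \<rho>"
  shows "\<exists>\<rho>'. mrep G n (q ^ Suc N) \<rho>' \<and> (\<forall>g\<in>carrier G. mcong n q (\<rho>' g) (\<rho> g))"
proof (induction N)
  case 0
  show ?case using assms(4) mcong_refl by (intro exI[of _ \<rho>]) simp
next
  case (Suc N)
  then obtain \<rho>1 where 1: "mrep G n (q ^ Suc N) \<rho>1" "\<forall>g\<in>carrier G. mcong n q (\<rho>1 g) (\<rho> g)" by blast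
  obtain \<rho>2 where 2: "mrep G n (q ^ Suc (Suc N)) \<rho>2" "\<forall>g\<in>carrier G. mcong n (q ^ Suc N) (\<rho>2 g) (\<rho>1 g)"
    using mrep_lift_step[OF assms(1,2) _ assms(3) 1(1)] by auto
  have "mcong n q (\<rho>2 g) (\<rho> g)" if "g \<in> carrier G" for g
  proof -
    have "mcong n q (\<rho>2 g) (\<rho>1 g)" using 2(2) that by (auto intro: mcong_mono)
    then show ?thesis using 1(2) that mcong_trans by blast
  qed
  then show ?case using 2(1) by blast
qed

section \<open>Representations modulo prime powers\<close>

definition mv :: "nat \<Rightarrow> imat \<Rightarrow> (nat \<Rightarrow> int) \<Rightarrow> nat \<Rightarrow> int" where
  "mv n A v = (\<lambda>i. \<Sum>j<n. A i j * v j)"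

definition vcong :: "nat \<Rightarrow> int \<Rightarrow> (nat \<Rightarrow> int) \<Rightarrow> (nat \<Rightarrow> int) \<Rightarrow> bool" where
  "vcong n M v w \<longleftrightarrow> (\<forall>i<n. [v i = w i] (mod M))"

lemma vcong_refl [simp]: "vcong n M v v"
  by (simp add: vcong_def)

lemma vcong_sym: "vcong n M v w \<Longrightarrow> vcong n M w v"
  by (simp add: vcong_def cong_sym_eq)

lemma vcong_trans: "vcong n M u v \<Longrightarrow> vcong n M v w \<Longrightarrow> vcong n M u w"
  unfolding vcong_def using cong_trans by blast

lemma vcong_smult: "[s = t] (mod M) \<Longrightarrow> vcong n M v w \<Longrightarrow> vcong n M (\<lambda>i. s * v i) (\<lambda>i. t * w i)"
  by (simp add: vcong_def cong_mult)

lemma mv_mm: "mv n (mm n A B) v = mv n A (mv n B v)"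
  unfolding mv_def mm_def sum_distrib_left sum_distrib_right
  by (intro ext, subst sum.swap) (simp add: mult.assoc)

lemma mv_cong: "mcong n M A B \<Longrightarrow> vcong n M v w \<Longrightarrow> vcong n M (mv n A v) (mv n B w)"
  by (auto simp: vcong_def mv_def intro!: cong_sum cong_mult dest: mcong_entry)

lemma mv_mid: "vcong n M (mv n mid v) v"
  by (simp add: vcong_def mv_def mid_def if_distrib[of "\<lambda>x. x * _"] cong: if_cong)

lemma mv_sum: "mv n (\<Sum>x\<in>S. f x) v = (\<lambda>i. \<Sum>x\<in>S. mv n (f x) v i)"
  unfolding mv_def sum_fun_apply2 sum_distrib_right by (intro ext, subst sum.swap) simp

lemma mv_msc: "mv n (msc c A) v = (\<lambda>i. c * mv n A v i)"
  by (simp add: mv_def msc_def sum_distrib_left mult.assoc)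

lemma mv_smult: "mv n A (\<lambda>i. c * v i) = (\<lambda>i. c * mv n A v i)"
  by (simp add: mv_def sum_distrib_left mult.left_commute)

text \<open>Only one inclusion is demanded. For finite C it implies equality
  (\<open>conj_C\<close>), and thereby closure under inverses.\<close>

definition normalizes :: "('g, 'm) monoid_scheme \<Rightarrow> 'g set \<Rightarrow> 'g set" where
  "normalizes G C = {g \<in> carrier G. \<forall>c\<in>C. g \<otimes>\<^bsub>G\<^esub> c \<otimes>\<^bsub>G\<^esub> inv\<^bsub>G\<^esub> g \<in> C}"

locale modular_rep = group G for G :: "('g, 'm) monoid_scheme" (structure) +
  fixes p n N :: nat and \<rho> :: "'g \<Rightarrow> imat"
  assumes fin: "finite (carrier G)" and prime_p: "prime p"
    and coprime_order: "coprime (Coset.order G) p"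
    and N_pos: "N \<ge> 1"
    and rep: "mrep G n (int p ^ N) \<rho>"
begin

text \<open>Vectors over the field with p elements, represented by residues between 0 and p - 1 and
  undefined from n on. A subspace is thus a finite set, and its cardinality reveals its
  dimension.\<close>

definition Vs :: "(nat \<Rightarrow> int) set" where
  "Vs = {..<n} \<rightarrow>\<^sub>E {0..<int p}"

definition FixS :: "imat \<Rightarrow> (nat \<Rightarrow> int) set" where
  "FixS A = {v \<in> Vs. vcong n p (mv n A v) v}"

definition eig :: "'g \<Rightarrow> int \<Rightarrow> (nat \<Rightarrow> int) \<Rightarrow> bool" where
  "eig g t v \<longleftrightarrow> vcong n p (mv n (\<rho> g) v) (\<lambda>i. t * v i)"

text \<open>The t-eigenspace of x inside the space fixed by C. In particular
  \<open>ES C \<one> 1\<close> is that fixed space itself.\<close>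

definition ES :: "'g set \<Rightarrow> 'g \<Rightarrow> int \<Rightarrow> (nat \<Rightarrow> int) set" where
  "ES C x t = {v \<in> Vs. (\<forall>c\<in>C. eig c 1 v) \<and> eig x t v}"

lemma p_gt1: "int p > 1"
  using prime_p prime_gt_1_nat by auto

lemma finite_Vs: "finite Vs"
  by (simp add: Vs_def finite_PiE)

lemma fixed_dim:
  assumes "mcong n (int p ^ N') (mm n A A) A" "N' \<ge> 1"
  shows "\<exists>d\<le>n. [mtr n A = int d] (mod int p ^ N') \<and> card (FixS A) = p ^ d"
proof -
  have "\<exists>r\<le>card {..<n}. [(\<Sum>i\<in>{..<n}. A i i) = int r] (mod int p ^ N') \<and>
    card {v \<in> {..<n} \<rightarrow>\<^sub>E {0..<int p}. \<forall>i\<in>{..<n}. [(\<Sum>j\<in>{..<n}. A i j * v j) = v i] (mod int p)} = p ^ r"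
    by (rule idempotent_trace) (use assms prime_p mcong_entry in \<open>auto simp: mm_def\<close>)
  then show ?thesis by (simp add: mtr_def FixS_def vcong_def mv_def Vs_def Ball_def)
qed

lemma rep_mult: "g \<in> carrier G \<Longrightarrow> h \<in> carrier G \<Longrightarrow> mcong n (int p ^ N) (mm n (\<rho> g) (\<rho> h)) (\<rho> (g \<otimes> h))"
  and rep_one: "mcong n (int p ^ N) (\<rho> \<one>) mid"
  using rep by (auto simp: mrep_def)

lemma mod_p: "mcong n (int p ^ N) A B \<Longrightarrow> mcong n p A B"
  by (rule mcong_mono) (use N_pos in \<open>auto simp: dvd_power\<close>)

lemma eig_mult:
  assumes "g \<in> carrier G" "h \<in> carrier G" "eig g s v" "eig h t v"
  shows "eig (g \<otimes> h) (s * t) v"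
proof -
  have "vcong n p (mv n (\<rho> (g \<otimes> h)) v) (mv n (\<rho> g) (mv n (\<rho> h) v))"
    unfolding mv_mm[symmetric] by (rule mv_cong[OF mcong_sym[OF mod_p[OF rep_mult]] vcong_refl]) (use assms in auto)
  moreover have "vcong n p (mv n (\<rho> g) (mv n (\<rho> h) v)) (mv n (\<rho> g) (\<lambda>i. t * v i))"
    using assms(4) by (intro mv_cong mcong_refl) (simp add: eig_def)
  moreover have "vcong n p (mv n (\<rho> g) (\<lambda>i. t * v i)) (\<lambda>i. t * (s * v i))"
    unfolding mv_smult using assms(3) by (intro vcong_smult) (auto simp: eig_def)
  ultimately have "vcong n p (mv n (\<rho> (g \<otimes> h)) v) (\<lambda>i. t * (s * v i))"
    using vcong_trans by blast
  then show ?thesis by (simp add: eig_def algebra_simps)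
qed

lemma eig_one: "eig \<one> 1 v"
  unfolding eig_def using mv_cong[OF mod_p[OF rep_one] vcong_refl] mv_mid vcong_trans by fastforce

lemma eig_pow:
  assumes "g \<in> carrier G" "eig g s v"
  shows "eig (g [^] (k::nat)) (s ^ k) v"
proof (induction k)
  case 0 show ?case by (simp add: eig_one)
next
  case (Suc k)
  have "eig (g [^] k \<otimes> g) (s ^ k * s) v" by (rule eig_mult) (use assms Suc in auto)
  then show ?case by (simp add: mult.commute)
qed

lemma eig_cong: "[s = t] (mod int p) \<Longrightarrow> eig g s v \<Longrightarrow> eig g t v"
  unfolding eig_def by (erule vcong_trans) (rule vcong_smult[OF _ vcong_refl])

lemma eig_vcong: "vcong n p v w \<Longrightarrow> eig g s v \<Longrightarrow> eig g s w"
  unfolding eig_def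
  using vcong_trans[OF mv_cong[OF mcong_refl vcong_sym]] vcong_trans vcong_smult[OF cong_refl] by metis

lemma eig_inv:
  assumes g: "g \<in> carrier G" and e: "eig g s v" and st: "[s * t = 1] (mod int p)"
  shows "eig (inv g) t v"
proof -
  have "vcong n p (mv n (\<rho> (inv g)) (mv n (\<rho> g) v)) (mv n (\<rho> \<one>) v)"
    unfolding mv_mm[symmetric] using mv_cong[OF mod_p[OF rep_mult[of "inv g" g]] vcong_refl] g by simp
  then have "vcong n p (mv n (\<rho> (inv g)) (mv n (\<rho> g) v)) v"
    using eig_one[of v] vcong_trans by (auto simp: eig_def)
  moreover have "vcong n p (mv n (\<rho> (inv g)) (\<lambda>i. s * v i)) (mv n (\<rho> (inv g)) (mv n (\<rho> g) v))"
    by (rule mv_cong[OF mcong_refl vcong_sym]) (use e in \<open>simp add: eig_def\<close>)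
  ultimately have "vcong n p (\<lambda>i. s * mv n (\<rho> (inv g)) v i) v"
    unfolding mv_smult using vcong_trans by blast
  then have 1: "vcong n p (\<lambda>i. t * (s * mv n (\<rho> (inv g)) v i)) (\<lambda>i. t * v i)"
    by (intro vcong_smult) auto
  have 2: "vcong n p (\<lambda>i. 1 * mv n (\<rho> (inv g)) v i) (\<lambda>i. (s * t) * mv n (\<rho> (inv g)) v i)"
    by (intro vcong_smult vcong_refl cong_sym[OF st])
  have 3: "(\<lambda>i. (s * t) * mv n (\<rho> (inv g)) v i) = (\<lambda>i. t * (s * mv n (\<rho> (inv g)) v i))"
    by (simp add: algebra_simps)
  show ?thesis unfolding eig_def using vcong_trans[OF 2[unfolded 3] 1] by simp
qed

definition T :: "'g \<Rightarrow> int" where "T g = mtr n (\<rho> g)"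

lemma T_conj:
  assumes "g \<in> carrier G" "h \<in> carrier G"
  shows "[T (h \<otimes> g \<otimes> inv h) = T g] (mod int p ^ N)"
proof -
  have "[T (h \<otimes> g \<otimes> inv h) = mtr n (mm n (\<rho> (h \<otimes> g)) (\<rho> (inv h)))] (mod int p ^ N)"
    unfolding T_def by (intro mcong_mtr mcong_sym[OF rep_mult]) (use assms in auto)
  also have "mtr n (mm n (\<rho> (h \<otimes> g)) (\<rho> (inv h))) = mtr n (mm n (\<rho> (inv h)) (\<rho> (h \<otimes> g)))"
    by (rule mtr_mm)
  also have "[\<dots> = T (inv h \<otimes> (h \<otimes> g))] (mod int p ^ N)"
    unfolding T_def by (intro mcong_mtr rep_mult) (use assms in auto)
  also have "inv h \<otimes> (h \<otimes> g) = g" using assms by (simp add: m_assoc[symmetric])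
  finally show ?thesis .
qed

end

section \<open>The fixed space of a subgroup as a module for the normalizer\<close>

locale modular_rep_sub = modular_rep +
  fixes C :: "'a set"
  assumes subC: "subgroup C G"
begin

abbreviation "Nm \<equiv> normalizes G C"

lemma Nm_carrier: "g \<in> Nm \<Longrightarrow> g \<in> carrier G"
  by (simp add: normalizes_def)

lemma C_carrier: "c \<in> C \<Longrightarrow> c \<in> carrier G"
  using subgroup.subset[OF subC] by blast

lemma finite_C: "finite C"
  using fin subgroup.subset[OF subC] finite_subset by blast

lemma conj_C: "g \<in> Nm \<Longrightarrow> (\<lambda>c. g \<otimes> c \<otimes> inv g) ` C = C"
proof (rule card_subset_eq[OF finite_C])
  assume g: "g \<in> Nm"
  show "(\<lambda>c. g \<otimes> c \<otimes> inv g) ` C \<subseteq> C" using g by (auto simp: normalizes_def)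
  have "inj_on (\<lambda>c. g \<otimes> c \<otimes> inv g) C"
    using g C_carrier Nm_carrier by (auto intro!: inj_onI)
  then show "card ((\<lambda>c. g \<otimes> c \<otimes> inv g) ` C) = card C" by (rule card_image)
qed

lemma Nm_mult: "g \<in> Nm \<Longrightarrow> h \<in> Nm \<Longrightarrow> g \<otimes> h \<in> Nm"
proof -
  assume g: "g \<in> Nm" and h: "h \<in> Nm"
  have "g \<otimes> h \<otimes> c \<otimes> inv (g \<otimes> h) = g \<otimes> (h \<otimes> c \<otimes> inv h) \<otimes> inv g" if "c \<in> C" for c
    using Nm_carrier[OF g] Nm_carrier[OF h] C_carrier[OF that] by (simp add: inv_mult_group m_assoc)
  then show ?thesis using g h unfolding normalizes_def by simp
qed

lemma Nm_inv: "g \<in> Nm \<Longrightarrow> inv g \<in> Nm"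
proof -
  assume g: "g \<in> Nm"
  have "inv g \<otimes> c \<otimes> inv (inv g) \<in> C" if "c \<in> C" for c
  proof -
    obtain c' where c': "c' \<in> C" "c = g \<otimes> c' \<otimes> inv g" using conj_C[OF g] \<open>c \<in> C\<close> by blast
    have "inv g \<otimes> c \<otimes> inv (inv g) = c'"
      using c' Nm_carrier[OF g] C_carrier[OF c'(1)] by (simp add: m_assoc[symmetric]) (simp add: m_assoc)
    then show ?thesis using c' by simp
  qed
  then show ?thesis using Nm_carrier[OF g] unfolding normalizes_def by simp
qed

lemma C_Nm: "c \<in> C \<Longrightarrow> c \<in> Nm"
  using subC by (auto simp: normalizes_def subgroup.m_closed subgroup.m_inv_closed subgroup.mem_carrier)

lemma one_C: "\<one> \<in> C"
  using subC subgroup.one_closed by blast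

lemma Nm_pow: "g \<in> Nm \<Longrightarrow> g [^] (k::nat) \<in> Nm"
  by (induction k) (auto intro: Nm_mult C_Nm[OF one_C])

lemma subgroup_Nm: "subgroup Nm G"
  by (rule subgroupI) (use Nm_carrier C_Nm[OF one_C] Nm_inv Nm_mult in auto)

definition \<kappa> :: int where
  "\<kappa> = (SOME k. [int (card C) * k = 1] (mod int p ^ N))"

lemma kappa: "[int (card C) * \<kappa> = 1] (mod int p ^ N)"
proof -
  have "card C dvd Coset.order G" using lagrange[OF subC] by (metis dvd_triv_right)
  then have "coprime (card C) p" using coprime_divisors[OF _ dvd_refl coprime_order] by blast
  then have "coprime (int (card C)) (int p ^ N)" by simp
  then show ?thesis unfolding \<kappa>_def using someI_ex[OF cong_solve_coprime_int] by blast
qed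

text \<open>The averaging projection onto the vectors fixed by C, composed with
  \<open>\<rho> g\<close>. On the normalizer this projection commutes with \<open>\<rho>\<close>
  modulo p^N, so \<open>E\<close> is multiplicative there and depends only on the coset of C: it is
  the representation of Nm / C on the fixed space, written with n by n matrices.\<close>

definition E :: "'a \<Rightarrow> imat" where
  "E g = msc \<kappa> (\<Sum>c\<in>C. \<rho> (c \<otimes> g))"

text \<open>The character of Nm / C on the space fixed by C, with values modulo p^N.\<close>

definition \<tau> :: "'a \<Rightarrow> int" where
  "\<tau> g = mtr n (E g)"

lemma tau_eq: "\<tau> g = \<kappa> * (\<Sum>c\<in>C. T (c \<otimes> g))"
  by (simp add: \<tau>_def E_def mtr_msc mtr_sum T_def)

lemma sum_coset:
  assumes "c \<in> C" "g \<in> carrier G"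
  shows "(\<Sum>c'\<in>C. f (c' \<otimes> (c \<otimes> g))) = (\<Sum>c'\<in>C. f (c' \<otimes> g))"
  by (rule sum.reindex_bij_witness[of _ "\<lambda>c'. c' \<otimes> inv c" "\<lambda>c'. c' \<otimes> c"])
     (use assms C_carrier subC in \<open>auto simp: m_assoc subgroup.m_closed subgroup.m_inv_closed\<close>)

lemma E_coset: "c \<in> C \<Longrightarrow> g \<in> carrier G \<Longrightarrow> E (c \<otimes> g) = E g"
  by (simp add: E_def sum_coset)

lemma E_mult:
  assumes g: "g \<in> Nm" and h: "h \<in> carrier G"
  shows "mcong n (int p ^ N) (mm n (E g) (E h)) (E (g \<otimes> h))"
proof -
  note gc = Nm_carrier[OF g]
  have inner: "(\<Sum>c'\<in>C. \<rho> (c \<otimes> g \<otimes> (c' \<otimes> h))) = (\<Sum>c'\<in>C. \<rho> (c' \<otimes> (g \<otimes> h)))" if c: "c \<in> C" for c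
  proof -
    have "(\<Sum>c'\<in>C. \<rho> (c' \<otimes> (g \<otimes> h))) = (\<Sum>c'\<in>(\<lambda>d. c \<otimes> d) ` C. \<rho> (c' \<otimes> (g \<otimes> h)))"
    proof -
      have "(\<lambda>d. c \<otimes> d) ` C = C"
      proof (rule card_subset_eq[OF finite_C])
        show "(\<lambda>d. c \<otimes> d) ` C \<subseteq> C" by (auto intro: subgroup.m_closed[OF subC c])
        show "card ((\<lambda>d. c \<otimes> d) ` C) = card C"
          using c C_carrier by (intro card_image inj_onI) auto
      qed
      then show ?thesis by simp
    qed
    also have "\<dots> = (\<Sum>d\<in>C. \<rho> (c \<otimes> d \<otimes> (g \<otimes> h)))"
      using c C_carrier by (subst sum.reindex) (auto intro!: inj_onI)
    also have "\<dots> = (\<Sum>d\<in>(\<lambda>c. g \<otimes> c \<otimes> inv g) ` C. \<rho> (c \<otimes> d \<otimes> (g \<otimes> h)))"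
      using conj_C[OF g] by simp
    also have "\<dots> = (\<Sum>d\<in>C. \<rho> (c \<otimes> (g \<otimes> d \<otimes> inv g) \<otimes> (g \<otimes> h)))"
      using gc C_carrier by (subst sum.reindex) (auto intro!: inj_onI)
    also have "\<dots> = (\<Sum>c'\<in>C. \<rho> (c \<otimes> g \<otimes> (c' \<otimes> h)))"
    proof (rule sum.cong[OF refl])
      fix d assume d: "d \<in> C"
      have "inv g \<otimes> (g \<otimes> h) = h" using gc h by (simp add: m_assoc[symmetric])
      then have "c \<otimes> (g \<otimes> d \<otimes> inv g) \<otimes> (g \<otimes> h) = c \<otimes> g \<otimes> (d \<otimes> h)"
        using gc h C_carrier c d by (simp add: m_assoc)
      then show "\<rho> (c \<otimes> (g \<otimes> d \<otimes> inv g) \<otimes> (g \<otimes> h)) = \<rho> (c \<otimes> g \<otimes> (d \<otimes> h))" by simp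
    qed
    finally show ?thesis by simp
  qed
  have "mm n (E g) (E h) = msc (\<kappa> * \<kappa>) (\<Sum>c\<in>C. \<Sum>c'\<in>C. mm n (\<rho> (c \<otimes> g)) (\<rho> (c' \<otimes> h)))"
  proof -
    have "mm n (\<Sum>c\<in>C. \<rho> (c \<otimes> g)) (\<Sum>c\<in>C. \<rho> (c \<otimes> h)) = (\<Sum>c\<in>C. \<Sum>c'\<in>C. mm n (\<rho> (c \<otimes> g)) (\<rho> (c' \<otimes> h)))"
      unfolding mm_sum_left by (simp only: mm_sum_right)
    then show ?thesis by (simp add: E_def mm_msc_left mm_msc_right msc_msc)
  qed
  moreover have "mcong n (int p ^ N) \<dots> (msc (\<kappa> * \<kappa>) (\<Sum>c\<in>C. \<Sum>c'\<in>C. \<rho> (c \<otimes> g \<otimes> (c' \<otimes> h))))"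
    by (intro mcong_msc mcong_sum rep_mult) (use gc h C_carrier in auto)
  moreover have "msc (\<kappa> * \<kappa>) (\<Sum>c\<in>C. \<Sum>c'\<in>C. \<rho> (c \<otimes> g \<otimes> (c' \<otimes> h))) = msc (int (card C) * \<kappa>) (E (g \<otimes> h))"
    by (simp add: inner E_def msc_msc) (simp add: msc_def fun_eq_iff algebra_simps sum_fun_apply2)
  moreover have "mcong n (int p ^ N) (msc (int (card C) * \<kappa>) (E (g \<otimes> h))) (E (g \<otimes> h))"
    using mcong_msc_scalar[OF kappa, of n "E (g \<otimes> h)"] by (simp add: msc_def)
  ultimately show ?thesis by (simp only:) (rule mcong_trans)
qed

lemma E_periodic:
  assumes "x \<in> Nm" "x [^] m \<in> C"
  shows "E (x [^] (i::nat)) = E (x [^] (i mod m))"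
proof -
  have xc: "x \<in> carrier G" using assms Nm_carrier by blast
  have "x [^] i = x [^] (m * (i div m) + i mod m)" by simp
  also have "\<dots> = (x [^] m) [^] (i div m) \<otimes> x [^] (i mod m)"
    using xc by (simp add: nat_pow_mult nat_pow_pow)
  finally have "x [^] i = (x [^] m) [^] (i div m) \<otimes> x [^] (i mod m)" .
  moreover have "(x [^] m) [^] (k::nat) \<in> C" for k
    by (induction k) (use assms(2) subC in \<open>auto simp: one_C subgroup.m_closed\<close>)
  ultimately show ?thesis using E_coset xc by simp
qed

text \<open>The polynomial with coefficients a, evaluated at x and followed by restriction to the
  space fixed by C. When x^m lies in C, polynomials count modulo X^m - 1, so a coefficient vector
  that is idempotent for cyclic convolution yields a projection.\<close>

definition lin :: "'a \<Rightarrow> nat \<Rightarrow> (nat \<Rightarrow> int) \<Rightarrow> imat" where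
  "lin x m a = (\<Sum>i<m. msc (a i) (E (x [^] i)))"

text \<open>The exponent N' may be smaller than N: projections onto eigenspaces are available modulo
  p^N, whereas the idempotents of quadratic factors used for p = 13 and p = 19 are given modulo p
  only.\<close>

lemma lin_idempotent:
  assumes x: "x \<in> Nm" "x [^] m \<in> C" and m: "m \<ge> 1" and N': "N' \<le> N"
    and conv: "\<And>k. k < m \<Longrightarrow> [(\<Sum>(i,j) \<in> {ij \<in> {..<m} \<times> {..<m}. (fst ij + snd ij) mod m = k}. a i * a j) = a k] (mod int p ^ N')"
  shows "mcong n (int p ^ N') (mm n (lin x m a) (lin x m a)) (lin x m a)"
proof -
  have xc: "x \<in> carrier G" using x Nm_carrier by blast
  let ?S = "{..<m} \<times> {..<m}"
  have 1: "mm n (lin x m a) (lin x m a) = (\<Sum>ij\<in>?S. msc (a (fst ij) * a (snd ij)) (mm n (E (x [^] fst ij)) (E (x [^] snd ij))))"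
  proof -
    have "mm n (lin x m a) (lin x m a) = (\<Sum>i<m. \<Sum>j<m. msc (a i * a j) (mm n (E (x [^] i)) (E (x [^] j))))"
      unfolding lin_def mm_sum_left by (intro sum.cong refl)
        (simp add: mm_sum_right mm_msc_left mm_msc_right msc_msc msc_sum mult.commute)
    then show ?thesis by (simp add: sum.cartesian_product split_def)
  qed
  have 2: "mcong n (int p ^ N') \<dots> (\<Sum>ij\<in>?S. msc (a (fst ij) * a (snd ij)) (E (x [^] ((fst ij + snd ij) mod m))))"
  proof (intro mcong_sum mcong_msc)
    fix ij :: "nat \<times> nat"
    have "mcong n (int p ^ N) (mm n (E (x [^] fst ij)) (E (x [^] snd ij))) (E (x [^] (fst ij + snd ij)))"
      using E_mult[OF Nm_pow[OF x(1), of "fst ij"] nat_pow_closed[OF xc, of "snd ij"]] xc by (simp add: nat_pow_mult)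
    then have "mcong n (int p ^ N') (mm n (E (x [^] fst ij)) (E (x [^] snd ij))) (E (x [^] (fst ij + snd ij)))"
      by (rule mcong_mono) (simp add: N' le_imp_power_dvd)
    then show "mcong n (int p ^ N') (mm n (E (x [^] fst ij)) (E (x [^] snd ij))) (E (x [^] ((fst ij + snd ij) mod m)))"
      using E_periodic[OF x] by metis
  qed
  have 3: "(\<Sum>ij\<in>?S. msc (a (fst ij) * a (snd ij)) (E (x [^] ((fst ij + snd ij) mod m))))
      = (\<Sum>k<m. \<Sum>ij\<in>{ij \<in> ?S. (fst ij + snd ij) mod m = k}. msc (a (fst ij) * a (snd ij)) (E (x [^] ((fst ij + snd ij) mod m))))"
    by (rule sum.group[symmetric]) (use m in auto)
  have 4: "\<dots> = (\<Sum>k<m. msc (\<Sum>(i,j) \<in> {ij \<in> ?S. (fst ij + snd ij) mod m = k}. a i * a j) (E (x [^] k)))"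
    by (intro sum.cong refl) (simp add: msc_def fun_eq_iff sum_fun_apply2 sum_distrib_right split_def)
  have 5: "mcong n (int p ^ N') \<dots> (lin x m a)"
    unfolding lin_def by (intro mcong_sum mcong_msc_scalar conv) auto
  show ?thesis using 2 5 mcong_trans unfolding 1 3 4 by blast
qed

lemma lin_trace: "mtr n (lin x m a) = (\<Sum>i<m. a i * \<tau> (x [^] i))"
  by (simp add: lin_def mtr_sum mtr_msc \<tau>_def)

end

section \<open>Roots of unity modulo prime powers\<close>

lemma fermat_int:
  fixes t :: int
  assumes "prime p" "\<not> int p dvd t"
  shows "[t ^ (p - 1) = 1] (mod int p)"
proof -
  define a where "a = nat (t mod int p)"
  have a: "int a = t mod int p" using assms(1) prime_gt_0_nat by (simp add: a_def)
  then have ta: "[int a = t] (mod int p)" by (simp add: cong_def)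
  have "\<not> p dvd a"
    using assms(2) ta cong_dvd_iff int_dvd_int_iff by blast
  then have "[a ^ (p - 1) = 1] (mod p)" by (rule fermat_theorem[OF assms(1)])
  then have "[int a ^ (p - 1) = 1] (mod int p)" by (metis cong_int_iff of_nat_1 of_nat_power)
  then show ?thesis using cong_pow[OF ta] cong_trans cong_sym by blast
qed

lemma cong_power_prime:
  fixes a b :: int
  assumes "[a = b] (mod int p ^ Suc k)"
  shows "[a ^ p = b ^ p] (mod int p ^ Suc (Suc k))"
proof -
  have ab: "[a = b] (mod int p)" using assms by (rule cong_pow_imp_cong) simp
  have e: "a ^ p - b ^ p = (a - b) * (\<Sum>i<p. b ^ (p - Suc i) * a ^ i)"
    by (rule power_diff_sumr2)
  have "[(\<Sum>i<p. b ^ (p - Suc i) * a ^ i) = (\<Sum>i<p. b ^ (p - Suc i) * b ^ i)] (mod int p)"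
    by (intro cong_sum cong_mult cong_pow cong_refl ab)
  also have "(\<Sum>i<p. b ^ (p - Suc i) * b ^ i) = (\<Sum>i<p. b ^ (p - 1))"
    by (intro sum.cong refl) (simp flip: power_add)
  also have "\<dots> = int p * b ^ (p - 1)" by simp
  finally have "int p dvd (\<Sum>i<p. b ^ (p - Suc i) * a ^ i)"
    by (metis cong_dvd_iff dvd_triv_left)
  moreover have "int p ^ Suc k dvd a - b" using assms by (simp add: cong_iff_dvd_diff)
  ultimately have "int p ^ Suc k * int p dvd a ^ p - b ^ p" unfolding e by (rule mult_dvd_mono[rotated])
  then show ?thesis by (simp add: cong_iff_dvd_diff mult.commute)
qed

lemma cong_power_prime_power:
  fixes a b :: int
  assumes "[a = b] (mod int p)"
  shows "[a ^ (p ^ k) = b ^ (p ^ k)] (mod int p ^ Suc k)"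
proof (induction k)
  case 0 show ?case using assms by simp
next
  case (Suc k)
  have "[(a ^ (p ^ k)) ^ p = (b ^ (p ^ k)) ^ p] (mod int p ^ Suc (Suc k))"
    by (rule cong_power_prime) (use Suc in simp)
  then show ?case by (simp add: power_mult[symmetric] mult.commute)
qed

lemma card_pairs_mod:
  fixes m k :: nat
  assumes "k < m"
  shows "card {ij \<in> {..<m} \<times> {..<m}. (fst ij + snd ij) mod m = k} = m"
proof -
  have "bij_betw fst {ij \<in> {..<m} \<times> {..<m}. (fst ij + snd ij) mod m = k} {..<m}"
  proof (rule bij_betw_byWitness[of _ "\<lambda>i. (i, (k + (m - i)) mod m)"])
    show "\<forall>ij\<in>{ij \<in> {..<m} \<times> {..<m}. (fst ij + snd ij) mod m = k}. (fst ij, (k + (m - fst ij)) mod m) = ij"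
    proof
      fix ij assume "ij \<in> {ij \<in> {..<m} \<times> {..<m}. (fst ij + snd ij) mod m = k}"
      then obtain i j where [simp]: "ij = (i, j)" and ij: "i < m" "j < m" "(i + j) mod m = k" by (cases ij) auto
      have "(k + (m - i)) mod m = (i + j + (m - i)) mod m" using ij(3) by (metis mod_add_left_eq)
      also have "i + j + (m - i) = j + m" using ij by simp
      finally show "(fst ij, (k + (m - fst ij)) mod m) = ij" using ij by simp
    qed
    show "(\<lambda>i. (i, (k + (m - i)) mod m)) ` {..<m} \<subseteq> {ij \<in> {..<m} \<times> {..<m}. (fst ij + snd ij) mod m = k}"
    proof (rule image_subsetI)
      fix i assume "i \<in> {..<m}"
      then have i: "i < m" by simp
      have "(i + (k + (m - i)) mod m) mod m = (i + (k + (m - i))) mod m" by (simp add: mod_simps)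
      also have "i + (k + (m - i)) = k + m" using i by simp
      finally have "(i + (k + (m - i)) mod m) mod m = k" using assms by simp
      then show "(i, (k + (m - i)) mod m) \<in> {ij \<in> {..<m} \<times> {..<m}. (fst ij + snd ij) mod m = k}"
        using i assms by auto
    qed
  qed auto
  then show ?thesis using bij_betw_same_card by fastforce
qed

context modular_rep
begin

text \<open>The Teichmueller representative modulo p^N: this power keeps the residue modulo p and
  turns a root of unity modulo p into one modulo p^N.\<close>

definition teich :: "int \<Rightarrow> int" where
  "teich t = t ^ (p ^ (N - 1))"

lemma teich_power: "[t ^ m = 1] (mod int p) \<Longrightarrow> [teich t ^ m = 1] (mod int p ^ N)"
  using cong_power_prime_power[of "t ^ m" 1 p "N - 1"] N_pos
  by (simp add: teich_def power_mult[symmetric] mult.commute)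

lemma teich_mod: "[teich t = t] (mod int p)"
proof -
  have "[t ^ (p ^ k) = t] (mod int p)" for k
  proof (induction k)
    case (Suc k)
    have "[(t ^ (p ^ k)) ^ p = t ^ p] (mod int p)" using Suc by (rule cong_pow)
    also have "[t ^ p = t] (mod int p)"
    proof (cases "int p dvd t")
      case True
      then have "int p dvd t ^ p" using prime_p prime_gt_0_nat by (simp add: dvd_power_iff dvd_trans[OF _ dvd_power])
      then show ?thesis using True by (simp add: cong_iff_dvd_diff)
    next
      case False
      then have "[t ^ (p - 1) = 1] (mod int p)" by (rule fermat_int[OF prime_p])
      then have "[t * t ^ (p - 1) = t * 1] (mod int p)" by (intro cong_mult cong_refl)
      then show ?thesis using prime_p prime_gt_0_nat by (simp add: power_Suc[symmetric] del: power_Suc)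
    qed
    finally show ?case by (simp add: power_mult[symmetric] mult.commute)
  qed simp
  then show ?thesis by (simp add: teich_def)
qed

lemma ES_cong: "[s = t] (mod int p) \<Longrightarrow> ES C x s = ES C x t"
  unfolding ES_def using eig_cong cong_sym by blast

end

section \<open>Projections onto eigenspaces and their traces\<close>

context modular_rep_sub
begin

text \<open>The dimension of the eigenspace. The value is meaningful once \<open>dim_formula\<close>
  has shown that the cardinality is a power of p.\<close>

definition D :: "'a \<Rightarrow> int \<Rightarrow> nat" where
  "D x t = (THE d. card (ES C x t) = p ^ d)"

lemma D_unique: "card (ES C x t) = p ^ d \<Longrightarrow> D x t = d"
  unfolding D_def using prime_p prime_gt_1_nat by (intro the_equality) auto

lemma rho_E:
  assumes x: "x \<in> Nm" and g: "g \<in> carrier G"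
  shows "mcong n (int p ^ N) (mm n (\<rho> x) (E g)) (E (x \<otimes> g))"
proof -
  have xc: "x \<in> carrier G" using x Nm_carrier by blast
  have "mm n (\<rho> x) (E g) = msc \<kappa> (\<Sum>c'\<in>C. mm n (\<rho> x) (\<rho> (c' \<otimes> g)))"
    by (simp add: E_def mm_msc_right mm_sum_right)
  moreover have "mcong n (int p ^ N) \<dots> (msc \<kappa> (\<Sum>c'\<in>C. \<rho> (x \<otimes> (c' \<otimes> g))))"
    by (intro mcong_msc mcong_sum rep_mult) (use g xc C_carrier in auto)
  moreover have "(\<Sum>c'\<in>C. \<rho> (x \<otimes> (c' \<otimes> g))) = (\<Sum>c'\<in>C. \<rho> (c' \<otimes> (x \<otimes> g)))"
  proof -
    have "(\<Sum>c'\<in>C. \<rho> (c' \<otimes> (x \<otimes> g))) = (\<Sum>c'\<in>(\<lambda>d. x \<otimes> d \<otimes> inv x) ` C. \<rho> (c' \<otimes> (x \<otimes> g)))"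
      using conj_C[OF x] by simp
    also have "\<dots> = (\<Sum>d\<in>C. \<rho> (x \<otimes> d \<otimes> inv x \<otimes> (x \<otimes> g)))"
      using xc C_carrier by (subst sum.reindex) (auto intro!: inj_onI)
    also have "\<dots> = (\<Sum>d\<in>C. \<rho> (x \<otimes> (d \<otimes> g)))"
    proof (rule sum.cong[OF refl])
      fix d assume "d \<in> C"
      moreover have "inv x \<otimes> (x \<otimes> g) = g" using xc g by (simp add: m_assoc[symmetric])
      ultimately have "x \<otimes> d \<otimes> inv x \<otimes> (x \<otimes> g) = x \<otimes> (d \<otimes> g)"
        using xc g C_carrier by (simp add: m_assoc)
      then show "\<rho> (x \<otimes> d \<otimes> inv x \<otimes> (x \<otimes> g)) = \<rho> (x \<otimes> (d \<otimes> g))" by simp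
    qed
    finally show ?thesis by simp
  qed
  ultimately show ?thesis by (simp add: E_def)
qed

lemma lin_fix_C:
  assumes "x \<in> carrier G" "v \<in> FixS (lin x m a)" "c \<in> C"
  shows "eig c 1 v"
proof -
  let ?A = "lin x m a"
  have "mm n (\<rho> c) ?A = (\<Sum>i<m. msc (a i) (mm n (\<rho> c) (E (x [^] i))))"
    by (simp add: lin_def mm_sum_right mm_msc_right)
  moreover have "mcong n (int p ^ N) \<dots> ?A"
    unfolding lin_def using assms rho_E[OF C_Nm[OF assms(3)]]
    by (intro mcong_sum mcong_msc) (simp add: E_coset)
  ultimately have "mcong n p (mm n (\<rho> c) ?A) ?A" using mod_p by simp
  then have "vcong n p (mv n (\<rho> c) (mv n ?A v)) (mv n ?A v)"
    unfolding mv_mm[symmetric] by (rule mv_cong) simp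
  then have "eig c 1 (mv n ?A v)" by (simp add: eig_def)
  then show ?thesis using assms(2) eig_vcong by (auto simp: FixS_def)
qed

text \<open>With 1/m for k and 1/\<mu> for \<nu>, the matrix is the Fourier projection (1/m) (sum
  over i of \<mu>^(-i) x^i) onto the \<mu>-eigenspace of x in the space fixed by C.\<close>

lemma FixS_lin:
  assumes x: "x \<in> Nm" "x [^] m \<in> C" and m: "m \<ge> 1"
    and k: "[int m * k = 1] (mod int p ^ N)"
    and nu: "[\<nu> ^ m = 1] (mod int p ^ N)" and mn: "[\<mu> * \<nu> = 1] (mod int p ^ N)"
  shows "FixS (lin x m (\<lambda>i. k * \<nu> ^ i)) = ES C x \<mu>"
proof -
  let ?A = "lin x m (\<lambda>i. k * \<nu> ^ i)"
  have xc: "x \<in> carrier G" using x Nm_carrier by blast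
  have c1: "[int m * k = 1] (mod int p)" "[\<mu> * \<nu> = 1] (mod int p)"
    "[int (card C) * \<kappa> = 1] (mod int p)"
    using k mn kappa N_pos cong_pow_imp_cong by blast+
  have "v \<in> ES C x \<mu>" if v: "v \<in> FixS ?A" for v
  proof -
    have vV: "v \<in> Vs" and vA: "vcong n p (mv n ?A v) v" using v by (auto simp: FixS_def)
    have "eig c 1 v" if c: "c \<in> C" for c by (rule lin_fix_C[OF xc v c])
    moreover have "eig x \<mu> v"
    proof -
      have xE: "mcong n (int p ^ N) (mm n (\<rho> x) (E g)) (E (x \<otimes> g))" if g: "g \<in> carrier G" for g
        by (rule rho_E[OF x(1) g])
      have xS: "x \<otimes> x [^] i = x [^] Suc i" for i
        using xc by (metis nat_pow_Suc2)
      have "mm n (\<rho> x) ?A = (\<Sum>i<m. msc (k * \<nu> ^ i) (mm n (\<rho> x) (E (x [^] i))))"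
        by (simp add: lin_def mm_sum_right mm_msc_right)
      moreover have a1: "mcong n (int p ^ N) \<dots> (\<Sum>i<m. msc (k * \<nu> ^ i) (E (x [^] Suc i)))"
        unfolding xS[symmetric] by (intro mcong_sum mcong_msc xE) (use xc in auto)
      moreover have a2: "mcong n (int p ^ N) (\<Sum>i<m. msc (k * \<nu> ^ i) (E (x [^] Suc i))) (\<Sum>i<m. msc (\<mu> * (k * \<nu> ^ Suc i)) (E (x [^] Suc i)))"
      proof (intro mcong_sum mcong_msc_scalar)
        fix i
        have "[k * \<nu> ^ i * (\<mu> * \<nu>) = k * \<nu> ^ i * 1] (mod int p ^ N)" by (intro cong_mult cong_refl mn)
        then show "[k * \<nu> ^ i = \<mu> * (k * \<nu> ^ Suc i)] (mod int p ^ N)"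
          using cong_sym by (fastforce simp: algebra_simps)
      qed
      moreover have a3: "(\<Sum>i<m. msc (\<mu> * (k * \<nu> ^ Suc i)) (E (x [^] Suc i))) = msc \<mu> (\<Sum>i<m. msc (k * \<nu> ^ Suc i) (E (x [^] Suc i)))"
        by (simp add: msc_sum msc_msc)
      \<comment> \<open>Multiplication by x has shifted the index by one. The boundary terms for 0
        and m agree because x^m lies in C and \<nu>^m = 1.\<close>
      moreover have a4: "mcong n (int p ^ N) (msc \<mu> (\<Sum>i<m. msc (k * \<nu> ^ Suc i) (E (x [^] Suc i)))) (msc \<mu> ?A)"
      proof (rule mcong_msc)
        let ?f = "\<lambda>i. msc (k * \<nu> ^ i) (E (x [^] i))"
        have shift: "(\<Sum>i<m. f (Suc i)) + f 0 = (\<Sum>i<m. f i) + f m" for f :: "nat \<Rightarrow> imat"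
          using sum.lessThan_Suc_shift[of f m] sum.lessThan_Suc[of f m] by (simp only: add.commute)
        have "(\<Sum>i<m. ?f (Suc i)) + ?f 0 = (\<Sum>i<m. ?f i) + ?f m" by (rule shift)
        then have e: "(\<Sum>i<m. ?f (Suc i)) = ?A + (?f m - ?f 0)" by (simp add: lin_def algebra_simps)
        have "E (x [^] m) = E (x [^] (0::nat))" using E_periodic[OF x, of m] by simp
        then have "mcong n (int p ^ N) (?f m) (?f 0)"
          using cong_mult[OF cong_refl nu, of k] by (simp only: power_0) (intro mcong_msc_scalar)
        then have "mdvd n (int p ^ N) (?f m - ?f 0)" by (simp add: mcong_def)
        then show "mcong n (int p ^ N) (\<Sum>i<m. ?f (Suc i)) ?A" unfolding e mcong_def by simp
      qed
      ultimately have "mcong n (int p ^ N) (mm n (\<rho> x) ?A) (msc \<mu> ?A)"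
        using mcong_trans[OF a1 mcong_trans[OF a2[unfolded a3] a4]] by (simp only:)
      then have "vcong n p (mv n (\<rho> x) (mv n ?A v)) (mv n (msc \<mu> ?A) v)"
        unfolding mv_mm[symmetric] by (rule mv_cong[OF mod_p vcong_refl])
      then have "eig x \<mu> (mv n ?A v)" by (simp add: eig_def mv_msc)
      then show ?thesis using vA eig_vcong by blast
    qed
    ultimately show ?thesis using vV by (simp add: ES_def)
  qed
  moreover have "v \<in> FixS ?A" if v: "v \<in> ES C x \<mu>" for v
  proof -
    have vV: "v \<in> Vs" and vC: "\<And>c. c \<in> C \<Longrightarrow> eig c 1 v" and vx: "eig x \<mu> v" using v by (auto simp: ES_def)
    have Ev: "vcong n p (mv n (E (x [^] i)) v) (\<lambda>j. \<mu> ^ i * v j)" for i :: nat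
    proof -
      have e1: "eig (c \<otimes> x [^] i) (\<mu> ^ i) v" if "c \<in> C" for c
        using eig_mult[OF C_carrier[OF that] nat_pow_closed[OF xc] vC[OF that] eig_pow[OF xc vx]] by simp
      have "mv n (E (x [^] i)) v = (\<lambda>j. \<kappa> * (\<Sum>c\<in>C. mv n (\<rho> (c \<otimes> x [^] i)) v j))"
        by (simp add: E_def mv_msc mv_sum)
      moreover have "vcong n p \<dots> (\<lambda>j. \<kappa> * (\<Sum>c\<in>C. \<mu> ^ i * v j))"
        unfolding vcong_def by (intro allI impI cong_mult cong_refl cong_sum) (use e1 in \<open>auto simp: vcong_def eig_def\<close>)
      moreover have "(\<lambda>j. \<kappa> * (\<Sum>c\<in>C. \<mu> ^ i * v j)) = (\<lambda>j. (int (card C) * \<kappa>) * (\<mu> ^ i * v j))"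
        by (simp add: algebra_simps)
      moreover have "vcong n p (\<lambda>j. (int (card C) * \<kappa>) * (\<mu> ^ i * v j)) (\<lambda>j. 1 * (\<mu> ^ i * v j))"
        by (intro vcong_smult c1 vcong_refl)
      ultimately show ?thesis using vcong_trans by simp
    qed
    have "mv n ?A v = (\<lambda>j. \<Sum>i<m. (k * \<nu> ^ i) * mv n (E (x [^] i)) v j)"
      by (simp add: lin_def mv_sum mv_msc)
    moreover have b1: "vcong n p \<dots> (\<lambda>j. \<Sum>i<m. (k * \<nu> ^ i) * (\<mu> ^ i * v j))"
      using Ev unfolding vcong_def by (intro allI impI cong_sum cong_mult cong_refl) blast
    moreover have b2: "vcong n p (\<lambda>j. \<Sum>i<m. (k * \<nu> ^ i) * (\<mu> ^ i * v j)) (\<lambda>j. \<Sum>i<m. k * v j)"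
      unfolding vcong_def
    proof (intro allI impI cong_sum)
      fix i j
      have "[k * v j * (\<mu> * \<nu>) ^ i = k * v j * 1 ^ i] (mod int p)" by (intro cong_mult cong_pow cong_refl c1)
      then show "[(k * \<nu> ^ i) * (\<mu> ^ i * v j) = k * v j] (mod int p)" by (simp add: power_mult_distrib algebra_simps)
    qed
    moreover have b3: "(\<lambda>j. \<Sum>i<m. k * v j) = (\<lambda>j. (int m * k) * v j)" by (simp add: algebra_simps)
    moreover have "vcong n p (\<lambda>j. (int m * k) * v j) (\<lambda>j. 1 * v j)" by (intro vcong_smult c1 vcong_refl)
    then have "vcong n p (\<lambda>j. (int m * k) * v j) v" by simp
    ultimately have "vcong n p (mv n ?A v) v" using vcong_trans[OF b1 b2[unfolded b3]] by (simp only:) (rule vcong_trans)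
    then show ?thesis using vV by (simp add: FixS_def)
  qed
  ultimately show ?thesis by blast
qed

lemma dim_formula0:
  assumes x: "x \<in> Nm" "x [^] m \<in> C" and m: "m \<ge> 1" "coprime m p"
    and nu: "[\<nu> ^ m = 1] (mod int p ^ N)" and mn: "[\<mu> * \<nu> = 1] (mod int p ^ N)"
  shows "D x \<mu> \<le> n" "card (ES C x \<mu>) = p ^ D x \<mu>"
    "[int m * int (D x \<mu>) = (\<Sum>i<m. \<nu> ^ i * \<tau> (x [^] i))] (mod int p ^ N)"
proof -
  have "coprime (int m) (int p ^ N)" using m by simp
  then obtain k where k: "[int m * k = 1] (mod int p ^ N)" using cong_solve_coprime_int by blast
  let ?A = "lin x m (\<lambda>i. k * \<nu> ^ i)"
  have "mcong n (int p ^ N) (mm n ?A ?A) ?A"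
  proof (rule lin_idempotent[OF x m(1) order_refl])
    fix l assume l: "l < m"
    let ?P = "{ij \<in> {..<m} \<times> {..<m}. (fst ij + snd ij) mod m = l}"
    have "[(\<Sum>(i,j) \<in> ?P. (k * \<nu> ^ i) * (k * \<nu> ^ j)) = (\<Sum>(i,j) \<in> ?P. k * k * \<nu> ^ l)] (mod int p ^ N)"
    proof (rule cong_sum)
      fix ij assume "ij \<in> ?P"
      then obtain i j where [simp]: "ij = (i, j)" and ij: "(i + j) mod m = l" by (cases ij) auto
      have "\<nu> ^ (i + j) = \<nu> ^ (m * ((i + j) div m) + l)" using ij by (metis mult_div_mod_eq)
      also have "\<dots> = (\<nu> ^ m) ^ ((i + j) div m) * \<nu> ^ l" by (simp add: power_add power_mult)
      finally have "[\<nu> ^ (i + j) = 1 ^ ((i + j) div m) * \<nu> ^ l] (mod int p ^ N)"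
        using nu by (simp only:) (intro cong_mult cong_pow cong_refl)
      then have "[k * k * \<nu> ^ (i + j) = k * k * \<nu> ^ l] (mod int p ^ N)" by (intro cong_mult cong_refl) simp
      then show "[(case ij of (i, j) \<Rightarrow> k * \<nu> ^ i * (k * \<nu> ^ j)) = (case ij of (i, j) \<Rightarrow> k * k * \<nu> ^ l)] (mod int p ^ N)"
        by (simp add: power_add algebra_simps)
    qed
    also have "(\<Sum>(i,j) \<in> ?P. k * k * \<nu> ^ l) = (int m * k) * (k * \<nu> ^ l)"
      using card_pairs_mod[OF l] by (simp add: split_def)
    also have "[(int m * k) * (k * \<nu> ^ l) = 1 * (k * \<nu> ^ l)] (mod int p ^ N)"
      by (intro cong_mult cong_refl k)
    finally show "[(\<Sum>(i,j) \<in> ?P. (k * \<nu> ^ i) * (k * \<nu> ^ j)) = k * \<nu> ^ l] (mod int p ^ N)" by simp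
  qed
  then obtain d where d: "d \<le> n" "[mtr n ?A = int d] (mod int p ^ N)" "card (FixS ?A) = p ^ d"
    using fixed_dim N_pos by blast
  have dD: "D x \<mu> = d" by (rule D_unique) (use d FixS_lin[OF x m(1) k nu mn] in simp)
  show "D x \<mu> \<le> n" "card (ES C x \<mu>) = p ^ D x \<mu>"
    using d dD FixS_lin[OF x m(1) k nu mn] by simp_all
  have "[int m * int d = int m * mtr n ?A] (mod int p ^ N)"
    by (intro cong_mult cong_refl cong_sym[OF d(2)])
  also have "int m * mtr n ?A = (\<Sum>i<m. (int m * k) * (\<nu> ^ i * \<tau> (x [^] i)))"
    by (simp add: lin_trace sum_distrib_left algebra_simps)
  also have "[\<dots> = (\<Sum>i<m. 1 * (\<nu> ^ i * \<tau> (x [^] i)))] (mod int p ^ N)"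
    by (intro cong_sum cong_mult cong_refl k)
  finally show "[int m * int (D x \<mu>) = (\<Sum>i<m. \<nu> ^ i * \<tau> (x [^] i))] (mod int p ^ N)" by (simp add: dD)
qed

text \<open>The trace of the Fourier projection. The number \<open>teich t ^ (m - 1)\<close> is the
  inverse of the Teichmueller representative of t.\<close>

lemma dim_formula:
  assumes x: "x \<in> Nm" "x [^] m \<in> C" and m: "m \<ge> 1" "coprime m p"
    and t: "[t ^ m = 1] (mod int p)"
  shows "D x t \<le> n" "card (ES C x t) = p ^ D x t"
    "[int m * int (D x t) = (\<Sum>i<m. (teich t ^ (m - 1)) ^ i * \<tau> (x [^] i))] (mod int p ^ N)"
proof -
  have tm: "[teich t ^ m = 1] (mod int p ^ N)" using t by (rule teich_power)
  have 1: "[(teich t ^ (m - 1)) ^ m = 1] (mod int p ^ N)"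
    using cong_pow[OF tm, of "m - 1"] by (simp add: power_mult[symmetric] mult.commute)
  have 2: "[teich t * teich t ^ (m - 1) = 1] (mod int p ^ N)"
    using tm m by (simp flip: power_Suc)
  have e: "ES C x (teich t) = ES C x t" by (rule ES_cong[OF teich_mod])
  then have D: "D x (teich t) = D x t" by (simp add: D_def)
  show "D x t \<le> n" "card (ES C x t) = p ^ D x t"
    "[int m * int (D x t) = (\<Sum>i<m. (teich t ^ (m - 1)) ^ i * \<tau> (x [^] i))] (mod int p ^ N)"
    using dim_formula0[OF x m 1 2] unfolding e D by blast+
qed

end

section \<open>Traces under inverse semirationality\<close>

lemma (in group) inv_mult_cancel:
  "a \<in> carrier G \<Longrightarrow> b \<in> carrier G \<Longrightarrow> inv a \<otimes> (a \<otimes> b) = b"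
  "a \<in> carrier G \<Longrightarrow> b \<in> carrier G \<Longrightarrow> a \<otimes> (inv a \<otimes> b) = b"
  by (simp_all add: m_assoc[symmetric])

context modular_rep_sub
begin

lemma tau_inv:
  assumes "g \<in> Nm"
  shows "\<tau> (inv g) = \<kappa> * (\<Sum>c\<in>C. T (inv (c \<otimes> g)))"
proof -
  have gi: "inv g \<in> Nm" and gc: "g \<in> carrier G" using assms Nm_inv Nm_carrier by auto
  have "(\<Sum>c\<in>C. T (c \<otimes> inv g)) = (\<Sum>c\<in>(\<lambda>d. inv g \<otimes> d \<otimes> inv (inv g)) ` C. T (c \<otimes> inv g))"
    using conj_C[OF gi] by simp
  also have "\<dots> = (\<Sum>d\<in>C. T (inv g \<otimes> d \<otimes> inv (inv g) \<otimes> inv g))"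
    using gc C_carrier by (subst sum.reindex) (auto intro!: inj_onI)
  also have "\<dots> = (\<Sum>d\<in>C. T (inv g \<otimes> d))"
    by (intro sum.cong refl) (use gc C_carrier in \<open>simp add: m_assoc\<close>)
  also have "\<dots> = (\<Sum>c\<in>C. T (inv (c \<otimes> g)))"
    by (rule sum.reindex_bij_witness[of _ "\<lambda>c. inv c" "\<lambda>c. inv c"])
      (use gc C_carrier subC in \<open>auto simp: inv_mult_group subgroup.m_inv_closed\<close>)
  finally show ?thesis by (simp add: tau_eq)
qed

definition dimU :: nat where "dimU = D \<one> 1"

lemma dimU: "dimU \<le> n" "card (ES C \<one> 1) = p ^ dimU" "[int dimU = \<tau> \<one>] (mod int p ^ N)"
  using dim_formula[of \<one> 1 1] C_Nm[OF one_C] one_C by (auto simp: dimU_def)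

text \<open>Summing the dimension formula over all powers of t leaves only the term i = 0, by
  orthogonality of roots of unity. For 0 < i < m this needs \<nu>^i - 1 to be a unit modulo p^N,
  which holds because t has exact order m already modulo p. Both sides are less than p^N, so the
  resulting congruence is an equality.\<close>

lemma sum_D:
  assumes x: "x \<in> Nm" "x [^] m \<in> C" and m: "m \<ge> 1" "coprime m p"
    and t: "[t ^ m = 1] (mod int p)" and ord: "\<And>i. 0 < i \<Longrightarrow> i < m \<Longrightarrow> \<not> [t ^ i = 1] (mod int p)"
    and big: "n * p < p ^ N" "m \<le> p"
  shows "(\<Sum>a<m. D x (t ^ a)) = dimU"
proof -
  let ?M = "int p ^ N"
  define \<nu> where "\<nu> = teich t ^ (m - 1)"
  have ta: "[(t ^ a) ^ m = 1] (mod int p)" for a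
    using cong_pow[OF t, of a] by (simp add: power_mult[symmetric] mult.commute)
  have teich_pow: "teich (t ^ a) = teich t ^ a" for a
    by (simp add: teich_def power_mult[symmetric] mult.commute)
  have "int m * int (\<Sum>a<m. D x (t ^ a)) = (\<Sum>a<m. int m * int (D x (t ^ a)))"
    by (simp add: sum_distrib_left)
  also have "[\<dots> = (\<Sum>a<m. \<Sum>i<m. (\<nu> ^ i) ^ a * \<tau> (x [^] i))] (mod ?M)"
  proof (rule cong_sum)
    fix a
    have "((teich (t ^ a)) ^ (m - 1)) ^ i = (\<nu> ^ i) ^ a" for i
      by (simp add: \<nu>_def teich_pow power_mult[symmetric] mult.commute mult.left_commute)
    then show "[int m * int (D x (t ^ a)) = (\<Sum>i<m. (\<nu> ^ i) ^ a * \<tau> (x [^] i))] (mod ?M)"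
      using dim_formula(3)[OF x m ta[of a]] by simp
  qed
  also have "(\<Sum>a<m. \<Sum>i<m. (\<nu> ^ i) ^ a * \<tau> (x [^] i)) = (\<Sum>i<m. (\<Sum>a<m. (\<nu> ^ i) ^ a) * \<tau> (x [^] i))"
    by (subst sum.swap) (simp add: sum_distrib_right)
  also have "[\<dots> = (\<Sum>i<m. (if i = 0 then int m else 0) * \<tau> (x [^] i))] (mod ?M)"
  proof (intro cong_sum cong_mult cong_refl)
    fix i assume "i \<in> {..<m}"
    show "[(\<Sum>a<m. (\<nu> ^ i) ^ a) = (if i = 0 then int m else 0)] (mod ?M)"
    proof (cases "i = 0")
      case False
      have "[teich t ^ m = 1] (mod ?M)" using t by (rule teich_power)
      then have "[(teich t ^ m) ^ ((m - 1) * i) = 1 ^ ((m - 1) * i)] (mod ?M)" by (rule cong_pow)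
      then have "[(\<nu> ^ i) ^ m = 1] (mod ?M)"
        by (simp add: \<nu>_def power_mult[symmetric] mult.commute mult.left_commute)
      then have "?M dvd (\<nu> ^ i) ^ m - 1" by (simp add: cong_iff_dvd_diff)
      then have "?M dvd (\<nu> ^ i - 1) * (\<Sum>a<m. (\<nu> ^ i) ^ a)" by (simp add: power_diff_1_eq)
      moreover have "\<not> int p dvd \<nu> ^ i - 1"
      proof
        assume "int p dvd \<nu> ^ i - 1"
        then have "[\<nu> ^ i = 1] (mod int p)" by (simp add: cong_iff_dvd_diff)
        moreover have "[\<nu> ^ i = (t ^ (m - 1)) ^ i] (mod int p)"
          unfolding \<nu>_def by (intro cong_pow teich_mod)
        ultimately have "[(t ^ (m - 1)) ^ i = 1] (mod int p)" using cong_trans cong_sym by blast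
        then have "[(t ^ (m - 1)) ^ i * t ^ i = 1 * t ^ i] (mod int p)" by (intro cong_mult cong_refl)
        moreover have "(t ^ (m - 1)) ^ i * t ^ i = (t ^ m) ^ i"
          using m(1) by (simp add: power_mult_distrib[symmetric] power_Suc2[symmetric] del: power_Suc)
        moreover have "[(t ^ m) ^ i = 1 ^ i] (mod int p)" by (rule cong_pow[OF t])
        ultimately have "[t ^ i = 1] (mod int p)" using cong_trans cong_sym by (metis mult_1 power_one)
        then show False using ord[of i] False \<open>i \<in> {..<m}\<close> by auto
      qed
      then have "coprime (int p) (\<nu> ^ i - 1)" using prime_p by (simp add: prime_imp_coprime)
      then have "coprime ?M (\<nu> ^ i - 1)" by simp
      ultimately show ?thesis using False by (simp add: coprime_dvd_mult_right_iff cong_0_iff)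
    qed simp
  qed
  also have "(\<Sum>i<m. (if i = 0 then int m else 0) * \<tau> (x [^] i)) = int m * \<tau> \<one>"
  proof -
    have "(\<Sum>i<m. (if i = 0 then int m else 0) * \<tau> (x [^] i)) = (\<Sum>i\<in>{0::nat}. (if i = 0 then int m else 0) * \<tau> (x [^] i))"
      by (rule sum.mono_neutral_right) (use m(1) in auto)
    then show ?thesis by simp
  qed
  also have "[int m * \<tau> \<one> = int m * int dimU] (mod ?M)"
    by (intro cong_mult cong_refl cong_sym[OF dimU(3)])
  finally have "[int m * int (\<Sum>a<m. D x (t ^ a)) = int m * int dimU] (mod ?M)" .
  moreover have "coprime (int m) ?M" using m by simp
  ultimately have "[int (\<Sum>a<m. D x (t ^ a)) = int dimU] (mod ?M)"
    using cong_mult_lcancel by blast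
  then have "[(\<Sum>a<m. D x (t ^ a)) = dimU] (mod p ^ N)" by (metis cong_int_iff of_nat_power)
  moreover have "(\<Sum>a<m. D x (t ^ a)) \<le> m * n"
    using sum_bounded_above[of "{..<m}" "\<lambda>a. D x (t ^ a)" n] dim_formula(1)[OF x m ta] by simp
  moreover have "m * n < p ^ N"
  proof -
    have "m * n \<le> n * p" using big(2) by (simp add: mult.commute)
    then show ?thesis using big(1) by linarith
  qed
  moreover have "dimU < p ^ N"
    using dimU(1) big prime_p prime_gt_0_nat[of p] by (metis One_nat_def Suc_leI le_trans linorder_not_less mult_le_mono2 nat_mult_1_right)
  ultimately show ?thesis by (simp add: cong_def)
qed

end

locale modular_rep_isr = modular_rep_sub +
  assumes isr: "\<And>g k. g \<in> carrier G \<Longrightarrow> coprime k (Coset.order G) \<Longrightarrow>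
      \<exists>h\<in>carrier G. g [^] (k::nat) = h \<otimes> g \<otimes> inv h \<or> g [^] k = h \<otimes> inv g \<otimes> inv h"
    and big: "n * p < p ^ N"
begin

lemma conj_inv:
  assumes "g \<in> carrier G" "h \<in> carrier G"
  shows "inv (h \<otimes> g \<otimes> inv h) = h \<otimes> inv g \<otimes> inv h"
  using assms by (simp add: inv_mult_group m_assoc)

text \<open>Either alternative of \<open>isr\<close> maps the pair of classes of g and its inverse
  to itself, possibly exchanging the two.\<close>

lemma T_isr:
  assumes g: "g \<in> carrier G" and k: "coprime k (Coset.order G)"
  shows "[T (g [^] k) + T (inv (g [^] k)) = T g + T (inv g)] (mod int p ^ N)"
proof -
  obtain h where h: "h \<in> carrier G" "g [^] k = h \<otimes> g \<otimes> inv h \<or> g [^] k = h \<otimes> inv g \<otimes> inv h"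
    using isr[OF g k] by blast
  from h(2) show ?thesis
  proof
    assume e: "g [^] k = h \<otimes> g \<otimes> inv h"
    have "inv (g [^] k) = h \<otimes> inv g \<otimes> inv h" using e conj_inv[OF g h(1)] by simp
    then show ?thesis unfolding e using T_conj g h(1) by (intro cong_add) (auto simp: conj_inv)
  next
    assume e: "g [^] k = h \<otimes> inv g \<otimes> inv h"
    have "inv (g [^] k) = h \<otimes> g \<otimes> inv h" using e conj_inv[OF inv_closed[OF g] h(1)] g by simp
    then have "[T (g [^] k) + T (inv (g [^] k)) = T (inv g) + T g] (mod int p ^ N)"
      using T_conj[of g h] T_conj[of "inv g" h] e g h(1) by (metis cong_add inv_closed)
    then show ?thesis by (simp add: add.commute)
  qed
qed

text \<open>Squares remove the sign: if the k-th power moves g into the class of its inverse, doing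
  so twice leads back to the class of g. This is why square exponents give more than
  \<open>T_isr\<close>.\<close>

lemma T_isr_square:
  assumes g: "g \<in> carrier G" and k: "coprime k (Coset.order G)"
  shows "[T (g [^] (k * k)) = T g] (mod int p ^ N)"
proof -
  obtain h where h: "h \<in> carrier G" "g [^] k = h \<otimes> g \<otimes> inv h \<or> g [^] k = h \<otimes> inv g \<otimes> inv h"
    using isr[OF g k] by blast
  obtain h' where h': "h' \<in> carrier G" "(g [^] k) [^] k = h' \<otimes> (g [^] k) \<otimes> inv h' \<or> (g [^] k) [^] k = h' \<otimes> inv (g [^] k) \<otimes> inv h'"
    using isr[OF nat_pow_closed[OF g] k] by blast
  have pk: "(h \<otimes> y \<otimes> inv h) [^] k = h \<otimes> y [^] k \<otimes> inv h" if "y \<in> carrier G" for y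
  proof -
    have "(h \<otimes> y \<otimes> inv h) [^] j = h \<otimes> y [^] j \<otimes> inv h" for j :: nat
    proof (induction j)
      case (Suc j)
      show ?case using Suc h(1) that by (simp add: m_assoc inv_mult_cancel)
    qed (use h(1) in simp)
    then show ?thesis .
  qed
  have kk: "g [^] (k * k) = (g [^] k) [^] k" using g by (simp add: nat_pow_pow)
  show ?thesis using h(2)
  proof
    assume e: "g [^] k = h \<otimes> g \<otimes> inv h"
    then have "g [^] (k * k) = h \<otimes> g [^] k \<otimes> inv h" using kk pk[OF g] by simp
    then have "[T (g [^] (k * k)) = T (g [^] k)] (mod int p ^ N)" using T_conj g h(1) by simp
    also have "[T (g [^] k) = T g] (mod int p ^ N)" unfolding e using T_conj g h(1) by simp
    finally show ?thesis .
  next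
    assume e: "g [^] k = h \<otimes> inv g \<otimes> inv h"
    then have "g [^] (k * k) = h \<otimes> inv (g [^] k) \<otimes> inv h"
      using kk pk[OF inv_closed[OF g]] g by (simp add: nat_pow_inv)
    then have "[T (g [^] (k * k)) = T (inv (g [^] k))] (mod int p ^ N)" using T_conj g h(1) by simp
    also have "inv (g [^] k) = h \<otimes> g \<otimes> inv h" using e conj_inv[OF inv_closed[OF g] h(1)] g by simp
    also have "[T (h \<otimes> g \<otimes> inv h) = T g] (mod int p ^ N)" using T_conj g h(1) by simp
    finally show ?thesis .
  qed
qed

lemma pow_inj:
  assumes "coprime k (Coset.order G)" "x \<in> carrier G" "y \<in> carrier G" "x [^] k = y [^] k"
  shows "x = y"
proof -
  have "Coset.order G \<noteq> 0" using fin order_gt_0_iff_finite by simp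
  then obtain l where l: "[k * l = 1] (mod Coset.order G)" using assms(1) cong_solve_coprime_nat by auto
  have e: "z [^] (k * l) = z" if "z \<in> carrier G" for z
  proof -
    have "z [^] (k * l) = z [^] ((k * l) mod Coset.order G)"
      using that pow_order_eq_1[OF that] by (metis mult_div_mod_eq nat_pow_closed nat_pow_mult nat_pow_one nat_pow_pow l_one)
    also have "(k * l) mod Coset.order G = 1 mod Coset.order G" using l by (simp add: cong_def)
    also have "z [^] (1 mod Coset.order G) = z"
    proof (cases "Coset.order G = 1")
      case True
      then have "z = \<one>" using that one_closed by (metis card_1_singletonE Coset.order_def singletonD)
      then show ?thesis by simp
    next
      case False
      then show ?thesis using that by simp
    qed
    finally show ?thesis .
  qed
  show ?thesis using e[OF assms(2)] e[OF assms(3)] assms by (metis nat_pow_pow)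
qed

text \<open>The k-th power maps the coset C x into C x^k, and it is injective because k is prime to
  |G|. So the k-th powers of C x run through C x^k exactly once.\<close>

lemma sum_coset_pow:
  assumes x: "x \<in> Nm" and k: "coprime k (Coset.order G)"
  shows "(\<Sum>c\<in>C. f (c \<otimes> x [^] k)) = (\<Sum>c\<in>C. f ((c \<otimes> x) [^] k))"
proof -
  have xc: "x \<in> carrier G" using x Nm_carrier by blast
  define \<phi> where "\<phi> = (\<lambda>c. (c \<otimes> x) [^] k \<otimes> inv (x [^] k))"
  have powC: "(c \<otimes> x) [^] j \<otimes> inv (x [^] j) \<in> C" if "c \<in> C" for c and j :: nat
  proof (induction j)
    case (Suc j)
    let ?u = "(c \<otimes> x) [^] j \<otimes> inv (x [^] j)"
    have "?u \<otimes> (x [^] j \<otimes> c \<otimes> inv (x [^] j)) \<in> C"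
      using Suc Nm_pow[OF x, of j] that subC by (auto simp: normalizes_def subgroup.m_closed)
    moreover have "?u \<otimes> (x [^] j \<otimes> c \<otimes> inv (x [^] j)) = (c \<otimes> x) [^] Suc j \<otimes> inv (x [^] Suc j)"
    proof -
      have "?u \<otimes> (x [^] j \<otimes> c \<otimes> inv (x [^] j)) = (c \<otimes> x) [^] j \<otimes> (c \<otimes> inv (x [^] j))"
        using xc C_carrier[OF that] by (simp add: m_assoc inv_mult_cancel)
      also have "\<dots> = (c \<otimes> x) [^] Suc j \<otimes> inv (x [^] Suc j)"
        using xc C_carrier[OF that] by (simp add: m_assoc inv_mult_group inv_mult_cancel)
      finally show ?thesis .
    qed
    ultimately show ?case by simp
  qed (use xc one_C in simp)
  have "inj_on \<phi> C"
  proof (rule inj_onI)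
    fix c d assume cd: "c \<in> C" "d \<in> C" "\<phi> c = \<phi> d"
    then have "(c \<otimes> x) [^] k = (d \<otimes> x) [^] k" using xc C_carrier by (simp add: \<phi>_def)
    then have "c \<otimes> x = d \<otimes> x" using pow_inj[OF k] xc C_carrier cd by simp
    then show "c = d" using xc C_carrier cd by simp
  qed
  moreover have "\<phi> ` C \<subseteq> C" using powC by (auto simp: \<phi>_def)
  ultimately have im: "\<phi> ` C = C" using finite_C by (simp add: endo_inj_surj)
  have "(\<Sum>c\<in>C. f (c \<otimes> x [^] k)) = (\<Sum>c\<in>\<phi> ` C. f (c \<otimes> x [^] k))" by (simp add: im)
  also have "\<dots> = (\<Sum>c\<in>C. f (\<phi> c \<otimes> x [^] k))" using \<open>inj_on \<phi> C\<close> by (simp add: sum.reindex)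
  also have "\<dots> = (\<Sum>c\<in>C. f ((c \<otimes> x) [^] k))"
    by (intro sum.cong refl) (use xc C_carrier in \<open>simp add: \<phi>_def m_assoc\<close>)
  finally show ?thesis .
qed

lemma tau_isr:
  assumes x: "x \<in> Nm" and k: "coprime k (Coset.order G)"
  shows "[\<tau> (x [^] k) + \<tau> (inv (x [^] k)) = \<tau> x + \<tau> (inv x)] (mod int p ^ N)"
proof -
  have xc: "x \<in> carrier G" using x Nm_carrier by blast
  have "\<tau> (x [^] k) + \<tau> (inv (x [^] k)) = \<kappa> * (\<Sum>c\<in>C. T (c \<otimes> x [^] k) + T (inv (c \<otimes> x [^] k)))"
    by (simp add: tau_eq[of "x [^] k"] tau_inv[OF Nm_pow[OF x]] sum.distrib algebra_simps)
  also have "\<dots> = \<kappa> * (\<Sum>c\<in>C. T ((c \<otimes> x) [^] k) + T (inv ((c \<otimes> x) [^] k)))"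
    using sum_coset_pow[OF x k, of "\<lambda>g. T g + T (inv g)"] by simp
  also have "[\<dots> = \<kappa> * (\<Sum>c\<in>C. T (c \<otimes> x) + T (inv (c \<otimes> x)))] (mod int p ^ N)"
    by (intro cong_mult cong_refl cong_sum T_isr k) (use xc C_carrier in auto)
  also have "\<kappa> * (\<Sum>c\<in>C. T (c \<otimes> x) + T (inv (c \<otimes> x))) = \<tau> x + \<tau> (inv x)"
    by (simp add: tau_eq[of x] tau_inv[OF x] sum.distrib algebra_simps)
  finally show ?thesis .
qed

lemma tau_isr_square:
  assumes x: "x \<in> Nm" and k: "coprime k (Coset.order G)"
  shows "[\<tau> (x [^] (k * k)) = \<tau> x] (mod int p ^ N)"
proof -
  have xc: "x \<in> carrier G" using x Nm_carrier by blast
  have k2: "coprime (k * k) (Coset.order G)" using k by simp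
  have "\<tau> (x [^] (k * k)) = \<kappa> * (\<Sum>c\<in>C. T ((c \<otimes> x) [^] (k * k)))"
    using sum_coset_pow[OF x k2, of T] by (simp add: tau_eq)
  also have "[\<dots> = \<kappa> * (\<Sum>c\<in>C. T (c \<otimes> x))] (mod int p ^ N)"
    by (intro cong_mult cong_refl cong_sum T_isr_square k) (use xc C_carrier in auto)
  also have "\<kappa> * (\<Sum>c\<in>C. T (c \<otimes> x)) = \<tau> x" by (simp add: tau_eq)
  finally show ?thesis .
qed

lemma pow_in_C: "c \<in> C \<Longrightarrow> c [^] (k::nat) \<in> C"
  by (induction k) (use subC one_C in \<open>auto simp: subgroup.m_closed\<close>)

text \<open>The Fourier expansions of the two sides agree term by term, since x^i normalizes C
  whenever x does. The bound \<open>big\<close> again makes equalities of the congruences.\<close>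

lemma D_isr:
  assumes x: "x \<in> Nm" "x [^] m \<in> C" and m: "m \<ge> 1" "coprime m p"
    and t: "[t ^ m = 1] (mod int p)" and k: "coprime k (Coset.order G)"
  shows "D (x [^] k) t + D (inv (x [^] k)) t = D x t + D (inv x) t"
    and "D (x [^] (k * k)) t = D x t"
proof -
  let ?M = "int p ^ N"
  let ?\<nu> = "teich t ^ (m - 1)"
  have xc: "x \<in> carrier G" using x Nm_carrier by blast
  have mem: "inv y \<in> Nm" "inv y [^] m \<in> C" if "y \<in> Nm" "y [^] m \<in> C" for y
    using that Nm_inv Nm_carrier subC by (auto simp: nat_pow_inv subgroup.m_inv_closed)
  have memk: "x [^] l \<in> Nm" "(x [^] l) [^] m \<in> C" for l :: nat
  proof -
    show "x [^] l \<in> Nm" by (rule Nm_pow[OF x(1)])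
    have "(x [^] l) [^] m = (x [^] m) [^] l" using xc by (simp add: nat_pow_pow mult.commute)
    then show "(x [^] l) [^] m \<in> C" using pow_in_C[OF x(2)] by simp
  qed
  have swap: "(x [^] l) [^] i = (x [^] i) [^] l" "inv (x [^] l) [^] i = inv ((x [^] i) [^] l)"
    "inv x [^] i = inv (x [^] i)" for l i :: nat
    using xc by (simp_all add: nat_pow_pow nat_pow_inv mult.commute)
  note F = dim_formula[OF _ _ m t]
  have "[int m * int (D (x [^] k) t + D (inv (x [^] k)) t) = (\<Sum>i<m. ?\<nu> ^ i * (\<tau> ((x [^] i) [^] k) + \<tau> (inv ((x [^] i) [^] k))))] (mod ?M)"
    using cong_add[OF F(3)[OF memk, of k] F(3)[OF mem[OF memk], of k]]
    by (simp add: swap sum.distrib distrib_left)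
  also have "[(\<Sum>i<m. ?\<nu> ^ i * (\<tau> ((x [^] i) [^] k) + \<tau> (inv ((x [^] i) [^] k)))) = (\<Sum>i<m. ?\<nu> ^ i * (\<tau> (x [^] i) + \<tau> (inv (x [^] i))))] (mod ?M)"
    by (intro cong_sum cong_mult cong_refl tau_isr k Nm_pow x)
  also have "[(\<Sum>i<m. ?\<nu> ^ i * (\<tau> (x [^] i) + \<tau> (inv (x [^] i)))) = int m * int (D x t + D (inv x) t)] (mod ?M)"
    using cong_sym[OF cong_add[OF F(3)[OF x] F(3)[OF mem[OF x]]]]
    by (simp add: swap sum.distrib distrib_left)
  finally have "[int m * int (D (x [^] k) t + D (inv (x [^] k)) t) = int m * int (D x t + D (inv x) t)] (mod ?M)" .
  moreover have cm: "coprime (int m) ?M" using m by simp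
  ultimately have "[int (D (x [^] k) t + D (inv (x [^] k)) t) = int (D x t + D (inv x) t)] (mod ?M)"
    using cong_mult_lcancel by blast
  then have c: "[D (x [^] k) t + D (inv (x [^] k)) t = D x t + D (inv x) t] (mod p ^ N)" by (metis cong_int_iff of_nat_power)
  have p2: "2 \<le> p" using prime_p prime_ge_2_nat by blast
  have lt: "a + b < p ^ N" if "a \<le> n" "b \<le> n" for a b
  proof -
    have "a + b \<le> n * 2" using that by simp
    also have "\<dots> \<le> n * p" using p2 by simp
    finally show ?thesis using big by simp
  qed
  have "D (x [^] k) t + D (inv (x [^] k)) t < p ^ N" "D x t + D (inv x) t < p ^ N"
    using F(1)[OF memk] F(1)[OF mem[OF memk]] F(1)[OF x] F(1)[OF mem[OF x]] lt by auto
  then show "D (x [^] k) t + D (inv (x [^] k)) t = D x t + D (inv x) t" using c by (simp add: cong_def)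
  have "[int m * int (D (x [^] (k * k)) t) = (\<Sum>i<m. ?\<nu> ^ i * \<tau> ((x [^] i) [^] (k * k)))] (mod ?M)"
    using F(3)[OF memk, of "k * k"] by (simp add: swap(1)[of "k * k"])
  also have "[(\<Sum>i<m. ?\<nu> ^ i * \<tau> ((x [^] i) [^] (k * k))) = (\<Sum>i<m. ?\<nu> ^ i * \<tau> (x [^] i))] (mod ?M)"
    by (intro cong_sum cong_mult cong_refl tau_isr_square k Nm_pow x)
  also have "[(\<Sum>i<m. ?\<nu> ^ i * \<tau> (x [^] i)) = int m * int (D x t)] (mod ?M)"
    by (rule cong_sym[OF F(3)[OF x]])
  finally have "[int (D (x [^] (k * k)) t) = int (D x t)] (mod ?M)" using cm cong_mult_lcancel by blast
  then have "[D (x [^] (k * k)) t = D x t] (mod p ^ N)" by (metis cong_int_iff of_nat_power)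
  moreover have "D (x [^] (k * k)) t < p ^ N" "D x t < p ^ N"
    using F(1)[OF memk] F(1)[OF x] lt[of _ 0] by auto
  ultimately show "D (x [^] (k * k)) t = D x t" by (simp add: cong_def)
qed

end

section \<open>Stabilizers acting freely on their fixed space\<close>

lemma cosets_of_subgroup:
  fixes G (structure)
  assumes "group G" "subgroup C G" "subgroup H G" "C \<subseteq> H"
  shows "card {C #> g | g. g \<in> H} * card C = card H"
proof -
  interpret group G by fact
  have s: "subgroup C (G\<lparr>carrier := H\<rparr>)" using subgroup_incl[OF assms(2-4)] .
  have g: "group (G\<lparr>carrier := H\<rparr>)" using subgroup_imp_group[OF assms(3)] .
  have "rcosets\<^bsub>G\<lparr>carrier := H\<rparr>\<^esub> C = {C #> g | g. g \<in> H}"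
    by (auto simp: RCOSETS_def r_coset_def)
  then show ?thesis using group.lagrange[OF g s] by (simp add: Coset.order_def)
qed

context modular_rep
begin

definition zv :: "nat \<Rightarrow> int" where "zv = (\<lambda>i\<in>{..<n}. 0)"

lemma zv_Vs: "zv \<in> Vs"
  using p_gt1 by (auto simp: zv_def Vs_def)

lemma Vs_eqI: "v \<in> Vs \<Longrightarrow> w \<in> Vs \<Longrightarrow> vcong n p v w \<Longrightarrow> v = w"
proof
  fix i assume vw: "v \<in> Vs" "w \<in> Vs" "vcong n p v w"
  show "v i = w i"
  proof (cases "i < n")
    case True
    have "[v i = w i] (mod int p)" using vw(3) True unfolding vcong_def by blast
    moreover have "v i \<in> {0..<int p}" using vw(1) True by (simp add: Vs_def PiE_iff)
    moreover have "w i \<in> {0..<int p}" using vw(2) True by (simp add: Vs_def PiE_iff)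
    ultimately show ?thesis by (simp add: cong_def)
  next
    case False then show ?thesis using vw by (auto simp: Vs_def PiE_def extensional_def)
  qed
qed

lemma nonzero_entry:
  assumes "v \<in> Vs" "v \<noteq> zv"
  obtains i where "i < n" "\<not> int p dvd v i"
proof -
  have "\<not> vcong n p v zv" using Vs_eqI[OF assms(1) zv_Vs] assms(2) by blast
  then obtain i where "i < n" "\<not> [v i = 0] (mod int p)" by (auto simp: vcong_def zv_def)
  then show ?thesis using that by (simp add: cong_0_iff)
qed

lemma eig_unique:
  assumes "v \<in> Vs" "v \<noteq> zv" "eig g s v" "eig g t v"
  shows "[s = t] (mod int p)"
proof -
  obtain i where i: "i < n" "\<not> int p dvd v i" using nonzero_entry[OF assms(1,2)] .
  have "vcong n p (\<lambda>i. s * v i) (\<lambda>i. t * v i)"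
    using assms(3,4) unfolding eig_def using vcong_sym vcong_trans by blast
  then have "[s * v i = t * v i] (mod int p)" using i by (simp add: vcong_def)
  moreover have "coprime (v i) (int p)" using i(2) prime_p by (simp add: coprime_commute prime_imp_coprime)
  ultimately show ?thesis using cong_mult_rcancel by blast
qed

lemma eig_zv: "eig g t zv"
  by (simp add: eig_def vcong_def mv_def zv_def)

definition act :: "'g \<Rightarrow> (nat \<Rightarrow> int) \<Rightarrow> nat \<Rightarrow> int" where
  "act g v = (\<lambda>i\<in>{..<n}. mv n (\<rho> g) v i mod int p)"

lemma act_Vs: "act g v \<in> Vs"
  using p_gt1 by (auto simp: act_def Vs_def)

lemma act_vcong: "vcong n p (act g v) (mv n (\<rho> g) v)"
  by (simp add: act_def vcong_def cong_def)

lemma act_mult: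
  assumes "g \<in> carrier G" "h \<in> carrier G"
  shows "act (g \<otimes> h) v = act g (act h v)"
proof (rule Vs_eqI[OF act_Vs act_Vs])
  have "vcong n p (mv n (\<rho> (g \<otimes> h)) v) (mv n (mm n (\<rho> g) (\<rho> h)) v)"
    by (rule mv_cong[OF mcong_sym[OF mod_p[OF rep_mult]] vcong_refl]) (use assms in auto)
  moreover have "vcong n p (mv n (\<rho> g) (mv n (\<rho> h) v)) (mv n (\<rho> g) (act h v))"
    by (rule mv_cong[OF mcong_refl vcong_sym[OF act_vcong]])
  ultimately show "vcong n p (act (g \<otimes> h) v) (act g (act h v))"
    using vcong_trans[OF act_vcong] vcong_trans vcong_sym[OF act_vcong] unfolding mv_mm by blast
qed

lemma act_eq_iff: "v \<in> Vs \<Longrightarrow> act g v = v \<longleftrightarrow> eig g 1 v"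
proof
  assume "v \<in> Vs" "act g v = v"
  then show "eig g 1 v" using act_vcong[of g v] vcong_sym by (auto simp: eig_def)
next
  assume v: "v \<in> Vs" "eig g 1 v"
  then have "vcong n p (act g v) v" using act_vcong[of g v] vcong_trans by (auto simp: eig_def)
  then show "act g v = v" using v(1) Vs_eqI act_Vs by blast
qed

definition vadd :: "(nat \<Rightarrow> int) \<Rightarrow> (nat \<Rightarrow> int) \<Rightarrow> nat \<Rightarrow> int" where
  "vadd v w = (\<lambda>i\<in>{..<n}. (v i + w i) mod int p)"

lemma vadd_Vs: "vadd v w \<in> Vs"
  using p_gt1 by (auto simp: vadd_def Vs_def)

lemma vadd_vcong: "vcong n p (vadd v w) (\<lambda>i. v i + w i)"
  by (simp add: vadd_def vcong_def cong_def)

lemma mv_add: "mv n A (\<lambda>i. v i + w i) = (\<lambda>i. mv n A v i + mv n A w i)"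
  by (simp add: mv_def sum.distrib distrib_left)

lemma eig_vadd:
  assumes "eig g t v" "eig g t w"
  shows "eig g t (vadd v w)"
proof -
  have "vcong n p (mv n (\<rho> g) (\<lambda>i. v i + w i)) (\<lambda>i. t * (v i + w i))"
    unfolding mv_add using assms by (auto simp: eig_def vcong_def distrib_left intro: cong_add)
  then have "eig g t (\<lambda>i. v i + w i)" by (simp add: eig_def)
  then show ?thesis using eig_vcong vcong_sym[OF vadd_vcong] by blast
qed

definition stab :: "(nat \<Rightarrow> int) \<Rightarrow> 'g set" where
  "stab v = {g \<in> carrier G. eig g 1 v}"

lemma stab_subgroup: "subgroup (stab v) G"
proof (rule subgroupI)
  show "stab v \<noteq> {}" using eig_one by (auto simp: stab_def)
next
  fix a assume "a \<in> stab v"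
  then show "inv a \<in> stab v" using eig_inv[of a 1 v 1] by (auto simp: stab_def)
next
  fix a b assume "a \<in> stab v" "b \<in> stab v"
  then show "a \<otimes> b \<in> stab v" using eig_mult[of a b 1 v 1] by (auto simp: stab_def)
qed (auto simp: stab_def)

end

text \<open>The stabilizer \<open>C\<close> of a vector, if its order is maximal, is the stabilizer of every nonzero
  vector that it fixes; this is the assumption \<open>free\<close>.\<close>

locale free_rep = modular_rep_isr +
  assumes free: "\<And>u g. u \<in> ES C \<one> 1 \<Longrightarrow> u \<noteq> zv \<Longrightarrow> g \<in> carrier G \<Longrightarrow> eig g 1 u \<Longrightarrow> g \<in> C"
    and nontriv: "ES C \<one> 1 \<noteq> {zv}"
begin

abbreviation "U \<equiv> ES C \<one> 1"

lemma U_iff: "u \<in> U \<longleftrightarrow> u \<in> Vs \<and> (\<forall>c\<in>C. eig c 1 u)"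
  by (auto simp: ES_def eig_one)

lemma zv_U: "zv \<in> U"
  by (simp add: U_iff zv_Vs eig_zv)

lemma zv_ES: "zv \<in> ES C x t"
  by (simp add: ES_def zv_Vs eig_zv)

lemma finite_ES: "finite (ES C x t)"
  using finite_Vs by (rule finite_subset[rotated]) (auto simp: ES_def)

lemma ES_U: "ES C x t \<subseteq> U"
  by (auto simp: ES_def U_iff eig_one)

lemma card_U: "card U = p ^ dimU"
  by (rule dimU(2))

lemma dimU_pos: "dimU \<ge> 1"
proof (rule ccontr)
  assume "\<not> dimU \<ge> 1"
  then have "card U = 1" using card_U by simp
  then show False using zv_U nontriv by (metis card_1_singletonE singletonD)
qed

definition Q :: "'a set set" where "Q = {C #> g | g. g \<in> Nm}"

definition r :: nat where "r = card Q"

lemma r_card: "r * card C = card Nm"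
  unfolding r_def Q_def using cosets_of_subgroup[OF is_group subC subgroup_Nm] C_Nm by blast

lemma card_C_pos: "card C > 0"
  using finite_C one_C card_gt_0_iff by blast

lemma r_dvd_order: "r dvd Coset.order G"
  using r_card lagrange[OF subgroup_Nm] by (metis dvd_mult dvd_triv_left mult.commute)

lemma r_pos: "r > 0"
  using r_dvd_order fin order_gt_0_iff_finite by (metis dvd_0_left_iff gr0I)

lemma finite_Q: "finite Q"
  using r_pos unfolding r_def using card_gt_0_iff by blast

text \<open>An element that merely rescales u conjugates C into the stabilizer of u, which is
  contained in C by \<open>free\<close>.\<close>

lemma eig_Nm:
  assumes u: "u \<in> U" "u \<noteq> zv" and h: "h \<in> carrier G" "eig h t u" and t: "coprime t (int p)"
  shows "h \<in> Nm"
proof -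
  obtain t' where t': "[t * t' = 1] (mod int p)" using t cong_solve_coprime_int by blast
  have "h \<otimes> c \<otimes> inv h \<in> C" if c: "c \<in> C" for c
  proof (rule free[OF u])
    show "h \<otimes> c \<otimes> inv h \<in> carrier G" using h C_carrier[OF c] by simp
    have "eig (h \<otimes> c \<otimes> inv h) (t * 1 * t') u"
      using h C_carrier[OF c] u c t' by (intro eig_mult eig_inv) (auto simp: U_iff)
    then show "eig (h \<otimes> c \<otimes> inv h) 1 u" using eig_cong t' by simp
  qed
  then show ?thesis using h by (simp add: normalizes_def)
qed

lemma coset_eq_iff:
  assumes "g \<in> Nm" "h \<in> Nm"
  shows "C #> g = C #> h \<longleftrightarrow> g \<otimes> inv h \<in> C"
proof
  assume e: "C #> g = C #> h"
  have "g \<in> C #> h" using e rcos_self[OF Nm_carrier[OF assms(1)] subC] by simp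
  then obtain c where "c \<in> C" "g = c \<otimes> h" by (auto simp: r_coset_def)
  then show "g \<otimes> inv h \<in> C" using assms Nm_carrier C_carrier by (simp add: m_assoc)
next
  assume c: "g \<otimes> inv h \<in> C"
  have "g = (g \<otimes> inv h) \<otimes> h" using assms Nm_carrier by (simp add: m_assoc)
  then have "g \<in> C #> h" using c unfolding r_coset_def by blast
  then show "C #> g = C #> h" using repr_independence[OF _ Nm_carrier[OF assms(2)] subC] by simp
qed

lemma coset_eq_eig:
  assumes u: "u \<in> U" "u \<noteq> zv" and g: "g \<in> Nm" "eig g s u" and h: "h \<in> Nm" "eig h s u" and s: "coprime s (int p)"
  shows "C #> g = C #> h"
proof -
  obtain s' where s': "[s * s' = 1] (mod int p)" using s cong_solve_coprime_int by blast
  have "eig (g \<otimes> inv h) (s * s') u"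
    using g h Nm_carrier s' by (intro eig_mult eig_inv) auto
  then have "g \<otimes> inv h \<in> C" using free[OF u] g h Nm_carrier eig_cong s' by auto
  then show ?thesis using coset_eq_iff g h by simp
qed

lemma eig_coset:
  assumes "u \<in> U" "g \<in> Nm" "h \<in> Nm" "C #> g = C #> h" "eig g s u"
  shows "eig h s u"
proof -
  have "h \<otimes> inv g \<in> C" using coset_eq_iff[OF assms(3,2)] assms(4) by simp
  then have "eig (h \<otimes> inv g \<otimes> g) (1 * s) u"
    using assms Nm_carrier by (intro eig_mult) (auto simp: U_iff)
  then show ?thesis using assms Nm_carrier by (simp add: m_assoc)
qed

lemma act_U:
  assumes "g \<in> Nm" "u \<in> U"
  shows "act g u \<in> U"
proof -
  have gc: "g \<in> carrier G" using assms Nm_carrier by blast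
  have "eig c 1 (act g u)" if c: "c \<in> C" for c
  proof -
    obtain d where d: "d \<in> C" "c = g \<otimes> d \<otimes> inv g" using conj_C[OF assms(1)] c by blast
    have "c \<otimes> g = g \<otimes> d" using d gc C_carrier by (simp add: m_assoc)
    then have "act c (act g u) = act g (act d u)"
      using gc C_carrier c d act_mult by metis
    moreover have "act d u = u" using d assms(2) act_eq_iff U_iff by blast
    ultimately show ?thesis using act_eq_iff[OF act_Vs] by simp
  qed
  then show ?thesis by (simp add: U_iff act_Vs)
qed

lemma act_nonzero:
  assumes "g \<in> carrier G" "u \<in> Vs" "u \<noteq> zv"
  shows "act g u \<noteq> zv"
proof
  assume e: "act g u = zv"
  have "act (inv g) (act g u) = act \<one> u" using act_mult[of "inv g" g u] assms by simp
  moreover have "act (inv g) zv = zv" using act_eq_iff[OF zv_Vs] eig_zv by blast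
  moreover have "act \<one> u = u" using act_eq_iff assms(2) eig_one by blast
  ultimately show False using e assms(3) by simp
qed

text \<open>Nm / C acts freely on the nonzero vectors of U, so these fall into orbits of length
  r.\<close>

lemma r_dvd: "r dvd p ^ dimU - 1"
proof -
  let ?O = "\<lambda>u. (\<lambda>g. act g u) ` Nm"
  let ?X = "U - {zv}"
  have cO: "card (?O u) = r" if u: "u \<in> ?X" for u
  proof -
    have uV: "u \<in> Vs" using u U_iff by blast
    have fib: "card {g \<in> Nm. act g u = w} = card C" if w: "w \<in> ?O u" for w
    proof -
      obtain g0 where g0: "g0 \<in> Nm" "w = act g0 u" using w by blast
      have "{g \<in> Nm. act g u = w} = (\<lambda>c. g0 \<otimes> c) ` C"
      proof (intro subset_antisym subsetI)
        fix g assume g: "g \<in> {g \<in> Nm. act g u = w}"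
        then have gc: "g \<in> carrier G" "g0 \<in> carrier G" using g0 Nm_carrier by auto
        have "act (inv g0 \<otimes> g) u = act (inv g0) (act g0 u)" using g g0 gc act_mult by simp
        also have "\<dots> = act (inv g0 \<otimes> g0) u" using gc by (intro act_mult[symmetric]) auto
        also have "\<dots> = u" using gc act_eq_iff[OF uV] eig_one by simp
        finally have "inv g0 \<otimes> g \<in> C" using free[of u] u gc act_eq_iff[OF uV] by auto
        moreover have "g = g0 \<otimes> (inv g0 \<otimes> g)" using gc by (simp add: inv_mult_cancel)
        ultimately show "g \<in> (\<lambda>c. g0 \<otimes> c) ` C" by blast
      next
        fix g assume "g \<in> (\<lambda>c. g0 \<otimes> c) ` C"
        then obtain c where c: "c \<in> C" "g = g0 \<otimes> c" by blast
        have "act c u = u" using c u act_eq_iff U_iff by blast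
        then have "act g u = w" using c g0 C_carrier Nm_carrier act_mult by simp
        then show "g \<in> {g \<in> Nm. act g u = w}" using c g0 Nm_mult C_Nm by blast
      qed
      then show ?thesis using g0 C_carrier Nm_carrier by (simp add: card_image inj_on_def)
    qed
    have fN: "finite Nm" using fin Nm_carrier by (meson finite_subset subsetI)
    have "card Nm = (\<Sum>w\<in>?O u. card {g \<in> Nm. act g u = w})"
      using sum.image_gen[OF fN, of "\<lambda>_. 1::nat" "\<lambda>g. act g u"] by simp
    also have "\<dots> = card (?O u) * card C" using fib by simp
    finally show ?thesis using r_card card_C_pos by simp
  qed
  have "r dvd card (\<Union>(?O ` ?X))"
  proof (rule dvd_partition)
    show "finite (\<Union>(?O ` ?X))"
      by (rule finite_subset[OF _ finite_Vs]) (use act_Vs in blast)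
    show "\<forall>c\<in>?O ` ?X. r dvd card c" using cO by auto
    show "\<forall>c1\<in>?O ` ?X. \<forall>c2\<in>?O ` ?X. c1 \<noteq> c2 \<longrightarrow> c1 \<inter> c2 = {}"
    proof -
      have sub: "?O u \<subseteq> ?O w" if "u \<in> U" "w \<in> U" "g \<in> Nm" "h \<in> Nm" "act g u = act h w" for u w g h
      proof
        fix y assume "y \<in> ?O u"
        then obtain k where k: "k \<in> Nm" "y = act k u" by blast
        have gc: "g \<in> carrier G" "h \<in> carrier G" "k \<in> carrier G" using that k Nm_carrier by auto
        have "u = act (inv g \<otimes> g) u" using gc that act_eq_iff eig_one U_iff by (metis l_inv)
        also have "\<dots> = act (inv g) (act g u)" using gc by (intro act_mult) auto
        also have "\<dots> = act (inv g) (act h w)" using that by simp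
        finally have "y = act (k \<otimes> (inv g \<otimes> h)) w" using k gc act_mult by simp
        then show "y \<in> ?O w" using that k Nm_mult Nm_inv by blast
      qed
      have "?O u = ?O w" if uw: "u \<in> ?X" "w \<in> ?X" and ne: "?O u \<inter> ?O w \<noteq> {}" for u w
      proof -
        obtain g h where "g \<in> Nm" "h \<in> Nm" "act g u = act h w" using ne by force
        then show ?thesis using sub[of u w g h] sub[of w u h g] uw by (simp add: subset_antisym)
      qed
      then show ?thesis by blast
    qed
  qed
  moreover have "\<Union>(?O ` ?X) = ?X"
  proof (intro subset_antisym subsetI)
    fix y assume "y \<in> \<Union>(?O ` ?X)"
    then show "y \<in> ?X" using act_U act_nonzero Nm_carrier U_iff by auto
  next
    fix y assume y: "y \<in> ?X"
    then have "act \<one> y = y" using act_eq_iff eig_one U_iff by blast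
    then have "y = act \<one> y" by simp
    then have "y \<in> ?O y" using C_Nm[OF one_C] by blast
    then show "y \<in> \<Union>(?O ` ?X)" using y by blast
  qed
  moreover have "card ?X = p ^ dimU - 1" using card_U zv_U finite_ES by simp
  ultimately show ?thesis by simp
qed

definition EV :: "int \<Rightarrow> 'a set \<Rightarrow> (nat \<Rightarrow> int) set" where
  "EV t X = {u \<in> U. \<exists>h\<in>X. eig h t u}"

lemma EV_coset: "h \<in> Nm \<Longrightarrow> EV t (C #> h) = ES C h t"
proof (intro subset_antisym subsetI)
  fix u assume h: "h \<in> Nm" and "u \<in> EV t (C #> h)"
  then obtain c where c: "c \<in> C" "u \<in> U" "eig (c \<otimes> h) t u" by (auto simp: EV_def r_coset_def)
  have "c \<otimes> h \<in> C #> h" using c by (auto simp: r_coset_def)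
  then have "C #> (c \<otimes> h) = C #> h" using repr_independence[OF _ Nm_carrier[OF h] subC] by simp
  then have "eig h t u" using eig_coset[OF c(2) Nm_mult[OF C_Nm[OF c(1)] h] h _ c(3)] by blast
  then show "u \<in> ES C h t" using c by (simp add: ES_def U_iff)
next
  fix u assume h: "h \<in> Nm" and u: "u \<in> ES C h t"
  then show "u \<in> EV t (C #> h)"
    using rcos_self[OF Nm_carrier[OF h] subC] ES_U by (auto simp: EV_def ES_def)
qed

text \<open>Each nonzero vector of U is a t-eigenvector of exactly one coset: an element that
  rescales it by t exists by assumption and normalizes C by \<open>eig_Nm\<close>, and two such
  elements differ by one that fixes the vector.\<close>

lemma card_EV:
  assumes t: "coprime t (int p)" and all: "\<And>u. u \<in> U \<Longrightarrow> u \<noteq> zv \<Longrightarrow> \<exists>h\<in>carrier G. eig h t u"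
  shows "(\<Sum>X\<in>Q. card (EV t X - {zv})) = p ^ dimU - 1"
proof -
  have "(\<Sum>X\<in>Q. card (EV t X - {zv})) = card (\<Union>X\<in>Q. EV t X - {zv})"
  proof (rule card_UN_disjoint[symmetric])
    show "finite Q" by (rule finite_Q)
    show "\<forall>X\<in>Q. finite (EV t X - {zv})"
      using finite_ES[of \<one> 1] by (auto simp: EV_def)
    show "\<forall>X\<in>Q. \<forall>Y\<in>Q. X \<noteq> Y \<longrightarrow> (EV t X - {zv}) \<inter> (EV t Y - {zv}) = {}"
    proof (intro ballI impI, rule ccontr)
      fix X Y assume XY: "X \<in> Q" "Y \<in> Q" "X \<noteq> Y" and "(EV t X - {zv}) \<inter> (EV t Y - {zv}) \<noteq> {}"
      then obtain u where u: "u \<in> EV t X" "u \<in> EV t Y" "u \<noteq> zv" by blast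
      obtain g h where gh: "X = C #> g" "Y = C #> h" "g \<in> Nm" "h \<in> Nm" using XY by (auto simp: Q_def)
      have "eig g t u" "eig h t u" "u \<in> U" using u gh EV_coset eig_one by (auto simp: ES_def)
      then show False using coset_eq_eig[of u g t h] u gh t XY by simp
    qed
  qed
  also have "(\<Union>X\<in>Q. EV t X - {zv}) = U - {zv}"
  proof (intro subset_antisym subsetI)
    fix u assume u: "u \<in> U - {zv}"
    then obtain h where h: "h \<in> carrier G" "eig h t u" using all by blast
    then have "h \<in> Nm" using eig_Nm[of u h t] u t by simp
    moreover then have "u \<in> EV t (C #> h)" using EV_coset u h by (auto simp: ES_def U_iff)
    ultimately show "u \<in> (\<Union>X\<in>Q. EV t X - {zv})" using u by (auto simp: Q_def)
  qed (auto simp: EV_def)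
  also have "card (U - {zv}) = p ^ dimU - 1" using card_U zv_U finite_ES by simp
  finally show ?thesis .
qed

lemma count_bound:
  assumes t: "coprime t (int p)" and all: "\<And>u. u \<in> U \<Longrightarrow> u \<noteq> zv \<Longrightarrow> \<exists>h\<in>carrier G. eig h t u"
    and c: "\<And>h. h \<in> Nm \<Longrightarrow> ES C h t \<noteq> {zv} \<Longrightarrow> card (ES C h t) \<le> p ^ c"
  shows "p ^ dimU - 1 \<le> card {X \<in> Q. EV t X \<noteq> {zv}} * (p ^ c - 1)"
proof -
  have z: "zv \<in> EV t X" if "X \<in> Q" for X using that zv_ES EV_coset by (auto simp: Q_def)
  have "p ^ dimU - 1 = (\<Sum>X\<in>Q. card (EV t X - {zv}))" using card_EV[OF t all] by simp
  also have "\<dots> = (\<Sum>X\<in>{X \<in> Q. EV t X \<noteq> {zv}}. card (EV t X - {zv}))"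
    by (rule sum.mono_neutral_right) (use finite_Q z in auto)
  also have "\<dots> \<le> (\<Sum>X\<in>{X \<in> Q. EV t X \<noteq> {zv}}. p ^ c - 1)"
  proof (rule sum_mono)
    fix X assume X: "X \<in> {X \<in> Q. EV t X \<noteq> {zv}}"
    then obtain h where h: "h \<in> Nm" "X = C #> h" by (auto simp: Q_def)
    then have "card (EV t X) \<le> p ^ c" using c[OF h(1)] X EV_coset by simp
    moreover have "card (EV t X - {zv}) = card (EV t X) - 1"
      using zv_ES finite_ES EV_coset h by simp
    ultimately show "card (EV t X - {zv}) \<le> p ^ c - 1" by simp
  qed
  finally show ?thesis by simp
qed

end

section \<open>Balance of eigenspaces\<close>

lemma funpow_fixed_prime:
  assumes "prime q" "(f ^^ q) x = x" "0 < i" "i < q" "(f ^^ i) x = x"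
  shows "f x = x"
proof -
  have mult: "(f ^^ (j * k)) x = x" if "(f ^^ j) x = x" for j k
    using that by (induction k) (simp_all add: funpow_add)
  have "coprime i q" using assms(1,3,4) by (metis coprime_commute nat_dvd_not_less prime_imp_coprime)
  then obtain a where a: "[i * a = 1] (mod q)" using cong_solve_coprime_nat[of i q] by auto
  obtain b where b: "i * a = 1 + q * b"
  proof -
    have "i * a \<ge> 1"
    proof (rule ccontr)
      assume "\<not> i * a \<ge> 1"
      then have "i * a = 0" by linarith
      then have "[0 = 1] (mod q)" using a by (simp only:)
      then show False using assms(1) prime_gt_1_nat[of q] by (simp add: cong_def)
    qed
    have "q dvd i * a - 1" using a by (rule cong_to_1_nat)
    then show ?thesis using that \<open>i * a \<ge> 1\<close> by (metis dvdE le_add_diff_inverse)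
  qed
  have "x = (f ^^ (1 + q * b)) x" using mult[OF assms(5), of a] b by simp
  also have "\<dots> = f ((f ^^ (q * b)) x)" by simp
  also have "\<dots> = f x" using mult[OF assms(2), of b] by simp
  finally show ?thesis by simp
qed

text \<open>The nontrivial orbits of a cyclic group of prime order all have that order.\<close>
lemma sum_fixed_points_cong:
  fixes g :: "'a \<Rightarrow> int"
  assumes "prime q" "finite W" "f ` W \<subseteq> W" "\<And>x. x \<in> W \<Longrightarrow> (f ^^ q) x = x"
    and "\<And>x. x \<in> W \<Longrightarrow> g (f x) = g x"
  shows "[(\<Sum>x\<in>W. g x) = (\<Sum>x\<in>{x \<in> W. f x = x}. g x)] (mod int q)"
  using assms(2-)
proof (induction "card W" arbitrary: W rule: less_induct)
  case less
  show ?case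
  proof (cases "\<forall>x\<in>W. f x = x")
    case True
    then have "{x \<in> W. f x = x} = W" by blast
    then show ?thesis by simp
  next
    case False
    then obtain x where x: "x \<in> W" "f x \<noteq> x" by blast
    let ?O = "(\<lambda>i. (f ^^ i) x) ` {..<q}"
    have inW: "(f ^^ i) y \<in> W" if "y \<in> W" for i y using less.prems(2) that by (induction i) auto
    have q0: "q > 0" using assms(1) prime_gt_0_nat by blast
    have inj: "inj_on (\<lambda>i. (f ^^ i) x) {..<q}"
    proof (rule linorder_inj_onI')
      fix i j assume ij: "i \<in> {..<q}" "j \<in> {..<q}" "i < j"
      show "(f ^^ i) x \<noteq> (f ^^ j) x"
      proof
        assume e: "(f ^^ i) x = (f ^^ j) x"
        have "(f ^^ (q - i)) ((f ^^ j) x) = (f ^^ (q - i)) ((f ^^ i) x)" using e by simp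
        also have "\<dots> = (f ^^ (q - i + i)) x" by (simp only: funpow_add o_apply)
        also have "\<dots> = x" using ij less.prems(3)[OF x(1)] by simp
        finally have "(f ^^ (q - i + j)) x = x" by (simp only: funpow_add o_apply)
        moreover have "q - i + j = (j - i) + q" using ij by simp
        ultimately have "(f ^^ ((j - i) + q)) x = x" by simp
        then have "(f ^^ (j - i)) x = x" using less.prems(3)[OF x(1)] by (simp add: funpow_add)
        moreover have "0 < j - i" "j - i < q" using ij by auto
        ultimately show False using funpow_fixed_prime[OF assms(1) less.prems(3)[OF x(1)]] x by blast
      qed
    qed
    then have cO: "card ?O = q" by (simp add: card_image)
    have OW: "?O \<subseteq> W" using inW x by blast
    have stepO: "f y \<in> ?O \<longleftrightarrow> y \<in> ?O" if "y \<in> W" for y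
    proof
      assume "y \<in> ?O"
      then obtain i where i: "i < q" "y = (f ^^ i) x" by blast
      show "f y \<in> ?O"
      proof (cases "Suc i < q")
        case True then show ?thesis using i by (intro image_eqI[of _ _ "Suc i"]) auto
      next
        case False
        then have "Suc i = q" using i by simp
        then have "f y = x" using i less.prems(3)[OF x(1)] by (metis funpow.simps(2) o_apply)
        then show ?thesis using q0 by (intro image_eqI[of _ _ 0]) auto
      qed
    next
      assume "f y \<in> ?O"
      then obtain i where i: "i < q" "f y = (f ^^ i) x" by blast
      have "y = (f ^^ q) y" using less.prems(3) that by simp
      also have "\<dots> = (f ^^ (q - 1)) (f y)" using q0 by (metis Suc_pred' funpow_Suc_right o_apply)
      also have "\<dots> = (f ^^ (q - 1 + i)) x" by (simp add: i funpow_add)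
      also have "\<dots> \<in> ?O"
      proof (cases "i = 0")
        case True then show ?thesis using q0 by auto
      next
        case False
        then have "q - 1 + i = (i - 1) + q" using q0 by simp
        then have "(f ^^ (q - 1 + i)) x = (f ^^ (i - 1)) x" using less.prems(3)[OF x(1)] by (simp add: funpow_add)
        then show ?thesis using i by (intro image_eqI[of _ _ "i - 1"]) auto
      qed
      finally show "y \<in> ?O" .
    qed
    let ?W = "W - ?O"
    have fW: "finite ?W" using less.prems(1) by blast
    have c: "card ?W < card W" using OW cO q0 less.prems(1) x
      by (intro psubset_card_mono) (auto intro!: exI[of _ x] image_eqI[of _ _ 0])
    have IH: "[(\<Sum>x\<in>?W. g x) = (\<Sum>x\<in>{x \<in> ?W. f x = x}. g x)] (mod int q)"
    proof (rule less.hyps[OF c fW])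
      show "f ` ?W \<subseteq> ?W"
      proof (rule image_subsetI)
        fix y assume y: "y \<in> ?W"
        then have "f y \<in> W" using less.prems(2) by blast
        moreover have "f y \<notin> ?O" using stepO[of y] y by (simp only: Diff_iff simp_thms)
        ultimately show "f y \<in> ?W" by (rule DiffI)
      qed
    qed (use less.prems in auto)
    have gO: "g ((f ^^ i) x) = g x" for i
      using less.prems(4) inW[OF x(1)] by (induction i) auto
    have "(\<Sum>x\<in>W. g x) = (\<Sum>x\<in>?W. g x) + (\<Sum>x\<in>?O. g x)"
      using OW less.prems(1) by (simp add: sum.subset_diff)
    also have "(\<Sum>x\<in>?O. g x) = int q * g x"
      using inj by (simp add: sum.reindex gO)
    finally have A: "[(\<Sum>x\<in>W. g x) = (\<Sum>x\<in>?W. g x)] (mod int q)" by (simp add: cong_iff_dvd_diff)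
    have B: "{x \<in> ?W. f x = x} = {x \<in> W. f x = x}"
    proof -
      have "f y \<noteq> y" if "y \<in> ?O" for y
      proof
        assume fy: "f y = y"
        obtain i where i: "i < q" "y = (f ^^ i) x" using \<open>y \<in> ?O\<close> by blast
        have "(f ^^ k) y = y" for k using fy by (induction k) auto
        then have "y = (f ^^ (q - i)) ((f ^^ i) x)" using i by metis
        also have "\<dots> = (f ^^ (q - i + i)) x" by (simp only: funpow_add o_apply)
        also have "\<dots> = x" using i less.prems(3)[OF x(1)] by simp
        finally show False using fy x by simp
      qed
      then show ?thesis by blast
    qed
    show ?thesis using cong_trans[OF A IH] unfolding B .
  qed
qed

text \<open>k' is chosen congruent to 1 modulo the primes that divide N but not m; primes dividing m
  are taken care of by the coprimality of k and m. In this way a unit modulo m is represented by an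
  exponent to which inverse semirationality applies.\<close>

lemma exists_cong_coprime:
  fixes k m N :: nat
  assumes "coprime k m" "N > 0"
  shows "\<exists>k'. [k' = k] (mod m) \<and> coprime k' N"
proof -
  define N' where "N' = \<Prod>{q. prime q \<and> q dvd N \<and> \<not> q dvd m}"
  have finP: "finite {q. prime q \<and> q dvd N \<and> \<not> q dvd m}"
    by (rule finite_subset[OF _ finite_divisors_nat[OF assms(2)]]) blast
  have "coprime m N'"
    unfolding N'_def
  proof (rule prod_coprime_right)
    fix q assume "q \<in> {q. prime q \<and> q dvd N \<and> \<not> q dvd m}"
    then have "coprime q m" using prime_imp_coprime by blast
    then show "coprime m q" by (simp add: ac_simps)
  qed
  then obtain k' where k': "[k' = k] (mod m)" "[k' = 1] (mod N')"
    using binary_chinese_remainder_nat by blast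
  have "coprime k' N"
  proof (rule ccontr)
    assume "\<not> coprime k' N"
    then obtain q where q: "prime q" "q dvd k'" "q dvd N"
      using prime_factor_nat[of "gcd k' N"] by (auto simp: coprime_iff_gcd_eq_1)
    show False
    proof (cases "q dvd m")
      case True
      then have "[k' = k] (mod q)" using k'(1) cong_dvd_modulus_nat by blast
      then have "q dvd k" using q(2) cong_dvd_iff by blast
      then show False using True assms(1) q(1) not_prime_unit by (metis coprime_common_divisor)
    next
      case False
      then have "q dvd N'" unfolding N'_def using q finP by (intro dvd_prodI) auto
      then have "[k' = 1] (mod q)" using k'(2) cong_dvd_modulus_nat by blast
      then have "q dvd 1" using q(2) cong_dvd_iff by blast
      then show False using q(1) not_prime_unit by blast
    qed
  qed
  then show ?thesis using k'(1) by blast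
qed

lemma sum_pairs_mod:
  fixes a :: "nat \<Rightarrow> int"
  assumes "k < m"
  shows "(\<Sum>(i,j) \<in> {ij \<in> {..<m} \<times> {..<m}. (fst ij + snd ij) mod m = k}. a i * a j)
    = (\<Sum>i<m. a i * a ((k + (m - i)) mod m))"
proof (rule sum.reindex_bij_witness[of _ "\<lambda>i. (i, (k + (m - i)) mod m)" fst])
  fix ij assume "ij \<in> {ij \<in> {..<m} \<times> {..<m}. (fst ij + snd ij) mod m = k}"
  then obtain i j where [simp]: "ij = (i, j)" and ij: "i < m" "j < m" "(i + j) mod m = k" by (cases ij) auto
  have "(k + (m - i)) mod m = (i + j + (m - i)) mod m" using ij(3) by (metis mod_add_left_eq)
  also have "i + j + (m - i) = j + m" using ij by simp
  finally have e: "(k + (m - i)) mod m = j" using ij by simp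
  show "(fst ij, (k + (m - fst ij)) mod m) = ij" "fst ij \<in> {..<m}"
    "a (fst ij) * a ((k + (m - fst ij)) mod m) = (case ij of (i, j) \<Rightarrow> a i * a j)"
    using e ij by simp_all
next
  fix i assume "i \<in> {..<m}"
  then have i: "i < m" by simp
  have "(i + (k + (m - i)) mod m) mod m = (i + (k + (m - i))) mod m" by (simp add: mod_simps)
  also have "i + (k + (m - i)) = k + m" using i by simp
  finally have "(i + (k + (m - i)) mod m) mod m = k" using assms by simp
  then show "(i, (k + (m - i)) mod m) \<in> {ij \<in> {..<m} \<times> {..<m}. (fst ij + snd ij) mod m = k}"
    using i assms by auto
qed auto

context free_rep
begin

lemma D_pos: "ES C h t \<noteq> {zv} \<Longrightarrow> card (ES C h t) = p ^ d \<Longrightarrow> d \<ge> 1"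
proof (rule ccontr)
  assume "ES C h t \<noteq> {zv}" "card (ES C h t) = p ^ d" "\<not> d \<ge> 1"
  then have "card (ES C h t) = 1" by simp
  then show False using zv_ES[of h t] \<open>ES C h t \<noteq> {zv}\<close> by (metis card_1_singletonE singletonD)
qed

lemma pow_coset:
  assumes "h \<in> Nm" "h [^] m \<in> C" "[a = b] (mod m)"
  shows "C #> h [^] a = C #> h [^] (b::nat)"
proof -
  have e: "C #> h [^] a = C #> h [^] (a mod m)" for a :: nat
  proof -
    have hc: "h \<in> carrier G" using assms Nm_carrier by blast
    have "h [^] a = (h [^] m) [^] (a div m) \<otimes> h [^] (a mod m)"
      using hc by (simp add: nat_pow_mult nat_pow_pow)
    then have "h [^] a \<otimes> inv (h [^] (a mod m)) = (h [^] m) [^] (a div m)"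
      using hc by (simp add: m_assoc)
    then show ?thesis using pow_in_C[OF assms(2)] coset_eq_iff[OF Nm_pow Nm_pow] assms(1) by simp
  qed
  show ?thesis using e[of a] e[of b] assms(3) by (simp add: cong_def)
qed

lemma ES_coset: "g \<in> Nm \<Longrightarrow> h \<in> Nm \<Longrightarrow> C #> g = C #> h \<Longrightarrow> ES C g t = ES C h t"
  using EV_coset by metis

text \<open>Modulo C the elements h and h^e generate the same group, and passing from h to h^e
  raises eigenvalues to the power e, so that t^b becomes t.\<close>

lemma ES_twist:
  assumes h: "h \<in> Nm" "h [^] m \<in> C" and t: "[t ^ m = 1] (mod int p)"
    and g: "g \<in> Nm" "C #> g = C #> h [^] e" and eb: "[e * b = 1] (mod m)"
  shows "ES C h (t ^ b) = ES C g t"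
proof -
  have hc: "h \<in> carrier G" using h Nm_carrier by blast
  have te: "[t ^ a = t ^ a'] (mod int p)" if "[a = a'] (mod m)" for a a'
  proof -
    have e: "[t ^ a = t ^ (a mod m)] (mod int p)" for a
    proof -
      have "t ^ a = (t ^ m) ^ (a div m) * t ^ (a mod m)" by (simp flip: power_mult power_add)
      moreover have "[(t ^ m) ^ (a div m) * t ^ (a mod m) = 1 ^ (a div m) * t ^ (a mod m)] (mod int p)"
        by (intro cong_mult cong_pow t cong_refl)
      ultimately show ?thesis by simp
    qed
    show ?thesis using e[of a] e[of a'] that cong_trans cong_sym by (metis cong_def)
  qed
  have "u \<in> ES C h (t ^ b) \<longleftrightarrow> u \<in> ES C (h [^] e) t" for u
  proof
    assume u: "u \<in> ES C h (t ^ b)"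
    have "eig (h [^] e) ((t ^ b) ^ e) u" using u hc by (intro eig_pow) (auto simp: ES_def)
    moreover have "[(t ^ b) ^ e = t] (mod int p)"
      using te[OF eb] by (simp flip: power_mult add: mult.commute)
    ultimately show "u \<in> ES C (h [^] e) t" using u eig_cong by (auto simp: ES_def)
  next
    assume u: "u \<in> ES C (h [^] e) t"
    have "eig ((h [^] e) [^] b) (t ^ b) u" using u hc by (intro eig_pow) (auto simp: ES_def)
    then have "eig (h [^] (e * b)) (t ^ b) u" using hc by (simp add: nat_pow_pow)
    moreover have "C #> h [^] (e * b) = C #> h [^] (1::nat)" by (rule pow_coset[OF h eb])
    ultimately have "eig h (t ^ b) u"
      using eig_coset[of u "h [^] (e * b)" h "t ^ b"] u ES_U[of "h [^] e" t] Nm_pow[OF h(1)] h(1) hc by auto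
    then show "u \<in> ES C h (t ^ b)" using u by (auto simp: ES_def)
  qed
  then show ?thesis using ES_coset[OF g(1) Nm_pow[OF h(1)] g(2)] by blast
qed

text \<open>The dimensions of the eigenspaces of h for the powers t^a add up to that of U. If a is
  not prime to m, an eigenvector for t^a would be fixed by some h^i with 0 < i < m; then h^i lies in
  C and fixes u as well, although t^i is not 1. So these eigenspaces are 0. For a prime to m, the
  dimension for t^a equals the dimension for t of a power of h, and \<open>D_isr\<close> makes the
  sum for t^a and its inverse independent of a. Adding over the totatives counts U twice. If -1 is a
  square modulo m, the inverse of h is a square power of h modulo C, and the two dimensions are
  equal.\<close>

lemma eigen_balance:
  assumes h: "h \<in> Nm" and u: "u \<in> U" "u \<noteq> zv" "eig h t u"
    and m: "m \<ge> 2" "m < p" and t: "[t ^ m = 1] (mod int p)"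
    and ord: "\<And>i. 0 < i \<Longrightarrow> i < m \<Longrightarrow> \<not> [t ^ i = 1] (mod int p)"
  shows "totient m * (D h t + D (inv h) t) = 2 * dimU" "card (ES C h t) = p ^ D h t" "D h t \<ge> 1"
    "\<And>j. [j * j = m - 1] (mod m) \<Longrightarrow> D (inv h) t = D h t"
proof -
  have hc: "h \<in> carrier G" using h Nm_carrier by blast
  have cm: "coprime m p" using m prime_p by (metis coprime_commute nat_dvd_not_less not_less_iff_gr_or_eq prime_imp_coprime zero_less_iff_neq_zero le_zero_eq not_numeral_le_zero)
  have hm: "h [^] m \<in> C"
  proof (rule free[OF u(1,2)])
    have "eig (h [^] m) (t ^ m) u" using eig_pow[OF hc u(3)] .
    then show "eig (h [^] m) 1 u" using eig_cong t by blast
  qed (use hc in simp)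
  have m1: "m \<ge> 1" using m by simp
  show c: "card (ES C h t) = p ^ D h t" by (rule dim_formula(2)[OF h hm m1 cm t])
  have "u \<in> ES C h t" using u by (simp add: ES_def U_iff)
  then show "D h t \<ge> 1" using D_pos[OF _ c] u by blast
  have oG: "Coset.order G > 0" using fin order_gt_0_iff_finite by blast
  define f where "f = (\<lambda>a. D h (t ^ a))"
  have lift: "\<exists>k. [k * a = 1] (mod m) \<and> coprime k (Coset.order G)" if "coprime a m" for a
  proof -
    obtain k0 where k0: "[a * k0 = 1] (mod m)" using cong_solve_coprime_nat[OF \<open>coprime a m\<close>] by auto
    then have "coprime (a * k0) m" using cong_imp_coprime[OF cong_sym] by fastforce
    then have "coprime k0 m" by simp
    then obtain k where k: "[k = k0] (mod m)" "coprime k (Coset.order G)" using exists_cong_coprime oG by blast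
    have "[k * a = k0 * a] (mod m)" by (intro cong_mult k cong_refl)
    then show ?thesis using k0 k cong_trans by (metis mult.commute)
  qed
  \<comment> \<open>Modulo C the inverse is the natural power with exponent (m - 1) k, so that
    \<open>ES_twist\<close> applies to it.\<close>
  have inv_coset: "C #> inv (h [^] k) = C #> h [^] ((m - 1) * k)" for k
  proof -
    have "inv (h [^] k) \<otimes> inv (h [^] ((m - 1) * k)) = inv ((h [^] m) [^] k)"
    proof -
      have "inv (h [^] k) \<otimes> inv (h [^] ((m - 1) * k)) = inv (h [^] ((m - 1) * k) \<otimes> h [^] k)"
        using hc by (simp add: inv_mult_group)
      also have "h [^] ((m - 1) * k) \<otimes> h [^] k = h [^] ((m - 1) * k + k)" using hc by (simp add: nat_pow_mult)
      also have "(m - 1) * k + k = m * k" using m1 by (simp add: algebra_simps)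
      finally show ?thesis using hc by (simp add: nat_pow_pow)
    qed
    then show ?thesis using coset_eq_iff[OF Nm_inv[OF Nm_pow] Nm_pow] h pow_in_C[OF hm] subC
      by (simp add: subgroup.m_inv_closed)
  qed
  have pair: "f a + f (m - a) = D h t + D (inv h) t" if a: "coprime a m" "a < m" for a
  proof -
    obtain k where k: "[k * a = 1] (mod m)" "coprime k (Coset.order G)" using lift a by blast
    have "ES C h (t ^ a) = ES C (h [^] k) t"
      by (rule ES_twist[OF h hm t Nm_pow[OF h] refl k(1)])
    then have 1: "f a = D (h [^] k) t" by (simp add: f_def D_def)
    have "[((m - 1) * k) * (m - a) = 1] (mod m)"
    proof -
      have "[int (((m - 1) * k) * (m - a)) = 1] (mod int m)"
      proof -
        have "int (((m - 1) * k) * (m - a)) = (int m - 1) * int k * (int m - int a)"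
          using m1 a by (simp add: of_nat_diff)
        also have "\<dots> = int m * (int k * (int m - int a - 1)) + int (k * a)" by (simp add: algebra_simps)
        also have "[\<dots> = int (k * a)] (mod int m)" by (simp add: cong_iff_dvd_diff)
        also have "[int (k * a) = 1] (mod int m)" using k(1) by (metis cong_int_iff of_nat_1)
        finally show ?thesis .
      qed
      then show ?thesis by (metis cong_int_iff of_nat_1)
    qed
    then have "ES C h (t ^ (m - a)) = ES C (inv (h [^] k)) t"
      by (rule ES_twist[OF h hm t Nm_inv[OF Nm_pow[OF h]] inv_coset])
    then have 2: "f (m - a) = D (inv (h [^] k)) t" by (simp add: f_def D_def)
    show ?thesis unfolding 1 2 by (rule D_isr(1)[OF h hm m1 cm t k(2)])
  qed
  have zero: "f a = 0" if a: "\<not> coprime a m" "a < m" for a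
  proof -
    define i where "i = m div gcd a m"
    have g: "gcd a m > 1" using a m by (metis coprime_iff_gcd_eq_1 gcd_eq_0_iff less_one linorder_neqE_nat not_one_less_zero zero_neq_numeral le_zero_eq)
    then have i: "0 < i" "i < m" using m by (auto simp: i_def div_greater_zero_iff gcd_le2_nat)
    have "m dvd a * i"
    proof -
      have "a * i = (a div gcd a m) * m" unfolding i_def
        by (metis div_mult_swap dvd_div_mult gcd_dvd1 gcd_dvd2)
      then show ?thesis by simp
    qed
    then have tai: "[(t ^ a) ^ i = 1] (mod int p)"
      using cong_pow[OF t] by (auto simp flip: power_mult elim!: dvdE)
    have "ES C h (t ^ a) = {zv}"
    proof (rule ccontr)
      assume "ES C h (t ^ a) \<noteq> {zv}"
      then obtain w where w: "w \<in> ES C h (t ^ a)" "w \<noteq> zv" using zv_ES by blast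
      have "eig (h [^] i) ((t ^ a) ^ i) w" using w hc by (intro eig_pow) (auto simp: ES_def)
      then have "h [^] i \<in> C" using free[of w "h [^] i"] w ES_U hc tai eig_cong by blast
      then have "eig (h [^] i) 1 u" using u U_iff by blast
      moreover have "eig (h [^] i) (t ^ i) u" using eig_pow[OF hc u(3)] .
      ultimately have "[t ^ i = 1] (mod int p)" using eig_unique u U_iff by blast
      then show False using ord i by blast
    qed
    then have "card (ES C h (t ^ a)) = p ^ 0" by simp
    then show ?thesis unfolding f_def by (rule D_unique)
  qed
  have tot: "(\<Sum>a<m. f a) = dimU"
    unfolding f_def using sum_D[OF h hm m1 cm t ord big] m by simp
  have "(\<Sum>a<m. f a) = (\<Sum>a\<in>totatives m. f a)"
  proof (rule sum.mono_neutral_right)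
    show "totatives m \<subseteq> {..<m}" using totatives_less m by auto
    show "\<forall>a\<in>{..<m} - totatives m. f a = 0"
    proof
      fix a assume a: "a \<in> {..<m} - totatives m"
      have "\<not> coprime a m"
      proof
        assume c: "coprime a m"
        then have "a \<noteq> 0" using m by (auto intro!: Nat.gr0I)
        then show False using a c by (auto simp: totatives_def)
      qed
      then show "f a = 0" using zero a by blast
    qed
  qed simp
  then have S: "(\<Sum>a\<in>totatives m. f a) = dimU" using tot by simp
  have mem: "m - a \<in> totatives m" "m - (m - a) = a" if a: "a \<in> totatives m" for a
  proof -
    have lt: "a < m" using a m totatives_less by simp
    show "m - (m - a) = a" using lt by simp
    have "coprime (m - a) m"
    proof (rule coprimeI)
      fix d assume d: "d dvd m - a" "d dvd m"
      then have "d dvd m - (m - a)" by (rule dvd_diff_nat[rotated])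
      then have "d dvd a" using lt by simp
      moreover have "coprime a m" using a by (simp add: totatives_def)
      ultimately show "is_unit d" using d(2) coprime_common_divisor by blast
    qed
    then show "m - a \<in> totatives m" using a lt by (auto simp: totatives_def)
  qed
  have "(\<Sum>a\<in>totatives m. f (m - a)) = (\<Sum>a\<in>totatives m. f a)"
    by (rule sum.reindex_bij_witness[of _ "\<lambda>a. m - a" "\<lambda>a. m - a"]) (use mem in auto)
  then have "2 * dimU = (\<Sum>a\<in>totatives m. f a + f (m - a))" using S by (simp add: sum.distrib)
  also have "\<dots> = (\<Sum>a\<in>totatives m. D h t + D (inv h) t)"
    by (intro sum.cong refl pair) (use m totatives_less in \<open>auto simp: totatives_def\<close>)
  also have "\<dots> = totient m * (D h t + D (inv h) t)" by (simp add: totient_def)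
  finally show "totient m * (D h t + D (inv h) t) = 2 * dimU" by simp
  show "D (inv h) t = D h t" if j: "[j * j = m - 1] (mod m)" for j
  proof -
    have "coprime (j * j) m"
    proof -
      have "coprime (m - 1) m" using coprime_diff_one_left_nat[of m] m1 by simp
      then show ?thesis using j cong_imp_coprime cong_sym by blast
    qed
    then have "coprime j m" by simp
    then obtain k where k: "[k = j] (mod m)" "coprime k (Coset.order G)" using exists_cong_coprime oG by blast
    have "[k * k = m - 1] (mod m)" using cong_mult[OF k(1) k(1)] j cong_trans by blast
    then have "C #> h [^] (k * k) = C #> h [^] (m - 1)" by (rule pow_coset[OF h hm])
    also have "\<dots> = C #> inv (h [^] (1::nat))" using inv_coset[of 1] by simp
    finally have "ES C (h [^] (k * k)) t = ES C (inv h) t"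
      using ES_coset[OF Nm_pow[OF h] Nm_inv[OF h]] hc by simp
    then have "D (h [^] (k * k)) t = D (inv h) t" by (simp add: D_def)
    then show ?thesis using D_isr(2)[OF h hm m1 cm t k(2)] by simp
  qed
qed

end

section \<open>Elements of prime order modulo the stabilizer\<close>

text \<open>Cauchy's theorem in the quotient H / C: Sylow's theorem provides a subgroup of order q
  there, and a nontrivial element of it is pulled back to a representative y.\<close>

lemma element_of_prime_order_mod:
  fixes G (structure)
  assumes "group G" "finite (carrier G)" "subgroup C G" "subgroup H G" "C \<subseteq> H"
    and norm: "\<And>h c. h \<in> H \<Longrightarrow> c \<in> C \<Longrightarrow> h \<otimes> c \<otimes> inv h \<in> C"
    and q: "prime q" "q dvd card {C #> g | g. g \<in> H}"
  shows "\<exists>y\<in>H. y \<notin> C \<and> y [^] q \<in> C"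
proof -
  interpret group G by fact
  define K where "K = G\<lparr>carrier := H\<rparr>"
  have gK: "group K" unfolding K_def using subgroup_imp_group[OF assms(4)] .
  have invK: "inv\<^bsub>K\<^esub> h = inv h" if "h \<in> H" for h
    unfolding K_def using m_inv_consistent[OF assms(4) that] .
  have sK: "subgroup C K" unfolding K_def using subgroup_incl[OF assms(3-5)] .
  have nK: "C \<lhd> K"
    using group.normal_inv_iff[OF gK] sK norm invK by (auto simp: K_def)
  interpret N: normal C K by (rule nK)
  let ?F = "K Mod C"
  have gF: "group ?F" by (rule N.factorgroup_is_group)
  have cF: "carrier ?F = {C #> g | g. g \<in> H}"
    by (auto simp: FactGroup_def RCOSETS_def K_def r_coset_def)
  have finF: "finite (carrier ?F)"
    using finite_subset[OF subgroup.subset[OF assms(4)] assms(2)] unfolding cF by (simp add: setcompr_eq_image)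
  obtain m where m: "Coset.order ?F = q ^ 1 * m" using q(2) unfolding Coset.order_def cF by auto
  obtain S where S: "subgroup S ?F" "card S = q" using sylow_thm[OF q(1) gF m finF] by auto
  have "card S > 1" using S q prime_gt_1_nat by simp
  moreover have "card S \<le> 1" if "S \<subseteq> {\<one>\<^bsub>?F\<^esub>}" using card_mono[OF _ that] by simp
  ultimately obtain X where X: "X \<in> S" "X \<noteq> \<one>\<^bsub>?F\<^esub>" by (metis linorder_not_le singleton_iff subsetI)
  have XF: "X \<in> carrier ?F" using X S subgroup.subset by blast
  have Xq: "X [^]\<^bsub>?F\<^esub> q = \<one>\<^bsub>?F\<^esub>"
  proof -
    have gS: "group (?F\<lparr>carrier := S\<rparr>)" using group.subgroup_imp_group[OF gF S(1)] .
    have "X [^]\<^bsub>?F\<lparr>carrier := S\<rparr>\<^esub> Coset.order (?F\<lparr>carrier := S\<rparr>) = \<one>\<^bsub>?F\<lparr>carrier := S\<rparr>\<^esub>"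
      by (rule group.pow_order_eq_1[OF gS]) (use X in simp)
    then show ?thesis using S(2) by (simp add: Coset.order_def nat_pow_def)
  qed
  obtain y where y: "y \<in> H" "X = C #> y" using XF cF by auto
  have pw: "X [^]\<^bsub>?F\<^esub> (k::nat) = C #> (y [^] k)" for k
  proof (induction k)
    case 0
    show ?case using subgroup.subset[OF assms(3)] by (simp add: FactGroup_def coset_mult_one K_def)
  next
    case (Suc k)
    have yk: "y [^] k \<in> H" using y assms(4) by (induction k) (auto simp: subgroup.one_closed subgroup.m_closed)
    have "X [^]\<^bsub>?F\<^esub> Suc k = (C #> (y [^] k)) <#>\<^bsub>K\<^esub> (C #> y)" using Suc y by (simp add: FactGroup_def)
    also have "\<dots> = C #> (y [^] k \<otimes> y)"
      using N.rcos_sum[of "y [^] k" y] yk y by (simp add: K_def r_coset_def)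
    finally show ?case by simp
  qed
  have oneF: "\<one>\<^bsub>?F\<^esub> = C" by (simp add: FactGroup_def)
  have yc: "y \<in> carrier G" using y subgroup.subset[OF assms(4)] by blast
  have "y [^] q \<in> C #> (y [^] q)" using rcos_self[OF _ assms(3)] yc by simp
  then have "y [^] q \<in> C" using pw[of q] Xq oneF by simp
  moreover have "y \<notin> C" using X(2) y(2) oneF coset_join2[OF yc assms(3)] by auto
  ultimately show ?thesis using y by blast
qed

context free_rep
begin

lemma element_of_prime_order:
  assumes "prime q" "q dvd r"
  obtains y where "y \<in> Nm" "y \<notin> C" "y [^] q \<in> C"
  using element_of_prime_order_mod[OF is_group fin subC subgroup_Nm, of q] assms C_Nm
  unfolding r_def Q_def normalizes_def by blast

lemma FixS_lin_U:
  assumes "x \<in> carrier G"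
  shows "FixS (lin x m a) \<subseteq> U"
  using lin_fix_C[OF assms] by (auto simp: U_iff FixS_def)

lemma act_FixS_lin:
  assumes x: "x \<in> Nm" and v: "v \<in> FixS (lin x m a)"
  shows "act x v \<in> FixS (lin x m a)"
proof -
  let ?A = "lin x m a"
  have xc: "x \<in> carrier G" using x Nm_carrier by blast
  have Ex: "mcong n (int p ^ N) (mm n (E g) (\<rho> x)) (E (g \<otimes> x))" if g: "g \<in> carrier G" for g
  proof -
    have "mm n (E g) (\<rho> x) = msc \<kappa> (\<Sum>c\<in>C. mm n (\<rho> (c \<otimes> g)) (\<rho> x))"
      by (simp add: E_def mm_msc_left mm_sum_left)
    moreover have "mcong n (int p ^ N) \<dots> (msc \<kappa> (\<Sum>c\<in>C. \<rho> (c \<otimes> g \<otimes> x)))"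
      by (intro mcong_msc mcong_sum rep_mult) (use g xc C_carrier in auto)
    moreover have "(\<Sum>c\<in>C. \<rho> (c \<otimes> g \<otimes> x)) = (\<Sum>c\<in>C. \<rho> (c \<otimes> (g \<otimes> x)))"
      by (intro sum.cong refl) (use g xc C_carrier in \<open>simp add: m_assoc\<close>)
    ultimately show ?thesis by (simp add: E_def)
  qed
  have comm: "mcong n (int p ^ N) (mm n ?A (\<rho> x)) (mm n (\<rho> x) ?A)"
  proof -
    have "mm n ?A (\<rho> x) = (\<Sum>i<m. msc (a i) (mm n (E (x [^] i)) (\<rho> x)))"
      by (simp add: lin_def mm_sum_left mm_msc_left)
    moreover have "mm n (\<rho> x) ?A = (\<Sum>i<m. msc (a i) (mm n (\<rho> x) (E (x [^] i))))"
      by (simp add: lin_def mm_sum_right mm_msc_right)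
    moreover have "mcong n (int p ^ N) (mm n (E (x [^] i)) (\<rho> x)) (mm n (\<rho> x) (E (x [^] i)))" for i :: nat
    proof -
      have xi: "x [^] i \<in> carrier G" using xc by simp
      have e: "x [^] i \<otimes> x = x \<otimes> x [^] i" using xc by (metis nat_pow_Suc nat_pow_Suc2)
      show ?thesis by (rule mcong_trans[OF Ex[OF xi, unfolded e] mcong_sym[OF rho_E[OF x xi]]])
    qed
    ultimately show ?thesis by (simp only:) (intro mcong_sum mcong_msc)
  qed
  have "vcong n p (mv n ?A (act x v)) (mv n ?A (mv n (\<rho> x) v))"
    by (rule mv_cong[OF mcong_refl act_vcong])
  moreover have "vcong n p (mv n ?A (mv n (\<rho> x) v)) (mv n (\<rho> x) (mv n ?A v))"
    unfolding mv_mm[symmetric] by (rule mv_cong[OF mod_p[OF comm] vcong_refl])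
  moreover have "vcong n p (mv n (\<rho> x) (mv n ?A v)) (mv n (\<rho> x) v)"
    by (rule mv_cong[OF mcong_refl]) (use v in \<open>simp add: FixS_def\<close>)
  ultimately have "vcong n p (mv n ?A (act x v)) (act x v)"
    using vcong_trans vcong_sym[OF act_vcong] by blast
  then show ?thesis by (simp add: FixS_def act_Vs)
qed

text \<open>y permutes the vectors of this space in orbits of length 1 or q, and it fixes only 0, as
  a nonzero fixed vector would put y into C.\<close>

lemma prime_dvd_card_FixS:
  assumes q: "prime q" and y: "y \<in> Nm" "y \<notin> C" "y [^] q \<in> C"
  shows "[int (card (FixS (lin y m a))) = 1] (mod int q)"
proof -
  let ?W = "FixS (lin y m a)"
  have yc: "y \<in> carrier G" using y Nm_carrier by blast
  have fp: "(act y ^^ k) x = act (y [^] k) x" if "x \<in> Vs" for k x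
  proof (induction k)
    case 0
    have "act \<one> x = x" using act_eq_iff[OF that] eig_one by blast
    then show ?case by simp
  next
    case (Suc k)
    have "y \<otimes> y [^] k = y [^] Suc k" using yc by (metis nat_pow_Suc2)
    then show ?case using Suc act_mult[OF yc nat_pow_closed[OF yc], of k] by (metis funpow.simps(2) o_apply)
  qed
  have WU: "?W \<subseteq> U" by (rule FixS_lin_U[OF yc])
  then have WV: "?W \<subseteq> Vs" using U_iff by blast
  have "[(\<Sum>x\<in>?W. 1) = (\<Sum>x\<in>{x \<in> ?W. act y x = x}. 1)] (mod int q)"
  proof (rule sum_fixed_points_cong[OF q])
    show "finite ?W" using WV finite_Vs finite_subset by blast
    show "act y ` ?W \<subseteq> ?W" using act_FixS_lin[OF y(1)] by blast
    show "(act y ^^ q) x = x" if "x \<in> ?W" for x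
      using that WU WV y(3) fp act_eq_iff U_iff by (metis subsetD)
  qed auto
  moreover have "{x \<in> ?W. act y x = x} = {zv}"
  proof -
    have "x = zv" if "x \<in> ?W" "act y x = x" for x
    proof (rule ccontr)
      assume "x \<noteq> zv"
      then have "y \<in> C" using free[of x y] that WU WV act_eq_iff yc by blast
      then show False using y by blast
    qed
    moreover have "zv \<in> ?W" by (simp add: FixS_def zv_Vs) (simp add: vcong_def mv_def zv_def)
    moreover have "act y zv = zv" using act_eq_iff[OF zv_Vs] eig_zv by blast
    ultimately show ?thesis by blast
  qed
  ultimately show ?thesis by simp
qed

text \<open>For prime q every i with 0 < i < q is prime to q, so the sum of the traces of y^i and
  y^(-i) is a constant s. Symmetric coefficients therefore see only dim U and s. The vanishing of
  the 1-eigenspace of y gives one linear relation between these, the trace of the idempotent a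
  second one. The factors 2 come from pairing i with q - i.\<close>

lemma prime_order_trace:
  assumes q: "prime q" "q \<noteq> p" "odd q" and y: "y \<in> Nm" "y \<notin> C" "y [^] q \<in> C"
    and a: "\<And>i. 0 < i \<Longrightarrow> i < q \<Longrightarrow> a (q - i) = a i"
    and conv: "\<And>k. k < q \<Longrightarrow> [(\<Sum>i<q. a i * a ((k + (q - i)) mod q)) = a k] (mod int p)"
  obtains d s where "d \<le> dimU" "card (FixS (lin y q a)) = p ^ d"
    "[2 * int dimU + (int q - 1) * s = 0] (mod int p)"
    "[2 * int d = 2 * a 0 * int dimU + (\<Sum>i=1..<q. a i) * s] (mod int p)"
proof -
  have yc: "y \<in> carrier G" using y Nm_carrier by blast
  have q2: "q > 2" using q by (metis even_numeral le_neq_implies_less prime_ge_2_nat)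
  have cqp: "coprime q p" using q prime_p primes_coprime by blast
  have oG: "Coset.order G > 0" using fin order_gt_0_iff_finite by blast
  define s where "s = \<tau> y + \<tau> (inv y)"
  note modp = cong_pow_imp_cong[OF _ N_pos]
  have inv_coset: "C #> inv (y [^] i) = C #> y [^] (q - i)" if "i < q" for i
  proof -
    have "inv (y [^] i) \<otimes> inv (y [^] (q - i)) = inv (y [^] (q - i) \<otimes> y [^] i)"
      using yc by (simp add: inv_mult_group)
    also have "y [^] (q - i) \<otimes> y [^] i = y [^] q" using yc that by (simp add: nat_pow_mult)
    finally show ?thesis
      using coset_eq_iff[OF Nm_inv[OF Nm_pow[OF y(1)]] Nm_pow[OF y(1)]] y(3) subC by (simp add: subgroup.m_inv_closed)
  qed
  have tau_coset: "\<tau> g = \<tau> h" if "g \<in> Nm" "h \<in> Nm" "C #> g = C #> h" for g h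
  proof -
    have "g \<otimes> inv h \<in> C" using coset_eq_iff that by blast
    then have "E (g \<otimes> inv h \<otimes> h) = E h" using E_coset that Nm_carrier by blast
    then show ?thesis using that Nm_carrier by (simp add: \<tau>_def m_assoc)
  qed
  have pair: "[\<tau> (y [^] i) + \<tau> (y [^] (q - i)) = s] (mod int p)" if i: "0 < i" "i < q" for i
  proof -
    have "coprime i q" using i q(1) by (metis coprime_commute nat_dvd_not_less prime_imp_coprime)
    then obtain k where k: "[k = i] (mod q)" "coprime k (Coset.order G)" using exists_cong_coprime oG by blast
    have 1: "C #> y [^] k = C #> y [^] i" by (rule pow_coset[OF y(1,3) k(1)])
    have 2: "C #> inv (y [^] k) = C #> inv (y [^] i)"
    proof -
      have "y [^] k \<otimes> inv (y [^] i) \<in> C" using 1 coset_eq_iff Nm_pow[OF y(1)] by blast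
      then have "inv (y [^] i) \<otimes> (y [^] k \<otimes> inv (y [^] i)) \<otimes> inv (inv (y [^] i)) \<in> C"
        using Nm_inv[OF Nm_pow[OF y(1)]] by (auto simp: normalizes_def)
      moreover have "inv (y [^] i) \<otimes> (y [^] k \<otimes> inv (y [^] i)) \<otimes> inv (inv (y [^] i)) = inv (y [^] i) \<otimes> y [^] k"
        using yc by (simp add: m_assoc)
      ultimately have "inv (inv (y [^] i) \<otimes> y [^] k) \<in> C" using subC by (simp add: subgroup.m_inv_closed)
      then have "inv (y [^] k) \<otimes> inv (inv (y [^] i)) \<in> C" using yc by (simp add: inv_mult_group)
      then show ?thesis using coset_eq_iff Nm_inv Nm_pow[OF y(1)] by blast
    qed
    have "\<tau> (y [^] i) + \<tau> (y [^] (q - i)) = \<tau> (y [^] k) + \<tau> (inv (y [^] k))"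
      using tau_coset[OF Nm_pow[OF y(1)] Nm_pow[OF y(1)] 1] tau_coset[OF Nm_inv[OF Nm_pow[OF y(1)]] Nm_pow[OF y(1)] 2[THEN trans, OF inv_coset[OF i(2)]]]
      by simp
    moreover have "[\<tau> (y [^] k) + \<tau> (inv (y [^] k)) = s] (mod int p)"
      unfolding s_def by (rule modp[OF tau_isr[OF y(1) k(2)]])
    ultimately show ?thesis by simp
  qed
  have dimp: "[\<tau> \<one> = int dimU] (mod int p)" by (rule cong_sym[OF modp[OF dimU(3)]])
  have q0: "{..<q} = insert 0 {1..<q}" using q2 by auto
  have dbl: "[2 * (\<Sum>i<q. b i * \<tau> (y [^] i)) = 2 * b 0 * int dimU + (\<Sum>i=1..<q. b i) * s] (mod int p)"
    if b: "\<And>i. 0 < i \<Longrightarrow> i < q \<Longrightarrow> b (q - i) = b i" for b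
  proof -
    have rev: "(\<Sum>i=1..<q. b i * \<tau> (y [^] (q - i))) = (\<Sum>i=1..<q. b i * \<tau> (y [^] i))"
      by (rule sum.reindex_bij_witness[of _ "\<lambda>i. q - i" "\<lambda>i. q - i"]) (use b in auto)
    have "2 * (\<Sum>i<q. b i * \<tau> (y [^] i)) = 2 * b 0 * \<tau> \<one> + ((\<Sum>i=1..<q. b i * \<tau> (y [^] i)) + (\<Sum>i=1..<q. b i * \<tau> (y [^] (q - i))))"
      unfolding q0 rev by simp
    also have "\<dots> = 2 * b 0 * \<tau> \<one> + (\<Sum>i=1..<q. b i * (\<tau> (y [^] i) + \<tau> (y [^] (q - i))))"
      by (simp add: sum.distrib distrib_left)
    also have "[\<dots> = 2 * b 0 * int dimU + (\<Sum>i=1..<q. b i * s)] (mod int p)"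
      by (intro cong_add cong_mult cong_refl cong_sum pair dimp) auto
    finally show ?thesis by (simp add: sum_distrib_right)
  qed
  have "D y 1 = 0"
  proof (rule D_unique)
    have "u = zv" if "u \<in> ES C y 1" for u
    proof (rule ccontr)
      assume "u \<noteq> zv"
      then have "y \<in> C" using free[of u y] that ES_U yc by (auto simp: ES_def eig_one)
      then show False using y by blast
    qed
    then have "ES C y 1 = {zv}" using zv_ES by blast
    then show "card (ES C y 1) = p ^ 0" by simp
  qed
  moreover have "[int q * int (D y 1) = (\<Sum>i<q. (teich 1 ^ (q - 1)) ^ i * \<tau> (y [^] i))] (mod int p)"
    by (rule modp[OF dim_formula(3)[OF y(1,3) _ cqp]]) (use q2 in auto)
  ultimately have z: "[0 = (\<Sum>i<q. 1 * \<tau> (y [^] i))] (mod int p)" by (simp add: teich_def)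
  have 1: "[2 * int dimU + (int q - 1) * s = 0] (mod int p)"
  proof -
    have "[2 * 0 = 2 * (\<Sum>i<q. 1 * \<tau> (y [^] i))] (mod int p)" by (intro cong_mult cong_refl z)
    also have "[2 * (\<Sum>i<q. 1 * \<tau> (y [^] i)) = 2 * 1 * int dimU + (\<Sum>i=1..<q. 1) * s] (mod int p)"
      by (rule dbl) simp
    finally show ?thesis using q2 by (simp add: of_nat_diff cong_sym_eq)
  qed
  have "mcong n (int p ^ 1) (mm n (lin y q a) (lin y q a)) (lin y q a)"
  proof (rule lin_idempotent[OF y(1,3)])
    show "[(\<Sum>(i, j)\<in>{ij \<in> {..<q} \<times> {..<q}. (fst ij + snd ij) mod q = k}. a i * a j) = a k] (mod int p ^ 1)" if "k < q" for k
      using conv[OF that] sum_pairs_mod[OF that, of a] by simp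
  qed (use q2 N_pos in auto)
  then obtain d where d: "[mtr n (lin y q a) = int d] (mod int p ^ 1)" "card (FixS (lin y q a)) = p ^ d"
    using fixed_dim[of 1] by auto
  have "card (FixS (lin y q a)) \<le> card U" by (rule card_mono[OF finite_ES FixS_lin_U[OF yc]])
  then have "d \<le> dimU" using d(2) card_U prime_p prime_gt_1_nat by (simp add: power_le_imp_le_exp)
  moreover have "[2 * int d = 2 * a 0 * int dimU + (\<Sum>i=1..<q. a i) * s] (mod int p)"
  proof -
    have "[2 * int d = 2 * mtr n (lin y q a)] (mod int p)" using cong_sym[OF d(1)] by (intro cong_mult cong_refl) simp
    also have "2 * mtr n (lin y q a) = 2 * (\<Sum>i<q. a i * \<tau> (y [^] i))" by (simp add: lin_trace)
    also have "[\<dots> = 2 * a 0 * int dimU + (\<Sum>i=1..<q. a i) * s] (mod int p)" by (rule dbl) (rule a)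
    finally show ?thesis .
  qed
  ultimately show ?thesis using that d(2) 1 by blast
qed

end

section \<open>Counting eigenvectors\<close>

context free_rep
begin

text \<open>By \<open>eigen_balance\<close> the dimensions for t of h and of its inverse have the
  same sum c for every coset that has t-eigenvectors at all, so each t-eigenspace has dimension at
  most c. When h and its inverse have equal dimensions, c is even and c / 2 is the exact dimension.
  Counting the nonzero vectors of U then bounds the number of such cosets from below.\<close>

lemma eigenvector_count:
  assumes all: "\<And>u. u \<in> U \<Longrightarrow> u \<noteq> zv \<Longrightarrow> \<exists>h\<in>carrier G. eig h t u"
    and m: "m \<ge> 2" "m < p" and t: "[t ^ m = 1] (mod int p)"
    and ord: "\<And>i. 0 < i \<Longrightarrow> i < m \<Longrightarrow> \<not> [t ^ i = 1] (mod int p)"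
  obtains c where "c \<ge> 1" "totient m * c = 2 * dimU"
    "p ^ dimU - 1 \<le> card {X \<in> Q. EV t X \<noteq> {zv}} * (p ^ c - 1)"
    "\<And>j. [j * j = m - 1] (mod m) \<Longrightarrow> \<exists>c'\<ge>1. c = 2 * c' \<and> p ^ dimU - 1 \<le> card {X \<in> Q. EV t X \<noteq> {zv}} * (p ^ c' - 1)"
proof -
  have "\<not> int p dvd t"
  proof
    assume "int p dvd t"
    then have "[t ^ m = 0] (mod int p)" using m(1) by (simp add: cong_0_iff dvd_power_iff dvd_trans[OF _ dvd_power])
    then have "[1 = 0] (mod int p)" using t cong_trans cong_sym by blast
    then show False using p_gt1 by (simp add: cong_def)
  qed
  then have ct: "coprime t (int p)" using prime_imp_coprime[of "int p" t] prime_p by (simp add: ac_simps)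
  have bal: "totient m * (D h t + D (inv h) t) = 2 * dimU" "card (ES C h t) = p ^ D h t"
    "\<And>j. [j * j = m - 1] (mod m) \<Longrightarrow> D (inv h) t = D h t" "D h t \<ge> 1"
    if h: "h \<in> Nm" and ne: "ES C h t \<noteq> {zv}" for h
  proof -
    obtain u where u: "u \<in> ES C h t" "u \<noteq> zv" using ne zv_ES by blast
    then have "u \<in> U" "eig h t u" using ES_U by (auto simp: ES_def eig_one)
    then show "totient m * (D h t + D (inv h) t) = 2 * dimU" "card (ES C h t) = p ^ D h t"
      "\<And>j. [j * j = m - 1] (mod m) \<Longrightarrow> D (inv h) t = D h t" "D h t \<ge> 1"
      using eigen_balance[OF h _ u(2) _ m t ord] by blast+
  qed
  have tp: "totient m > 0" using m by simp
  obtain u where u: "u \<in> U" "u \<noteq> zv" using nontriv zv_U by blast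
  obtain h0 where h0: "h0 \<in> carrier G" "eig h0 t u" using all[OF u] by blast
  have h0N: "h0 \<in> Nm" by (rule eig_Nm[OF u h0 ct])
  have "u \<in> ES C h0 t" using u h0 by (simp add: ES_def U_iff)
  then have ne0: "ES C h0 t \<noteq> {zv}" using u by blast
  define c where "c = D h0 t + D (inv h0) t"
  have c: "totient m * c = 2 * dimU" unfolding c_def by (rule bal(1)[OF h0N ne0])
  have ceq: "D h t + D (inv h) t = c" if "h \<in> Nm" "ES C h t \<noteq> {zv}" for h
    using bal(1)[OF that] c tp by (metis mult_cancel1 neq0_conv)
  have c1: "c \<ge> 1" using bal(4)[OF h0N ne0] by (simp add: c_def)
  have B: "card (ES C h t) \<le> p ^ c" if "h \<in> Nm" "ES C h t \<noteq> {zv}" for h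
    using ceq[OF that] bal(2)[OF that] prime_p prime_gt_0_nat by (simp add: power_increasing Suc_leI)
  have sq: "\<exists>c'\<ge>1. c = 2 * c' \<and> p ^ dimU - 1 \<le> card {X \<in> Q. EV t X \<noteq> {zv}} * (p ^ c' - 1)"
    if j: "[j * j = m - 1] (mod m)" for j
  proof -
    have eq: "D h t + D h t = c" if "h \<in> Nm" "ES C h t \<noteq> {zv}" for h
      using ceq[OF that] bal(3)[OF that j] by simp
    have bd: "card (ES C h t) \<le> p ^ D h0 t" if "h \<in> Nm" "ES C h t \<noteq> {zv}" for h
      proof -
      have "D h t = D h0 t" using eq[OF that] eq[OF h0N ne0] by linarith
      then show ?thesis using bal(2)[OF that] by simp
    qed
    have "p ^ dimU - 1 \<le> card {X \<in> Q. EV t X \<noteq> {zv}} * (p ^ D h0 t - 1)"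
      by (rule count_bound[OF ct all bd])
    then show ?thesis using eq[OF h0N ne0] bal(4)[OF h0N ne0] by (intro exI[of _ "D h0 t"]) auto
  qed
  show ?thesis by (rule that[OF c1 c count_bound[OF ct all B] sq])
qed

lemma card_EV_le_r: "card {X \<in> Q. P X} \<le> r"
  unfolding r_def by (rule card_mono[OF finite_Q]) blast

section \<open>Partitions of the fixed space into eigenspaces\<close>

definition vsub :: "(nat \<Rightarrow> int) \<Rightarrow> (nat \<Rightarrow> int) \<Rightarrow> nat \<Rightarrow> int" where
  "vsub v w = (\<lambda>i\<in>{..<n}. (v i - w i) mod int p)"

lemma vsub_Vs: "vsub v w \<in> Vs"
  using p_gt1 by (auto simp: vsub_def Vs_def)

lemma vsub_vcong: "vcong n p (vsub v w) (\<lambda>i. v i - w i)"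
  by (simp add: vsub_def vcong_def cong_def)

lemma eig_vsub:
  assumes "eig g t v" "eig g t w"
  shows "eig g t (vsub v w)"
proof -
  have "mv n (\<rho> g) (\<lambda>i. v i - w i) = (\<lambda>i. mv n (\<rho> g) v i - mv n (\<rho> g) w i)"
    by (simp add: mv_def sum_subtractf right_diff_distrib)
  then have "vcong n p (mv n (\<rho> g) (\<lambda>i. v i - w i)) (\<lambda>i. t * (v i - w i))"
    using assms by (auto simp: eig_def vcong_def right_diff_distrib intro: cong_diff)
  then have "eig g t (\<lambda>i. v i - w i)" by (simp add: eig_def)
  then show ?thesis using eig_vcong vcong_sym[OF vsub_vcong] by blast
qed

lemma vsub_eq_zv: "v \<in> Vs \<Longrightarrow> w \<in> Vs \<Longrightarrow> vsub v w = zv \<Longrightarrow> v = w"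
proof -
  assume vw: "v \<in> Vs" "w \<in> Vs" "vsub v w = zv"
  have "vcong n p (\<lambda>i. v i - w i) zv" using vsub_vcong[of v w] vcong_sym vw(3) by metis
  then have "vcong n p v w" by (auto simp: vcong_def zv_def cong_iff_dvd_diff)
  then show "v = w" using Vs_eqI vw by blast
qed

lemma eig_of_vsub:
  assumes "eig g t (vsub v w)" "eig g t w"
  shows "eig g t v"
proof -
  have "vcong n p (vadd (vsub v w) w) v"
    by (simp add: vcong_def vadd_def vsub_def cong_def mod_simps)
  then show ?thesis using eig_vcong[OF _ eig_vadd[OF assms]] by blast
qed

text \<open>The t-eigenspaces of the cosets partition the nonzero vectors of U. If each has at most
  p^c elements, dividing p^(2c) - 1 by p^c - 1 gives the bound. If one of them, E, is larger, let w
  lie outside E. The vectors w - e with e in E lie in pairwise different parts: two in the same part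
  would have their difference both in that part and in E, but a part other than E meets E only in 0.
  So there are at least |E| parts.\<close>

lemma nonscalar_parts:
  assumes t: "coprime t (int p)" and all: "\<And>u. u \<in> U \<Longrightarrow> u \<noteq> zv \<Longrightarrow> \<exists>h\<in>carrier G. eig h t u"
    and ns: "\<And>x. x \<in> Nm \<Longrightarrow> \<exists>u\<in>U. \<not> eig x t u" and c: "dimU = 2 * c"
  shows "p ^ c + 1 \<le> card {X \<in> Q. EV t X \<noteq> {zv}}"
proof -
  let ?S = "{X \<in> Q. EV t X \<noteq> {zv}}"
  have p1: "p ^ c > 1" using c dimU_pos prime_p prime_gt_1_nat by (metis One_nat_def Suc_leI gr0I mult_is_0 not_one_le_zero one_less_power)
  show ?thesis
  proof (cases "\<forall>h\<in>Nm. card (ES C h t) \<le> p ^ c")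
    case True
    then have "p ^ dimU - 1 \<le> card ?S * (p ^ c - 1)" by (intro count_bound[OF t all]) auto
    moreover have "p ^ dimU - 1 = (p ^ c + 1) * (p ^ c - 1)"
    proof -
      have "p ^ dimU = p ^ c * p ^ c" by (simp add: c mult_2 power_add)
      then show ?thesis using p1 by (simp add: algebra_simps)
    qed
    ultimately have "(p ^ c + 1) * (p ^ c - 1) \<le> card ?S * (p ^ c - 1)" by simp
    moreover have "0 < p ^ c - 1" using p1 by simp
    ultimately show ?thesis by (simp only: mult_le_cancel2)
  next
    case False
    then obtain h where h: "h \<in> Nm" "card (ES C h t) > p ^ c" by (auto simp: not_le)
    obtain w where w: "w \<in> U" "\<not> eig h t w" using ns[OF h(1)] by blast
    let ?E = "ES C h t"
    have EU: "e \<in> U" if "e \<in> ?E" for e using that ES_U by blast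
    have we: "vsub w e \<in> U" "\<not> eig h t (vsub w e)" if "e \<in> ?E" for e
    proof -
      show "vsub w e \<in> U" using EU[OF that] w(1) eig_vsub by (auto simp: U_iff vsub_Vs)
      show "\<not> eig h t (vsub w e)" using eig_of_vsub[of h t w e] that w(2) by (auto simp: ES_def)
    qed
    have "\<exists>g. g \<in> Nm \<and> eig g t (vsub w e)" if e: "e \<in> ?E" for e
    proof -
      have nz: "vsub w e \<noteq> zv" using we(2)[OF e] eig_zv by metis
      then show ?thesis using all[OF we(1)[OF e]] eig_Nm[OF we(1)[OF e] nz _ _ t] by blast
    qed
    then obtain g where g: "\<And>e. e \<in> ?E \<Longrightarrow> g e \<in> Nm" "\<And>e. e \<in> ?E \<Longrightarrow> eig (g e) t (vsub w e)" by metis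
    define \<phi> where "\<phi> = (\<lambda>e. C #> g e)"
    have inE: "vsub w e \<in> EV t (\<phi> e)" "vsub w e \<noteq> zv" if "e \<in> ?E" for e
    proof -
      show "vsub w e \<in> EV t (\<phi> e)"
        using EV_coset[OF g(1)[OF that]] g(2)[OF that] we(1)[OF that] by (simp add: \<phi>_def ES_def U_iff)
      show "vsub w e \<noteq> zv" using we(2)[OF that] eig_zv by metis
    qed
    have "inj_on \<phi> ?E"
    proof (rule inj_onI)
      fix e e' assume e: "e \<in> ?E" "e' \<in> ?E" "\<phi> e = \<phi> e'"
      have "eig (g e) t (vsub w e')"
        using eig_coset[OF we(1)[OF e(2)] g(1)[OF e(2)] g(1)[OF e(1)] _ g(2)[OF e(2)]] e(3) by (simp add: \<phi>_def)
      then have 1: "eig (g e) t (vsub (vsub w e) (vsub w e'))" using g(2)[OF e(1)] eig_vsub by blast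
      have "vcong n p (vsub (vsub w e) (vsub w e')) (vsub e' e)"
        by (simp add: vcong_def vsub_def cong_def mod_simps)
      then have 2: "eig (g e) t (vsub e' e)" using 1 eig_vcong by blast
      have 3: "eig h t (vsub e' e)" using e eig_vsub by (auto simp: ES_def)
      have dU: "vsub e' e \<in> U" using EU[OF e(1)] EU[OF e(2)] eig_vsub by (auto simp: U_iff vsub_Vs)
      show "e = e'"
      proof (rule ccontr)
        assume "e \<noteq> e'"
        then have "vsub e' e \<noteq> zv" using vsub_eq_zv EU e U_iff by blast
        then have "C #> g e = C #> h" using coset_eq_eig[OF dU _ g(1)[OF e(1)] 2 h(1) 3 t] by blast
        then have "eig h t (vsub w e)" using eig_coset[OF we(1)[OF e(1)] g(1)[OF e(1)] h(1) _ g(2)[OF e(1)]] by blast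
        then show False using we(2)[OF e(1)] by blast
      qed
    qed
    moreover have "\<phi> ` ?E \<subseteq> ?S" using g(1) inE by (auto simp: \<phi>_def Q_def)
    moreover have "finite ?S" using finite_Q by simp
    ultimately have "card ?E \<le> card ?S" using card_inj_on_le by blast
    then show ?thesis using h(2) by simp
  qed
qed

lemma coset_shift: "h \<in> carrier G \<Longrightarrow> x \<in> carrier G \<Longrightarrow> (C #> h) #> x = C #> (h \<otimes> x)"
  using coset_mult_assoc[of C h x] subgroup.subset[OF subC] by simp

text \<open>If some element acts on \<open>U\<close> as the scalar 3, its powers shift the cosets with eigenvalue 2 to three
  times as many cosets. Otherwise there are at least \<open>13 ^ c + 1\<close> cosets with eigenvalue 3, and the
  scalar \<open>-1\<close> shifts them to as many others.\<close>

lemma p13_bound: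
  assumes p: "p = 13" and all: "\<And>u. u \<in> U \<Longrightarrow> u \<noteq> zv \<Longrightarrow> \<exists>h\<in>carrier G. eig h 2 u"
  obtains c where "c \<ge> 1" "dimU = 2 * c" "2 * (13 ^ c + 1) \<le> r"
proof -
  have tot12: "totient 12 = 4"
    using totient_mult_coprime[of 4 3] totient_prime_power[of 2 2] totient_prime[of 3] by (simp add: coprime_iff_gcd_eq_1 gcd_non_0_nat)
  \<comment> \<open>2 is a primitive root modulo 13.\<close>
  have ord: "\<not> [2 ^ i = 1] (mod int p)" if "0 < i" "i < 12" for i
  proof -
    have "i = 1 \<or> i = 2 \<or> i = 3 \<or> i = 4 \<or> i = 5 \<or> i = 6 \<or> i = 7 \<or> i = 8 \<or> i = 9 \<or> i = 10 \<or> i = 11"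
      using that by presburger
    then show ?thesis by (auto simp: p cong_def)
  qed
  have t: "[(2::int) ^ 12 = 1] (mod int p)" by (simp add: p cong_def)
  obtain c where c: "c \<ge> 1" "totient 12 * c = 2 * dimU"
    "p ^ dimU - 1 \<le> card {X \<in> Q. EV 2 X \<noteq> {zv}} * (p ^ c - 1)"
  proof (rule eigenvector_count[OF all _ _ t ord])
    show "2 \<le> (12::nat)" "12 < p" using p by simp_all
  qed (assumption | rule that)+
  have dc: "dimU = 2 * c" using c(2) tot12 by simp
  have ct2: "coprime (2::int) (int p)" and ct3: "coprime (3::int) (int p)"
    unfolding p by (simp_all add: coprime_iff_gcd_eq_1 gcd_non_0_int)
  let ?S2 = "{X \<in> Q. EV 2 X \<noteq> {zv}}" and ?S3 = "{X \<in> Q. EV 3 X \<noteq> {zv}}"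
  have pc: "13 ^ c > (1::nat)" using c(1) by (intro one_less_power) auto
  have S2: "13 ^ c + 1 \<le> card ?S2"
  proof -
    have "p ^ dimU = p ^ c * p ^ c" by (simp add: dc mult_2 power_add)
    moreover have pc': "p ^ c > 1" using pc by (simp only: p)
    ultimately have "p ^ dimU - 1 = (p ^ c + 1) * (p ^ c - 1)" by (simp add: algebra_simps)
    then have "(p ^ c + 1) * (p ^ c - 1) \<le> card ?S2 * (p ^ c - 1)" using c(3) by simp
    moreover have "0 < p ^ c - 1" using pc' by simp
    ultimately have "p ^ c + 1 \<le> card ?S2" by (simp only: mult_le_cancel2)
    then show ?thesis by (simp only: p)
  qed
  \<comment> \<open>2^4 = 16 = 3 modulo 13.\<close>
  have pow4: "eig (h [^] (4::nat)) 3 u" if "h \<in> carrier G" "eig h 2 u" for h u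
    by (rule eig_cong[OF _ eig_pow[OF that]]) (simp add: p cong_def)
  have rep: "\<exists>h u. h \<in> Nm \<and> X = C #> h \<and> u \<in> U \<and> u \<noteq> zv \<and> eig h s u"
    if X: "X \<in> Q" "EV s X \<noteq> {zv}" for X s
  proof -
    obtain h where h: "h \<in> Nm" "X = C #> h" using X by (auto simp: Q_def)
    then have "ES C h s \<noteq> {zv}" using EV_coset X by simp
    then obtain u where "u \<in> ES C h s" "u \<noteq> zv" using zv_ES by blast
    then show ?thesis using h ES_U by (auto simp: ES_def eig_one)
  qed
  show ?thesis
  proof (cases "\<exists>x0\<in>Nm. \<forall>u\<in>U. eig x0 3 u")
    case True
    then obtain x0 where x0: "x0 \<in> Nm" "\<And>u. u \<in> U \<Longrightarrow> eig x0 3 u" by blast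
    note x0c = Nm_carrier[OF x0(1)]
    have x0p: "eig (x0 [^] i) (3 ^ i) u" if "u \<in> U" for u and i :: nat
      by (rule eig_pow[OF x0c x0(2)[OF that]])
    let ?f = "\<lambda>(X, i). X #> (x0 [^] (i::nat))"
    have fQ: "?f ` (?S2 \<times> {..<3}) \<subseteq> Q"
    proof (rule image_subsetI)
      fix Xi assume "Xi \<in> ?S2 \<times> {..<3::nat}"
      then obtain X i where [simp]: "Xi = (X, i)" and X: "X \<in> Q" by auto
      then obtain h where h: "h \<in> Nm" "X = C #> h" by (auto simp: Q_def)
      then have "?f Xi = C #> (h \<otimes> x0 [^] i)" using coset_shift Nm_carrier x0c by simp
      then show "?f Xi \<in> Q" using h Nm_mult Nm_pow[OF x0(1)] by (auto simp: Q_def)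
    qed
    have "inj_on ?f (?S2 \<times> {..<3})"
    proof (rule inj_onI)
      fix Xi Yj assume a: "Xi \<in> ?S2 \<times> {..<3::nat}" "Yj \<in> ?S2 \<times> {..<3::nat}" and e: "?f Xi = ?f Yj"
      obtain X i Y j where [simp]: "Xi = (X, i)" "Yj = (Y, j)" by (cases Xi, cases Yj)
      have X: "X \<in> Q" "EV 2 X \<noteq> {zv}" "i < 3" and Y: "Y \<in> Q" "EV 2 Y \<noteq> {zv}" "j < 3" using a by simp_all
      obtain h u where h: "h \<in> Nm" "X = C #> h" "u \<in> U" "u \<noteq> zv" "eig h 2 u" using rep[OF X(1,2)] by blast
      obtain k w where k: "k \<in> Nm" "Y = C #> k" "w \<in> U" "w \<noteq> zv" "eig k 2 w" using rep[OF Y(1,2)] by blast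
      define g where "g = h \<otimes> x0 [^] i"
      define g' where "g' = k \<otimes> x0 [^] j"
      have gN: "g \<in> Nm" "g' \<in> Nm" using h k Nm_mult Nm_pow[OF x0(1)] by (auto simp: g_def g'_def)
      have gg: "C #> g = C #> g'" using e h k coset_shift Nm_carrier x0c by (simp add: g_def g'_def)
      note cr = Nm_carrier[OF h(1)] Nm_carrier[OF k(1)] Nm_carrier[OF gN(2)] nat_pow_closed[OF x0c]
      have "eig g (2 * 3 ^ i) u" unfolding g_def by (rule eig_mult[OF cr(1,4) h(5) x0p[OF h(3)]])
      then have "eig g' (2 * 3 ^ i) u" by (rule eig_coset[OF h(3) gN gg])
      then have gu: "eig (g' [^] (4::nat)) ((2 * 3 ^ i) ^ 4) u" by (rule eig_pow[OF cr(3)])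
      have "eig g' (2 * 3 ^ j) w" unfolding g'_def by (rule eig_mult[OF cr(2,4) k(5) x0p[OF k(3)]])
      then have gw: "eig (g' [^] (4::nat)) ((2 * 3 ^ j) ^ 4) w" by (rule eig_pow[OF cr(3)])
      have "[(16::int) * 3 ^ (4 * j) = 3 * 3 ^ (4 * j)] (mod int p)"
        by (rule cong_mult[OF _ cong_refl]) (simp add: p cong_def)
      moreover have "(2 * 3 ^ j) ^ 4 = (16::int) * 3 ^ (4 * j)"
        by (simp add: power_mult_distrib power_mult[symmetric] mult.commute)
      ultimately have cg: "[(2 * 3 ^ j) ^ 4 = (3::int) ^ (1 + 4 * j)] (mod int p)" by simp
      \<comment> \<open>The fourth power of g' has the eigenvalue 3^(1 + 4 j) at w, so it coincides
        modulo C with that power of the scalar \<open>x0\<close>. Hence it has the same eigenvalue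
        at u, where it was computed as 3^(1 + 4 i). As 3 has order 3 modulo 13 and i, j < 3, this
        gives i = j.\<close>
      have "coprime ((3::int) ^ (1 + 4 * j)) (int p)" using ct3 by simp
      then have co: "C #> (g' [^] (4::nat)) = C #> (x0 [^] (1 + 4 * j))"
        by (rule coset_eq_eig[OF k(3,4) Nm_pow[OF gN(2)] eig_cong[OF cg gw] Nm_pow[OF x0(1)] x0p[OF k(3)]])
      have "eig (g' [^] (4::nat)) (3 ^ (1 + 4 * j)) u"
        by (rule eig_coset[OF h(3) Nm_pow[OF x0(1)] Nm_pow[OF gN(2)] co[symmetric] x0p[OF h(3)]])
      then have "[(2 * 3 ^ i) ^ 4 = (3::int) ^ (1 + 4 * j)] (mod int p)"
        using eig_unique[OF _ h(4) gu] h(3) U_iff by blast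
      moreover have "i = 0 \<or> i = 1 \<or> i = 2" "j = 0 \<or> j = 1 \<or> j = 2" using X(3) Y(3) by presburger+
      ultimately have ij: "i = j" by (auto simp: p cong_def)
      have "g \<otimes> inv g' = h \<otimes> inv k"
        using h k Nm_carrier x0c ij by (simp add: g_def g'_def inv_mult_group m_assoc inv_mult_cancel)
      then have "C #> h = C #> k" using gg coset_eq_iff[OF gN] coset_eq_iff[OF h(1) k(1)] by simp
      then show "Xi = Yj" using h k ij by simp
    qed
    then have "card (?S2 \<times> {..<3::nat}) \<le> card Q" using fQ finite_Q card_inj_on_le by blast
    then have "card ?S2 * 3 \<le> r" by (simp add: r_def card_cartesian_product)
    then show ?thesis using that[OF c(1) dc] S2 by simp
  next
    case False
    have all3: "\<exists>h\<in>carrier G. eig h 3 u" if "u \<in> U" "u \<noteq> zv" for u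
      using all[OF that] pow4 by blast
    have S3: "13 ^ c + 1 \<le> card ?S3"
      using nonscalar_parts[OF ct3 all3 _ dc] False p by blast
    obtain u0 where u0: "u0 \<in> U" "u0 \<noteq> zv" using nontriv zv_U by blast
    obtain h0 where h0: "h0 \<in> carrier G" "eig h0 2 u0" using all[OF u0] by blast
    have h0N: "h0 \<in> Nm" by (rule eig_Nm[OF u0 h0 ct2])
    \<comment> \<open>2^6 = 64 = -1 modulo 13.\<close>
    define z where "z = h0 [^] (6::nat)"
    have zN: "z \<in> Nm" and zc: "z \<in> carrier G" using h0 h0N Nm_pow by (auto simp: z_def)
    have z0: "eig z (-1) u0" unfolding z_def by (rule eig_cong[OF _ eig_pow[OF h0]]) (simp add: p cong_def)
    have zz: "z \<otimes> z \<in> C" using free[OF u0, of "z \<otimes> z"] eig_mult[OF zc zc z0 z0] zc by simp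
    have znC: "z \<notin> C"
    proof
      assume "z \<in> C"
      then have "[(1::int) = -1] (mod int p)" using z0 eig_unique[of u0 z 1 "-1"] u0 U_iff by blast
      then show False by (simp add: p cong_def)
    qed
    \<comment> \<open>The square of z lies in C, so z fixes the sum of w and its image under z. A
      nonzero fixed vector in U would put z into C; therefore the sum is 0.\<close>
    have scal: "eig z (-1) w" if w: "w \<in> U" for w
    proof -
      define y where "y = vadd w (act z w)"
      have yU: "y \<in> U" using act_U[OF zN w] w eig_vadd by (auto simp: y_def U_iff vadd_Vs)
      have "eig (z \<otimes> z) 1 w" using zz w U_iff by blast
      then have aa: "act z (act z w) = w"
        using act_mult[OF zc zc, of w] act_eq_iff[of w "z \<otimes> z"] w U_iff by simp
      have zzw: "vcong n p (mv n (\<rho> z) (act z w)) w"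
        using vcong_sym[OF act_vcong[of z "act z w"]] by (simp only: aa)
      have v1: "vcong n p (mv n (\<rho> z) y) (mv n (\<rho> z) (\<lambda>i. w i + act z w i))"
        unfolding y_def by (rule mv_cong[OF mcong_refl vadd_vcong])
      have v2: "vcong n p (mv n (\<rho> z) (\<lambda>i. w i + act z w i)) (\<lambda>i. act z w i + w i)"
        unfolding mv_add using zzw vcong_sym[OF act_vcong[of z w]] by (auto simp: vcong_def intro: cong_add)
      have v3: "vcong n p (\<lambda>i. act z w i + w i) y"
        using vcong_sym[OF vadd_vcong[of w "act z w"]] by (simp add: y_def add.commute)
      have "eig z 1 y" unfolding eig_def using vcong_trans[OF v1 vcong_trans[OF v2 v3]] by simp
      then have "y = zv" using free[OF yU] znC zc by blast
      then have "vcong n p (\<lambda>i. w i + act z w i) zv" using vcong_sym[OF vadd_vcong[of w "act z w"]] by (simp add: y_def)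
      then have "vcong n p (act z w) (\<lambda>i. -1 * w i)"
        by (auto simp: vcong_def zv_def cong_iff_dvd_diff add.commute)
      then show ?thesis unfolding eig_def using vcong_trans[OF vcong_sym[OF act_vcong]] by blast
    qed
    let ?f = "\<lambda>X. X #> z"
    have sh: "?f (C #> h) = C #> (h \<otimes> z)" if "h \<in> Nm" for h using coset_shift that Nm_carrier zc by blast
    have fQ: "?f ` ?S3 \<subseteq> Q"
    proof (rule image_subsetI)
      fix X assume "X \<in> ?S3"
      then obtain h where h: "h \<in> Nm" "X = C #> h" by (auto simp: Q_def)
      then show "?f X \<in> Q" using sh Nm_mult zN by (auto simp: Q_def)
    qed
    have inj: "inj_on ?f ?S3"
    proof (rule inj_onI)
      fix X Y assume XY: "X \<in> ?S3" "Y \<in> ?S3" "?f X = ?f Y"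
      obtain h k where h: "h \<in> Nm" "X = C #> h" and k: "k \<in> Nm" "Y = C #> k" using XY by (auto simp: Q_def)
      have "C #> (h \<otimes> z) = C #> (k \<otimes> z)" using XY h k sh by simp
      then have "h \<otimes> z \<otimes> inv (k \<otimes> z) \<in> C" using coset_eq_iff Nm_mult h k zN by blast
      moreover have "h \<otimes> z \<otimes> inv (k \<otimes> z) = h \<otimes> inv k"
        using h k Nm_carrier zc by (simp add: inv_mult_group m_assoc inv_mult_cancel)
      ultimately show "X = Y" using coset_eq_iff h k by simp
    qed
    \<comment> \<open>If X and its shift by z both had the eigenvalue 3, the cube of h z would fix a
      nonzero vector, because 3^3 = 1 modulo 13, and would lie in C. On u, however, this cube acts
      by (-3)^3 = -1.\<close>
    have disj: "?f ` ?S3 \<inter> ?S3 = {}"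
    proof (rule ccontr)
      assume "?f ` ?S3 \<inter> ?S3 \<noteq> {}"
      then obtain X where X: "X \<in> ?S3" "?f X \<in> ?S3" by blast
      obtain h u where h: "h \<in> Nm" "X = C #> h" "u \<in> U" "u \<noteq> zv" "eig h 3 u" using rep[of X 3] X by blast
      obtain g w where g: "g \<in> Nm" "?f X = C #> g" "w \<in> U" "w \<noteq> zv" "eig g 3 w" using rep[of "?f X" 3] X by blast
      have hz: "h \<otimes> z \<in> Nm" using h zN Nm_mult by blast
      have "C #> g = C #> (h \<otimes> z)" using g h sh by simp
      then have "eig (h \<otimes> z) 3 w" using eig_coset[OF g(3,1) hz _ g(5)] by blast
      then have "eig ((h \<otimes> z) [^] (3::nat)) (3 ^ 3) w" using eig_pow hz Nm_carrier by blast
      then have "eig ((h \<otimes> z) [^] (3::nat)) 1 w" by (rule eig_cong[rotated]) (simp add: p cong_def)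
      then have "(h \<otimes> z) [^] (3::nat) \<in> C" using free[OF g(3,4)] hz Nm_carrier by blast
      then have 1: "eig ((h \<otimes> z) [^] (3::nat)) 1 u" using h U_iff by blast
      have "eig (h \<otimes> z) (3 * -1) u" using h Nm_carrier zc scal by (intro eig_mult) auto
      then have "eig ((h \<otimes> z) [^] (3::nat)) ((3 * -1) ^ 3) u" using eig_pow hz Nm_carrier by blast
      then have "[1 = (3 * -1) ^ 3] (mod int p)" using 1 eig_unique h U_iff by blast
      then show False by (simp add: p cong_def)
    qed
    have fin3: "finite ?S3" using finite_Q by simp
    have "card (?f ` ?S3 \<union> ?S3) \<le> card Q" using fQ by (intro card_mono[OF finite_Q]) blast
    moreover have "card (?f ` ?S3 \<union> ?S3) = card ?S3 + card ?S3"
      using card_Un_disjoint[OF finite_imageI[OF fin3] fin3 disj] card_image[OF inj] by simp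
    ultimately show ?thesis using that[OF c(1) dc] S3 by (simp add: r_def)
  qed
qed

end

section \<open>Numerical estimates\<close>

definition primes_within :: "nat set \<Rightarrow> nat \<Rightarrow> bool" where
  "primes_within S r \<longleftrightarrow> r > 0 \<and> (\<forall>q. prime q \<longrightarrow> q dvd r \<longrightarrow> q \<in> S)"

lemma primes_within_dvd:
  assumes "primes_within S r" "r dvd s * k" "\<And>q. q \<in> S \<Longrightarrow> \<not> q dvd k"
  shows "r dvd s"
proof -
  have "coprime r k"
  proof (rule ccontr)
    assume "\<not> coprime r k"
    then obtain q where "prime q" "q dvd r" "q dvd k"
      by (metis coprime_iff_gcd_eq_1 gcd_greatest_iff prime_factor_nat)
    then show False using assms by (auto simp: primes_within_def)
  qed
  then show ?thesis using assms(2) coprime_dvd_mult_left_iff by blast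
qed

section \<open>The part of p^n - 1 composed of the primes 2, 3, 5, 7\<close>

lemma geometric_sum_cong:
  fixes y k :: int
  assumes "y = 1 + q * k"
  shows "[(\<Sum>i<m. y ^ i) = int m + q * k * (\<Sum>i<m. int i)] (mod q * q)"
proof -
  have "[y ^ i = 1 + int i * (q * k)] (mod q * q)" for i
  proof (induction i)
    case (Suc i)
    have "[y * y ^ i = (1 + q * k) * (1 + int i * (q * k))] (mod q * q)"
      unfolding assms(1)[symmetric] by (rule cong_mult[OF cong_refl Suc])
    moreover have "(1 + q * k) * (1 + int i * (q * k)) = (1 + int (Suc i) * (q * k)) + q * q * (int i * k * k)"
      by (simp add: algebra_simps)
    ultimately have "[y * y ^ i = (1 + int (Suc i) * (q * k)) + q * q * (int i * k * k)] (mod q * q)" by simp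
    then have "[y * y ^ i = 1 + int (Suc i) * (q * k)] (mod q * q)"
      by (simp add: cong_def mod_simps)
    then show ?case by simp
  qed simp
  then have "[(\<Sum>i<m. y ^ i) = (\<Sum>i<m. 1 + int i * (q * k))] (mod q * q)" by (rule cong_sum)
  then show ?thesis by (simp add: sum.distrib sum_distrib_left mult.commute)
qed

text \<open>The sum is q times a number prime to q, so passing from y to y^q raises the exponent of
  q in y - 1 by exactly one. For q = 2 this requires y = 1 modulo 4.\<close>

lemma geometric_sum_prime:
  fixes y :: int
  assumes q: "prime q" and y: "[y = 1] (mod int q)" and y4: "q = 2 \<Longrightarrow> [y = 1] (mod 4)"
  obtains w where "(\<Sum>i<q. y ^ i) = int q * w" "coprime w (int q)"
proof -
  obtain k where k: "y = 1 + int q * k" using y by (metis add.commute cong_iff_lin cong_sym mult.commute)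
  have qpos: "int q > 0" using q prime_gt_0_nat by simp
  have "[(\<Sum>i<q. y ^ i) = int q] (mod int q * int q)"
  proof (cases "q = 2")
    case True
    then have "(\<Sum>i<q. y ^ i) = 1 + y" by (simp add: numeral_2_eq_2)
    then show ?thesis using y4[OF True] True cong_add[OF cong_refl[of 1], of y 1 4] by simp
  next
    case False
    then have "odd q" using q primes_dvd_imp_eq two_is_prime_nat by blast
    have "2 * (\<Sum>i<q. i) = q * (q - 1)"
      by (induction q) (auto simp: algebra_simps)
    moreover obtain h where "q = 2 * h + 1" using \<open>odd q\<close> by (elim oddE)
    then have "q - 1 = 2 * h" by simp
    ultimately have "(\<Sum>i<q. i) = q * h" by simp
    then have "(\<Sum>i<q. int i) = int q * int h" by (simp flip: of_nat_sum of_nat_mult)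
    then have "int q * k * (\<Sum>i<q. int i) = int q * int q * (k * int h)" by simp
    then have "[int q + int q * k * (\<Sum>i<q. int i) = int q] (mod int q * int q)"
      by (simp only: cong_iff_dvd_diff) simp
    then show ?thesis using geometric_sum_cong[OF k, of q] cong_trans by blast
  qed
  then obtain j where j: "(\<Sum>i<q. y ^ i) = int q + (int q * int q) * j"
    by (metis cong_iff_lin cong_sym mult.commute add.commute)
  show ?thesis
  proof
    show "(\<Sum>i<q. y ^ i) = int q * (1 + int q * j)" using j by (simp add: algebra_simps)
    show "coprime (1 + int q * j) (int q)" by (metis add.commute coprime_1_left coprime_add_one_left coprime_mult_left_iff coprime_commute)
  qed
qed

text \<open>Each factor q of n contributes one more power of q, by
  \<open>geometric_sum_prime\<close>, while factors of n prime to q contribute nothing, because the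
  geometric sum is then congruent to its length modulo q.\<close>

lemma lifting_exponent:
  fixes x :: int
  assumes q: "prime q" and x: "[x = 1] (mod int q)" and x4: "q = 2 \<Longrightarrow> [x = 1] (mod 4)"
    and d: "int q ^ e dvd x ^ n - 1" and n: "n > 0"
  shows "int q ^ e dvd int n * (x - 1)"
  using d n
proof (induction n arbitrary: e rule: less_induct)
  case (less n)
  have fac: "z ^ m - 1 = (z - 1) * (\<Sum>i<m. z ^ i)" for z :: int and m by (rule power_diff_1_eq)
  show ?case
  proof (cases "q dvd n")
    case False
    have "[(\<Sum>i<n. x ^ i) = (\<Sum>i<n. 1)] (mod int q)"
      by (rule cong_sum) (use cong_pow[OF x] in simp)
    then have "[(\<Sum>i<n. x ^ i) = int n] (mod int q)" by simp
    moreover have "coprime (int n) (int q)"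
      using False prime_imp_coprime[OF q False] by (simp add: coprime_commute)
    ultimately have "coprime (\<Sum>i<n. x ^ i) (int q)" using cong_imp_coprime cong_sym by blast
    then have "coprime (int q ^ e) (\<Sum>i<n. x ^ i)" by (simp add: coprime_commute)
    then have "int q ^ e dvd x - 1"
      using less.prems(1) unfolding fac[of x n] by (simp add: coprime_dvd_mult_left_iff)
    then show ?thesis by simp
  next
    case True
    then obtain n' where n': "n = q * n'" by blast
    then have lt: "n' < n" "n' > 0" using less.prems(2) prime_gt_1_nat[OF q] by auto
    define y where "y = x ^ n'"
    have "[y = 1] (mod int q)" unfolding y_def using cong_pow[OF x, of n'] by simp
    moreover have "[y = 1] (mod 4)" if "q = 2" unfolding y_def using cong_pow[OF x4[OF that], of n'] by simp
    ultimately obtain w where w: "(\<Sum>i<q. y ^ i) = int q * w" "coprime w (int q)"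
      using geometric_sum_prime[OF q] by blast
    have xy: "x ^ n - 1 = (y - 1) * int q * w"
      using fac[of y q] w(1) by (simp add: y_def n' power_mult mult.commute)
    have "coprime (int q ^ e) w" using w(2) by (simp add: coprime_commute)
    then have ed: "int q ^ e dvd (y - 1) * int q"
      using less.prems(1) unfolding xy by (simp add: coprime_dvd_mult_left_iff)
    show ?thesis
    proof (cases e)
      case (Suc f)
      have "int q ^ f dvd y - 1" using ed Suc prime_gt_0_nat[OF q] by (simp add: mult.commute)
      then have "int q ^ f dvd int n' * (x - 1)" using less.IH[OF lt(1) _ lt(2)] by (simp add: y_def)
      then show ?thesis using Suc n' by (simp add: mult_dvd_mono mult.assoc)
    qed simp
  qed
qed

text \<open>12 is the least common multiple of q - 1 for q = 2, 3, 5, 7, so p^12 is 1 modulo each of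
  these q, and also modulo 4. The power of q in p^n - 1 is at most that in p^(12 n) - 1, which
  exceeds the one in p^12 - 1 only through n.\<close>

lemma smooth_part_bound:
  fixes p :: nat
  assumes r: "primes_within {2,3,5,7} r" and d: "r dvd p ^ n - 1" and n: "n > 0" and p: "prime p" "p > 7"
  shows "r dvd n * (p ^ 12 - 1)"
proof (rule multiplicity_le_imp_dvd)
  show "r \<noteq> 0" using r by (simp add: primes_within_def)
  have p1: "p ^ k \<ge> 1" for k using p by simp
  fix q :: nat assume q: "prime q"
  show "multiplicity q r \<le> multiplicity q (n * (p ^ 12 - 1))"
  proof (cases "q dvd r")
    case False
    then show ?thesis by (simp add: not_dvd_imp_multiplicity_0)
  next
    case True
    then have qS: "q = 2 \<or> q = 3 \<or> q = 5 \<or> q = 7" using r q by (auto simp: primes_within_def)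
    define x where "x = int p ^ 12"
    have "\<not> q dvd p" using p qS q primes_dvd_imp_eq[OF q p(1)] by auto
    then have cp: "\<not> int q dvd int p" by simp
    have fer: "[int p ^ (q - 1) = 1] (mod int q)"
      using fermat_theorem[OF q \<open>\<not> q dvd p\<close>] by (metis cong_int_iff of_nat_1 of_nat_power)
    have "q - 1 dvd 12" using qS by auto
    then obtain k where "12 = (q - 1) * k" by blast
    then have x1: "[x = 1] (mod int q)" unfolding x_def
      using cong_pow[OF fer, of k] by (simp only: power_mult) simp
    have x4: "[x = 1] (mod 4)" if "q = 2"
    proof -
      have "odd (int p)" using cp that by simp
      then obtain b where "int p = 2 * b + 1" by (elim oddE)
      then have "int p ^ 2 = 1 + 4 * (b * b + b)" by (simp add: power2_eq_square algebra_simps)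
      then have "[int p ^ 2 = 1] (mod 4)" by (simp only: cong_iff_dvd_diff) simp
      from cong_pow[OF this, of 6] show ?thesis by (simp add: x_def)
    qed
    let ?e = "multiplicity q r"
    have "q ^ ?e dvd p ^ n - 1" using multiplicity_dvd d dvd_trans by blast
    then have "int (q ^ ?e) dvd int (p ^ n - 1)" by (simp only: int_dvd_int_iff)
    then have "int q ^ ?e dvd int p ^ n - 1" using p1[of n] by (simp add: of_nat_diff)
    moreover have "int p ^ n - 1 dvd x ^ n - 1"
    proof -
      have "x ^ n = (int p ^ n) ^ 12" by (simp add: x_def power_mult[symmetric] mult.commute)
      then show ?thesis using power_diff_1_eq[of "int p ^ n" 12] by simp
    qed
    ultimately have dx: "int q ^ ?e dvd x ^ n - 1" by (rule dvd_trans)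
    have "int q ^ ?e dvd int n * (x - 1)" by (rule lifting_exponent[OF q x1 x4 dx n])
    also have "int n * (x - 1) = int (n * (p ^ 12 - 1))" using p1[of 12] by (simp add: x_def of_nat_diff)
    finally have "q ^ ?e dvd n * (p ^ 12 - 1)" by (metis int_dvd_int_iff of_nat_power)
    moreover have "n * (p ^ 12 - 1) \<noteq> 0" using n p one_less_power[of p 12] by simp
    ultimately show ?thesis using q by (intro multiplicity_geI) (auto simp: prime_gt_1_nat)
  qed
qed

text \<open>8/35 is the product of 1 - 1/q over q = 2, 3, 5, 7, the least possible ratio of the
  totient of such an m to m.\<close>

lemma totient_smooth_bound:
  assumes "primes_within {2,3,5,7} m"
  shows "8 * m \<le> 35 * totient m"
proof -
  have sub: "prime_factors m \<subseteq> {2,3,5,7}"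
    using assms by (auto simp: primes_within_def prime_factors_dvd)
  let ?f = "\<lambda>p::nat. 1 - 1 / real p"
  have "(\<Prod>p\<in>{2,3,5,7}. ?f p) = (\<Prod>p\<in>{2,3,5,7} - prime_factors m. ?f p) * (\<Prod>p\<in>prime_factors m. ?f p)"
    by (rule prod.subset_diff[OF sub]) simp
  also have "\<dots> \<le> 1 * (\<Prod>p\<in>prime_factors m. ?f p)"
    by (rule mult_right_mono[OF prod_le_1 prod_nonneg]) (use sub in auto)
  finally have "8 / 35 \<le> (\<Prod>p\<in>prime_factors m. ?f p)" by simp
  then have "real m * (8 / 35) \<le> real (totient m)" unfolding totient_formula2 by (intro mult_left_mono) auto
  then show ?thesis by simp
qed

text \<open>For c >= 1 the number p^n - 1 is greater than (p^(n - c) - 1) (p^c - 1).\<close>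

lemma power_gap:
  fixes p :: nat
  assumes "p \<ge> 2" "1 \<le> c" "c \<le> n" "p ^ n - 1 \<le> r * (p ^ c - 1)"
  shows "p ^ (n - c) \<le> r"
proof (rule ccontr)
  define a b where "a = p ^ (n - c)" and "b = p ^ c"
  assume "\<not> p ^ (n - c) \<le> r"
  then have r: "r \<le> a - 1" by (simp add: a_def)
  have pn: "p ^ n = a * b" using assms(3) by (simp add: a_def b_def power_add[symmetric])
  have a1: "a \<ge> 1" using assms(1) by (simp add: a_def)
  have b2: "b \<ge> 2" using assms(1,2) power_increasing[of 1 c p] by (simp add: b_def)
  have "r * (b - 1) \<le> (a - 1) * (b - 1)" using r by (rule mult_right_mono) simp
  moreover have "a * b - 1 \<le> r * (b - 1)" using assms(4) by (simp only: pn b_def)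
  ultimately have "a * b - 1 \<le> (a - 1) * (b - 1)" by (rule order_trans[rotated])
  moreover obtain a' b' where "a = a' + 1" "b = b' + 2" using a1 b2 by (metis add.commute le_Suc_ex)
  ultimately show False by (simp add: algebra_simps)
qed

lemma exponential_beats_linear:
  fixes P :: nat
  assumes "P \<ge> 2" "c0 \<ge> 1" "P ^ c0 > K * c0" "c \<ge> c0"
  shows "P ^ c > K * c"
  using assms(4)
proof (induction c rule: dec_induct)
  case base show ?case by (rule assms(3))
next
  case (step c)
  have "K * Suc c \<le> K * c + K * c" using step assms(2) by simp
  also have "\<dots> < 2 * P ^ c" using step by simp
  also have "\<dots> \<le> P ^ Suc c" using assms(1) by simp
  finally show ?case .
qed

lemma smooth_part_dvd:
  assumes r: "primes_within {2,3,5,7} r" "r dvd p ^ n - 1" "n > 0" "prime p" "p > 7"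
    and k: "p ^ 12 - 1 = s * k" "\<not> 2 dvd k" "\<not> 3 dvd k" "\<not> 5 dvd k" "\<not> 7 dvd k"
  shows "r dvd n * s"
  by (rule primes_within_dvd[OF r(1), of _ k])
    (use smooth_part_bound[OF r] k in \<open>auto simp: mult.assoc\<close>)

text \<open>With n = f c, the lower bound p^(n - c) = (p^(f - 1))^c for r is exponential in c, while
  the upper bound n s = f s c is linear. \<open>c0\<close> is a value from which on the exponential
  is larger.\<close>

lemma exponent_case_bound:
  assumes r: "primes_within {2,3,5,7} r" "r dvd p ^ n - 1" "prime p" "p > 7"
    and k: "p ^ 12 - 1 = s * k" "\<not> 2 dvd k" "\<not> 3 dvd k" "\<not> 5 dvd k" "\<not> 7 dvd k"
    and b: "n = f * c" "p ^ n - 1 \<le> r * (p ^ c - 1)" "f \<ge> 2" "c0 \<ge> 1" "(p ^ (f - 1)) ^ c0 > f * s * c0"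
    and c: "c \<ge> 1"
  shows "c < c0"
proof (rule ccontr)
  assume "\<not> c < c0"
  then have c0: "c \<ge> c0" by simp
  have n: "n > 0" "c \<le> n" using b c by auto
  have "p ^ 1 \<le> p ^ (f - 1)" using b(3) r(4) by (intro power_increasing) auto
  then have "(p ^ (f - 1)) ^ c > f * s * c"
    using r(4) by (intro exponential_beats_linear[OF _ b(4,5) c0]) simp
  moreover have "(p ^ (f - 1)) ^ c = p ^ (n - c)" using b(1) by (simp add: power_mult[symmetric] diff_mult_distrib)
  moreover have "p ^ (n - c) \<le> r" using power_gap[OF _ c n(2) b(2)] r(4) by simp
  moreover have "r \<le> n * s"
  proof (rule dvd_imp_le[OF smooth_part_dvd[OF r(1,2) n(1) r(3,4) k]])
    have "s \<noteq> 0" using k(1) r(4) one_less_power[of p 12] by (intro notI) simp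
    then show "0 < n * s" using n by simp
  qed
  ultimately show False using b(1) by (simp add: mult_ac)
qed

text \<open>If t >= 20 then n >= 10 c, so r is at least p^(n - c) with n - c >= 9. Removing from
  p^12 - 1 a factor of degree 4 that is prime to 2, 3, 5, 7 leaves an upper bound of 2 n p^8 for r.
  These bounds are incompatible for p >= 21.\<close>

lemma large_totient_case:
  assumes r: "primes_within {2,3,5,7} r" "r dvd p ^ n - 1" "prime p" "p > 7"
    and b: "t * c = 2 * n" "p ^ n - 1 \<le> r * (p ^ c - 1)" "c \<ge> 1" "t \<le> p - 1"
  shows "t < 20"
proof (rule ccontr)
  assume "\<not> t < 20"
  then have "20 * c \<le> t * c" by (intro mult_right_mono) auto
  then have nc: "10 * c \<le> n" using b by simp
  then have n: "n > 0" "c \<le> n" using b by auto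
  have p21: "p \<ge> 21" using b(4) \<open>\<not> t < 20\<close> by simp
  \<comment> \<open>the value at \<open>p\<close> of the twelfth cyclotomic polynomial, which is prime to 2, 3, 5 and 7\<close>
  define k where "k = p ^ 4 - p ^ 2 + 1"
  define s where "s = (p ^ 6 - 1) * (p ^ 2 + 1)"
  have ik: "int k = int p ^ 4 - int p ^ 2 + 1" unfolding k_def
    using power_increasing[of 2 4 p] r(4) by (simp add: of_nat_diff)
  have "int (s * k) = int (p ^ 12 - 1)"
    unfolding of_nat_mult ik s_def using r(4) by (simp add: of_nat_diff algebra_simps power_add[symmetric])
  then have sk: "p ^ 12 - 1 = s * k" by (metis of_nat_eq_iff)
  have nd: "\<not> q dvd k" if "q \<in> {2,3,5,7}" for q
  proof
    assume "q dvd k"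
    then have "int q dvd int p ^ 4 - int p ^ 2 + 1" unfolding ik[symmetric] by simp
    then have "(int p ^ 4 - int p ^ 2 + 1) mod int q = 0" by simp
    moreover have c: "[int p = int p mod int q] (mod int q)" by (simp add: cong_def)
    then have "(int p ^ 4 - int p ^ 2 + 1) mod int q = ((int p mod int q) ^ 4 - (int p mod int q) ^ 2 + 1) mod int q"
      using cong_add[OF cong_diff[OF cong_pow[OF c] cong_pow[OF c]] cong_refl] by (simp only: cong_def)
    moreover have "int p mod int q \<in> {0..<int q}" using that by auto
    moreover have "((x ^ 4 - x ^ 2 + 1) mod int q) \<noteq> 0" if "x \<in> {0..<int q}" for x :: int
    proof -
      have "\<forall>x\<in>set [0..6::int]. (x ^ 4 - x ^ 2 + 1) mod 2 \<noteq> 0 \<and> (x ^ 4 - x ^ 2 + 1) mod 3 \<noteq> 0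
        \<and> (x ^ 4 - x ^ 2 + 1) mod 5 \<noteq> 0 \<and> (x ^ 4 - x ^ 2 + 1) mod 7 \<noteq> 0" by code_simp
      moreover have "x \<in> set [0..6::int]" using that \<open>q \<in> {2,3,5,7}\<close> by auto
      ultimately show ?thesis using \<open>q \<in> {2,3,5,7}\<close> by (auto simp del: set_upto)
    qed
    ultimately show False by metis
  qed
  have s: "s \<le> 2 * p ^ 8"
  proof -
    have "s \<le> p ^ 6 * (2 * p ^ 2)" unfolding s_def using r(4) by (intro mult_mono) auto
    also have "\<dots> = 2 * p ^ 8" by (simp add: power_add[symmetric])
    finally show ?thesis .
  qed
  have s0: "s > 0" using sk r(4) one_less_power[of p 12] by (intro gr0I) simp
  have "p ^ (n - c) \<le> r" using power_gap[OF _ b(3) n(2) b(2)] r(4) by simp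
  also have "r \<le> n * s"
    using dvd_imp_le[OF smooth_part_dvd[OF r(1,2) n(1) r(3,4) sk]] nd n s0 by simp
  also have "\<dots> \<le> n * (2 * p ^ 8)" using s by simp
  finally have 1: "p ^ (n - c) \<le> 2 * n * p ^ 8" by (simp add: mult_ac)
  \<comment> \<open>Nothing is truncated: c >= 1 and n >= 10 c give n - c >= 9. The tightest case of
    the last inequality is x = 1, where it reads 189 > 180.\<close>
  define x where "x = n - c - 8"
  have x: "x \<ge> 1" "n - c = x + 8" "9 * n \<le> 10 * x + 80" using nc b(3) by (auto simp: x_def)
  have "p ^ x \<le> 2 * n" using 1 r(4) unfolding x(2) power_add by simp
  moreover have "21 ^ x \<le> p ^ x" using p21 by (intro power_mono) auto
  moreover have "9 * 21 ^ x > 20 * x + (160::nat)" using x(1) by (induction x rule: dec_induct) auto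
  ultimately show False using x(3) by linarith
qed

text \<open>\<open>totient_smooth_bound\<close> bounds p - 1 linearly in terms of its totient, which
  leaves a finite search. The primes 71 and 73 survive the sieve, but the totient of p - 1 is 24 for
  both.\<close>

lemma small_primes:
  assumes p: "prime p" "p > 7" and sm: "primes_within {2,3,5,7} (p - 1)" and t: "totient (p - 1) < 20"
  shows "(p, totient (p - 1)) \<in> {(11, 4), (13, 4), (17, 8), (19, 6), (29, 12), (31, 8), (37, 12), (41, 16), (43, 12), (61, 16)}"
proof -
  have "p \<le> 88" using totient_smooth_bound[OF sm] t by simp
  then have "p \<in> set [8..<89]" using p unfolding set_upt by simp
  \<comment> \<open>11, 13, 23, 29 and 41 are the primes above 7 that divide p - 1 for some prime p
    in this range.\<close>
  moreover have "\<forall>p\<in>set [8..<89]. (\<forall>q\<in>set [2,3,5,7]. p mod q \<noteq> 0) \<longrightarrow> (\<forall>q\<in>set [11,13,23,29,41]. (p - 1) mod q \<noteq> 0)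
      \<longrightarrow> p \<in> set [11,13,17,19,29,31,37,41,43,61,71,73]" by code_simp
  moreover have "(p - 1) mod q \<noteq> 0" if "q \<in> set [11,13,23,29,41]" for q
  proof
    assume "(p - 1) mod q = 0"
    then have "q dvd p - 1" by blast
    moreover have "prime q" using that by auto
    ultimately have "q \<in> {2,3,5,7}" using sm unfolding primes_within_def by blast
    then show False using that by auto
  qed
  moreover have "p mod q \<noteq> 0" if "q \<in> set [2,3,5,7]" for q
  proof
    assume "p mod q = 0"
    then have "q dvd p" by blast
    moreover have "prime q" using that by auto
    ultimately have "q = p" using p(1) primes_dvd_imp_eq by blast
    then show False using that p(2) by auto
  qed
  ultimately have pl: "p \<in> set [11,13,17,19,29,31,37,41,43,61,71,73]" by blast
  have tp: "totient 2 = 1" "totient 4 = 2" "totient 8 = 4" "totient 16 = 8" "totient 3 = 2" "totient 9 = 6"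
    "totient 5 = 4" "totient 7 = 6"
    using totient_prime_power[of 2 1] totient_prime_power[of 2 2] totient_prime_power[of 2 3] totient_prime_power[of 2 4]
      totient_prime_power[of 3 1] totient_prime_power[of 3 2] totient_prime_power[of 5 1] totient_prime_power[of 7 1]
    by simp_all
  have T: "totient k = v" if "x * y = k" "gcd x y = 1" "totient x * totient y = v" for x y k v :: nat
    using totient_mult_coprime[of x y] that by (auto simp: coprime_iff_gcd_eq_1)
  have t15: "totient 15 = 8" by (rule T[of 3 5]) (simp_all add: tp gcd_non_0_nat)
  have t21: "totient 21 = 12" by (rule T[of 3 7]) (simp_all add: tp gcd_non_0_nat)
  have t35: "totient 35 = 24" by (rule T[of 5 7]) (simp_all add: tp gcd_non_0_nat)
  have t10: "totient 10 = 4" by (rule T[of 2 5]) (simp_all add: tp gcd_non_0_nat t15 t21 t35)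
  have t12: "totient 12 = 4" by (rule T[of 4 3]) (simp_all add: tp gcd_non_0_nat t15 t21 t35)
  have t18: "totient 18 = 6" by (rule T[of 2 9]) (simp_all add: tp gcd_non_0_nat t15 t21 t35)
  have t28: "totient 28 = 12" by (rule T[of 4 7]) (simp_all add: tp gcd_non_0_nat t15 t21 t35)
  have t30: "totient 30 = 8" by (rule T[of 2 15]) (simp_all add: tp gcd_non_0_nat t15 t21 t35)
  have t36: "totient 36 = 12" by (rule T[of 4 9]) (simp_all add: tp gcd_non_0_nat t15 t21 t35)
  have t40: "totient 40 = 16" by (rule T[of 8 5]) (simp_all add: tp gcd_non_0_nat t15 t21 t35)
  have t42: "totient 42 = 12" by (rule T[of 2 21]) (simp_all add: tp gcd_non_0_nat t15 t21 t35)
  have t60: "totient 60 = 16" by (rule T[of 4 15]) (simp_all add: tp gcd_non_0_nat t15 t21 t35)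
  have t70: "totient 70 = 24" by (rule T[of 2 35]) (simp_all add: tp gcd_non_0_nat t15 t21 t35)
  have t16: "totient 16 = 8" by (rule tp)
  have t72: "totient 72 = 24" by (rule T[of 8 9]) (simp_all add: tp gcd_non_0_nat t15 t21 t35)
  from pl have "p = 11 \<or> p = 13 \<or> p = 17 \<or> p = 19 \<or> p = 29 \<or> p = 31 \<or> p = 37 \<or> p = 41 \<or> p = 43 \<or> p = 61 \<or> p = 71 \<or> p = 73"
    by (simp only: list.set insert_iff empty_iff simp_thms)
  then show ?thesis using t
    by (elim disjE) (simp_all add: t10 t12 t28 t30 t36 t40 t42 t60 t70 t72 t16 t18)
qed

text \<open>In the numerical cases, \<open>s\<close> is the part of \<open>p ^ 12 - 1\<close> or \<open>p ^ n - 1\<close> that is composed of the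
  admissible primes, and \<open>k\<close> is the cofactor.\<close>

lemma orbit_count_contradiction:
  assumes r: "primes_within {2,3,5,7} r" "r dvd p ^ n - 1" "prime p" "p > 7"
    and sm: "primes_within {2,3,5,7} (p - 1)"
    and b: "totient (p - 1) * c = 2 * n" "p ^ n - 1 \<le> r * (p ^ c - 1)" "c \<ge> 1"
    and p11: "p = 11 \<Longrightarrow> \<exists>c'\<ge>1. c = 2 * c' \<and> p ^ n - 1 \<le> r * (p ^ c' - 1)"
    and p13: "p = 13 \<Longrightarrow> \<exists>c'\<ge>1. n = 2 * c' \<and> 2 * (13 ^ c' + 1) \<le> r"
    and no7: "p = 13 \<Longrightarrow> n = 2 \<or> n = 4 \<Longrightarrow> \<not> 7 dvd r"
    and no5: "p = 19 \<Longrightarrow> n = 6 \<Longrightarrow> \<not> 5 dvd r"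
  shows False
proof -
  have "totient (p - 1) \<le> p - 1" by (rule totient_le)
  then have t20: "totient (p - 1) < 20" using large_totient_case[OF r b] by blast
  note sp = small_primes[OF r(3,4) sm t20]
  note cb = exponent_case_bound[OF r]
  have no5': "primes_within {2,3,7} r" if "\<not> 5 dvd r" using r(1) that by (auto simp: primes_within_def)
  have no7': "primes_within {2,3,5} r" if "\<not> 7 dvd r" using r(1) that by (auto simp: primes_within_def)
  have c17: "c < 2" if "p = 17" "totient (p - 1) = 8"
    by (rule cb[where s = 60480 and k = 9633304187 and f = 4]) (use b that in auto)
  have c19: "c < 3" if "p = 19" "totient (p - 1) = 6"
    by (rule cb[where s = 740880 and k = 2987413507 and f = 3]) (use b that in auto)
  have c29: "c < 1" if "p = 29" "totient (p - 1) = 12"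
    by (rule cb[where s = 5040 and k = 70201345874101 and f = 6]) (use b that in auto)
  have c31: "c < 2" if "p = 31" "totient (p - 1) = 8"
    by (rule cb[where s = 282240 and k = 2790755328049 and f = 4]) (use b that in auto)
  have c37: "c < 1" if "p = 37" "totient (p - 1) = 12"
    by (rule cb[where s = 15120 and k = 435380423666669 and f = 6]) (use b that in auto)
  have c41: "c < 1" if "p = 41" "totient (p - 1) = 16"
    by (rule cb[where s = 10080 and k = 2238441498052201 and f = 8]) (use b that in auto)
  have c43: "c < 1" if "p = 43" "totient (p - 1) = 12"
    by (rule cb[where s = 25200 and k = 1585699634812007 and f = 6]) (use b that in auto)
  have c61: "c < 1" if "p = 61" "totient (p - 1) = 16"
    by (rule cb[where s = 5040 and k = 526656542519362333 and f = 8]) (use b that in auto)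
  have dv: "r \<le> s" if "primes_within S r" "p ^ n - 1 = s * k" "\<And>q. q \<in> S \<Longrightarrow> \<not> q dvd k" "s > 0" for S s k
    using dvd_imp_le[OF primes_within_dvd[OF that(1) _ that(3)] that(4)] r(2) that(2) by simp
  from sp consider "p = 11" "totient (p - 1) = 4" | "p = 13" | "p = 17" "totient (p - 1) = 8"
    | "p = 19" "totient (p - 1) = 6" | "p = 29" "totient (p - 1) = 12" | "p = 31" "totient (p - 1) = 8"
    | "p = 37" "totient (p - 1) = 12" | "p = 41" "totient (p - 1) = 16" | "p = 43" "totient (p - 1) = 12"
    | "p = 61" "totient (p - 1) = 16" by auto
  then show False
  proof cases
    case 1
    \<comment> \<open>The halved exponent is essential here. For n = 4 the admissible part of 11^4 -
      1 = 240 * 61 is 240; it exceeds (11^4 - 1) / (11^2 - 1) = 122 but not (11^4 - 1) / (11 - 1) =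
      1464.\<close>
    obtain c' where c': "c' \<ge> 1" "c = 2 * c'" "p ^ n - 1 \<le> r * (p ^ c' - 1)" using p11[OF 1(1)] by blast
    have n4: "n = 4 * c'" using b(1) 1(2) c'(2) by simp
    have "c' < 2"
      by (rule cb[where s = 5040 and k = 622704043 and f = 4]) (use 1 c' n4 in auto)
    then have "c' = 1" using c'(1) by simp
    then have n: "n = 4" using n4 by simp
    have "r \<le> 240" by (rule dv[OF r(1), where k = 61]) (auto simp: 1 n)
    then show False using c'(3) \<open>c' = 1\<close> by (simp add: 1 n)
  next
    case 2
    obtain c' where c': "c' \<ge> 1" "n = 2 * c'" "2 * (13 ^ c' + 1) \<le> r" using p13[OF 2] by blast
    have n: "n > 0" using c' by simp
    have "r dvd n * 5040"
      by (rule smooth_part_dvd[OF r(1,2) n r(3,4), where k = 4622635937]) (auto simp: 2)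
    then have "r \<le> n * 5040" using n by (intro dvd_imp_le) auto
    then have "13 ^ c' < 5040 * c'" using c' by simp
    moreover have "13 ^ c' > 5040 * c'" if "c' \<ge> 4"
      by (rule exponential_beats_linear[OF _ _ _ that]) auto
    ultimately have "c' < 4" using not_less by (meson less_asym)
    \<comment> \<open>The lower bounds for r are 28, 340 and 4396, the upper bounds 24, 240 and 504.
      The first two upper bounds rely on the exclusion of the prime 7; with it they would be 168 and
      1680.\<close>
    then consider "c' = 1" | "c' = 2" | "c' = 3" using c'(1) by linarith
    then show False
    proof cases
      assume c1: "c' = 1"
      have "r \<le> 24" by (rule dv[OF no7'[OF no7[OF 2]], where k = 7]) (use c'(2) c1 2 in auto)
      then show False using c'(3) c1 by simp
    next
      assume c1: "c' = 2"
      have "r \<le> 240" by (rule dv[OF no7'[OF no7[OF 2]], where k = 119]) (use c'(2) c1 2 in auto)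
      then show False using c'(3) c1 by simp
    next
      assume c1: "c' = 3"
      have "r \<le> 504" by (rule dv[OF r(1), where k = 9577]) (use c'(2) c1 2 in auto)
      then show False using c'(3) c1 by simp
    qed
  next
    case 3
    have c: "c = 1" using c17[OF 3] b(3) by simp
    then have n: "n = 4" using b(1) 3 by simp
    have "r \<le> 2880" by (rule dv[OF r(1), where k = 29]) (auto simp: 3 n)
    then show False using b(2) by (simp add: 3 c n)
  next
    case 4
    have "c = 1 \<or> c = 2" using c19[OF 4] b(3) by linarith
    then show False
    proof
      assume c: "c = 1"
      then have n: "n = 3" using b(1) 4 by simp
      have "r \<le> 54" by (rule dv[OF r(1), where k = 127]) (auto simp: 4 n)
      then show False using b(2) by (simp add: 4 c n)
    next
      assume c: "c = 2"
      then have n: "n = 6" using b(1) 4 by simp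
      have "r \<le> 74088" by (rule dv[OF no5'[OF no5[OF 4(1) n]], where k = 635]) (auto simp: 4 n)
      then show False using b(2) by (simp add: 4 c n)
    qed
  next
    case 6
    have c: "c = 1" using c31[OF 6] b(3) by simp
    then have n: "n = 4" using b(1) 6 by simp
    have "r \<le> 1920" by (rule dv[OF r(1), where k = 481]) (auto simp: 6 n)
    then show False using b(2) by (simp add: 6 c n)
  qed (use c29 c37 c41 c43 c61 b(3) in auto)
qed

section \<open>Representations in characteristic above 7\<close>

lemma primitive_root_int:
  assumes p: "prime p"
  obtains g :: int where "coprime g (int p)" "\<And>k. [g ^ k = 1] (mod int p) \<longleftrightarrow> (p - 1) dvd k"
proof -
  obtain a where a: "a \<in> totatives p" "ord p a = p - 1"
    using residue_prime_has_primroot[OF p] by blast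
  have "coprime (int a) (int p)" using a by (simp add: totatives_def)
  moreover have "[int a ^ k = 1] (mod int p) \<longleftrightarrow> (p - 1) dvd k" for k
  proof -
    have "[int a ^ k = 1] (mod int p) \<longleftrightarrow> [a ^ k = 1] (mod p)"
      using cong_int_iff[of "a ^ k" 1 p] by simp
    then show ?thesis using a(2) by (simp add: ord_divides')
  qed
  ultimately show ?thesis using that by blast
qed

context modular_rep
begin

lemma eig_square:
  assumes "g \<in> carrier G" "eig g t v \<or> eig g (- t) v"
  shows "eig (g \<otimes> g) (t * t) v"
  using assms eig_mult[of g g t v t] eig_mult[of g g "- t" v "- t"] by auto

text \<open>For p = 1 modulo 4 a power b of a primitive root satisfies b^2 = -1. An element that
  acts on v by b or by -b has a square acting by -1, and this square corrects the sign of any other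
  scalar.\<close>

lemma eig_exact:
  assumes p: "[int p = 1] (mod 4)" and t: "\<not> int p dvd t"
    and pm: "\<And>t. \<not> int p dvd t \<Longrightarrow> \<exists>g\<in>carrier G. eig g t v \<or> eig g (- t) v"
  shows "\<exists>g\<in>carrier G. eig g t v"
proof -
  obtain g0 where g0: "coprime g0 (int p)" "\<And>k. [g0 ^ k = 1] (mod int p) \<longleftrightarrow> (p - 1) dvd k"
    by (rule primitive_root_int[OF prime_p]) blast
  obtain k where k: "p - 1 = 4 * k"
  proof -
    have "4 dvd int p - 1" using p by (simp add: cong_iff_dvd_diff)
    then have "4 dvd int (p - 1)" using p_gt1 by (simp add: of_nat_diff)
    then show ?thesis using that by (metis dvdE int_dvd_int_iff of_nat_numeral)
  qed
  have k0: "k > 0" using k p_gt1 by (intro gr0I) auto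
  define b where "b = g0 ^ k"
  have "int p dvd (b * b - 1) * (b * b + 1)"
  proof -
    have "[g0 ^ (4 * k) = 1] (mod int p)" using g0(2) k by simp
    moreover have "g0 ^ (4 * k) = b ^ 4" by (simp add: b_def power_mult[symmetric] mult.commute)
    moreover have "b ^ 4 - 1 = (b * b - 1) * (b * b + 1)" by (simp add: eval_nat_numeral algebra_simps)
    ultimately show ?thesis by (metis cong_iff_dvd_diff)
  qed
  moreover have "\<not> int p dvd b * b - 1"
  proof
    assume "int p dvd b * b - 1"
    then have "[g0 ^ (2 * k) = 1] (mod int p)" by (simp add: cong_iff_dvd_diff b_def power_add[symmetric] mult_2)
    then have "4 * k dvd 2 * k" using g0(2) k by simp
    then show False using k0 by (auto dest: dvd_imp_le)
  qed
  ultimately have "int p dvd b * b - (-1)" using prime_p by (auto simp: prime_dvd_mult_iff)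
  then have b: "[b * b = -1] (mod int p)" by (simp only: cong_iff_dvd_diff)
  have "coprime b (int p)" using g0(1) by (simp add: b_def)
  then have "\<not> int p dvd b" using p_gt1 by (auto dest!: coprime_common_divisor[OF _ _ dvd_refl] simp: coprime_commute)
  then obtain g where g: "g \<in> carrier G" "eig g b v \<or> eig g (- b) v" using pm by blast
  have m: "eig (g \<otimes> g) (-1) v" using eig_cong[OF b eig_square[OF g]] .
  obtain h where h: "h \<in> carrier G" "eig h t v \<or> eig h (- t) v" using pm[OF t] by blast
  then show ?thesis
  proof (elim disjE)
    assume "eig h (- t) v"
    then have "eig (g \<otimes> g \<otimes> h) (-1 * - t) v" using g h m by (intro eig_mult) auto
    then show ?thesis using g h by (intro bexI[of _ "g \<otimes> g \<otimes> h"]) auto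
  qed blast
qed

end

text \<open>The coefficients \<open>a\<close> are those of the primitive idempotent of \<open>F[X]/(X^7 - 1)\<close> that belongs to a
  quadratic factor of \<open>X^7 - 1\<close> over the field \<open>F\<close> with 13 elements; likewise below for \<open>X^5 - 1\<close>
  over the field with 19 elements.\<close>

lemma (in free_rep) no_factor_7:
  assumes p: "p = 13" and n: "dimU = 2 \<or> dimU = 4"
  shows "\<not> 7 dvd r"
proof
  assume "7 dvd r"
  then obtain y where y: "y \<in> Nm" "y \<notin> C" "y [^] (7::nat) \<in> C"
    using element_of_prime_order[of 7] by auto
  define a where "a = (\<lambda>i. [4,1,3,7,7,3,1::int] ! i)"
  have sum7: "(\<Sum>i<7. f i) = f 0 + f 1 + f 2 + f 3 + f 4 + f 5 + f 6" for f :: "nat \<Rightarrow> int"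
    by (simp add: eval_nat_numeral)
  have a_vals: "a 0 = 4" "a 1 = 1" "a (Suc 0) = 1" "a 2 = 3" "a (Suc (Suc 0)) = 3" "a 3 = 7" "a 4 = 7" "a 5 = 3" "a 6 = 1"
    by (simp_all add: a_def numeral_2_eq_2)
  have lt7: "i = 0 \<or> i = 1 \<or> i = 2 \<or> i = 3 \<or> i = 4 \<or> i = 5 \<or> i = 6" if "i < 7" for i :: nat
    using that by presburger
  have sym: "a (7 - i) = a i" if "0 < i" "i < 7" for i
    using lt7[OF that(2)] that(1) by (auto simp: a_def)
  have conv: "[(\<Sum>i<7. a i * a ((k + (7 - i)) mod 7)) = a k] (mod int p)" if "k < 7" for k
    using lt7[OF that] unfolding sum7 by (elim disjE) (simp_all add: a_vals p cong_def)
  obtain d s where d: "d \<le> dimU" "[2 * int dimU + (int 7 - 1) * s = 0] (mod int p)"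
    "[2 * int d = 2 * a 0 * int dimU + (\<Sum>i=1..<7. a i) * s] (mod int p)"
  proof (rule prime_order_trace[OF _ _ _ y sym conv])
    show "prime (7::nat)" "odd (7::nat)" by simp_all
    show "7 \<noteq> p" using p by simp
  qed (assumption | rule that)+
  have "(\<Sum>i=1..<7. a i) = 22" by (simp add: a_def eval_nat_numeral)
  then have AB: "13 dvd 2 * int dimU + 6 * s" "13 dvd 2 * int d - (8 * int dimU + 22 * s)"
    using d(2,3) p by (simp_all add: cong_iff_dvd_diff a_def)
  \<comment> \<open>The combination eliminates s and yields 3 d = dim U modulo 13: the three
    quadratic factors of (X^7 - 1) / (X - 1) share U equally, which is impossible in dimension 2 or
    4.\<close>
  have "13 dvd 12 * (2 * int dimU + 6 * s) + 8 * (2 * int d - (8 * int dimU + 22 * s)) + 13 * (3 * int dimU + 8 * s - int d)"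
    by (rule dvd_add[OF dvd_add[OF dvd_mult[OF AB(1)] dvd_mult[OF AB(2)]] dvd_triv_left])
  then have "13 dvd 3 * int d - int dimU" by (simp add: algebra_simps)
  moreover have "d = 0 \<or> d = 1 \<or> d = 2 \<or> d = 3 \<or> d = 4" using n d(1) by linarith
  ultimately show False using n d(1) by (elim disjE) simp_all
qed

lemma (in free_rep) no_factor_5:
  assumes p: "p = 19" and n: "dimU = 6"
  shows "\<not> 5 dvd r"
proof
  assume "5 dvd r"
  then obtain y where y: "y \<in> Nm" "y \<notin> C" "y [^] (5::nat) \<in> C"
    using element_of_prime_order[of 5] by auto
  define a where "a = (\<lambda>i. [8,16,18,18,16::int] ! i)"
  have sum5: "(\<Sum>i<5. f i) = f 0 + f 1 + f 2 + f 3 + f 4" for f :: "nat \<Rightarrow> int"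
    by (simp add: eval_nat_numeral)
  have a_vals: "a 0 = 8" "a 1 = 16" "a (Suc 0) = 16" "a 2 = 18" "a (Suc (Suc 0)) = 18" "a 3 = 18" "a 4 = 16"
    by (simp_all add: a_def numeral_2_eq_2)
  have lt5: "i = 0 \<or> i = 1 \<or> i = 2 \<or> i = 3 \<or> i = 4" if "i < 5" for i :: nat
    using that by presburger
  have sym: "a (5 - i) = a i" if "0 < i" "i < 5" for i
    using lt5[OF that(2)] that(1) by (auto simp: a_def)
  have conv: "[(\<Sum>i<5. a i * a ((k + (5 - i)) mod 5)) = a k] (mod int p)" if "k < 5" for k
    using lt5[OF that] unfolding sum5 by (elim disjE) (simp_all add: a_vals p cong_def)
  obtain d s where d: "d \<le> dimU" "card (FixS (lin y 5 a)) = p ^ d" "[2 * int dimU + (int 5 - 1) * s = 0] (mod int p)"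
    "[2 * int d = 2 * a 0 * int dimU + (\<Sum>i=1..<5. a i) * s] (mod int p)"
  proof (rule prime_order_trace[OF _ _ _ y sym conv])
    show "prime (5::nat)" "odd (5::nat)" by simp_all
    show "5 \<noteq> p" using p by simp
  qed (assumption | rule that)+
  have "(\<Sum>i=1..<5. a i) = 68" by (simp add: a_def eval_nat_numeral)
  then have AB: "19 dvd 12 + 4 * s" "19 dvd 2 * int d - (96 + 68 * s)"
    using d(3,4) p n by (simp_all add: cong_iff_dvd_diff a_def)
  have "19 dvd 17 * (12 + 4 * s) + (2 * int d - (96 + 68 * s))" by (rule dvd_add[OF dvd_mult[OF AB(1)] AB(2)])
  then have "19 dvd 2 * int d + 108" by (simp add: algebra_simps)
  moreover have "d = 0 \<or> d = 1 \<or> d = 2 \<or> d = 3 \<or> d = 4 \<or> d = 5 \<or> d = 6" using n d(1) by linarith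
  ultimately have "d = 3" by (elim disjE) simp_all
  \<comment> \<open>Each of the two quadratic factors of (X^5 - 1) / (X - 1) would take half of U.
    But y permutes the 19^3 - 1 nonzero vectors of such a half in orbits of length 5, and 19^3 = 4
    modulo 5.\<close>
  then have "[int (19 ^ 3) = 1] (mod int 5)"
    using prime_dvd_card_FixS[OF _ y, of 5 a] d(2) p by simp
  then show False by (simp add: cong_def)
qed

text \<open>For p = 3 modulo 4 the sign of a scalar is not corrected, so t is the square of a
  primitive root, of odd order m = (p - 1) / 2; the totients of m and p - 1 agree. That p - 1 has
  only the primes 2, 3, 5, 7 follows because t is an eigenvalue of a group element, so that m
  divides |G|.\<close>

lemma (in free_rep) smooth_order_contradiction:
  assumes p: "p > 7" and sm: "primes_within {2,3,5,7} (Coset.order G)"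
    and pm: "\<And>t v. \<not> int p dvd t \<Longrightarrow> v \<in> Vs \<Longrightarrow> v \<noteq> zv \<Longrightarrow> \<exists>g\<in>carrier G. eig g t v \<or> eig g (- t) v"
  shows False
proof -
  have UV: "u \<in> Vs" if "u \<in> U" for u using that U_iff by blast
  obtain g0 where g0: "coprime g0 (int p)" "\<And>k. [g0 ^ k = 1] (mod int p) \<longleftrightarrow> (p - 1) dvd k"
    by (rule primitive_root_int[OF prime_p]) blast
  have ndvd: "\<not> int p dvd g0" using g0(1) p_gt1 by (auto dest!: coprime_common_divisor[OF _ _ dvd_refl] simp: coprime_commute)
  have "odd p" using prime_odd_nat[OF prime_p] p by simp
  obtain t m where t: "\<And>k. [t ^ k = 1] (mod int p) \<longleftrightarrow> m dvd k"
    and all: "\<And>u. u \<in> U \<Longrightarrow> u \<noteq> zv \<Longrightarrow> \<exists>h\<in>carrier G. eig h t u"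
    and m: "m = p - 1 \<and> p mod 4 = 1 \<or> p - 1 = 2 * m \<and> odd m"
  proof (cases "p mod 4 = 1")
    case True
    then have p1: "[int p = 1] (mod 4)" using zmod_int[of p 4] by (simp add: cong_def)
    show ?thesis
      by (rule that[of g0 "p - 1", OF g0(2)]) (use eig_exact[OF p1 ndvd pm] UV True in auto)
  next
    case False
    then have "p mod 4 = 3" using \<open>odd p\<close> by presburger
    then obtain k where k: "p = 4 * k + 3" by (metis mult_div_mod_eq)
    have pk: "p - 1 = 2 * (2 * k + 1)" by (simp add: k)
    show ?thesis
    proof (rule that[of "g0 * g0" "2 * k + 1"])
      show "[(g0 * g0) ^ i = 1] (mod int p) \<longleftrightarrow> (2 * k + 1) dvd i" for i
        using g0(2)[of "2 * i"] unfolding pk nat_mult_dvd_cancel_disj by (simp add: power_mult power2_eq_square)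
      show "\<exists>h\<in>carrier G. eig h (g0 * g0) u" if u: "u \<in> U" "u \<noteq> zv" for u
        using pm[OF ndvd UV[OF u(1)] u(2)] eig_square by blast
    qed (use pk in simp)
  qed
  have m2: "m \<ge> 2" "m < p" using m p by auto
  have tm: "totient m = totient (p - 1)"
    using m totient_mult_coprime[of 2 m] by (auto simp: coprime_left_2_iff_odd)
  have tt: "[t ^ m = 1] (mod int p)" using t by simp
  have ord: "\<not> [t ^ i = 1] (mod int p)" if "0 < i" "i < m" for i using t that nat_dvd_not_less by blast
  have "m dvd Coset.order G"
  proof -
    obtain u where u: "u \<in> U" "u \<noteq> zv" using nontriv zv_U by blast
    obtain h where h: "h \<in> carrier G" "eig h t u" using all[OF u] by blast
    have "eig \<one> (t ^ Coset.order G) u" using eig_pow[OF h, of "Coset.order G"] pow_order_eq_1[OF h(1)] by simp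
    then have "[t ^ Coset.order G = 1] (mod int p)" using eig_unique[OF UV[OF u(1)] u(2) _ eig_one] by blast
    then show ?thesis using t by simp
  qed
  then have smm: "q \<in> {2,3,5,7}" if "prime q" "q dvd m" for q
    using sm that dvd_trans unfolding primes_within_def by blast
  have sp: "primes_within {2,3,5,7} (p - 1)"
    unfolding primes_within_def
  proof (intro conjI allI impI)
    show "0 < p - 1" using p by simp
    fix q assume q: "prime q" "q dvd p - 1"
    then have "q dvd 2 * m" using m by auto
    then show "q \<in> {2,3,5,7}" using q(1) smm primes_dvd_imp_eq[OF q(1) two_is_prime_nat] by (auto simp: prime_dvd_mult_iff)
  qed
  have sr: "primes_within {2,3,5,7} r"
    using sm r_dvd_order r_pos dvd_trans unfolding primes_within_def by blast
  obtain c where c: "c \<ge> 1" "totient m * c = 2 * dimU"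
    "p ^ dimU - 1 \<le> card {X \<in> Q. EV t X \<noteq> {zv}} * (p ^ c - 1)"
    "\<And>j. [j * j = m - 1] (mod m) \<Longrightarrow> \<exists>c'\<ge>1. c = 2 * c' \<and> p ^ dimU - 1 \<le> card {X \<in> Q. EV t X \<noteq> {zv}} * (p ^ c' - 1)"
    using eigenvector_count[OF all m2 tt ord] by blast
  have le: "p ^ dimU - 1 \<le> r * (p ^ e - 1)" if "p ^ dimU - 1 \<le> card {X \<in> Q. EV t X \<noteq> {zv}} * (p ^ e - 1)" for e
    using le_trans[OF that mult_le_mono1[OF card_EV_le_r]] .
  show False
  proof (rule orbit_count_contradiction[OF sr r_dvd prime_p p sp _ le[OF c(3)] c(1)])
    show "totient (p - 1) * c = 2 * dimU" using c(2) tm by simp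
    show "\<exists>c'\<ge>1. c = 2 * c' \<and> p ^ dimU - 1 \<le> r * (p ^ c' - 1)" if "p = 11"
    proof -
      \<comment> \<open>Modulo 5 the number -1 = 4 is a square, so the dimensions for h and its
        inverse agree and c is even.\<close>
      have "m = 5" using m that by auto
      then have "[2 * 2 = m - 1] (mod m)" by (simp add: cong_def)
      from c(4)[OF this] show ?thesis using le by blast
    qed
    show "\<exists>c'\<ge>1. dimU = 2 * c' \<and> 2 * (13 ^ c' + 1) \<le> r" if p13: "p = 13"
    proof -
      have p1: "[int p = 1] (mod 4)" "\<not> int p dvd 2" using p13 by (simp_all add: cong_def)
      have "\<exists>h\<in>carrier G. eig h 2 u" if "u \<in> U" "u \<noteq> zv" for u
        using eig_exact[OF p1 pm] UV that by blast
      from p13_bound[OF p13 this] show ?thesis by blast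
    qed
    show "\<not> 7 dvd r" if "p = 13" "dimU = 2 \<or> dimU = 4" by (rule no_factor_7[OF that])
    show "\<not> 5 dvd r" if "p = 19" "dimU = 6" by (rule no_factor_5[OF that])
  qed
qed

theorem no_smooth_isr_rep:
  fixes G (structure)
  assumes G: "group G" "finite (carrier G)" and p: "prime p" "p > 7"
    and sm: "primes_within {2,3,5,7} (Coset.order G)"
    and isr: "\<And>g k. g \<in> carrier G \<Longrightarrow> coprime k (Coset.order G) \<Longrightarrow>
      \<exists>h\<in>carrier G. g [^] (k::nat) = h \<otimes> g \<otimes> inv h \<or> g [^] k = h \<otimes> inv g \<otimes> inv h"
    and rep: "mrep G n (int p) \<rho>" and n: "n > 0"
    and pm: "\<And>t v i. \<not> int p dvd t \<Longrightarrow> i < n \<Longrightarrow> \<not> int p dvd v i \<Longrightarrow>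
      \<exists>g\<in>carrier G. vcong n p (mv n (\<rho> g) v) (\<lambda>i. t * v i) \<or> vcong n p (mv n (\<rho> g) v) (\<lambda>i. - t * v i)"
  shows False
proof -
  have co: "coprime (Coset.order G) p"
  proof (rule ccontr)
    assume "\<not> coprime (Coset.order G) p"
    then have "p dvd Coset.order G" using p(1) prime_imp_coprime coprime_commute by blast
    then show False using sm p unfolding primes_within_def by auto
  qed
  \<comment> \<open>N has to satisfy n p < p^N; this choice does, since already 2^N is greater than
    n p.\<close>
  define N where "N = Suc (n * p)"
  obtain \<rho>' where r': "mrep G n (int p ^ N) \<rho>'" "\<And>g. g \<in> carrier G \<Longrightarrow> mcong n (int p) (\<rho>' g) (\<rho> g)"
    using mrep_lift[OF G _ rep, of "n * p"] co unfolding N_def by auto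
  interpret R: modular_rep G p n N \<rho>'
    by (intro modular_rep.intro modular_rep_axioms.intro) (use G p co r' in \<open>auto simp: N_def\<close>)
  have pmR: "\<exists>g\<in>carrier G. R.eig g t v \<or> R.eig g (- t) v" if t: "\<not> int p dvd t" and v: "v \<in> R.Vs" "v \<noteq> R.zv" for t v
  proof -
    obtain i where i: "i < n" "\<not> int p dvd v i" using R.nonzero_entry[OF v] .
    obtain g where g: "g \<in> carrier G" "vcong n p (mv n (\<rho> g) v) (\<lambda>i. t * v i) \<or> vcong n p (mv n (\<rho> g) v) (\<lambda>i. - t * v i)"
      using pm[of t i v, OF t i] by blast
    have 1: "vcong n p (mv n (\<rho>' g) v) (mv n (\<rho> g) v)" by (rule mv_cong[OF r'(2)[OF g(1)] vcong_refl])
    show ?thesis using g(2) unfolding R.eig_def by (intro bexI[OF _ g(1)]) (auto intro: vcong_trans[OF 1])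
  qed
  define X where "X = R.Vs - {R.zv}"
  have fX: "finite X" unfolding X_def R.Vs_def by (intro finite_Diff finite_PiE) auto
  have neX: "X \<noteq> {}"
  proof -
    have "(\<lambda>i\<in>{..<n}. 1) \<in> R.Vs" "(\<lambda>i\<in>{..<n}. 1) \<noteq> R.zv"
      using p n by (auto simp: R.Vs_def R.zv_def fun_eq_iff)
    then show ?thesis by (auto simp: X_def)
  qed
  obtain v where v: "v \<in> X" "\<And>u. u \<in> X \<Longrightarrow> card (R.stab u) \<le> card (R.stab v)"
  proof -
    have "Max ((\<lambda>u. card (R.stab u)) ` X) \<in> (\<lambda>u. card (R.stab u)) ` X" using fX neX by (intro Max_in) auto
    then obtain v where "v \<in> X" "card (R.stab v) = Max ((\<lambda>u. card (R.stab u)) ` X)" by auto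
    then show ?thesis using that fX by simp
  qed
  interpret S: modular_rep_sub G p n N \<rho>' "R.stab v"
    by (intro modular_rep_sub.intro modular_rep_sub_axioms.intro R.modular_rep_axioms R.stab_subgroup)
  have "n * p < 2 ^ N" unfolding N_def using less_exp[of "Suc (n * p)"] by linarith
  also have "2 ^ N \<le> p ^ N" using p by (intro power_mono) auto
  finally have big: "n * p < p ^ N" .
  interpret I: modular_rep_isr G p n N \<rho>' "R.stab v"
    by unfold_locales (use isr big in blast)+
  have free: "g \<in> R.stab v" if u: "u \<in> R.ES (R.stab v) \<one> 1" "u \<noteq> R.zv" and g: "g \<in> carrier G" "R.eig g 1 u" for u g
  proof -
    have "R.stab v \<subseteq> R.stab u" using u by (auto simp: R.ES_def R.stab_def)
    moreover have "u \<in> X" using u by (auto simp: R.ES_def X_def)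
    moreover have "finite (R.stab u)" using G(2) by (auto simp: R.stab_def)
    ultimately have "R.stab v = R.stab u" using v(2) card_seteq by blast
    then show ?thesis using g by (simp add: R.stab_def)
  qed
  have "v \<in> R.ES (R.stab v) \<one> 1" using v(1) R.eig_one by (auto simp: X_def R.ES_def R.stab_def)
  then have nontriv: "R.ES (R.stab v) \<one> 1 \<noteq> {R.zv}" using v(1) by (auto simp: X_def)
  interpret F: free_rep G p n N \<rho>' "R.stab v"
    by unfold_locales (use free nontriv in blast)+
  show False by (rule F.smooth_order_contradiction[OF p(2) sm pmR])
qed

section \<open>Solvable inverse semirational groups\<close>

primrec lincomb :: "('a, 'm) monoid_scheme \<Rightarrow> (nat \<Rightarrow> 'a) \<Rightarrow> nat \<Rightarrow> (nat \<Rightarrow> int) \<Rightarrow> 'a" where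
  "lincomb K e 0 v = \<one>\<^bsub>K\<^esub>"
| "lincomb K e (Suc n) v = lincomb K e n v \<otimes>\<^bsub>K\<^esub> e n [^]\<^bsub>K\<^esub> v n"

lemma (in group) int_pow_cong:
  assumes "x \<in> carrier G" "x [^] (q::nat) = \<one>" "[a = b] (mod int q)"
  shows "x [^] a = x [^] b"
proof -
  have "ord x dvd q" using assms(1,2) pow_eq_id by blast
  then have "int (ord x) dvd b - a" using assms(3) by (metis cong_iff_dvd_diff cong_sym dvd_trans int_dvd_int_iff)
  then show ?thesis using int_pow_eq[OF assms(1)] by (simp add: dvd_diff_commute)
qed

lemma (in group) pow_cong:
  assumes "x \<in> carrier G" "x [^] (q::nat) = \<one>" "[a = b] (mod q)"
  shows "x [^] a = x [^] b"
  using int_pow_cong[OF assms(1,2), of "int a" "int b"] assms(3) by (simp add: cong_int_iff int_pow_int)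

context comm_group
begin

lemma lincomb_closed: "(\<And>i. i < n \<Longrightarrow> e i \<in> carrier G) \<Longrightarrow> lincomb G e n v \<in> carrier G"
  by (induction n) auto

lemma lincomb_add:
  "(\<And>i. i < n \<Longrightarrow> e i \<in> carrier G) \<Longrightarrow> lincomb G e n (\<lambda>i. v i + w i) = lincomb G e n v \<otimes> lincomb G e n w"
  by (induction n) (simp_all add: lincomb_closed int_pow_mult m_ac)

lemma lincomb_cong:
  assumes "\<And>i. i < n \<Longrightarrow> e i \<in> carrier G" "\<And>x. x \<in> carrier G \<Longrightarrow> x [^] (q::nat) = \<one>" "vcong n (int q) v w"
  shows "lincomb G e n v = lincomb G e n w"
  using assms(1,3)
proof (induction n)
  case (Suc n)
  have "e n [^] v n = e n [^] w n"
    by (rule int_pow_cong[OF _ assms(2)]) (use Suc.prems in \<open>auto simp: vcong_def\<close>)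
  moreover have "lincomb G e n v = lincomb G e n w" using Suc by (auto simp: vcong_def)
  ultimately show ?case by simp
qed simp

text \<open>A basis is an independent family of greatest length; lengths are bounded because n
  independent elements have q^n distinct combinations. \<open>\<Phi>\<close> accepts arbitrary
  integer functions as coordinates and identifies them exactly when they agree modulo q below n, so
  integer matrices can be applied to coordinates without reducing them.\<close>

lemma elementary_abelian_coordinates:
  assumes fin: "finite (carrier G)" and q: "prime q" and ex: "\<And>x. x \<in> carrier G \<Longrightarrow> x [^] q = \<one>"
  obtains n \<Phi> where "\<And>v. \<Phi> v \<in> carrier G" "\<And>v w. \<Phi> (\<lambda>i. v i + w i) = \<Phi> v \<otimes> \<Phi> w"
    "\<And>x. x \<in> carrier G \<Longrightarrow> \<exists>v. \<Phi> v = x" "\<And>v w. \<Phi> v = \<Phi> w \<longleftrightarrow> vcong n (int q) v w"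
proof -
  define indep where "indep = (\<lambda>n e. (\<forall>i<n. e i \<in> carrier G) \<and> (\<forall>v. lincomb G e n v = \<one> \<longrightarrow> (\<forall>i<n. int q dvd v i)))"
  have inj: "vcong n (int q) v w" if "indep n e" "lincomb G e n v = lincomb G e n w" for n e v w
  proof -
    have cl: "\<And>i. i < n \<Longrightarrow> e i \<in> carrier G" using that by (simp add: indep_def)
    have "lincomb G e n (\<lambda>i. v i - w i) \<otimes> lincomb G e n w = lincomb G e n v"
      using lincomb_add[OF cl, where v = "\<lambda>i. v i - w i" and w = w] by simp
    then have "lincomb G e n (\<lambda>i. v i - w i) \<otimes> lincomb G e n w = \<one> \<otimes> lincomb G e n w"
      using that(2) lincomb_closed[OF cl] by simp
    then have "lincomb G e n (\<lambda>i. v i - w i) = \<one>"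
      using right_cancel[OF lincomb_closed[OF cl] lincomb_closed[OF cl] one_closed] by (simp only:)
    then have "\<forall>i<n. int q dvd v i - w i"
      using that(1) unfolding indep_def by (elim conjE) (erule allE, erule (1) mp)
    then show ?thesis by (simp add: vcong_def cong_iff_dvd_diff)
  qed
  have bound: "n \<le> card (carrier G)" if "indep n e" for n e
  proof -
    let ?V = "{..<n} \<rightarrow>\<^sub>E {0..<int q}"
    have "inj_on (lincomb G e n) ?V"
    proof (rule inj_onI)
      fix v w assume vw: "v \<in> ?V" "w \<in> ?V" "lincomb G e n v = lincomb G e n w"
      have veq: "v i = w i" if "i < n" for i
      proof -
        have "[v i = w i] (mod int q)" using inj[OF \<open>indep n e\<close> vw(3)] that by (simp add: vcong_def)
        moreover have "v i \<in> {0..<int q}" "w i \<in> {0..<int q}"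
          using PiE_mem[OF vw(1)] PiE_mem[OF vw(2)] that by blast+
        ultimately show ?thesis by (simp add: cong_def)
      qed
      show "v = w" by (rule PiE_ext[OF vw(1,2)]) (use veq in simp)
    qed
    moreover have "lincomb G e n ` ?V \<subseteq> carrier G" using that lincomb_closed by (auto simp: indep_def)
    ultimately have "card ?V \<le> card (carrier G)" using card_inj_on_le fin by blast
    moreover have "card ?V = q ^ n" by (simp add: card_PiE)
    moreover have "n < q ^ n" using less_exp[of n] power_mono[of 2 q n] prime_ge_2_nat[OF q] by linarith
    ultimately show ?thesis by simp
  qed
  have ex0: "\<exists>e. indep 0 e" by (simp add: indep_def)
  define n where "n = (GREATEST n. \<exists>e. indep n e)"
  have bound': "\<forall>k. (\<exists>e. indep k e) \<longrightarrow> k \<le> card (carrier G)" using bound by blast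
  have "\<exists>e. indep n e" unfolding n_def by (rule GreatestI_nat[where P = "\<lambda>n. \<exists>e. indep n e", OF ex0]) (use bound' in blast)
  then obtain e where e: "indep n e" by blast
  have max: "\<not> indep (Suc n) e'" for e'
  proof
    assume "indep (Suc n) e'"
    then have "\<exists>e. indep (Suc n) e" by blast
    then have "Suc n \<le> n" unfolding n_def
      by (rule Greatest_le_nat[where P = "\<lambda>n. \<exists>e. indep n e"]) (use bound' in blast)
    then show False by simp
  qed
  have cl: "\<And>i. i < n \<Longrightarrow> e i \<in> carrier G" using e by (simp add: indep_def)
  have surj: "\<exists>v. lincomb G e n v = x" if x: "x \<in> carrier G" for x
  proof -
    define e' where "e' = e(n := x)"
    have le: "lincomb G e' k v = lincomb G e k v" if "k \<le> n" for k v
      using that by (induction k) (auto simp: e'_def)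
    have "\<forall>i<Suc n. e' i \<in> carrier G" using x cl by (auto simp: e'_def less_Suc_eq)
    then obtain v i where v: "lincomb G e' (Suc n) v = \<one>" "i < Suc n" "\<not> int q dvd v i"
      using max[of e'] by (auto simp: indep_def)
    have v1: "lincomb G e n v \<otimes> x [^] v n = \<one>" using v(1) le[of n] by (simp add: e'_def)
    \<comment> \<open>In a relation between the basis and x the coefficient of x is prime to q, as
      otherwise the relation would be one between the basis elements alone. So the relation can be
      solved for x.\<close>
    have "\<not> int q dvd v n"
    proof
      assume d: "int q dvd v n"
      then have "x [^] v n = x [^] (0::int)" by (intro int_pow_cong[OF x ex[OF x]]) (simp add: cong_0_iff)
      then have "lincomb G e n v = \<one>" using v1 lincomb_closed[OF cl] by simp
      then have "\<forall>i<n. int q dvd v i" using e by (simp add: indep_def)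
      then show False using d v by (auto simp: less_Suc_eq)
    qed
    then have "coprime (v n) (int q)" using q prime_imp_coprime[of "int q" "v n"] by (simp add: ac_simps)
    then obtain c where c: "[v n * c = 1] (mod int q)" using cong_solve_coprime_int by blast
    have pw: "lincomb G e n (\<lambda>i. v i * k) = lincomb G e n v [^] k" for k :: int
    proof -
      have "lincomb G e j (\<lambda>i. v i * k) = lincomb G e j v [^] k" if "j \<le> n" for j
        using that
      proof (induction j)
        case (Suc j)
        then have "j < n" by simp
        then show ?case using Suc cl lincomb_closed[of j e v]
          by (simp add: int_pow_distrib int_pow_pow)
      qed simp
      then show ?thesis by simp
    qed
    have "lincomb G e n v = inv (x [^] v n)" using v1 lincomb_closed[OF cl] x by (simp add: inv_equality)
    then have "lincomb G e n v [^] (- c) = x [^] (v n * c)"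
      using x by (simp add: int_pow_neg int_pow_inv int_pow_pow)
    also have "\<dots> = x [^] (1::int)" by (rule int_pow_cong[OF x ex[OF x] c])
    finally show ?thesis using x pw[of "- c"] by (intro exI[of _ "\<lambda>i. v i * - c"]) simp
  qed
  show ?thesis
  proof (rule that[of "lincomb G e n" n])
    show "lincomb G e n v \<in> carrier G" for v by (rule lincomb_closed[OF cl])
    show "lincomb G e n (\<lambda>i. v i + w i) = lincomb G e n v \<otimes> lincomb G e n w" for v w by (rule lincomb_add[OF cl])
    show "\<exists>v. lincomb G e n v = x" if "x \<in> carrier G" for x by (rule surj[OF that])
    show "lincomb G e n v = lincomb G e n w \<longleftrightarrow> vcong n (int q) v w" for v w
    proof
      show "vcong n (int q) v w \<Longrightarrow> lincomb G e n v = lincomb G e n w"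
        by (rule lincomb_cong[where q = q]) (use cl ex in auto)
    qed (rule inj[OF e])
  qed
qed

end

section \<open>Inverse semirational groups and their quotients\<close>

definition inverse_semirational :: "('a, 'm) monoid_scheme \<Rightarrow> bool" where
  "inverse_semirational G \<longleftrightarrow> (\<forall>g\<in>carrier G. \<forall>k::nat. coprime k (Coset.order G) \<longrightarrow>
     (\<exists>h\<in>carrier G. g [^]\<^bsub>G\<^esub> k = h \<otimes>\<^bsub>G\<^esub> g \<otimes>\<^bsub>G\<^esub> inv\<^bsub>G\<^esub> h \<or> g [^]\<^bsub>G\<^esub> k = h \<otimes>\<^bsub>G\<^esub> inv\<^bsub>G\<^esub> g \<otimes>\<^bsub>G\<^esub> inv\<^bsub>G\<^esub> h))"

text \<open>An exponent prime to the order of the quotient need not be prime to |G|. It is moved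
  within its class modulo the order of the quotient to one that is, and the conjugacy in G is then
  projected.\<close>

lemma inverse_semirational_quotient:
  fixes G (structure)
  assumes "group G" "finite (carrier G)" "N \<lhd> G" "inverse_semirational G"
  shows "inverse_semirational (G Mod N)"
  unfolding inverse_semirational_def
proof (intro ballI allI impI)
  interpret group G by fact
  interpret normal N G by fact
  interpret Q: group "G Mod N" by (rule factorgroup_is_group)
  interpret f: group_hom G "G Mod N" "\<lambda>g. N #> g"
    by (intro group_hom.intro group_hom_axioms.intro r_coset_hom_Mod is_group factorgroup_is_group)
  fix X and k :: nat assume X: "X \<in> carrier (G Mod N)" and k: "coprime k (Coset.order (G Mod N))"
  obtain g where g: "g \<in> carrier G" "X = N #> g" using X by (auto simp: FactGroup_def RCOSETS_def)
  have "Coset.order G > 0" using assms(2) order_gt_0_iff_finite by blast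
  then obtain k' where k': "[k' = k] (mod Coset.order (G Mod N))" "coprime k' (Coset.order G)" using exists_cong_coprime k by blast
  obtain h where h: "h \<in> carrier G" "g [^] k' = h \<otimes> g \<otimes> inv h \<or> g [^] k' = h \<otimes> inv g \<otimes> inv h"
    using assms(4) g(1) k'(2) unfolding inverse_semirational_def by blast
  have Xk: "X [^]\<^bsub>G Mod N\<^esub> k = X [^]\<^bsub>G Mod N\<^esub> k'"
  proof -
    show ?thesis by (rule Q.pow_cong[OF X Q.pow_order_eq_1[OF X] cong_sym[OF k'(1)]])
  qed
  have "X [^]\<^bsub>G Mod N\<^esub> k' = N #> (g [^] k')" using f.hom_nat_pow[OF g(1)] g(2) by simp
  moreover have "N #> (h \<otimes> g \<otimes> inv h) = (N #> h) \<otimes>\<^bsub>G Mod N\<^esub> X \<otimes>\<^bsub>G Mod N\<^esub> inv\<^bsub>G Mod N\<^esub> (N #> h)"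
    "N #> (h \<otimes> inv g \<otimes> inv h) = (N #> h) \<otimes>\<^bsub>G Mod N\<^esub> inv\<^bsub>G Mod N\<^esub> X \<otimes>\<^bsub>G Mod N\<^esub> inv\<^bsub>G Mod N\<^esub> (N #> h)"
    using h(1) g f.hom_mult[of "h \<otimes> g" "inv h"] f.hom_mult[of h g] f.hom_mult[of "h \<otimes> inv g" "inv h"] f.hom_mult[of h "inv g"]
    by simp_all
  moreover have hc: "N #> h \<in> carrier (G Mod N)" using h(1) by (rule f.hom_closed)
  ultimately show "\<exists>h\<in>carrier (G Mod N). X [^]\<^bsub>G Mod N\<^esub> k = h \<otimes>\<^bsub>G Mod N\<^esub> X \<otimes>\<^bsub>G Mod N\<^esub> inv\<^bsub>G Mod N\<^esub> h \<or>
     X [^]\<^bsub>G Mod N\<^esub> k = h \<otimes>\<^bsub>G Mod N\<^esub> inv\<^bsub>G Mod N\<^esub> X \<otimes>\<^bsub>G Mod N\<^esub> inv\<^bsub>G Mod N\<^esub> h"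
    unfolding Xk using h(2) by (intro bexI[OF _ hc]) metis
qed

text \<open>As V is abelian, the conjugation by g on V depends only on the coset V g. The matrix of
  a coset is formed from some representative; its column j consists of coordinates of the conjugate
  of the basis element j.\<close>

lemma conj_representation:
  fixes G (structure)
  assumes "group G" "finite (carrier G)" and V: "V \<lhd> G" and ab: "\<And>x y. x \<in> V \<Longrightarrow> y \<in> V \<Longrightarrow> x \<otimes> y = y \<otimes> x"
    and q: "prime q" and ex: "\<And>x. x \<in> V \<Longrightarrow> x [^] q = \<one>"
  obtains n \<Phi> \<rho> where "\<And>v. \<Phi> v \<in> V" "\<And>v w. \<Phi> (\<lambda>i. v i + w i) = \<Phi> v \<otimes> \<Phi> w"
    "\<And>x. x \<in> V \<Longrightarrow> \<exists>v. \<Phi> v = x" "\<And>v w. \<Phi> v = \<Phi> w \<longleftrightarrow> vcong n (int q) v w"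
    "mrep (G Mod V) n (int q) \<rho>"
    "\<And>g v. g \<in> carrier G \<Longrightarrow> \<Phi> (mv n (\<rho> (V #> g)) v) = g \<otimes> \<Phi> v \<otimes> inv g"
    "\<And>v (k::int). \<Phi> (\<lambda>i. k * v i) = \<Phi> v [^] k"
proof -
  interpret group G by fact
  interpret normal V G by fact
  interpret Q: group "G Mod V" by (rule factorgroup_is_group)
  define K where "K = G\<lparr>carrier := V\<rparr>"
  have gK: "group K" unfolding K_def by (rule subgroup_imp_group[OF is_subgroup])
  have cK: "comm_group K" by (rule group.group_comm_groupI[OF gK]) (auto simp: K_def ab)
  interpret K: comm_group K by (rule cK)
  have cV: "carrier K = V" and mK: "x \<otimes>\<^bsub>K\<^esub> y = x \<otimes> y" and oK: "\<one>\<^bsub>K\<^esub> = \<one>" for x y by (simp_all add: K_def)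
  have VG: "x \<in> carrier G" if "x \<in> V" for x using that subset by blast
  have pK: "x [^]\<^bsub>K\<^esub> (k::nat) = x [^] k" for x k unfolding K_def by (rule nat_pow_consistent[symmetric])
  have finV: "finite V" using assms(2) subset finite_subset by blast
  obtain n \<Phi> where \<Phi>: "\<And>v. \<Phi> v \<in> V" "\<And>v w. \<Phi> (\<lambda>i. v i + w i) = \<Phi> v \<otimes> \<Phi> w"
    "\<And>x. x \<in> V \<Longrightarrow> \<exists>v. \<Phi> v = x" "\<And>v w. \<Phi> v = \<Phi> w \<longleftrightarrow> vcong n (int q) v w"
    by (rule K.elementary_abelian_coordinates[of q, unfolded cV mK oK pK, OF finV q ex]) blast+
  have \<Phi>0: "\<Phi> (\<lambda>i. 0) = \<one>"
    using \<Phi>(2)[of "\<lambda>i. 0" "\<lambda>i. 0"] VG[OF \<Phi>(1)] by simp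
  have \<Phi>nat: "\<Phi> (\<lambda>i. int k * v i) = \<Phi> v [^] k" for k v
  proof (induction k)
    case (Suc k)
    have "(\<lambda>i. int (Suc k) * v i) = (\<lambda>i. int k * v i + v i)" by (simp add: algebra_simps)
    then show ?case using \<Phi>(2)[of "\<lambda>i. int k * v i" v] Suc by simp
  qed (simp add: \<Phi>0)
  have \<Phi>int: "\<Phi> (\<lambda>i. k * v i) = \<Phi> v [^] k" for k :: int and v
  proof (cases k)
    case (nonneg m) then show ?thesis using \<Phi>nat by (simp add: int_pow_int)
  next
    case (neg m)
    have "\<Phi> (\<lambda>i. k * v i) \<otimes> \<Phi> (\<lambda>i. int (Suc m) * v i) = \<Phi> (\<lambda>i. k * v i + int (Suc m) * v i)"
      using \<Phi>(2)[of "\<lambda>i. k * v i" "\<lambda>i. int (Suc m) * v i"] by simp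
    also have "(\<lambda>i. k * v i + int (Suc m) * v i) = (\<lambda>i. 0)" unfolding neg by (simp add: algebra_simps)
    finally have "\<Phi> (\<lambda>i. k * v i) \<otimes> \<Phi> v [^] Suc m = \<one>" using \<Phi>0 \<Phi>nat[of "Suc m" v] by (simp only:)
    then have "\<Phi> (\<lambda>i. k * v i) = inv (\<Phi> v [^] Suc m)"
      using VG[OF \<Phi>(1)] nat_pow_closed inv_equality by metis
    then show ?thesis unfolding neg using VG[OF \<Phi>(1)] by (simp only: int_pow_neg_int)
  qed
  define e where "e = (\<lambda>(j::nat) (i::nat). if i = j then 1 else (0::int))"
  define col where "col = (\<lambda>h j. SOME v. \<Phi> v = h \<otimes> \<Phi> (e j) \<otimes> inv h)"
  have col: "\<Phi> (col h j) = h \<otimes> \<Phi> (e j) \<otimes> inv h" if "h \<in> carrier G" for h j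
    unfolding col_def using \<Phi>(3)[OF inv_op_closed2[OF that \<Phi>(1)]] by (rule someI_ex)
  define R where "R = (\<lambda>h i j. col h j i)"
  have R: "\<Phi> (mv n (R h) v) = h \<otimes> \<Phi> v \<otimes> inv h" if h: "h \<in> carrier G" for h v
  proof -
    have "h \<otimes> \<Phi> (\<lambda>i. \<Sum>j<m. v j * e j i) \<otimes> inv h = \<Phi> (\<lambda>i. \<Sum>j<m. v j * col h j i)" for m
    proof (induction m)
      case 0 show ?case using h by (simp add: \<Phi>0)
    next
      case (Suc m)
      let ?a = "\<Phi> (\<lambda>i. \<Sum>j<m. v j * e j i)" and ?b = "\<Phi> (e m)"
      have cl: "?a \<in> carrier G" "?b \<in> carrier G" using VG[OF \<Phi>(1)] by blast+
      have "\<Phi> (\<lambda>i. \<Sum>j<Suc m. v j * e j i) = ?a \<otimes> ?b [^] v m"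
        using \<Phi>(2)[of "\<lambda>i. \<Sum>j<m. v j * e j i" "\<lambda>i. v m * e m i"] \<Phi>int[of "v m" "e m"] by simp
      moreover have "h \<otimes> (?a \<otimes> ?b [^] v m) \<otimes> inv h = (h \<otimes> ?a \<otimes> inv h) \<otimes> (h \<otimes> ?b \<otimes> inv h) [^] v m"
      proof -
        interpret c: group_hom G G "\<lambda>x. h \<otimes> x \<otimes> inv h"
          by unfold_locales (use h in \<open>auto simp: hom_def m_assoc inv_mult_cancel\<close>)
        show ?thesis using c.hom_mult[OF cl(1) int_pow_closed[OF cl(2)]] c.hom_int_pow[OF cl(2)] by simp
      qed
      moreover have "(h \<otimes> ?b \<otimes> inv h) [^] v m = \<Phi> (\<lambda>i. v m * col h m i)" using col[OF h] \<Phi>int by simp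
      ultimately show ?case
        using Suc \<Phi>(2)[of "\<lambda>i. \<Sum>j<m. v j * col h j i" "\<lambda>i. v m * col h m i"] by simp
    qed
    from this[of n] have "h \<otimes> \<Phi> (\<lambda>i. \<Sum>j<n. v j * e j i) \<otimes> inv h = \<Phi> (mv n (R h) v)"
      by (simp add: mv_def R_def mult.commute)
    moreover have "\<Phi> (\<lambda>i. \<Sum>j<n. v j * e j i) = \<Phi> v"
      unfolding \<Phi>(4) by (auto simp: vcong_def e_def if_distrib[of "\<lambda>x. _ * x"] cong: if_cong)
    ultimately show ?thesis by simp
  qed
  define \<rho> where "\<rho> = (\<lambda>X. R (SOME h. h \<in> X))"
  have \<rho>: "\<Phi> (mv n (\<rho> (V #> g)) v) = g \<otimes> \<Phi> v \<otimes> inv g" if g: "g \<in> carrier G" for g v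
  proof -
    have "(SOME h. h \<in> V #> g) \<in> V #> g" using rcos_self[OF g is_subgroup] by (rule someI)
    then obtain u where u: "u \<in> V" "(SOME h. h \<in> V #> g) = u \<otimes> g" by (auto simp: r_coset_def)
    let ?y = "g \<otimes> \<Phi> v \<otimes> inv g"
    have y: "?y \<in> V" by (rule inv_op_closed2[OF g \<Phi>(1)])
    have "\<Phi> (mv n (\<rho> (V #> g)) v) = (u \<otimes> g) \<otimes> \<Phi> v \<otimes> inv (u \<otimes> g)"
      unfolding \<rho>_def u(2) using R g VG u(1) by simp
    also have "\<dots> = u \<otimes> ?y \<otimes> inv u" using g VG[OF u(1)] VG[OF \<Phi>(1)] by (simp add: inv_mult_group m_assoc)
    also have "\<dots> = ?y \<otimes> u \<otimes> inv u" using ab[OF u(1) y] by simp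
    also have "\<dots> = ?y" using VG[OF u(1)] VG[OF y] by (simp add: m_assoc)
    finally show ?thesis .
  qed
  have matI: "mcong n (int q) A B" if AB: "\<And>v. \<Phi> (mv n A v) = \<Phi> (mv n B v)" for A B
  proof -
    have "[A i j = B i j] (mod int q)" if ij: "i < n" "j < n" for i j
    proof -
      have mve: "mv n M (e j) i = M i j" for M
        using ij by (simp add: mv_def e_def if_distrib[of "\<lambda>x. _ * x"] cong: if_cong)
      have "vcong n (int q) (mv n A (e j)) (mv n B (e j))" using AB[of "e j"] \<Phi>(4) by blast
      then have "[mv n A (e j) i = mv n B (e j) i] (mod int q)" using ij by (simp add: vcong_def)
      then show ?thesis by (simp only: mve)
    qed
    then show ?thesis by (simp add: mcong_def mdvd_def cong_iff_dvd_diff)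
  qed
  have "mrep (G Mod V) n (int q) \<rho>"
    unfolding mrep_def
  proof (intro conjI ballI matI)
    fix X Y v assume "X \<in> carrier (G Mod V)" "Y \<in> carrier (G Mod V)"
    then obtain g h where g: "g \<in> carrier G" "X = V #> g" and h: "h \<in> carrier G" "Y = V #> h"
      by (auto simp: FactGroup_def RCOSETS_def)
    have "X \<otimes>\<^bsub>G Mod V\<^esub> Y = V #> (g \<otimes> h)" using g h by (simp add: FactGroup_def rcos_sum)
    then show "\<Phi> (mv n (mm n (\<rho> X) (\<rho> Y)) v) = \<Phi> (mv n (\<rho> (X \<otimes>\<^bsub>G Mod V\<^esub> Y)) v)"
      using \<rho> g h VG[OF \<Phi>(1)] by (simp add: mv_mm inv_mult_group m_assoc)
  next
    fix v
    have "\<one>\<^bsub>G Mod V\<^esub> = V #> \<one>" using subset by (simp add: FactGroup_def)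
    moreover have "\<Phi> (mv n mid v) = \<Phi> v"
      unfolding \<Phi>(4) by (rule mv_mid)
    ultimately show "\<Phi> (mv n (\<rho> \<one>\<^bsub>G Mod V\<^esub>) v) = \<Phi> (mv n mid v)"
      using \<rho>[OF VG[OF one_closed]] VG[OF \<Phi>(1)] by simp
  qed
  then show ?thesis using that[OF \<Phi> _ \<rho> \<Phi>int] by blast
qed

text \<open>The last nontrivial term of the derived series is abelian and normal. V consists of its
  elements x with x^q = 1, where q is a prime dividing the order of one of its elements.\<close>

lemma minimal_elementary_abelian:
  fixes G (structure)
  assumes "group G" "finite (carrier G)" "solvable G" "Coset.order G > 1"
  obtains V q where "prime q" "V \<lhd> G" "V \<noteq> {\<one>}" "\<And>x y. x \<in> V \<Longrightarrow> y \<in> V \<Longrightarrow> x \<otimes> y = y \<otimes> x"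
    "\<And>x. x \<in> V \<Longrightarrow> x [^] (q::nat) = \<one>"
proof -
  interpret group G by fact
  define n where "n = (LEAST n. (derived G ^^ n) (carrier G) = {\<one>})"
  have "\<exists>n. (derived G ^^ n) (carrier G) = {\<one>}" using assms(3) solvable_iff_trivial_derived_seq by blast
  then have n: "(derived G ^^ n) (carrier G) = {\<one>}" unfolding n_def by (rule LeastI_ex)
  have "n \<noteq> 0"
  proof
    assume "n = 0"
    then have "carrier G = {\<one>}" using n by simp
    then show False using assms(4) by (simp add: Coset.order_def)
  qed
  then obtain m where m: "n = Suc m" by (cases n) auto
  define D where "D = (derived G ^^ m) (carrier G)"
  have D1: "D \<noteq> {\<one>}" using not_less_Least[of m "\<lambda>n. (derived G ^^ n) (carrier G) = {\<one>}"] m by (simp add: n_def D_def)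
  have dD: "derived G D = {\<one>}" using n by (simp add: m D_def)
  have ND: "D \<lhd> G" unfolding D_def
  proof (induction m)
    case 0 show ?case using normal_self by simp
  next
    case (Suc m) then show ?case using derived_is_normal by simp
  qed
  interpret D: normal D G by (rule ND)
  have DG: "x \<in> carrier G" if "x \<in> D" for x using that D.subset by blast
  have comm: "x \<otimes> y = y \<otimes> x" if "x \<in> D" "y \<in> D" for x y
  proof -
    have "x \<otimes> y \<otimes> inv x \<otimes> inv y \<in> derived_set G D" using that by blast
    then have "x \<otimes> y \<otimes> inv x \<otimes> inv y \<in> derived G D" unfolding derived_def by (rule generate.incl)
    then have "(x \<otimes> y) \<otimes> inv (y \<otimes> x) = \<one>" using that DG dD by (simp add: inv_mult_group m_assoc)
    then show ?thesis using that DG by (metis inv_closed inv_equality inv_inv m_closed)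
  qed
  obtain x where x: "x \<in> D" "x \<noteq> \<one>" using D1 D.one_closed by blast
  have "ord x \<noteq> 1" using x DG ord_eq_1 by blast
  then obtain q where q: "prime q" "q dvd ord x" using prime_factor_nat by blast
  define V where "V = {a \<in> D. a [^] q = \<one>}"
  obtain k where k: "ord x = q * k" using q by blast
  have ord_pos: "ord x > 0" using ord_ge_1[OF assms(2), of x] DG x by simp
  have "x [^] k \<in> D" using x(1) by (induction k) auto
  then have xk: "x [^] k \<in> V"
    using x DG k pow_ord_eq_1[of x] by (simp add: V_def nat_pow_pow mult.commute)
  have "x [^] k \<noteq> \<one>"
  proof
    assume "x [^] k = \<one>"
    then have "ord x dvd k" using pow_eq_id DG x by blast
    moreover have "k > 0" using k ord_pos by (intro gr0I) simp
    ultimately have "ord x \<le> k" by (rule dvd_imp_le)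
    then show False using k \<open>k > 0\<close> prime_gt_1_nat[OF q(1)] by simp
  qed
  then have "V \<noteq> {\<one>}" using xk by blast
  moreover have "V \<lhd> G"
    unfolding normal_inv_iff
  proof (intro conjI ballI subgroupI)
    show "V \<subseteq> carrier G" using DG by (auto simp: V_def)
    show "V \<noteq> {}" using xk by blast
    show "inv a \<in> V" if "a \<in> V" for a using that DG by (auto simp: V_def nat_pow_inv)
    show "a \<otimes> b \<in> V" if "a \<in> V" "b \<in> V" for a b
      using that DG comm by (auto simp: V_def pow_mult_distrib)
    fix g a assume g: "g \<in> carrier G" and a: "a \<in> V"
    interpret c: group_hom G G "\<lambda>x. g \<otimes> x \<otimes> inv g"
      by unfold_locales (use g in \<open>auto simp: hom_def m_assoc inv_mult_cancel\<close>)
    have aD: "a \<in> D" "a [^] q = \<one>" using a by (simp_all add: V_def)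
    have "(g \<otimes> a \<otimes> inv g) [^] q = g \<otimes> (a [^] q) \<otimes> inv g" by (rule c.hom_nat_pow[OF DG[OF aD(1)], symmetric])
    then have "(g \<otimes> a \<otimes> inv g) [^] q = \<one>" using aD(2) g by simp
    then show "g \<otimes> a \<otimes> inv g \<in> V" using a g D.inv_op_closed2 by (simp add: V_def)
  qed
  moreover have "x \<otimes> y = y \<otimes> x" if "x \<in> V" "y \<in> V" for x y using that comm by (simp add: V_def)
  moreover have "x [^] q = \<one>" if "x \<in> V" for x using that by (simp add: V_def)
  ultimately show ?thesis by (intro that[OF q(1), of V])
qed

lemma element_of_prime_order_in_subgroup:
  fixes G (structure)
  assumes "group G" "finite (carrier G)" "subgroup H G" "prime q" "q dvd card H"
  shows "\<exists>y\<in>H. y \<noteq> \<one> \<and> y [^] q = \<one>"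
proof -
  interpret group G by fact
  have HG: "H \<subseteq> carrier G" using assms(3) subgroup.subset by blast
  have "{\<one>} #> g = {g}" if "g \<in> H" for g using that HG by (auto simp: r_coset_def)
  then have "{{\<one>} #> g | g. g \<in> H} = (\<lambda>g. {g}) ` H" by blast
  then have "card {{\<one>} #> g | g. g \<in> H} = card H" by (simp add: card_image)
  then show ?thesis
    using element_of_prime_order_mod[OF assms(1,2) triv_subgroup assms(3) _ _ assms(4)] assms HG subgroup.one_closed[OF assms(3)]
    by (auto simp: subset_iff)
qed

text \<open>The induction runs over the normal subgroups N of the fixed group G. The further
  quotient P of Q = G / N has elements of another type, but its order is that of G / K for the
  kernel K of the composite map from G to P, so the induction hypothesis covers it. A prime above 7
  as exponent of W is then excluded by \<open>no_smooth_isr_rep\<close> for the action of P on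
  W.\<close>

theorem solvable_inverse_semirational_primes:
  fixes G (structure)
  assumes G: "group G" "finite (carrier G)" "solvable G" "inverse_semirational G"
  shows "primes_within {2,3,5,7} (Coset.order G)"
proof -
  interpret group G by fact
  have main: "primes_within {2,3,5,7} (Coset.order (G Mod N))" if "N \<lhd> G" for N
    using that
  proof (induction "Coset.order (G Mod N)" arbitrary: N rule: less_induct)
    case (less N)
    interpret N: normal N G by fact
    define Q where "Q = G Mod N"
    interpret Q: group Q unfolding Q_def by (rule N.factorgroup_is_group)
    interpret f: group_hom G Q "\<lambda>g. N #> g"
      unfolding Q_def by (intro group_hom.intro group_hom_axioms.intro N.r_coset_hom_Mod is_group N.factorgroup_is_group)
    have fsurj: "(\<lambda>g. N #> g) ` carrier G = carrier Q" by (auto simp: Q_def FactGroup_def RCOSETS_def)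
    have finQ: "finite (carrier Q)" using fsurj G(2) by (metis finite_imageI)
    have solQ: "solvable Q" using f.solvable_imp_solvable_img[of "carrier G"] G(3) fsurj by (simp add: solvable_def)
    have isrQ: "inverse_semirational Q" unfolding Q_def by (rule inverse_semirational_quotient[OF G(1,2) less.prems G(4)])
    have oQ: "Coset.order Q > 0" using finQ Q.order_gt_0_iff_finite by blast
    show ?case
    proof (cases "Coset.order Q > 1")
      case False
      then have "Coset.order Q = 1" using oQ by simp
      then show ?thesis unfolding Q_def[symmetric] by (auto simp: primes_within_def)
    next
      case True
      obtain W q where W: "prime q" "W \<lhd> Q" "W \<noteq> {\<one>\<^bsub>Q\<^esub>}"
        "\<And>x y. x \<in> W \<Longrightarrow> y \<in> W \<Longrightarrow> x \<otimes>\<^bsub>Q\<^esub> y = y \<otimes>\<^bsub>Q\<^esub> x" "\<And>x. x \<in> W \<Longrightarrow> x [^]\<^bsub>Q\<^esub> (q::nat) = \<one>\<^bsub>Q\<^esub>"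
        by (rule minimal_elementary_abelian[OF Q.is_group finQ solQ True]) blast
      interpret W: normal W Q by (rule W(2))
      define P where "P = Q Mod W"
      interpret P: group P unfolding P_def by (rule W.factorgroup_is_group)
      interpret w: group_hom Q P "\<lambda>g. W #>\<^bsub>Q\<^esub> g"
        unfolding P_def by (intro group_hom.intro group_hom_axioms.intro W.r_coset_hom_Mod Q.is_group W.factorgroup_is_group)
      have wsurj: "(\<lambda>g. W #>\<^bsub>Q\<^esub> g) ` carrier Q = carrier P" by (auto simp: P_def FactGroup_def RCOSETS_def)
      have finP: "finite (carrier P)" using wsurj finQ by (metis finite_imageI)
      have ordQ: "Coset.order P * card W = Coset.order Q"
        using Q.lagrange[OF W.is_subgroup] by (simp add: P_def FactGroup_def Coset.order_def)
      have finW: "finite W" using finQ W.subset finite_subset by blast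
      have cW: "card W > 1"
      proof -
        obtain z where z: "z \<in> W" "z \<noteq> \<one>\<^bsub>Q\<^esub>" using W(3) W.one_closed by blast
        then have "card {z, \<one>\<^bsub>Q\<^esub>} \<le> card W" using finW W.one_closed by (intro card_mono) auto
        then show ?thesis using z(2) by simp
      qed
      interpret k: group_hom G P "\<lambda>g. W #>\<^bsub>Q\<^esub> (N #> g)"
        by unfold_locales (auto simp: hom_def)
      let ?k = "\<lambda>g. W #>\<^bsub>Q\<^esub> (N #> g)"
      have ksurj: "?k ` carrier G = carrier P" using fsurj wsurj by (metis image_image)
      have "card (carrier (G Mod kernel G P ?k)) = card (carrier P)"
        by (rule iso_same_card[OF is_isoI[OF k.FactGroup_iso_set[OF ksurj]]])
      then have oP: "Coset.order (G Mod kernel G P ?k) = Coset.order P" by (simp add: Coset.order_def)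
      have Ppos: "Coset.order P > 0" using finP P.order_gt_0_iff_finite by blast
      have "Coset.order P * 1 < Coset.order P * card W" using cW Ppos by (intro mult_strict_left_mono)
      then have "Coset.order P < Coset.order Q" using ordQ by simp
      then have smP: "primes_within {2,3,5,7} (Coset.order P)"
        using less.hyps[OF _ k.normal_kernel] oP by (simp add: Q_def)
      have q7: "q \<in> {2,3,5,7}"
      proof (rule ccontr)
        assume "q \<notin> {2,3,5,7}"
        have "q > 7"
        proof (rule ccontr)
          assume "\<not> q > 7"
          then have "q = 0 \<or> q = 1 \<or> q = 2 \<or> q = 3 \<or> q = 4 \<or> q = 5 \<or> q = 6 \<or> q = 7" by presburger
          then show False using W(1) \<open>q \<notin> {2,3,5,7}\<close> by (elim disjE) auto
        qed
        obtain n \<Phi> \<rho> where \<Phi>: "\<And>v. \<Phi> v \<in> W" "\<And>v w. \<Phi> (\<lambda>i. v i + w i) = \<Phi> v \<otimes>\<^bsub>Q\<^esub> \<Phi> w"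
          "\<And>x. x \<in> W \<Longrightarrow> \<exists>v. \<Phi> v = x" "\<And>v w. \<Phi> v = \<Phi> w \<longleftrightarrow> vcong n (int q) v w"
          and \<rho>: "mrep (Q Mod W) n (int q) \<rho>"
          and act: "\<And>g v. g \<in> carrier Q \<Longrightarrow> \<Phi> (mv n (\<rho> (W #>\<^bsub>Q\<^esub> g)) v) = g \<otimes>\<^bsub>Q\<^esub> \<Phi> v \<otimes>\<^bsub>Q\<^esub> inv\<^bsub>Q\<^esub> g"
          and pow: "\<And>v (k::int). \<Phi> (\<lambda>i. k * v i) = \<Phi> v [^]\<^bsub>Q\<^esub> k"
          by (rule conj_representation[OF Q.is_group finQ W(2,4,1,5)]) blast+
        have WQ: "x \<in> carrier Q" if "x \<in> W" for x using that W.subset by blast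
        show False
        proof (rule no_smooth_isr_rep[OF P.is_group finP W(1) \<open>q > 7\<close> smP _ \<rho>[folded P_def]])
          have "inverse_semirational P" unfolding P_def by (rule inverse_semirational_quotient[OF Q.is_group finQ W(2) isrQ])
          then show "\<exists>h\<in>carrier P. g [^]\<^bsub>P\<^esub> (k::nat) = h \<otimes>\<^bsub>P\<^esub> g \<otimes>\<^bsub>P\<^esub> inv\<^bsub>P\<^esub> h \<or> g [^]\<^bsub>P\<^esub> k = h \<otimes>\<^bsub>P\<^esub> inv\<^bsub>P\<^esub> g \<otimes>\<^bsub>P\<^esub> inv\<^bsub>P\<^esub> h"
            if "g \<in> carrier P" "coprime k (Coset.order P)" for g k
            using that unfolding inverse_semirational_def by blast
          show "n > 0"
          proof (rule ccontr)
            assume "\<not> n > 0"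
            then have "\<Phi> v = \<Phi> w" for v w unfolding \<Phi>(4) by (simp add: vcong_def)
            then have "x = y" if "x \<in> W" "y \<in> W" for x y using \<Phi>(3)[OF that(1)] \<Phi>(3)[OF that(2)] by metis
            then show False using W(3) W.one_closed by blast
          qed
          fix t :: int and v :: "nat \<Rightarrow> int" and i assume t: "\<not> int q dvd t" and i: "i < n" "\<not> int q dvd v i"
          \<comment> \<open>The scalar t matters only modulo q; k represents it by an exponent prime
            to |Q|. Then t v, multiplicatively the k-th power, is conjugate to v or to its
            inverse.\<close>
          define s where "s = nat (t mod int q)"
          have q0: "int q > 0" using W(1) prime_gt_0_nat by simp
          then have s: "[int s = t] (mod int q)" by (simp add: s_def cong_def)
          have "\<not> q dvd s"
          proof
            assume "q dvd s"
            then have "int q dvd int s" by simp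
            then show False using t s cong_dvd_iff cong_sym by metis
          qed
          then have "coprime s q" using W(1) prime_imp_coprime coprime_commute by blast
          then obtain k where k: "[k = s] (mod q)" "coprime k (Coset.order Q)" using exists_cong_coprime oQ by blast
          have kt: "[int k = t] (mod int q)" using k(1) s cong_trans cong_int_iff by blast
          have cl: "\<Phi> v \<in> carrier Q" for v by (rule WQ[OF \<Phi>(1)])
          obtain h where h: "h \<in> carrier Q" "\<Phi> v [^]\<^bsub>Q\<^esub> k = h \<otimes>\<^bsub>Q\<^esub> \<Phi> v \<otimes>\<^bsub>Q\<^esub> inv\<^bsub>Q\<^esub> h \<or>
              \<Phi> v [^]\<^bsub>Q\<^esub> k = h \<otimes>\<^bsub>Q\<^esub> inv\<^bsub>Q\<^esub> \<Phi> v \<otimes>\<^bsub>Q\<^esub> inv\<^bsub>Q\<^esub> h"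
            using isrQ cl k(2) unfolding inverse_semirational_def by blast
          have pk: "\<Phi> v [^]\<^bsub>Q\<^esub> k = \<Phi> (\<lambda>i. t * v i)"
          proof -
            have "\<Phi> v [^]\<^bsub>Q\<^esub> k = \<Phi> (\<lambda>i. int k * v i)" using pow[of "int k" v] by (simp add: int_pow_int)
            also have "\<dots> = \<Phi> (\<lambda>i. t * v i)" unfolding \<Phi>(4) by (rule vcong_smult[OF kt vcong_refl])
            finally show ?thesis .
          qed
          have neg: "inv\<^bsub>Q\<^esub> \<Phi> w = \<Phi> (\<lambda>i. - w i)" for w
            using pow[of "-1" w] cl[of w] by (simp add: Q.int_pow_neg)
          let ?X = "W #>\<^bsub>Q\<^esub> h"
          have X: "?X \<in> carrier P" using h(1) w.hom_closed by blast
          have "vcong n (int q) (mv n (\<rho> ?X) v) (\<lambda>i. t * v i) \<or> vcong n (int q) (mv n (\<rho> ?X) v) (\<lambda>i. - t * v i)"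
            using h(2)
          proof
            assume "\<Phi> v [^]\<^bsub>Q\<^esub> k = h \<otimes>\<^bsub>Q\<^esub> \<Phi> v \<otimes>\<^bsub>Q\<^esub> inv\<^bsub>Q\<^esub> h"
            then have "\<Phi> (mv n (\<rho> ?X) v) = \<Phi> (\<lambda>i. t * v i)" using act[OF h(1)] pk by simp
            then show ?thesis using \<Phi>(4) by blast
          next
            assume "\<Phi> v [^]\<^bsub>Q\<^esub> k = h \<otimes>\<^bsub>Q\<^esub> inv\<^bsub>Q\<^esub> \<Phi> v \<otimes>\<^bsub>Q\<^esub> inv\<^bsub>Q\<^esub> h"
            then have "inv\<^bsub>Q\<^esub> (\<Phi> (\<lambda>i. t * v i)) = h \<otimes>\<^bsub>Q\<^esub> \<Phi> v \<otimes>\<^bsub>Q\<^esub> inv\<^bsub>Q\<^esub> h"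
              using pk h(1) cl by (simp add: Q.inv_mult_group Q.m_assoc)
            then have "\<Phi> (mv n (\<rho> ?X) v) = \<Phi> (\<lambda>i. - (t * v i))" using act[OF h(1)] neg by simp
            then show ?thesis using \<Phi>(4) by simp
          qed
          then show "\<exists>g\<in>carrier P. vcong n (int q) (mv n (\<rho> g) v) (\<lambda>i. t * v i) \<or> vcong n (int q) (mv n (\<rho> g) v) (\<lambda>i. - t * v i)"
            using X by blast
        qed
      qed
      show ?thesis unfolding primes_within_def Q_def[symmetric]
      proof (intro conjI allI impI)
        show "0 < Coset.order Q" by (rule oQ)
        fix p :: nat assume p: "prime p" "p dvd Coset.order Q"
        then have "p dvd Coset.order P \<or> p dvd card W" using ordQ by (metis prime_dvd_mult_iff)
        then show "p \<in> {2,3,5,7}"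
        proof
          assume "p dvd Coset.order P" then show ?thesis using smP p(1) unfolding primes_within_def by blast
        next
          assume "p dvd card W"
          then obtain y where y: "y \<in> W" "y \<noteq> \<one>\<^bsub>Q\<^esub>" "y [^]\<^bsub>Q\<^esub> p = \<one>\<^bsub>Q\<^esub>"
            using element_of_prime_order_in_subgroup[OF Q.is_group finQ W.is_subgroup p(1)] by blast
          have yc: "y \<in> carrier Q" using y W.subset by blast
          have "Q.ord y dvd p" "Q.ord y dvd q" using Q.pow_eq_id[OF yc] y W(5) by blast+
          moreover have "Q.ord y \<noteq> 1" using Q.ord_eq_1[OF yc] y(2) by blast
          ultimately have "p = q" using p(1) W(1) by (metis prime_nat_iff)
          then show ?thesis using q7 by simp
        qed
      qed
    qed
  qed
  have "Coset.order (G Mod {\<one>}) = Coset.order G"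
    using lagrange[OF triv_subgroup] by (simp add: FactGroup_def Coset.order_def)
  then show ?thesis using main[OF one_is_normal] by simp
qed

section \<open>Units in real algebraic number rings\<close>

lemma pseudo_division:
  fixes f h :: "int poly"
  assumes "h \<noteq> 0"
  obtains c q r where "c \<noteq> 0" "[:c:] * f = h * q + r" "r = 0 \<or> degree r < degree h"
  using pseudo_mod[OF assms, of f] by auto

text \<open>By pseudo division, an element h of least degree in the ideal generated by f and g
  divides every element of the ideal up to a nonzero integer factor. Since f is prime, it divides h
  or the quotient belonging to f. In the first case f would divide g; in the second h is
  constant.\<close>

lemma bezout_irreducible:
  fixes f g :: "int poly"
  assumes f: "irreducible f" "degree f > 0" and nd: "\<not> f dvd g"
  obtains u w c where "c \<noteq> 0" "u * f + w * g = [:c:]"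
proof -
  define J where "J = {u * f + w * g | u w. True} - {0}"
  have f0: "f \<noteq> 0" using f by auto
  have "1 * f + 0 * g \<in> J" unfolding J_def using f0 by (intro DiffI CollectI exI[of _ 1] exI[of _ 0]) auto
  then have "\<exists>h. h \<in> J \<and> (\<forall>h'. h' \<in> J \<longrightarrow> degree h \<le> degree h')"
    using ex_has_least_nat[of "\<lambda>h. h \<in> J" _ degree] by blast
  then obtain h where h: "h \<in> J" "\<And>h'. h' \<in> J \<Longrightarrow> degree h \<le> degree h'" by blast
  obtain u w where uw: "h = u * f + w * g" and h0: "h \<noteq> 0" using h(1) by (auto simp: J_def)
  have div: "\<exists>c q. c \<noteq> 0 \<and> [:c:] * k = h * q" if k: "k = a * f + b * g" for k a b
  proof -
    obtain c q r where cq: "c \<noteq> 0" "[:c:] * k = h * q + r" "r = 0 \<or> degree r < degree h"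
      by (rule pseudo_division[OF h0])
    have "r = [:c:] * k - h * q" using cq(2) by simp
    also have "\<dots> = ([:c:] * a - u * q) * f + ([:c:] * b - w * q) * g" unfolding k uw by (simp add: algebra_simps)
    finally have rJ: "r = ([:c:] * a - u * q) * f + ([:c:] * b - w * q) * g" .
    have "r = 0"
    proof (rule ccontr)
      assume "r \<noteq> 0"
      then have "r \<in> J" using rJ unfolding J_def by blast
      then show False using h(2)[of r] cq(3) \<open>r \<noteq> 0\<close> by simp
    qed
    then show ?thesis using cq by auto
  qed
  have pf: "prime_elem f" using f(1) by (rule irreducible_imp_prime_elem)
  obtain c q where c: "c \<noteq> 0" "[:c:] * f = h * q" using div[of f 1 0] by auto
  have "f dvd h * q" using c(2) by (metis dvd_triv_right)
  then have "f dvd h \<or> f dvd q" using prime_elem_dvd_multD[OF pf] by blast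
  then show ?thesis
  proof
    assume fh: "f dvd h"
    obtain c' q' where c': "c' \<noteq> 0" "[:c':] * g = h * q'" using div[of g 0 1] by auto
    have "f dvd [:c':] * g" using fh c'(2) by (simp add: dvd_mult2)
    then have "f dvd [:c':]" using prime_elem_dvd_multD[OF pf] nd by blast
    then have "degree f \<le> degree [:c':]" using c'(1) by (intro dvd_imp_degree_le) auto
    then show ?thesis using f(2) by simp
  next
    assume "f dvd q"
    then obtain q' where q': "q = f * q'" by blast
    have "f * [:c:] = f * (h * q')" using c(2) q' by (simp add: algebra_simps)
    then have hq: "[:c:] = h * q'" using f0 mult_cancel_left by blast
    have "q' \<noteq> 0" using hq c(1) by auto
    then have "degree h + degree q' = 0" using hq degree_mult_eq[OF h0] by (metis degree_pCons_0)
    then obtain b where b: "h = [:b:]" by (metis add_is_0 degree_eq_zeroE)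
    then have "b \<noteq> 0" using h0 by auto
    then show ?thesis using that[of b u w] uw b by simp
  qed
qed

lemma irreducible_dvd_of_root:
  fixes f g :: "int poly" and a :: "'a :: {field_char_0}"
  assumes f: "irreducible f" "degree f > 0" and r: "poly (of_int_poly f) a = 0" "poly (of_int_poly g) a = 0"
  shows "f dvd g"
proof (rule ccontr)
  assume "\<not> f dvd g"
  then obtain u w c where c: "c \<noteq> 0" "u * f + w * g = [:c:]" using bezout_irreducible[OF f] by metis
  have "poly (of_int_poly (u * f + w * g)) a = 0" using r by (simp add: of_int_poly_hom.hom_add of_int_poly_hom.hom_mult)
  then show False using c by simp
qed

lemma dvd_power_if_prime_factors_dvd:
  fixes P q :: "int poly"
  assumes "P \<noteq> 0" and "\<And>f. irreducible f \<Longrightarrow> f dvd P \<Longrightarrow> f dvd q"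
  obtains k where "P dvd q ^ k"
proof -
  have "prod_mset M dvd q ^ size M" if "\<And>f. f \<in># M \<Longrightarrow> f dvd q" for M
    using that by (induction M) (auto intro: mult_dvd_mono)
  moreover have "f dvd q" if "f \<in># prime_factorization P" for f
  proof (rule assms(2))
    show "irreducible f" using that by (metis in_prime_factors_imp_prime prime_elem_imp_irreducible prime_imp_prime_elem)
    show "f dvd P" using that by (rule in_prime_factors_imp_dvd)
  qed
  ultimately have "prod_mset (prime_factorization P) dvd q ^ size (prime_factorization P)" by blast
  then have "normalize P dvd q ^ size (prime_factorization P)"
    using prod_mset_prime_factorization_weak[OF assms(1)] by (metis normalize_dvd_iff)
  then show ?thesis using that by simp
qed

lemma abs_det_le:
  fixes A :: "int mat"
  assumes A: "A \<in> carrier_mat n n" and X: "\<And>i j. i < n \<Longrightarrow> j < n \<Longrightarrow> \<bar>A $$ (i, j)\<bar> \<le> X"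
  shows "\<bar>det A\<bar> \<le> fact n * X ^ n"
proof -
  have "\<bar>det A\<bar> \<le> (\<Sum>p | p permutes {0..<n}. \<bar>signof p * (\<Prod>i = 0..<n. A $$ (i, p i))\<bar>)"
    unfolding det_def'[OF A] by (rule sum_abs)
  also have "\<dots> \<le> (\<Sum>p | p permutes {0..<n}. X ^ n)"
  proof (rule sum_mono)
    fix p assume p: "p \<in> {p. p permutes {0..<n}}"
    have "(\<Prod>i = 0..<n. \<bar>A $$ (i, p i)\<bar>) \<le> (\<Prod>i = 0..<n. X)"
      by (rule prod_mono) (use p X permutes_in_image[of p "{0..<n}"] in auto)
    moreover have "\<bar>signof p :: int\<bar> = 1" by (simp add: sign_def)
    ultimately show "\<bar>signof p * (\<Prod>i = 0..<n. A $$ (i, p i))\<bar> \<le> X ^ n" by (simp add: abs_mult abs_prod)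
  qed
  also have "\<dots> = fact n * X ^ n" by (simp add: card_permutations)
  finally show ?thesis .
qed

section \<open>Arithmetic in the ring generated by a real algebraic integer\<close>

locale real_algebraic_integer =
  fixes f :: "int poly" and a :: real
  assumes irr: "irreducible f" and monic: "lead_coeff f = 1" and deg: "degree f \<ge> 2"
    and root: "poly (of_int_poly f) a = 0"
begin

abbreviation "d \<equiv> degree f"

definition ev :: "(nat \<Rightarrow> int) \<Rightarrow> real" where
  "ev b = (\<Sum>i<d. of_int (b i) * a ^ i)"

lemma ev_poly: "poly (of_int_poly (\<Sum>i<d. monom (b i) i)) a = ev b"
  by (simp add: ev_def of_int_poly_hom.hom_sum poly_sum poly_monom)

lemma ev_eq_0:
  assumes "ev b = 0" "i < d"
  shows "b i = 0"
proof -
  let ?g = "\<Sum>i<d. monom (b i) i"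
  have "f dvd ?g" using irreducible_dvd_of_root[OF irr _ root] ev_poly assms(1) deg by simp
  moreover have "degree ?g < d"
    by (rule degree_lessI) (use deg in \<open>auto simp: coeff_sum\<close>)
  ultimately have "?g = 0" using dvd_imp_degree_le not_le by blast
  then have "coeff ?g i = 0" by simp
  then show ?thesis using assms(2) by (simp add: coeff_sum)
qed

lemma power_reduction: "\<exists>c. a ^ i = ev c"
proof (induction i)
  case 0
  have "ev (\<lambda>i. if i = 0 then 1 else 0) = 1"
    using deg by (simp add: ev_def if_distrib[of of_int] if_distrib[of "\<lambda>x. x * _"] cong: if_cong)
  then show ?case by (metis power_0)
next
  case (Suc i)
  then obtain c where c: "a ^ i = ev c" by blast
  obtain e where e: "d = Suc e" using deg by (cases d) auto
  have fd: "a ^ d = - (\<Sum>l<d. of_int (coeff f l) * a ^ l)"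
  proof -
    have "0 = (\<Sum>l\<le>d. of_int (coeff f l) * a ^ l)" using root by (simp add: poly_altdef)
    also have "\<dots> = (\<Sum>l<d. of_int (coeff f l) * a ^ l) + a ^ d"
      using monic by (simp add: lessThan_Suc_atMost[symmetric])
    finally show ?thesis by simp
  qed
  have "a ^ Suc i = (\<Sum>l<d. of_int (c l) * a ^ Suc l)"
    by (simp add: c ev_def sum_distrib_left mult_ac)
  also have "\<dots> = (\<Sum>l<e. of_int (c l) * a ^ Suc l) + of_int (c e) * a ^ d" by (simp add: e)
  also have "(\<Sum>l<e. of_int (c l) * a ^ Suc l) = (\<Sum>l<d. of_int (if l = 0 then 0 else c (l - 1)) * a ^ l)"
    unfolding e sum.lessThan_Suc_shift by simp
  also have "\<dots> + of_int (c e) * a ^ d = ev (\<lambda>l. (if l = 0 then 0 else c (l - 1)) - c e * coeff f l)"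
    unfolding fd ev_def by (simp add: left_diff_distrib sum_subtractf sum_distrib_left mult.assoc)
  finally show ?case by blast
qed

definition cf :: "nat \<Rightarrow> nat \<Rightarrow> int" where
  "cf i = (SOME c. a ^ i = ev c)"

lemma cf: "a ^ i = ev (cf i)"
  unfolding cf_def by (rule someI_ex[OF power_reduction])

text \<open>Row k expresses \<open>ev b * a ^ k\<close> in the powers of a below the degree. So this
  is the matrix of multiplication by \<open>ev b\<close>, and its determinant \<open>nrm b\<close>
  is the norm.\<close>

definition mmat :: "(nat \<Rightarrow> int) \<Rightarrow> int mat" where
  "mmat b = mat d d (\<lambda>(k, l). \<Sum>i<d. b i * cf (i + k) l)"

lemma mmat_carrier: "mmat b \<in> carrier_mat d d"
  by (simp add: mmat_def)

lemma mmat_eigen: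
  assumes "k < d"
  shows "(\<Sum>l<d. of_int (mmat b $$ (k, l)) * a ^ l) = ev b * a ^ k"
proof -
  have "(\<Sum>l<d. of_int (mmat b $$ (k, l)) * a ^ l) = (\<Sum>l<d. \<Sum>i<d. of_int (b i) * (of_int (cf (i + k) l) * a ^ l))"
    using assms by (simp add: mmat_def sum_distrib_right mult.assoc)
  also have "\<dots> = (\<Sum>i<d. of_int (b i) * ev (cf (i + k)))"
    unfolding ev_def by (subst sum.swap) (simp add: sum_distrib_left)
  also have "\<dots> = (\<Sum>i<d. of_int (b i) * a ^ (i + k))" by (simp only: cf[symmetric])
  also have "\<dots> = ev b * a ^ k" by (simp add: ev_def[of b] power_add sum_distrib_right mult.assoc)
  finally show ?thesis .
qed

definition nrm :: "(nat \<Rightarrow> int) \<Rightarrow> int" where "nrm b = det (mmat b)"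

text \<open>The first row of the adjugate: the coordinates of the cofactor of \<open>ev b\<close> in
  its norm, which shows that the norm is a multiple of \<open>ev b\<close> inside the ring.\<close>

definition adj :: "(nat \<Rightarrow> int) \<Rightarrow> nat \<Rightarrow> int" where "adj b k = adj_mat (mmat b) $$ (0, k)"

lemma nrm_eq: "of_int (nrm b) = ev b * ev (adj b)"
proof -
  let ?A = "mmat b"
  note am = adj_mat[OF mmat_carrier, of b]
  have "(\<Sum>k<d. adj b k * ?A $$ (k, l)) = (if l = 0 then nrm b else 0)" if l: "l < d" for l
  proof -
    have "(adj_mat ?A * ?A) $$ (0, l) = (\<Sum>k<d. adj b k * ?A $$ (k, l))"
      using am(1) mmat_carrier[of b] l deg
      by (subst index_mult_mat) (auto simp: scalar_prod_def adj_def atLeast0LessThan)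
    then show ?thesis unfolding am(3) using l deg by (auto simp: nrm_def)
  qed note 1 = this
  have "of_int (nrm b) = (\<Sum>l<d. of_int (if l = 0 then nrm b else 0) * a ^ l)"
    using deg by (simp add: if_distrib[of of_int] if_distrib[of "\<lambda>x. x * _"] cong: if_cong)
  also have "\<dots> = (\<Sum>l<d. of_int (\<Sum>k<d. adj b k * ?A $$ (k, l)) * a ^ l)" using 1 by simp
  also have "\<dots> = (\<Sum>l<d. \<Sum>k<d. of_int (adj b k) * (of_int (?A $$ (k, l)) * a ^ l))"
    by (simp add: sum_distrib_right mult.assoc)
  also have "\<dots> = (\<Sum>k<d. of_int (adj b k) * (\<Sum>l<d. of_int (?A $$ (k, l)) * a ^ l))"
    by (subst sum.swap) (simp add: sum_distrib_left)
  also have "\<dots> = (\<Sum>k<d. of_int (adj b k) * (ev b * a ^ k))" using mmat_eigen by simp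
  also have "\<dots> = ev b * ev (adj b)" unfolding ev_def[of "adj b"] sum_distrib_left by (simp add: mult_ac)
  finally show ?thesis .
qed

lemma nrm_nonzero:
  assumes "i < d" "b i \<noteq> 0"
  shows "nrm b \<noteq> 0"
proof
  let ?A = "transpose_mat (mmat b)"
  assume "nrm b = 0"
  then have "det ?A = 0" using det_transpose[OF mmat_carrier] by (simp add: nrm_def)
  moreover have A: "?A \<in> carrier_mat d d" using mmat_carrier by simp
  ultimately obtain y where y: "y \<in> carrier_vec d" "y \<noteq> 0\<^sub>v d" "?A *\<^sub>v y = 0\<^sub>v d"
    using det_0_iff_vec_prod_zero by blast
  have col: "(\<Sum>k<d. y $ k * mmat b $$ (k, l)) = 0" if l: "l < d" for l
  proof -
    have "(?A *\<^sub>v y) $ l = (\<Sum>k<d. y $ k * mmat b $$ (k, l))"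
      using l mmat_carrier[of b] y(1) by (simp add: scalar_prod_def atLeast0LessThan mult.commute)
    then show ?thesis using y(3) l by simp
  qed
  have "0 = (\<Sum>l<d. of_int (\<Sum>k<d. y $ k * mmat b $$ (k, l)) * a ^ l)" using col by simp
  also have "\<dots> = (\<Sum>l<d. \<Sum>k<d. of_int (y $ k) * (of_int (mmat b $$ (k, l)) * a ^ l))"
    by (simp add: sum_distrib_right mult.assoc)
  also have "\<dots> = (\<Sum>k<d. of_int (y $ k) * (\<Sum>l<d. of_int (mmat b $$ (k, l)) * a ^ l))"
    by (subst sum.swap) (simp add: sum_distrib_left)
  also have "\<dots> = (\<Sum>k<d. of_int (y $ k) * (ev b * a ^ k))" using mmat_eigen by simp
  also have "\<dots> = ev b * ev (\<lambda>k. y $ k)" unfolding ev_def[of "\<lambda>k. y $ k"] sum_distrib_left by (simp add: mult_ac)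
  finally have "ev b = 0 \<or> ev (\<lambda>k. y $ k) = 0" by simp
  moreover have "ev b \<noteq> 0" using ev_eq_0 assms by blast
  ultimately have "y $ k = 0" if "k < d" for k using ev_eq_0 that by blast
  then have "y = 0\<^sub>v d" using y(1) by (intro eq_vecI) auto
  then show False using y(2) by simp
qed

definition B :: real where "B = (\<Sum>i<d. \<bar>a\<bar> ^ i)"

lemma B_ge_1: "B \<ge> 1"
proof -
  have "\<bar>a\<bar> ^ 0 \<le> B" unfolding B_def by (rule member_le_sum) (use deg in auto)
  then show ?thesis by simp
qed

lemma abs_ev_le:
  assumes "\<And>i. i < d \<Longrightarrow> \<bar>of_int (b i)\<bar> \<le> X"
  shows "\<bar>ev b\<bar> \<le> X * B"
proof -
  have "\<bar>ev b\<bar> \<le> (\<Sum>i<d. \<bar>of_int (b i) * a ^ i\<bar>)" unfolding ev_def by (rule sum_abs)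
  also have "\<dots> \<le> (\<Sum>i<d. X * \<bar>a\<bar> ^ i)"
    by (rule sum_mono) (use assms in \<open>auto simp: abs_mult power_abs intro: mult_right_mono\<close>)
  finally show ?thesis by (simp add: B_def sum_distrib_left)
qed

definition Cc :: int where "Cc = (\<Sum>j<2*d. \<Sum>l<d. \<bar>cf j l\<bar>)"

lemma mmat_bound:
  assumes b: "\<And>i. i < d \<Longrightarrow> \<bar>b i\<bar> \<le> K" and kl: "k < d" "l < d"
  shows "\<bar>mmat b $$ (k, l)\<bar> \<le> K * Cc"
proof -
  have K: "K \<ge> 0" using b[of 0] deg by simp
  have "\<bar>mmat b $$ (k, l)\<bar> \<le> (\<Sum>i<d. \<bar>b i * cf (i + k) l\<bar>)" using kl unfolding mmat_def by (simp add: sum_abs)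
  also have "\<dots> \<le> (\<Sum>i<d. K * \<bar>cf (i + k) l\<bar>)"
    by (rule sum_mono) (use b in \<open>auto simp: abs_mult intro: mult_right_mono\<close>)
  also have "\<dots> = K * (\<Sum>i<d. \<bar>cf (i + k) l\<bar>)" by (simp add: sum_distrib_left)
  also have "\<dots> \<le> K * Cc"
  proof (rule mult_left_mono[OF _ K])
    have "(\<Sum>i<d. \<bar>cf (i + k) l\<bar>) \<le> (\<Sum>i<d. \<Sum>l<d. \<bar>cf (i + k) l\<bar>)"
      by (rule sum_mono) (rule member_le_sum, use kl in auto)
    also have "\<dots> = (\<Sum>j\<in>(\<lambda>i. i + k) ` {..<d}. \<Sum>l<d. \<bar>cf j l\<bar>)"
      by (subst sum.reindex) (auto simp: inj_on_def)
    also have "\<dots> \<le> Cc" unfolding Cc_def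
      by (rule sum_mono2) (use kl in \<open>auto intro: sum_nonneg\<close>)
    finally show "(\<Sum>i<d. \<bar>cf (i + k) l\<bar>) \<le> Cc" .
  qed
  finally show ?thesis .
qed

lemma adj_bound:
  assumes b: "\<And>i. i < d \<Longrightarrow> \<bar>b i\<bar> \<le> K" and k: "k < d"
  shows "\<bar>adj b k\<bar> \<le> fact (d - 1) * (K * Cc) ^ (d - 1)"
proof -
  let ?M = "mat_delete (mmat b) k 0"
  have M: "?M \<in> carrier_mat (d - 1) (d - 1)" by (rule mat_delete_carrier[OF mmat_carrier])
  have "\<bar>?M $$ (i, j)\<bar> \<le> K * Cc" if ij: "i < d - 1" "j < d - 1" for i j
  proof -
    have "?M $$ (i, j) = mmat b $$ (insert_index k i, insert_index 0 j)"
      using mat_delete_index[of "mmat b" "d - 1" k 0 i j] mmat_carrier[of b] ij deg k by simp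
    then show ?thesis using mmat_bound[OF b] ij by (simp add: insert_index_def)
  qed
  then have "\<bar>det ?M\<bar> \<le> fact (d - 1) * (K * Cc) ^ (d - 1)" by (rule abs_det_le[OF M])
  moreover have "\<bar>adj b k\<bar> = \<bar>det ?M\<bar>"
    using k deg mmat_carrier[of b] by (simp add: adj_def adj_mat_def cofactor_def abs_mult power_abs)
  ultimately show ?thesis by simp
qed

text \<open>Box principle: the (K + 1)^d vectors with coordinates from 0 to K have values in an
  interval of length 2 B K, which is cut into pieces of length 2 B / K^(d - 1). The floor function F
  takes at most K^d + 1 values, fewer than there are vectors because d >= 2. The difference of two
  vectors in one piece is the desired element.\<close>

lemma small_element:
  assumes K: "K \<ge> (1::nat)"
  obtains b where "\<exists>i<d. b i \<noteq> 0" "\<And>i. i < d \<Longrightarrow> \<bar>b i\<bar> \<le> int K" "\<bar>ev b\<bar> * K ^ (d - 1) \<le> 2 * B"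
proof -
  let ?X = "{..<d} \<rightarrow>\<^sub>E {0..int K}"
  obtain e where e: "d = Suc (Suc e)" using deg by (metis add_2_eq_Suc le_Suc_ex)
  define F where "F = (\<lambda>b. \<lfloor>(ev b + K * B) * real K ^ (d - 1) / (2 * B)\<rfloor>)"
  have FX: "F b \<in> {0..int (K ^ d)}" if b: "b \<in> ?X" for b
  proof -
    have "\<bar>of_int (b i)\<bar> \<le> real K" if "i < d" for i using PiE_mem[OF b, of i] that by auto
    then have "\<bar>ev b\<bar> \<le> K * B" by (rule abs_ev_le)
    then have 1: "0 \<le> ev b + K * B" "ev b + K * B \<le> 2 * B * K" by (auto simp: mult.commute)
    have "(ev b + K * B) * real K ^ (d - 1) / (2 * B) \<le> (2 * B * K) * real K ^ (d - 1) / (2 * B)"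
      by (rule divide_right_mono[OF mult_right_mono[OF 1(2)]]) (use B_ge_1 in auto)
    also have "\<dots> = real (K ^ d)" using B_ge_1 by (simp add: e)
    finally have "F b \<le> \<lfloor>real (K ^ d)\<rfloor>" unfolding F_def by (rule floor_mono)
    moreover have "0 \<le> F b" using 1(1) B_ge_1 by (simp add: F_def)
    ultimately show ?thesis unfolding floor_of_nat by simp
  qed
  have "card {0..int (K ^ d)} = K ^ d + 1" by (simp add: nat_add_distrib nat_power_eq)
  moreover have "card ?X = (K + 1) ^ d" by (simp add: card_PiE nat_add_distrib)
  moreover have "K ^ d + 1 < (K + 1) ^ d"
  proof -
    have "(K + 1) ^ d = (K + 1) ^ Suc e * K + (K + 1) ^ e * (K + 1)" by (simp add: e algebra_simps)
    moreover have "K ^ Suc e * K \<le> (K + 1) ^ Suc e * K" by (intro mult_right_mono power_mono) auto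
    moreover have "1 * 2 \<le> (K + 1) ^ e * (K + 1)" using K by (intro mult_mono) auto
    moreover have "K ^ d = K ^ Suc e * K" by (simp add: e)
    ultimately show ?thesis by linarith
  qed
  ultimately have "\<not> inj_on F ?X"
    using FX card_inj_on_le[of F ?X "{0..int (K ^ d)}"] by fastforce
  then obtain b b' where b: "b \<in> ?X" "b' \<in> ?X" "b \<noteq> b'" "F b = F b'" by (auto simp: inj_on_def)
  show ?thesis
  proof (rule that[of "\<lambda>i. b i - b' i"])
    show "\<exists>i<d. b i - b' i \<noteq> 0"
    proof (rule ccontr)
      assume "\<not> (\<exists>i<d. b i - b' i \<noteq> 0)"
      then have "b = b'" by (intro PiE_ext[OF b(1,2)]) simp
      then show False using b(3) by blast
    qed
    show "\<bar>b i - b' i\<bar> \<le> int K" if "i < d" for i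
      using PiE_mem[OF b(1), of i] PiE_mem[OF b(2), of i] that by auto
    have "ev (\<lambda>i. b i - b' i) = ev b - ev b'" by (simp add: ev_def left_diff_distrib sum_subtractf)
    moreover have "\<bar>(ev b + K * B) * real K ^ (d - 1) / (2 * B) - (ev b' + K * B) * real K ^ (d - 1) / (2 * B)\<bar> < 1"
      using b(4) unfolding F_def by linarith
    then have "\<bar>(ev b - ev b') * real K ^ (d - 1) / (2 * B)\<bar> < 1"
      by (simp add: diff_divide_distrib[symmetric] left_diff_distrib[symmetric])
    then have "\<bar>ev b - ev b'\<bar> * real K ^ (d - 1) / (2 * B) < 1" using B_ge_1 by (simp add: abs_mult)
    then have "\<bar>ev b - ev b'\<bar> * real K ^ (d - 1) \<le> 2 * B" using B_ge_1 by (simp add: divide_less_eq)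
    ultimately show "\<bar>ev (\<lambda>i. b i - b' i)\<bar> * real (K ^ (d - 1)) \<le> 2 * B" by simp
  qed
qed

text \<open>The elements provided by \<open>small_element\<close> have bounded norm and arbitrarily
  small nonzero values, so infinitely many absolute values occur. Among them two with different
  absolute values share the norm N and the coordinates modulo N \<rho>. As N is a multiple of each
  in the ring, both quotients of the two have the form 1 + \<rho> t with t in the ring. Distinct
  absolute values ensure that this unit is not a root of unity.\<close>

theorem unit_congruent_one:
  assumes \<rho>: "\<rho> \<noteq> (0::int)"
  obtains t t' :: "int poly" where
    "poly (of_int_poly ((1 + [:\<rho>:] * t) * (1 + [:\<rho>:] * t'))) a = 1" "\<bar>poly (of_int_poly (1 + [:\<rho>:] * t)) a\<bar> \<noteq> 1"
proof -
  define C where "C = \<lceil>2 * B * (fact (d - 1) * of_int Cc ^ (d - 1) * B)\<rceil>"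
  define good where "good = (\<lambda>b. (\<exists>i<d. b i \<noteq> 0) \<and> \<bar>nrm b\<bar> \<le> C)"
  have Cc0: "Cc \<ge> 0" unfolding Cc_def by (intro sum_nonneg) auto
  have ex: "\<exists>b. good b \<and> \<bar>ev b\<bar> * real K ^ (d - 1) \<le> 2 * B" if K: "K \<ge> 1" for K :: nat
  proof -
    obtain b where b: "\<exists>i<d. b i \<noteq> 0" "\<And>i. i < d \<Longrightarrow> \<bar>b i\<bar> \<le> int K" "\<bar>ev b\<bar> * K ^ (d - 1) \<le> 2 * B"
      by (rule small_element[OF K]) blast
    let ?Y = "fact (d - 1) * (real K * of_int Cc) ^ (d - 1)"
    have "\<bar>of_int (adj b k)\<bar> \<le> ?Y" if "k < d" for k
    proof -
      have "real_of_int \<bar>adj b k\<bar> \<le> of_int (fact (d - 1) * (int K * Cc) ^ (d - 1))"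
        using adj_bound[OF b(2) that] by (simp only: of_int_le_iff)
      then show ?thesis by simp
    qed
    then have "\<bar>ev (adj b)\<bar> \<le> ?Y * B" by (rule abs_ev_le)
    then have "\<bar>real_of_int (nrm b)\<bar> \<le> \<bar>ev b\<bar> * (?Y * B)"
      unfolding nrm_eq abs_mult by (rule mult_left_mono) simp
    also have "\<dots> = (\<bar>ev b\<bar> * K ^ (d - 1)) * (fact (d - 1) * of_int Cc ^ (d - 1) * B)"
      by (simp add: power_mult_distrib)
    also have "\<dots> \<le> 2 * B * (fact (d - 1) * of_int Cc ^ (d - 1) * B)"
      by (rule mult_right_mono[OF b(3)]) (use Cc0 B_ge_1 in auto)
    finally have "\<bar>nrm b\<bar> \<le> C" unfolding C_def by linarith
    then show ?thesis using b by (auto simp: good_def)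
  qed
  define R where "R = (\<lambda>b. \<bar>ev b\<bar>) ` Collect good"
  have pos: "ev b \<noteq> 0" "nrm b \<noteq> 0" if "good b" for b
    using that ev_eq_0 nrm_nonzero by (auto simp: good_def)
  have infR: "infinite R"
  proof
    assume fin: "finite R"
    have ne: "R \<noteq> {}" using ex[of 1] by (auto simp: R_def)
    have "Min R \<in> R" by (rule Min_in[OF fin ne])
    then have mp: "Min R > 0" using pos by (auto simp: R_def)
    obtain K0 :: nat where K0: "real K0 > 2 * B / Min R" using reals_Archimedean2 by blast
    define K where "K = Suc K0"
    obtain b where b: "good b" "\<bar>ev b\<bar> * real K ^ (d - 1) \<le> 2 * B" using ex[of K] by (auto simp: K_def)
    have "Min R \<le> \<bar>ev b\<bar>" using fin b(1) by (intro Min_le) (auto simp: R_def)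
    moreover have "real K ^ 1 \<le> real K ^ (d - 1)" using deg by (intro power_increasing) (auto simp: K_def)
    ultimately have "Min R * real K ^ 1 \<le> \<bar>ev b\<bar> * real K ^ (d - 1)" by (intro mult_mono) auto
    then have "Min R * real K \<le> 2 * B" using b(2) by simp
    moreover have "2 * B < Min R * real K"
    proof -
      have "2 * B < real K0 * Min R" using K0 mp by (simp add: divide_less_eq)
      also have "\<dots> \<le> Min R * real K" using mp by (simp add: K_def algebra_simps)
      finally show ?thesis .
    qed
    ultimately show False by simp
  qed
  define sel where "sel = (\<lambda>r. SOME b. good b \<and> \<bar>ev b\<bar> = r)"
  have sel: "good (sel r)" "\<bar>ev (sel r)\<bar> = r" if "r \<in> R" for r
  proof -
    have "\<exists>b. good b \<and> \<bar>ev b\<bar> = r" using that by (auto simp: R_def)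
    then have "good (sel r) \<and> \<bar>ev (sel r)\<bar> = r" unfolding sel_def by (rule someI_ex)
    then show "good (sel r)" "\<bar>ev (sel r)\<bar> = r" by auto
  qed
  \<comment> \<open>The modulus contains the norm besides \<rho>, because the norm is used up in the
    division by the other element.\<close>
  define key where "key = (\<lambda>b. (nrm b, (\<lambda>i\<in>{..<d}. b i mod (nrm b * \<rho>))))"
  define M where "M = C * \<bar>\<rho>\<bar>"
  have "key b \<in> {- C..C} \<times> ({..<d} \<rightarrow>\<^sub>E {- M..M})" if b: "good b" for b
  proof -
    have N: "\<bar>nrm b\<bar> \<le> C" "nrm b * \<rho> \<noteq> 0" using b pos(2) \<rho> by (auto simp: good_def)
    have "\<bar>nrm b * \<rho>\<bar> \<le> M" unfolding M_def abs_mult by (rule mult_right_mono[OF N(1)]) simp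
    moreover have "\<bar>x mod (nrm b * \<rho>)\<bar> < \<bar>nrm b * \<rho>\<bar>" for x by (rule abs_mod_less[OF N(2)])
    ultimately have "\<bar>x mod (nrm b * \<rho>)\<bar> \<le> M" for x using order.strict_trans2 less_imp_le by meson
    then have "x mod (nrm b * \<rho>) \<in> {- M..M}" for x by (simp add: abs_le_iff minus_le_iff)
    then have "(\<lambda>i\<in>{..<d}. b i mod (nrm b * \<rho>)) \<in> {..<d} \<rightarrow>\<^sub>E {- M..M}" by (intro restrict_PiE_iff[THEN iffD2]) blast
    then show ?thesis using N(1) by (auto simp: key_def)
  qed
  then have "(\<lambda>r. key (sel r)) ` R \<subseteq> {- C..C} \<times> ({..<d} \<rightarrow>\<^sub>E {- M..M})" using sel by blast
  moreover have "finite ({- C..C} \<times> ({..<d} \<rightarrow>\<^sub>E {- M..M}))" by (intro finite_cartesian_product finite_PiE) auto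
  ultimately have "finite ((\<lambda>r. key (sel r)) ` R)" by (rule finite_subset)
  then obtain r0 where r0: "infinite {r \<in> R. key (sel r) = key (sel r0)}"
    using pigeonhole_infinite[OF infR] by blast
  then obtain r1 r2 where r: "r1 \<in> R" "r2 \<in> R" "key (sel r1) = key (sel r2)" "r1 \<noteq> r2"
  proof -
    obtain x where x: "x \<in> {r \<in> R. key (sel r) = key (sel r0)}" using r0 by (metis (no_types, lifting) finite.emptyI all_not_in_conv)
    have "infinite ({r \<in> R. key (sel r) = key (sel r0)} - {x})" using r0 by simp
    then obtain y where "y \<in> {r \<in> R. key (sel r) = key (sel r0)} - {x}" by (metis (no_types, lifting) finite.emptyI all_not_in_conv)
    then show ?thesis using that[of x y] x by auto
  qed
  define b1 b2 where "b1 = sel r1" and "b2 = sel r2"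
  define N where "N = nrm b1"
  have g: "good b1" "good b2" and ra: "\<bar>ev b1\<bar> = r1" "\<bar>ev b2\<bar> = r2" using sel r by (auto simp: b1_def b2_def)
  have N2: "nrm b2 = N" using r(3) by (simp add: key_def b1_def b2_def N_def)
  have cong: "b1 i mod (N * \<rho>) = b2 i mod (N * \<rho>)" if "i < d" for i
  proof -
    have "(\<lambda>i\<in>{..<d}. b1 i mod (N * \<rho>)) = (\<lambda>i\<in>{..<d}. b2 i mod (N * \<rho>))"
      using conjunct2[OF r(3)[unfolded key_def prod.inject, folded b1_def b2_def]] unfolding N2 N_def[symmetric] .
    then have "(\<lambda>i\<in>{..<d}. b1 i mod (N * \<rho>)) i = (\<lambda>i\<in>{..<d}. b2 i mod (N * \<rho>)) i" by (rule arg_cong)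
    then show ?thesis using that by simp
  qed
  define h where "h = (\<lambda>i. (b2 i - b1 i) div (N * \<rho>))"
  have "b2 i - b1 i = N * \<rho> * h i" if "i < d" for i
    using cong[OF that] unfolding h_def by (metis dvd_mult_div_cancel mod_eq_dvd_iff)
  then have "ev b2 - ev b1 = of_int (N * \<rho>) * ev h"
    by (simp add: ev_def sum_subtractf[symmetric] left_diff_distrib[symmetric] sum_distrib_left mult.assoc flip: of_int_diff)
  then have e21: "ev b2 = ev b1 + of_int N * of_int \<rho> * ev h" by simp
  have n1: "of_int N = ev b1 * ev (adj b1)" and n2: "of_int N = ev b2 * ev (adj b2)"
    using nrm_eq[of b1] nrm_eq[of b2] N2 by (auto simp: N_def)
  have nz: "ev b1 \<noteq> 0" "ev b2 \<noteq> 0" using pos g by auto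
  define pl where "pl = (\<lambda>b. \<Sum>i<d. monom (b i :: int) i)"
  have pl: "poly (of_int_poly (pl b)) a = ev b" for b unfolding pl_def by (rule ev_poly)
  have E1: "ev b1 * (1 + of_int \<rho> * (ev h * ev (adj b1))) = ev b2"
    unfolding e21 n1 by (simp add: algebra_simps)
  have E2: "ev b2 * (1 + of_int \<rho> * (- ev h * ev (adj b2))) = ev b1"
    using e21 n2 by (simp add: algebra_simps)
  let ?t = "pl h * pl (adj b1)" and ?t' = "- pl h * pl (adj b2)"
  have pc: "poly (of_int_poly [:\<rho>:]) a = of_int \<rho>" by (simp add: of_int_hom.map_poly_pCons_hom)
  have v: "poly (of_int_poly (1 + [:\<rho>:] * ?t)) a = 1 + of_int \<rho> * (ev h * ev (adj b1))"
    "poly (of_int_poly (1 + [:\<rho>:] * ?t')) a = 1 + of_int \<rho> * (- ev h * ev (adj b2))"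
    using pc by (simp_all only: of_int_poly_hom.hom_add of_int_poly_hom.hom_mult of_int_poly_hom.hom_uminus of_int_poly_hom.hom_one
        poly_add poly_mult poly_minus poly_1 pl)
  show ?thesis
  proof (rule that[of ?t ?t'])
    have "ev b1 * ((1 + of_int \<rho> * (ev h * ev (adj b1))) * (1 + of_int \<rho> * (- ev h * ev (adj b2)))) = ev b1"
      using E1 E2 by (simp only: mult.assoc[symmetric])
    then show "poly (of_int_poly ((1 + [:\<rho>:] * ?t) * (1 + [:\<rho>:] * ?t'))) a = 1"
      unfolding of_int_poly_hom.hom_mult[of "1 + _"] poly_mult v using nz(1) by simp
    show "\<bar>poly (of_int_poly (1 + [:\<rho>:] * ?t)) a\<bar> \<noteq> 1"
    proof
      assume "\<bar>poly (of_int_poly (1 + [:\<rho>:] * ?t)) a\<bar> = 1"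
      then have "\<bar>ev b1\<bar> * \<bar>1 + of_int \<rho> * (ev h * ev (adj b1))\<bar> = \<bar>ev b1\<bar>" unfolding v by simp
      then have "\<bar>ev b2\<bar> = \<bar>ev b1\<bar>" unfolding abs_mult[symmetric] E1 .
      then show False using ra r(4) by simp
    qed
  qed
qed

end

section \<open>Symmetric integer matrices\<close>

locale symmetric_integer_operator =
  fixes I :: "'i set" and L :: "'i \<Rightarrow> 'i \<Rightarrow> int"
  assumes finI: "finite I" and sym: "\<And>i j. i \<in> I \<Longrightarrow> j \<in> I \<Longrightarrow> L i j = L j i"
begin

definition T :: "('i \<Rightarrow> 'a :: comm_ring_1) \<Rightarrow> 'i \<Rightarrow> 'a" where
  "T v = (\<lambda>i. if i \<in> I then \<Sum>j\<in>I. of_int (L i j) * v j else 0)"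

text \<open>The polynomial P in the operator \<open>T\<close>, applied to v by Horner's scheme. The
  coefficient ring is left open: annihilation is stated for integer vectors, while eigenvectors are
  complex.\<close>

definition pe :: "int poly \<Rightarrow> ('i \<Rightarrow> 'a :: comm_ring_1) \<Rightarrow> 'i \<Rightarrow> 'a" where
  "pe P v = fold_coeffs (\<lambda>c w i. of_int c * v i + T w i) P (\<lambda>i. 0)"

definition supp :: "('i \<Rightarrow> 'a :: comm_ring_1) \<Rightarrow> bool" where
  "supp v \<longleftrightarrow> (\<forall>i. i \<notin> I \<longrightarrow> v i = 0)"

lemma T_0 [simp]: "T (\<lambda>i. 0) = (\<lambda>i. 0)"
  by (auto simp: T_def)

lemma T_add: "T (\<lambda>i. v i + w i) = (\<lambda>i. T v i + T w i)"
  by (auto simp: T_def distrib_left sum.distrib)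

lemma T_scale: "T (\<lambda>i. c * v i) = (\<lambda>i. c * T v i)"
  by (auto simp: T_def sum_distrib_left mult_ac)

lemma pe_0 [simp]: "pe 0 v = (\<lambda>i. 0)"
  by (simp add: pe_def)

lemma pe_pCons: "pe (pCons a P) v = (\<lambda>i. of_int a * v i + T (pe P v) i)"
  by (cases "P = 0"; cases "a = 0") (simp_all add: pe_def)

lemma pe_add: "pe (P + Q) v = (\<lambda>i. pe P v i + pe Q v i)"
  by (induction P Q rule: poly_induct2) (simp_all add: pe_pCons T_add algebra_simps)

lemma pe_smult: "pe (Polynomial.smult c P) v = (\<lambda>i. of_int c * pe P v i)"
  by (induction P) (simp_all add: pe_pCons T_scale algebra_simps)

lemma pe_vadd: "pe P (\<lambda>i. v i + w i) = (\<lambda>i. pe P v i + pe P w i)"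
  by (induction P) (simp_all add: pe_pCons T_add algebra_simps)

lemma pe_vscale: "pe P (\<lambda>i. c * v i) = (\<lambda>i. c * pe P v i)"
  by (induction P) (simp_all add: pe_pCons T_scale algebra_simps)

lemma pe_zero [simp]: "pe P (\<lambda>i. 0) = (\<lambda>i. 0)"
  by (induction P) (simp_all add: pe_pCons)

lemma pe_1 [simp]: "pe 1 v = v"
  by (simp add: one_pCons pe_pCons)

lemma pe_mult: "pe (P * Q) v = pe P (pe Q v)"
  by (induction P) (simp_all add: pe_pCons pe_add pe_smult)

lemma pe_sum: "pe (\<Sum>x\<in>S. P x) v = (\<lambda>i. \<Sum>x\<in>S. pe (P x) v i)"
  by (induction S rule: infinite_finite_induct) (simp_all add: pe_add)

lemma pe_vsum: "pe P (\<lambda>i. \<Sum>x\<in>S. v x i) = (\<lambda>i. \<Sum>x\<in>S. pe P (v x) i)"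
  by (induction S rule: infinite_finite_induct) (simp_all add: pe_vadd)

lemma pe_supp: "supp v \<Longrightarrow> supp (pe P v)"
  by (induction P) (auto simp: pe_pCons supp_def T_def)

lemma pe_of_int: "pe P (\<lambda>i. of_int (v i)) = (\<lambda>i. of_int (pe P v i) :: 'a :: comm_ring_1)"
proof (induction P)
  case (pCons a P)
  have "T (\<lambda>i. of_int (w i)) = (\<lambda>i. of_int (T w i) :: 'a)" for w :: "'i \<Rightarrow> int"
    by (auto simp: T_def)
  then show ?case using pCons by (simp add: pe_pCons)
qed simp

definition kills :: "int poly \<Rightarrow> bool" where
  "kills P \<longleftrightarrow> (\<forall>v :: 'i \<Rightarrow> int. supp v \<longrightarrow> pe P v = (\<lambda>i. 0))"

lemma kills_dvd: "kills P \<Longrightarrow> P dvd Q \<Longrightarrow> kills Q"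
  unfolding kills_def by (auto simp: mult.commute[of P] pe_mult)

lemma T_selfadjoint: "(\<Sum>i\<in>I. T v i * w i) = (\<Sum>i\<in>I. v i * T w i)"
proof -
  have "(\<Sum>i\<in>I. T v i * w i) = (\<Sum>i\<in>I. \<Sum>j\<in>I. of_int (L i j) * v j * w i)"
    by (simp add: T_def sum_distrib_right)
  also have "\<dots> = (\<Sum>j\<in>I. \<Sum>i\<in>I. of_int (L j i) * v j * w i)"
    by (subst sum.swap) (simp add: sym)
  also have "\<dots> = (\<Sum>i\<in>I. v i * T w i)"
    by (simp add: T_def sum_distrib_left mult_ac)
  finally show ?thesis .
qed

lemma pe_selfadjoint: "(\<Sum>i\<in>I. pe P v i * w i) = (\<Sum>i\<in>I. v i * pe P w i)"
proof (induction P arbitrary: v w)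
  case (pCons a P)
  have "pe P (T w) = T (pe P w)"
    using pe_mult[of P "[:0, 1:]" w] pe_mult[of "[:0, 1:]" P w] by (simp add: mult.commute pe_pCons)
  then have "(\<Sum>i\<in>I. T (pe P v) i * w i) = (\<Sum>i\<in>I. v i * T (pe P w) i)"
    unfolding T_selfadjoint pCons.IH by simp
  then show ?case by (simp add: pe_pCons distrib_left distrib_right sum.distrib mult_ac)
qed simp

text \<open>By symmetry the squared length of P^j v is the inner product of v with P^(2 j) v. If the
  latter vanishes, so does P^j v, as a sum of integer squares is 0 only trivially. With j = k - 1
  this lowers the exponent as long as k >= 2.\<close>

lemma kills_reduced:
  assumes "kills (P ^ k)" "k \<ge> 1"
  shows "kills P"
  using assms
proof (induction k rule: less_induct)
  case (less k)
  show ?case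
  proof (cases "k = 1")
    case False
    define j where "j = k - 1"
    have j: "j \<ge> 1" "j < k" "k \<le> 2 * j" using False less.prems by (auto simp: j_def)
    have K: "kills (P ^ j * P ^ j)"
      by (rule kills_dvd[OF less.prems(1)]) (use j in \<open>simp add: power_add[symmetric] mult_2[symmetric] le_imp_power_dvd\<close>)
    have "kills (P ^ j)" unfolding kills_def
    proof (intro allI impI)
      fix v :: "'i \<Rightarrow> int" assume v: "supp v"
      let ?w = "pe (P ^ j) v"
      have "(\<Sum>i\<in>I. ?w i * ?w i) = (\<Sum>i\<in>I. v i * pe (P ^ j) ?w i)" by (rule pe_selfadjoint)
      also have "\<dots> = 0" using K v unfolding kills_def pe_mult by simp
      finally have "?w i * ?w i = 0" if "i \<in> I" for i
        using that sum_nonneg_eq_0_iff[OF finI, of "\<lambda>i. ?w i * ?w i"] by simp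
      then show "?w = (\<lambda>i. 0)" using pe_supp[OF v, of "P ^ j"] by (auto simp: supp_def fun_eq_iff)
    qed
    then show ?thesis using less.IH j by blast
  qed (use less.prems in simp)
qed

lemma supp_expansion:
  assumes "supp v"
  shows "v = (\<lambda>x. \<Sum>y\<in>I. v y * (if x = y then 1 else 0))"
  using assms finI by (auto simp: supp_def fun_eq_iff if_distrib[of "\<lambda>z. _ * z"] cong: if_cong)

definition h :: "nat \<Rightarrow> 'i" where "h = (SOME h. bij_betw h {..<card I} I)"

lemma h: "bij_betw h {..<card I} I"
proof -
  have "\<exists>h. bij_betw h {..<card I} I"
    using ex_bij_betw_nat_finite[OF finI] by (simp add: atLeast0LessThan)
  then show ?thesis unfolding h_def by (rule someI_ex)
qed

lemma h_I: "i < card I \<Longrightarrow> h i \<in> I"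
  using h by (auto simp: bij_betw_def)

lemma sum_h: "(\<Sum>x\<in>I. F x) = (\<Sum>i<card I. F (h i))"
  using sum.reindex_bij_betw[OF h, of F] by simp

definition A :: "int mat" where "A = mat (card I) (card I) (\<lambda>(i, j). L (h i) (h j))"

lemma A_carrier: "A \<in> carrier_mat (card I) (card I)"
  by (simp add: A_def)

text \<open>The determinant trick: the column of unit vectors is annihilated by the matrix \<open>X - A\<close>,
  hence by its determinant.\<close>

lemma kills_char_poly: "kills (char_poly A)"
proof -
  let ?n = "card I"
  let ?M = "char_poly_matrix A"
  define e where "e = (\<lambda>j x. if x = h j then 1 else (0 :: int))"
  have M: "?M \<in> carrier_mat ?n ?n" using A_carrier by simp
  note am = adj_mat[OF M]
  have Mij: "?M $$ (i, j) = (if i = j then [:0, 1:] else 0) + [:- L (h i) (h j):]" if "i < ?n" "j < ?n" for i j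
    using that by (simp add: char_poly_matrix_def A_def)
  have row: "(\<Sum>j<?n. pe (?M $$ (i, j)) (e j) x) = 0" if i: "i < ?n" for i x
  proof -
    have "(\<Sum>j<?n. pe (?M $$ (i, j)) (e j) x) = (\<Sum>j<?n. (if i = j then T (e j) x else 0) - L (h i) (h j) * e j x)"
      by (rule sum.cong) (use i in \<open>auto simp: Mij pe_add pe_pCons\<close>)
    also have "\<dots> = T (e i) x - (\<Sum>j<?n. L (h i) (h j) * e j x)"
      using i by (simp add: sum_subtractf)
    also have "(\<Sum>j<?n. L (h i) (h j) * e j x) = (\<Sum>y\<in>I. L (h i) y * (if x = y then 1 else 0))"
      by (simp add: sum_h e_def)
    also have "\<dots> = (if x \<in> I then L (h i) x else 0)"
      using finI by (simp add: if_distrib[of "\<lambda>z. _ * z"] cong: if_cong)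
    also have "T (e i) x = (if x \<in> I then L x (h i) else 0)"
      using finI h_I[OF i] by (simp add: T_def e_def if_distrib[of "\<lambda>z. _ * z"] cong: if_cong)
    finally show ?thesis using sym h_I[OF i] by simp
  qed
  have ek: "pe (char_poly A) (e k) = (\<lambda>x. 0)" if k: "k < ?n" for k
  proof
    fix x
    have entry: "(\<Sum>i<?n. adj_mat ?M $$ (k, i) * ?M $$ (i, j)) = (if k = j then char_poly A else 0)" if j: "j < ?n" for j
    proof -
      have "(adj_mat ?M * ?M) $$ (k, j) = (\<Sum>i<?n. adj_mat ?M $$ (k, i) * ?M $$ (i, j))"
        using am(1) M k j by (subst index_mult_mat) (auto simp: scalar_prod_def atLeast0LessThan)
      then show ?thesis unfolding am(3) using k j by (auto simp: char_poly_def)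
    qed
    have "pe (char_poly A) (e k) x = (\<Sum>j<?n. pe (if k = j then char_poly A else 0) (e j) x)"
      using k by (simp add: if_distrib[of pe] if_distrib[of "\<lambda>f. f _"] cong: if_cong)
    also have "\<dots> = (\<Sum>j<?n. \<Sum>i<?n. pe (adj_mat ?M $$ (k, i)) (pe (?M $$ (i, j)) (e j)) x)"
      by (rule sum.cong) (simp_all add: entry[symmetric] pe_sum pe_mult)
    also have "\<dots> = (\<Sum>i<?n. pe (adj_mat ?M $$ (k, i)) (\<lambda>x. \<Sum>j<?n. pe (?M $$ (i, j)) (e j) x) x)"
      by (subst sum.swap) (simp add: pe_vsum)
    also have "\<dots> = 0" using row by simp
    finally show "pe (char_poly A) (e k) x = 0" .
  qed
  show ?thesis unfolding kills_def
  proof (intro allI impI)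
    fix v :: "'i \<Rightarrow> int" assume v: "supp v"
    have ve: "v = (\<lambda>x. \<Sum>k<?n. v (h k) * e k x)"
      using supp_expansion[OF v] unfolding sum_h e_def .
    have "pe (char_poly A) v = pe (char_poly A) (\<lambda>x. \<Sum>k<?n. v (h k) * e k x)"
      by (rule arg_cong[OF ve])
    also have "\<dots> = (\<lambda>x. \<Sum>k<?n. v (h k) * pe (char_poly A) (e k) x)"
      by (simp add: pe_vsum pe_vscale)
    finally show "pe (char_poly A) v = (\<lambda>i. 0)" using ek by simp
  qed
qed

lemma real_eigenvector:
  fixes \<alpha> :: complex
  assumes root: "poly (of_int_poly (char_poly A)) \<alpha> = 0"
  obtains a :: real and Y :: "'i \<Rightarrow> complex" where "\<alpha> = of_real a" "supp Y" "Y \<noteq> (\<lambda>i. 0)"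
    "T Y = (\<lambda>i. \<alpha> * Y i)"
proof -
  let ?n = "card I"
  let ?A = "map_mat of_int A :: complex mat"
  have cA: "?A \<in> carrier_mat ?n ?n" using A_carrier by simp
  have "poly (char_poly ?A) \<alpha> = 0" using root by (simp add: of_int_hom.char_poly_hom[OF A_carrier])
  then have "eigenvalue ?A \<alpha>" using eigenvalue_root_char_poly[OF cA] by blast
  then obtain y where y: "y \<in> carrier_vec ?n" "y \<noteq> 0\<^sub>v ?n" "?A *\<^sub>v y = \<alpha> \<cdot>\<^sub>v y"
    using A_carrier by (auto simp: eigenvalue_def eigenvector_def)
  define k where "k = inv_into {..<?n} h"
  have k: "k (h i) = i" if "i < ?n" for i
    using that h inv_into_f_f[of h "{..<?n}" i] by (simp add: k_def bij_betw_def)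
  define Y where "Y = (\<lambda>x. if x \<in> I then y $ k x else 0)"
  have Yh: "Y (h i) = y $ i" if "i < ?n" for i using that h_I k by (simp add: Y_def)
  have TY: "T Y (h i) = \<alpha> * Y (h i)" if i: "i < ?n" for i
  proof -
    have "T Y (h i) = (\<Sum>j<?n. of_int (L (h i) (h j)) * y $ j)"
      using h_I[OF i] by (simp add: T_def sum_h Yh)
    also have "\<dots> = (?A *\<^sub>v y) $ i"
      using i y(1) by (simp add: A_def scalar_prod_def atLeast0LessThan)
    finally show ?thesis using y i by (simp add: Yh)
  qed
  have surj: "\<exists>i<?n. x = h i" if "x \<in> I" for x using h that by (auto simp: bij_betw_def)
  have TYx: "T Y = (\<lambda>x. \<alpha> * Y x)"
  proof
    fix x show "T Y x = \<alpha> * Y x"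
    proof (cases "x \<in> I")
      case True then show ?thesis using surj TY by blast
    next
      case False then show ?thesis by (simp add: T_def Y_def)
    qed
  qed
  have Y0: "Y \<noteq> (\<lambda>i. 0)"
  proof
    assume "Y = (\<lambda>i. 0)"
    then have "y $ i = 0" if "i < ?n" for i using Yh that by metis
    then have "y = 0\<^sub>v ?n" using y(1) by (intro eq_vecI) auto
    then show False using y(2) by blast
  qed
  have sY: "supp Y" by (simp add: supp_def Y_def)
  define s where "s = (\<Sum>x\<in>I. Y x * cnj (Y x))"
  have cT: "T (\<lambda>x. cnj (Y x)) = (\<lambda>x. cnj \<alpha> * cnj (Y x))"
  proof -
    have "T (\<lambda>x. cnj (Y x)) = (\<lambda>x. cnj (T Y x))" by (auto simp: T_def)
    then show ?thesis by (simp add: TYx)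
  qed
  have "\<alpha> * s = (\<Sum>x\<in>I. T Y x * cnj (Y x))" by (simp add: TYx s_def sum_distrib_left mult.assoc)
  also have "\<dots> = cnj \<alpha> * s" unfolding T_selfadjoint cT by (simp add: s_def sum_distrib_left mult_ac)
  finally have "\<alpha> = cnj \<alpha> \<or> s = 0" by (simp only: mult_cancel_right disj_commute)
  moreover have "s \<noteq> 0"
  proof
    assume "s = 0"
    have "s = of_real (\<Sum>x\<in>I. (cmod (Y x))\<^sup>2)" unfolding s_def of_real_sum complex_norm_square ..
    then have "(\<Sum>x\<in>I. (cmod (Y x))\<^sup>2) = 0" using \<open>s = 0\<close> by (metis of_real_eq_0_iff)
    then have "\<forall>x\<in>I. (cmod (Y x))\<^sup>2 = 0" using sum_nonneg_eq_0_iff[OF finI, of "\<lambda>x. (cmod (Y x))\<^sup>2"] by simp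
    then have "Y x = 0" for x using sY by (cases "x \<in> I") (auto simp: supp_def)
    then show False using Y0 by blast
  qed
  ultimately have "\<alpha> \<in> \<real>" by (simp add: Reals_cnj_iff)
  then obtain a where "\<alpha> = of_real a" by (auto elim: Reals_cases)
  then show ?thesis using that sY Y0 TYx by blast
qed

lemma pe_eigenvector:
  assumes "T Y = (\<lambda>i. \<alpha> * Y i)"
  shows "pe P Y = (\<lambda>i. poly (of_int_poly P) \<alpha> * Y i)"
proof (induction P)
  case (pCons c P)
  have "T (\<lambda>i. poly (of_int_poly P) \<alpha> * Y i) = (\<lambda>i. poly (of_int_poly P) \<alpha> * (\<alpha> * Y i))"
    unfolding T_scale assms by simp
  then show ?case using pCons by (simp add: pe_pCons of_int_hom.map_poly_pCons_hom algebra_simps)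
qed simp

text \<open>If every irreducible factor of the characteristic polynomial divides the product of the
  X - a over its integer roots, \<open>kills_reduced\<close> shows that this squarefree product
  annihilates. Otherwise there is a monic irreducible factor f of degree at least 2; its roots are
  real. Then f g' annihilates for some g' not divisible by f, and u f + w g' = \<rho>. Units 1 +
  \<rho> t and 1 + \<rho> t' at a root a give E = 1 + t w g' and E' likewise: E is 1 modulo g' and 1
  + \<rho> t modulo f, so E E' = 1 modulo f g'. On an eigenvector for a, E acts by a number of
  absolute value other than 1, so no positive power of E is the identity.\<close>

theorem integral_spectrum_or_unit:
  "(\<exists>S. finite S \<and> kills (\<Prod>a\<in>S. [:- a, 1:])) \<or>
   (\<exists>E E'. (\<forall>v :: 'i \<Rightarrow> int. supp v \<longrightarrow> pe E (pe E' v) = v) \<and>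
      (\<forall>j>0. \<exists>v :: 'i \<Rightarrow> int. supp v \<and> pe (E ^ j) v \<noteq> v))"
proof -
  define P0 where "P0 = char_poly A"
  have kP: "kills P0" unfolding P0_def by (rule kills_char_poly)
  have mon: "monic P0" unfolding P0_def using degree_monic_char_poly[OF A_carrier] by simp
  then have P00: "P0 \<noteq> 0" by auto
  define S where "S = {a. poly P0 a = 0}"
  have finS: "finite S" unfolding S_def by (rule poly_roots_finite[OF P00])
  show ?thesis
  proof (cases "\<forall>f. irreducible f \<longrightarrow> f dvd P0 \<longrightarrow> f dvd (\<Prod>a\<in>S. [:- a, 1:])")
    case True
    then obtain k where "P0 dvd (\<Prod>a\<in>S. [:- a, 1:]) ^ k" using dvd_power_if_prime_factors_dvd[OF P00] by blast
    then have "P0 dvd (\<Prod>a\<in>S. [:- a, 1:]) ^ Suc k" by (simp add: dvd_mult)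
    then have "kills ((\<Prod>a\<in>S. [:- a, 1:]) ^ Suc k)" by (rule kills_dvd[OF kP])
    then have "kills (\<Prod>a\<in>S. [:- a, 1:])" by (rule kills_reduced) simp
    then show ?thesis using finS by blast
  next
    case False
    then obtain f0 where f0: "irreducible f0" "f0 dvd P0" "\<not> f0 dvd (\<Prod>a\<in>S. [:- a, 1:])" by blast
    obtain g0 where g0: "P0 = f0 * g0" using f0(2) by blast
    have "lead_coeff f0 * lead_coeff g0 = 1" using mon g0 by (simp add: lead_coeff_mult)
    then have "lead_coeff f0 = 1 \<or> lead_coeff f0 = -1" by (metis zmult_eq_1_iff)
    then obtain f where f: "irreducible f" "f dvd P0" "\<not> f dvd (\<Prod>a\<in>S. [:- a, 1:])" "lead_coeff f = 1"
    proof
      assume "lead_coeff f0 = -1"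
      moreover have "irreducible (- f0)" using f0(1) irreducible_mult_unit_left[of "-1" f0] by simp
      ultimately show ?thesis using that[of "- f0"] f0 by simp
    qed (use f0 that in blast)
    have deg: "degree f \<ge> 2"
    proof (rule ccontr)
      assume "\<not> degree f \<ge> 2"
      then consider "degree f = 0" | "degree f = 1" by linarith
      then show False
      proof cases
        case 1
        then obtain c where c: "f = [:c:]" by (rule degree_eq_zeroE)
        then have "f = 1" using f(4) by (simp add: one_pCons)
        then show False using f(1) by simp
      next
        case 2
        then obtain b c where "f = [:b, c:]" by (metis degree1_coeffs)
        then have fb: "f = [:- (- b), 1:]" using f(4) 2 by auto
        then have "poly P0 (- b) = 0" using f(2) by (simp add: poly_eq_0_iff_dvd)
        then have "- b \<in> S" by (simp add: S_def)
        then have "f dvd (\<Prod>a\<in>S. [:- a, 1:])" unfolding fb using dvd_prodI[OF finS, of "- b" "\<lambda>a. [:- a, 1:]"] by simp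
        then show False using f(3) by blast
      qed
    qed
    have df: "degree (of_int_poly f :: complex poly) = degree f" by simp
    then obtain \<alpha> :: complex where \<alpha>: "poly (of_int_poly f) \<alpha> = 0"
      using fundamental_theorem_of_algebra[of "of_int_poly f :: complex poly"] deg by (auto simp: constant_degree)
    have "poly (of_int_poly P0) \<alpha> = 0"
      using f(2) \<alpha> by (auto elim!: dvdE simp: of_int_poly_hom.hom_mult)
    then obtain a Y where aY: "\<alpha> = of_real a" "supp Y" "Y \<noteq> (\<lambda>i. 0)" "T Y = (\<lambda>i. \<alpha> * Y i)"
      unfolding P0_def by (rule real_eigenvector)
    have polyR: "poly (of_int_poly g) (of_real a :: complex) = of_real (poly (of_int_poly g) a)" for g
      by (induction g) (simp_all add: of_int_hom.map_poly_pCons_hom)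
    have fa: "poly (of_int_poly f) a = 0" using \<alpha> unfolding aY(1) polyR by simp
    interpret F: real_algebraic_integer f a by unfold_locales (use f deg fa in auto)
    have nu: "\<not> is_unit f" using f(1) by (simp add: irreducible_def)
    obtain g' where g': "P0 = f ^ multiplicity f P0 * g'" "\<not> f dvd g'"
      by (rule multiplicity_decompose'[OF P00 nu])
    define e where "e = multiplicity f P0"
    have e1: "e \<ge> 1"
    proof (rule ccontr)
      assume "\<not> e \<ge> 1"
      then have "e = 0" by simp
      then have "P0 = g'" using g'(1)[folded e_def] by (simp only: power_0 mult_1_left)
      then show False using f(2) g'(2) by simp
    qed
    have "P0 dvd (f * g') ^ e"
    proof -
      have "f ^ e * g' dvd f ^ e * g' ^ e" using e1 by (intro mult_dvd_mono) (auto intro: dvd_power)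
      then show ?thesis using g'(1) by (simp add: e_def power_mult_distrib)
    qed
    then have km: "kills (f * g')" using kills_reduced[OF kills_dvd[OF kP] e1] by blast
    have dpos: "degree f > 0" using deg by simp
    obtain u w \<rho> where uw: "\<rho> \<noteq> 0" "u * f + w * g' = [:\<rho>:]"
      by (rule bezout_irreducible[OF f(1) dpos g'(2)])
    obtain t t' where t: "poly (of_int_poly ((1 + [:\<rho>:] * t) * (1 + [:\<rho>:] * t'))) a = 1"
        "\<bar>poly (of_int_poly (1 + [:\<rho>:] * t)) a\<bar> \<noteq> 1"
      by (rule F.unit_congruent_one[OF uw(1)])
    define E E' where "E = 1 + t * (w * g')" and "E' = 1 + t' * (w * g')"
    let ?ev = "\<lambda>g. poly (of_int_poly g) a"
    have wg: "w * g' = [:\<rho>:] - u * f" using uw(2) by (simp add: algebra_simps)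
    have Ef: "E = (1 + [:\<rho>:] * t) - f * (t * u)" "E' = (1 + [:\<rho>:] * t') - f * (t' * u)"
      unfolding E_def E'_def wg by (simp_all add: algebra_simps)
    have evE: "?ev E = ?ev (1 + [:\<rho>:] * t)" "?ev E' = ?ev (1 + [:\<rho>:] * t')"
      unfolding Ef of_int_poly_hom.hom_minus poly_diff of_int_poly_hom.hom_mult[of f] poly_mult fa by simp_all
    have "?ev (E * E' - 1) = 0"
      using t(1) unfolding of_int_poly_hom.hom_minus poly_diff of_int_poly_hom.hom_mult poly_mult evE by simp
    then have "f dvd E * E' - 1" by (rule irreducible_dvd_of_root[OF f(1) dpos fa])
    moreover have EE: "E * E' - 1 = g' * (w * (t + t' + t * t' * (w * g')))"
      unfolding E_def E'_def by (simp add: algebra_simps)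
    ultimately have "f dvd w * (t + t' + t * t' * (w * g'))"
      using prime_elem_dvd_multD[OF irreducible_imp_prime_elem[OF f(1)]] g'(2) by metis
    then have "f * g' dvd E * E' - 1" unfolding EE by (simp add: mult.commute mult_dvd_mono)
    then have kE: "kills (E * E' - 1)" by (rule kills_dvd[OF km])
    have "pe E (pe E' v) = v" if v: "supp v" for v :: "'i \<Rightarrow> int"
    proof -
      have "pe (E * E') v = (\<lambda>i. pe (E * E' - 1) v i + pe 1 v i)" using pe_add[of "E * E' - 1" 1 v] by simp
      then show ?thesis using kE v by (simp add: kills_def pe_mult)
    qed
    moreover have "\<exists>v :: 'i \<Rightarrow> int. supp v \<and> pe (E ^ j) v \<noteq> v" if j: "j > 0" for j
    proof (rule ccontr)
      assume "\<nexists>v :: 'i \<Rightarrow> int. supp v \<and> pe (E ^ j) v \<noteq> v"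
      then have id: "pe (E ^ j) v = v" if "supp v" for v :: "'i \<Rightarrow> int" using that by blast
      have \<delta>: "pe (E ^ j) (\<lambda>x. if x = y then 1 else (0 :: complex)) = (\<lambda>x. if x = y then 1 else 0)" if "y \<in> I" for y
      proof -
        have "pe (E ^ j) (\<lambda>x. if x = y then 1 else (0 :: int)) = (\<lambda>x. if x = y then 1 else 0)"
          using that by (intro id) (auto simp: supp_def)
        moreover have "(\<lambda>x. if x = y then 1 else (0 :: complex)) = (\<lambda>x. of_int (if x = y then 1 else 0))" by auto
        ultimately show ?thesis using pe_of_int[of "E ^ j" "\<lambda>x. if x = y then 1 else 0"] by simp
      qed
      have "pe (E ^ j) Y = (\<lambda>x. \<Sum>y\<in>I. Y y * pe (E ^ j) (\<lambda>x. if x = y then 1 else 0) x)"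
        by (subst supp_expansion[OF aY(2)]) (simp add: pe_vsum pe_vscale)
      also have "\<dots> = (\<lambda>x. \<Sum>y\<in>I. Y y * (if x = y then 1 else 0))" using \<delta> by simp
      also have "\<dots> = Y" by (rule supp_expansion[OF aY(2), symmetric])
      finally have "pe (E ^ j) Y = Y" .
      then have eq: "poly (of_int_poly (E ^ j)) \<alpha> * Y x = Y x" for x
        using pe_eigenvector[OF aY(4), of "E ^ j"] by (metis (full_types))
      obtain x where "Y x \<noteq> 0" using aY(3) by blast
      then have "poly (of_int_poly (E ^ j)) \<alpha> = 1" using eq[of x] by simp
      then have "?ev (E ^ j) = 1" unfolding aY(1) polyR by simp
      then have "?ev E ^ j = 1" by (simp add: of_int_poly_hom.hom_power)
      then have "\<bar>?ev E\<bar> ^ j = 1" by (metis power_abs abs_one)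
      then have "\<bar>?ev E\<bar> = 1" using j power_eq_1_iff[of j] by (metis abs_ge_zero gr0_implies_Suc power_eq_iff_eq_base power_one zero_le_one zero_less_Suc)
      then show False using t(2) evE(1) by simp
    qed
    ultimately show ?thesis by blast
  qed
qed

end

section \<open>Class functions and powers of group elements\<close>

text \<open>Roots are split off one at a time. At the next root a the product of the earlier factors
  is prime to p, because the roots are distinct modulo p, so the cofactor vanishes at a modulo p. It
  is applied to F = X^l - X, which vanishes everywhere modulo l.\<close>

lemma power_minus_self_mod_prime:
  fixes F :: "int poly"
  assumes p: "prime p" and S: "finite S" and inc: "\<And>a b. a \<in> S \<Longrightarrow> b \<in> S \<Longrightarrow> a \<noteq> b \<Longrightarrow> \<not> int p dvd a - b"
    and z: "\<And>a. a \<in> S \<Longrightarrow> int p dvd poly F a"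
  obtains s t where "F = (\<Prod>a\<in>S. [:- a, 1:]) * s + [:int p:] * t"
proof -
  have "\<exists>s t. F = (\<Prod>a\<in>S. [:- a, 1:]) * s + [:int p:] * t"
    using S inc z
  proof (induction S rule: finite_induct)
    case empty
    show ?case by (intro exI[of _ F] exI[of _ 0]) simp
  next
    case (insert a S)
    let ?q = "\<Prod>a\<in>S. [:- a, 1:]"
    obtain s t where st: "F = ?q * s + [:int p:] * t"
      using insert.IH insert.prems by (metis insert_iff)
    have "poly F a = poly ?q a * poly s a + int p * poly t a" by (simp add: st)
    then have "int p dvd poly ?q a * poly s a" using insert.prems(2)[of a] by (simp add: dvd_add_left_iff)
    moreover have "\<not> int p dvd poly ?q a"
    proof
      assume "int p dvd poly ?q a"
      then have "int p dvd (\<Prod>b\<in>S. a - b)" by (simp add: poly_prod)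
      then obtain b where "b \<in> S" "int p dvd a - b"
        using prime_dvd_prod_iff[OF insert.hyps(1), of "int p" "\<lambda>b. a - b"] p by auto
      then show False using insert.prems(1)[of a b] insert.hyps(2) by auto
    qed
    ultimately have "int p dvd poly s a" using p by (simp add: prime_dvd_mult_iff)
    then obtain c where c: "poly s a = int p * c" by blast
    have "[:- a, 1:] dvd s - [:poly s a:]" by (simp flip: poly_eq_0_iff_dvd)
    then obtain s' where s': "s - [:poly s a:] = [:- a, 1:] * s'" by blast
    have "F = ?q * (s - [:poly s a:]) + [:poly s a:] * ?q + [:int p:] * t" unfolding st by (simp add: algebra_simps)
    also have "\<dots> = ([:- a, 1:] * ?q) * s' + [:int p:] * ([:c:] * ?q + t)"
    proof -
      have "[:poly s a:] = [:int p:] * [:c:]" by (simp add: c)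
      then show ?thesis unfolding s' by (simp only:) (simp only: algebra_simps)
    qed
    also have "[:- a, 1:] * ?q = (\<Prod>a\<in>insert a S. [:- a, 1:])" using insert.hyps by simp
    finally show ?case by blast
  qed
  then show ?thesis using that by blast
qed

section \<open>The group ring as convolution algebra of integer functions\<close>

locale finite_group = group G for G (structure) +
  assumes fin: "finite (carrier G)"
begin

definition sup_on :: "('a \<Rightarrow> int) \<Rightarrow> bool" where
  "sup_on v \<longleftrightarrow> (\<forall>x. x \<notin> carrier G \<longrightarrow> v x = 0)"

definition conv :: "('a \<Rightarrow> int) \<Rightarrow> ('a \<Rightarrow> int) \<Rightarrow> 'a \<Rightarrow> int" where
  "conv u v = (\<lambda>x. if x \<in> carrier G then \<Sum>y\<in>carrier G. u (x \<otimes> inv y) * v y else 0)"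

definition \<delta> :: "'a \<Rightarrow> int" where "\<delta> = (\<lambda>x. if x = \<one> then 1 else 0)"

definition class_fun :: "('a \<Rightarrow> int) \<Rightarrow> bool" where
  "class_fun u \<longleftrightarrow> (\<forall>h\<in>carrier G. \<forall>x\<in>carrier G. u (h \<otimes> x \<otimes> inv h) = u x)"

definition conj_to :: "'a \<Rightarrow> 'a \<Rightarrow> bool" where
  "conj_to x y \<longleftrightarrow> (\<exists>h\<in>carrier G. y = h \<otimes> x \<otimes> inv h)"

lemma conj_to_refl: "x \<in> carrier G \<Longrightarrow> conj_to x x"
  unfolding conj_to_def by (rule bexI[of _ \<one>]) auto

lemma conj_to_sym: "x \<in> carrier G \<Longrightarrow> conj_to x y \<Longrightarrow> conj_to y x"
  unfolding conj_to_def
proof (elim bexE)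
  fix h assume "x \<in> carrier G" "h \<in> carrier G" "y = h \<otimes> x \<otimes> inv h"
  then show "\<exists>h\<in>carrier G. x = h \<otimes> y \<otimes> inv h"
    by (intro bexI[of _ "inv h"]) (auto simp: m_assoc inv_mult_cancel)
qed

lemma conj_to_trans: "x \<in> carrier G \<Longrightarrow> conj_to x y \<Longrightarrow> conj_to y z \<Longrightarrow> conj_to x z"
  unfolding conj_to_def
proof (elim bexE)
  fix h k assume "x \<in> carrier G" "h \<in> carrier G" "y = h \<otimes> x \<otimes> inv h" "k \<in> carrier G" "z = k \<otimes> y \<otimes> inv k"
  then show "\<exists>h\<in>carrier G. z = h \<otimes> x \<otimes> inv h"
    by (intro bexI[of _ "k \<otimes> h"]) (auto simp: m_assoc inv_mult_group)
qed

lemma conj_to_inv: "x \<in> carrier G \<Longrightarrow> conj_to x y \<Longrightarrow> conj_to (inv x) (inv y)"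
  unfolding conj_to_def by (auto simp: m_assoc inv_mult_group)

lemma conj_to_pow: "x \<in> carrier G \<Longrightarrow> conj_to x y \<Longrightarrow> conj_to (x [^] (n::nat)) (y [^] n)"
  unfolding conj_to_def
proof (elim bexE)
  fix h assume x: "x \<in> carrier G" and h: "h \<in> carrier G" "y = h \<otimes> x \<otimes> inv h"
  interpret c: group_hom G G "\<lambda>x. h \<otimes> x \<otimes> inv h"
    by unfold_locales (use h in \<open>auto simp: hom_def m_assoc inv_mult_cancel\<close>)
  show "\<exists>h\<in>carrier G. y [^] n = h \<otimes> x [^] n \<otimes> inv h"
    using c.hom_nat_pow[OF x, of n] h by (intro bexI[OF _ h(1)]) simp
qed

lemma sum_right_mult:
  assumes "a \<in> carrier G"
  shows "(\<Sum>y\<in>carrier G. F (y \<otimes> a)) = (\<Sum>y\<in>carrier G. F y)"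
  by (rule sum.reindex_bij_witness[of _ "\<lambda>y. y \<otimes> inv a" "\<lambda>y. y \<otimes> a"]) (use assms in \<open>auto simp: m_assoc\<close>)

lemma sum_conj:
  assumes "a \<in> carrier G"
  shows "(\<Sum>y\<in>carrier G. F (a \<otimes> y \<otimes> inv a)) = (\<Sum>y\<in>carrier G. F y)"
  by (rule sum.reindex_bij_witness[of _ "\<lambda>y. inv a \<otimes> y \<otimes> a" "\<lambda>y. a \<otimes> y \<otimes> inv a"])
    (use assms in \<open>auto simp: m_assoc inv_mult_cancel\<close>)

lemma conv_sup: "sup_on (conv u v)"
  by (simp add: conv_def sup_on_def)

lemma conv_delta: "sup_on v \<Longrightarrow> conv \<delta> v = v"
proof
  fix x assume v: "sup_on v"
  show "conv \<delta> v x = v x"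
  proof (cases "x \<in> carrier G")
    case True
    have "x \<otimes> inv y = \<one> \<longleftrightarrow> y = x" if "y \<in> carrier G" for y
      using that True by (metis inv_closed inv_equality inv_inv r_inv)
    then show ?thesis using True fin by (simp add: conv_def \<delta>_def if_distrib[of "\<lambda>z. z * _"] cong: if_cong)
  next
    case False then show ?thesis using v by (simp add: conv_def sup_on_def)
  qed
qed

lemma delta_sup: "sup_on \<delta>"
  by (auto simp: sup_on_def \<delta>_def)

lemma conv_assoc: "conv (conv u v) w = conv u (conv v w)"
proof
  fix x show "conv (conv u v) w x = conv u (conv v w) x"
  proof (cases "x \<in> carrier G")
    case x: True
    have "conv (conv u v) w x = (\<Sum>y\<in>carrier G. \<Sum>z\<in>carrier G. u (x \<otimes> inv y \<otimes> inv z) * v z * w y)"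
      using x by (simp add: conv_def sum_distrib_right)
    also have "\<dots> = (\<Sum>y\<in>carrier G. \<Sum>z\<in>carrier G. u (x \<otimes> inv z) * v (z \<otimes> inv y) * w y)"
    proof (rule sum.cong[OF refl])
      fix y assume y: "y \<in> carrier G"
      have "(\<Sum>z\<in>carrier G. u (x \<otimes> inv z) * v (z \<otimes> inv y) * w y)
         = (\<Sum>z\<in>carrier G. u (x \<otimes> inv (z \<otimes> y)) * v (z \<otimes> y \<otimes> inv y) * w y)"
        by (rule sum_right_mult[OF y, symmetric])
      also have "\<dots> = (\<Sum>z\<in>carrier G. u (x \<otimes> inv y \<otimes> inv z) * v z * w y)"
        using x y by (intro sum.cong) (auto simp: m_assoc inv_mult_group)
      finally show "(\<Sum>z\<in>carrier G. u (x \<otimes> inv y \<otimes> inv z) * v z * w y) = (\<Sum>z\<in>carrier G. u (x \<otimes> inv z) * v (z \<otimes> inv y) * w y)" ..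
    qed
    also have "\<dots> = conv u (conv v w) x"
      using x by (subst sum.swap) (simp add: conv_def sum_distrib_left mult.assoc)
    finally show ?thesis .
  qed (simp add: conv_def)
qed

lemma conv_class: "class_fun u \<Longrightarrow> class_fun v \<Longrightarrow> class_fun (conv u v)"
  unfolding class_fun_def
proof (intro ballI)
  fix h x assume uv: "\<forall>h\<in>carrier G. \<forall>x\<in>carrier G. u (h \<otimes> x \<otimes> inv h) = u x"
    "\<forall>h\<in>carrier G. \<forall>x\<in>carrier G. v (h \<otimes> x \<otimes> inv h) = v x" and h: "h \<in> carrier G" and x: "x \<in> carrier G"
  have "conv u v (h \<otimes> x \<otimes> inv h) = (\<Sum>y\<in>carrier G. u (h \<otimes> x \<otimes> inv h \<otimes> inv y) * v y)"
    using h x by (simp add: conv_def)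
  also have "\<dots> = (\<Sum>y\<in>carrier G. u (h \<otimes> x \<otimes> inv h \<otimes> inv (h \<otimes> y \<otimes> inv h)) * v (h \<otimes> y \<otimes> inv h))"
    by (rule sum_conj[OF h, symmetric])
  also have "\<dots> = (\<Sum>y\<in>carrier G. u (h \<otimes> (x \<otimes> inv y) \<otimes> inv h) * v (h \<otimes> y \<otimes> inv h))"
    using h x by (intro sum.cong) (auto simp: m_assoc inv_mult_group inv_mult_cancel)
  also have "\<dots> = conv u v x" using uv h x by (simp add: conv_def)
  finally show "conv u v (h \<otimes> x \<otimes> inv h) = conv u v x" .
qed

lemma delta_class: "class_fun \<delta>"
  unfolding class_fun_def \<delta>_def
proof (intro ballI)
  fix h x assume h: "h \<in> carrier G" and x: "x \<in> carrier G"
  have "h \<otimes> x \<otimes> inv h = \<one> \<longleftrightarrow> x = \<one>"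
  proof
    assume e: "h \<otimes> x \<otimes> inv h = \<one>"
    have "x = inv h \<otimes> (h \<otimes> x \<otimes> inv h) \<otimes> h" using h x by (simp add: m_assoc inv_mult_cancel)
    then show "x = \<one>" unfolding e using h by simp
  qed (use h in simp)
  then show "(if h \<otimes> x \<otimes> inv h = \<one> then 1 else 0 :: int) = (if x = \<one> then 1 else 0)" by simp
qed

section \<open>Powers in the group ring as sums over words\<close>

fun wprod :: "'a list \<Rightarrow> 'a" where
  "wprod [] = \<one>"
| "wprod (x # w) = x \<otimes> wprod w"

lemma wprod_closed: "set w \<subseteq> carrier G \<Longrightarrow> wprod w \<in> carrier G"
  by (induction w) auto

lemma wprod_append: "set w \<subseteq> carrier G \<Longrightarrow> set w' \<subseteq> carrier G \<Longrightarrow> wprod (w @ w') = wprod w \<otimes> wprod w'"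
  by (induction w) (auto simp: m_assoc wprod_closed)

lemma wprod_replicate: "x \<in> carrier G \<Longrightarrow> wprod (replicate n x) = x [^] n"
proof (induction n)
  case (Suc n)
  have "wprod (replicate (Suc n) x) = x \<otimes> x [^] n" using Suc by simp
  also have "\<dots> = x [^] Suc n" by (rule nat_pow_Suc2[OF Suc.prems, symmetric])
  finally show ?case .
qed simp

definition words :: "nat \<Rightarrow> 'a list set" where
  "words m = {w. set w \<subseteq> carrier G \<and> length w = m}"

lemma finite_words: "finite (words m)"
  unfolding words_def by (rule finite_lists_length_eq[OF fin])

lemma conv_power_words:
  "x \<in> carrier G \<Longrightarrow> (conv u ^^ m) \<delta> x = (\<Sum>w\<in>{w \<in> words m. wprod w = x}. prod_list (map u w))"
proof (induction m arbitrary: x)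
  case 0
  have "{w \<in> words 0. wprod w = x} = (if x = \<one> then {[]} else {})" by (auto simp: words_def)
  then show ?case by (simp add: \<delta>_def)
next
  case (Suc m)
  have "(conv u ^^ Suc m) \<delta> x = (\<Sum>y\<in>carrier G. u (x \<otimes> inv y) * (conv u ^^ m) \<delta> y)"
    using Suc.prems by (simp add: conv_def)
  also have "\<dots> = (\<Sum>y\<in>carrier G. \<Sum>w\<in>{w \<in> words m. wprod w = y}. u (x \<otimes> inv (wprod w)) * prod_list (map u w))"
    by (intro sum.cong refl) (simp add: Suc.IH sum_distrib_left)
  also have "\<dots> = (\<Sum>w\<in>words m. u (x \<otimes> inv (wprod w)) * prod_list (map u w))"
    by (rule sum.group[OF finite_words fin]) (auto simp: words_def wprod_closed)
  also have "\<dots> = (\<Sum>w\<in>{w \<in> words (Suc m). wprod w = x}. prod_list (map u w))"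
  proof (rule sum.reindex_bij_witness[of _ tl "\<lambda>w. (x \<otimes> inv (wprod w)) # w"])
    fix w assume w: "w \<in> words m"
    then show "tl ((x \<otimes> inv (wprod w)) # w) = w" by simp
    have c: "wprod w \<in> carrier G" using w wprod_closed by (auto simp: words_def)
    then show "(x \<otimes> inv (wprod w)) # w \<in> {w \<in> words (Suc m). wprod w = x}"
      using w Suc.prems by (auto simp: words_def m_assoc)
    show "prod_list (map u ((x \<otimes> inv (wprod w)) # w)) = u (x \<otimes> inv (wprod w)) * prod_list (map u w)" by simp
  next
    fix w assume w: "w \<in> {w \<in> words (Suc m). wprod w = x}"
    then obtain a w' where w': "w = a # w'" by (cases w) (auto simp: words_def)
    have c: "wprod w' \<in> carrier G" "a \<in> carrier G" using w w' wprod_closed by (auto simp: words_def)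
    show "(x \<otimes> inv (wprod (tl w))) # tl w = w" using w w' c by (auto simp: m_assoc)
    show "tl w \<in> words m" using w w' by (auto simp: words_def)
  qed
  finally show ?case .
qed

lemma wprod_rotate1:
  assumes "w \<in> words m"
  shows "rotate1 w \<in> words m" "conj_to (wprod w) (wprod (rotate1 w))"
    "prod_list (map u (rotate1 w)) = (prod_list (map u w) :: int)"
proof -
  show "rotate1 w \<in> words m" using assms by (simp add: words_def)
  show "prod_list (map u (rotate1 w)) = prod_list (map u w)" by (cases w) auto
  show "conj_to (wprod w) (wprod (rotate1 w))"
  proof (cases w)
    case (Cons a w')
    then have c: "a \<in> carrier G" "set w' \<subseteq> carrier G" "wprod w' \<in> carrier G"
      using assms wprod_closed by (auto simp: words_def)
    have "wprod (rotate1 w) = inv a \<otimes> wprod w \<otimes> inv (inv a)"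
      using c by (simp add: Cons wprod_append m_assoc inv_mult_cancel)
    then show ?thesis unfolding conj_to_def using c(1) by (intro bexI[of _ "inv a"]) auto
  qed (simp add: conj_to_refl)
qed

lemma rotate1_fixed:
  fixes w :: "'c list"
  assumes "rotate1 w = w" "w \<noteq> []"
  shows "w = replicate (length w) (hd w)"
proof -
  have "v = replicate (length v) a" if "v @ [a] = a # v" for v and a :: 'c

    using that by (induction v) auto
  moreover obtain a v where "w = a # v" using assms(2) by (cases w) auto
  ultimately show ?thesis using assms(1) by simp
qed

text \<open>Cyclic rotation acts on the words whose product lies in a conjugacy class; the fixed words are constant.\<close>

lemma conv_power_prime:
  assumes l: "prime l" and x: "x \<in> carrier G"
  shows "[(\<Sum>k\<in>{k \<in> carrier G. conj_to x k}. (conv u ^^ l) \<delta> k) = (\<Sum>y\<in>{y \<in> carrier G. conj_to x (y [^] l)}. u y)] (mod int l)"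
proof -
  let ?C = "{k \<in> carrier G. conj_to x k}"
  define W where "W = {w \<in> words l. conj_to x (wprod w)}"
  define g where "g = (\<lambda>w. prod_list (map u w))"
  have Wc: "wprod w \<in> carrier G" if "w \<in> words l" for w using that wprod_closed by (auto simp: words_def)
  have finW: "finite W" using finite_words by (simp add: W_def)
  have "(\<Sum>k\<in>?C. (conv u ^^ l) \<delta> k) = (\<Sum>k\<in>?C. \<Sum>w\<in>{w \<in> W. wprod w = k}. g w)"
    by (intro sum.cong refl) (auto simp: conv_power_words W_def g_def intro!: sum.cong)
  also have "\<dots> = (\<Sum>w\<in>W. g w)"
    by (rule sum.group[OF finW]) (use fin Wc in \<open>auto simp: W_def\<close>)
  also have "[(\<Sum>w\<in>W. g w) = (\<Sum>w\<in>{w \<in> W. rotate1 w = w}. g w)] (mod int l)"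
  proof (rule sum_fixed_points_cong[OF l finW])
    show "rotate1 ` W \<subseteq> W"
      using wprod_rotate1 conj_to_trans[OF x] by (auto simp: W_def)
    show "(rotate1 ^^ l) w = w" if "w \<in> W" for w
      using that rotate_id[of l w] by (simp add: W_def words_def rotate_def)
    show "g (rotate1 w) = g w" if "w \<in> W" for w
      unfolding g_def using that by (intro wprod_rotate1(3)[of _ l]) (simp add: W_def)
  qed
  also have "(\<Sum>w\<in>{w \<in> W. rotate1 w = w}. g w) = (\<Sum>y\<in>{y \<in> carrier G. conj_to x (y [^] l)}. u y ^ l)"
  proof (rule sum.reindex_bij_witness[of _ "replicate l" hd])
    have l0: "l > 0" using l prime_gt_0_nat by simp
    fix w assume w: "w \<in> {w \<in> W. rotate1 w = w}"
    then have ww: "length w = l" "set w \<subseteq> carrier G" "conj_to x (wprod w)" "rotate1 w = w" by (auto simp: W_def words_def)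
    then have ne: "w \<noteq> []" using l0 by auto
    show r: "replicate l (hd w) = w" using rotate1_fixed[OF ww(4) ne] ww(1) by simp
    have hc: "hd w \<in> carrier G" using ww(2) hd_in_set[OF ne] by blast
    show "hd w \<in> {y \<in> carrier G. conj_to x (y [^] l)}" using ww(3) hc wprod_replicate[OF hc, of l] r by simp
    show "u (hd w) ^ l = g w" unfolding g_def by (subst (2) r[symmetric]) simp
  next
    have l0: "l > 0" using l prime_gt_0_nat by simp
    fix y assume y: "y \<in> {y \<in> carrier G. conj_to x (y [^] l)}"
    show "hd (replicate l y) = y" using l0 by (cases l) auto
    have "rotate1 (replicate l y) = replicate l y" by (cases l) (auto simp: replicate_append_same)
    then show "replicate l y \<in> {w \<in> W. rotate1 w = w}" using y l0 by (auto simp: W_def words_def wprod_replicate)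
  qed
  also have "[(\<Sum>y\<in>{y \<in> carrier G. conj_to x (y [^] l)}. u y ^ l) = (\<Sum>y\<in>{y \<in> carrier G. conj_to x (y [^] l)}. u y)] (mod int l)"
  proof (rule cong_sum)
    fix y
    show "[u y ^ l = u y] (mod int l)"
    proof (cases "int l dvd u y")
      case True
      moreover have "int l dvd u y ^ l" using True prime_gt_0_nat[OF l] by (meson dvd_power dvd_trans)
      ultimately show ?thesis by (simp add: cong_def)
    next
      case False
      have "[u y * u y ^ (l - 1) = u y * 1] (mod int l)" by (rule cong_mult[OF cong_refl fermat_int[OF l False]])
      then show ?thesis using prime_gt_0_nat[OF l] by (simp add: power_Suc[symmetric] del: power_Suc)
    qed
  qed
  finally show ?thesis .
qed

text \<open>On its class the value is 2 if g is conjugate to its inverse, as befits the sum of two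
  equal class sums. Invariance under inversion (\<open>zf_inv\<close>) makes the matrix of
  convolution with this function symmetric.\<close>

definition zf :: "'a \<Rightarrow> 'a \<Rightarrow> int" where
  "zf g k = (if k \<in> carrier G then of_bool (conj_to g k) + of_bool (conj_to (inv g) k) else 0)"

lemma conj_to_cong: "x \<in> carrier G \<Longrightarrow> y \<in> carrier G \<Longrightarrow> conj_to x y \<Longrightarrow> conj_to g x \<longleftrightarrow> conj_to g y" if "g \<in> carrier G" for g x y
  using that conj_to_trans conj_to_sym by blast

lemma zf_class:
  assumes g: "g \<in> carrier G"
  shows "class_fun (zf g)"
  unfolding class_fun_def
proof (intro ballI)
  fix h x assume h: "h \<in> carrier G" and x: "x \<in> carrier G"
  have c: "conj_to x (h \<otimes> x \<otimes> inv h)" using h by (auto simp: conj_to_def)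
  show "zf g (h \<otimes> x \<otimes> inv h) = zf g x"
    using conj_to_cong[OF g x _ c] conj_to_cong[OF inv_closed[OF g] x _ c] h x by (simp add: zf_def)
qed

lemma zf_inv:
  assumes g: "g \<in> carrier G" and x: "x \<in> carrier G"
  shows "zf g (inv x) = zf g x"
proof -
  have "conj_to g (inv x) \<longleftrightarrow> conj_to (inv g) x" "conj_to (inv g) (inv x) \<longleftrightarrow> conj_to g x"
    using conj_to_inv[of g "inv x"] conj_to_inv[of "inv g" x] conj_to_inv[of "inv g" "inv x"] conj_to_inv[of g x] g x by auto
  then show ?thesis using x by (simp add: zf_def)
qed

text \<open>Torsion of central units leaves the integral spectrum as the only alternative, so z^l is
  congruent to z modulo a large prime l. Summed over the class of g^l, the coefficients of z^l are
  congruent to the sum of z over all y whose l-th power lies in that class. This sum is positive,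
  because y = g occurs, and less than l, so z does not vanish on the class of g^l.\<close>

lemma large_prime_power_conj:
  assumes g: "g \<in> carrier G"
    and tors: "\<And>u u'. sup_on u \<Longrightarrow> sup_on u' \<Longrightarrow> class_fun u \<Longrightarrow> class_fun u' \<Longrightarrow> conv u u' = \<delta> \<Longrightarrow> conv u' u = \<delta> \<Longrightarrow>
      \<exists>j>0. (conv u ^^ j) \<delta> = \<delta>"
  shows "\<exists>B::nat. \<forall>l>B. prime l \<longrightarrow> conj_to g (g [^] l) \<or> conj_to (inv g) (g [^] l)"
proof -
  let ?z = "zf g"
  interpret S: symmetric_integer_operator "carrier G" "\<lambda>x y. ?z (x \<otimes> inv y)"
  proof
    fix x y assume "x \<in> carrier G" "y \<in> carrier G"
    then show "?z (x \<otimes> inv y) = ?z (y \<otimes> inv x)"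
      using zf_inv[OF g, of "y \<otimes> inv x"] by (simp add: inv_mult_group)
  qed (rule fin)
  have supp: "S.supp v \<longleftrightarrow> sup_on v" for v :: "'a \<Rightarrow> int" by (simp add: S.supp_def sup_on_def)
  have T: "S.T v = conv ?z v" for v :: "'a \<Rightarrow> int" by (simp add: S.T_def conv_def fun_eq_iff)
  have pe_sup: "sup_on (S.pe P \<delta>)" for P using S.pe_supp[of \<delta> P] delta_sup supp by simp
  have pe_conv: "S.pe P v = conv (S.pe P \<delta>) v" if v: "sup_on v" for P and v :: "'a \<Rightarrow> int"
  proof (induction P)
    case 0 show ?case by (simp add: conv_def fun_eq_iff)
  next
    case (pCons a P)
    have "conv (\<lambda>i. a * u i + w i) v = (\<lambda>i. a * conv u v i + conv w v i)" for u w
      by (simp add: conv_def fun_eq_iff distrib_right sum.distrib sum_distrib_left mult.assoc)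
    then show ?case using conv_delta[OF v] by (simp add: S.pe_pCons T pCons conv_assoc)
  qed
  have pe_class: "class_fun (S.pe P \<delta>)" for P
  proof (induction P)
    case 0 show ?case by (simp add: class_fun_def)
  next
    case (pCons a P)
    have "class_fun (conv ?z (S.pe P \<delta>))" by (rule conv_class[OF zf_class[OF g] pCons(2)])
    then show ?case using delta_class by (simp add: S.pe_pCons T class_fun_def)
  qed
  have conv_pe: "conv (S.pe P \<delta>) (S.pe Q \<delta>) = S.pe (P * Q) \<delta>" for P Q
    using pe_conv[OF pe_sup, of P Q] by (simp add: S.pe_mult)
  have conv_pe_pow: "(conv (S.pe P \<delta>) ^^ j) \<delta> = S.pe (P ^ j) \<delta>" for P j
    by (induction j) (simp_all add: conv_pe)
  have "\<not> (\<exists>E E'. (\<forall>v :: 'a \<Rightarrow> int. S.supp v \<longrightarrow> S.pe E (S.pe E' v) = v) \<and>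
      (\<forall>j>0. \<exists>v :: 'a \<Rightarrow> int. S.supp v \<and> S.pe (E ^ j) v \<noteq> v))"
  proof
    assume "\<exists>E E'. (\<forall>v :: 'a \<Rightarrow> int. S.supp v \<longrightarrow> S.pe E (S.pe E' v) = v) \<and>
      (\<forall>j>0. \<exists>v :: 'a \<Rightarrow> int. S.supp v \<and> S.pe (E ^ j) v \<noteq> v)"
    then obtain E E' where E: "\<And>v :: 'a \<Rightarrow> int. S.supp v \<Longrightarrow> S.pe E (S.pe E' v) = v"
      "\<And>j. j > 0 \<Longrightarrow> \<exists>v :: 'a \<Rightarrow> int. S.supp v \<and> S.pe (E ^ j) v \<noteq> v" by blast
    have EE: "S.pe (E * E') \<delta> = \<delta>" using E(1)[of \<delta>] delta_sup supp by (simp add: S.pe_mult)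
    then have "\<exists>j>0. (conv (S.pe E \<delta>) ^^ j) \<delta> = \<delta>"
      by (intro tors[of _ "S.pe E' \<delta>"] pe_sup pe_class) (simp_all add: conv_pe mult.commute)
    then obtain j where j: "j > 0" "S.pe (E ^ j) \<delta> = \<delta>" using conv_pe_pow by auto
    obtain v :: "'a \<Rightarrow> int" where v: "S.supp v" "S.pe (E ^ j) v \<noteq> v" using E(2)[OF j(1)] by blast
    have "S.pe (E ^ j) v = v" using pe_conv[of v "E ^ j"] v(1) supp j(2) conv_delta by simp
    then show False using v(2) by blast
  qed
  then obtain S where S: "finite S" "S.kills (\<Prod>a\<in>S. [:- a, 1:])" using S.integral_spectrum_or_unit by blast
  \<comment> \<open>For primes l above the differences of elements of S, these elements stay
    distinct modulo l. For l > 2 |G|, a positive sum of distinct coefficients of z, each at most 2,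
    is not divisible by l.\<close>
  define B where "B = Max (insert (2 * card (carrier G)) ((\<lambda>(a, b). nat \<bar>a - b\<bar>) ` (S \<times> S)))"
  have fB: "finite (insert (2 * card (carrier G)) ((\<lambda>(a, b). nat \<bar>a - b\<bar>) ` (S \<times> S)))" using S(1) by simp
  have B1: "2 * card (carrier G) \<le> B" unfolding B_def by (rule Max_ge[OF fB]) simp
  have B2: "nat \<bar>a - b\<bar> \<le> B" if "a \<in> S" "b \<in> S" for a b unfolding B_def by (rule Max_ge[OF fB]) (use that in force)
  have large: "conj_to g (g [^] l) \<or> conj_to (inv g) (g [^] l)" if l: "l > B" "prime l" for l
  proof -
    have inc: "\<not> int l dvd a - b" if "a \<in> S" "b \<in> S" "a \<noteq> b" for a b
    proof
      assume "int l dvd a - b"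
      then have "int l \<le> \<bar>a - b\<bar>" using that(3) dvd_imp_le_int[of "a - b" "int l"] by simp
      then show False using B2[OF that(1,2)] l(1) by linarith
    qed
    let ?X = "[:0, 1:] :: int poly"
    have "int l dvd poly (?X ^ l - ?X) a" for a
    proof -
      have "[a ^ l = a] (mod int l)"
      proof (cases "int l dvd a")
        case True
        moreover have "int l dvd a ^ l" using True prime_gt_0_nat[OF l(2)] by (meson dvd_power dvd_trans)
        ultimately show ?thesis by (simp add: cong_def)
      next
        case False
        have "[a * a ^ (l - 1) = a * 1] (mod int l)" by (rule cong_mult[OF cong_refl fermat_int[OF l(2) False]])
        then show ?thesis using prime_gt_0_nat[OF l(2)] by (simp add: power_Suc[symmetric] del: power_Suc)
      qed
      then show ?thesis by (simp add: cong_iff_dvd_diff)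
    qed
    then obtain s t where st: "?X ^ l - ?X = (\<Prod>a\<in>S. [:- a, 1:]) * s + [:int l:] * t"
      using power_minus_self_mod_prime[OF l(2) S(1) inc] by blast
    have X: "S.pe ?X v = conv ?z v" for v :: "'a \<Rightarrow> int"
      by (simp add: S.pe_pCons T conv_def fun_eq_iff)
    have Xl: "S.pe (?X ^ m) v = (conv ?z ^^ m) v" for m and v :: "'a \<Rightarrow> int"
      by (induction m) (simp_all add: S.pe_pCons T)
    have zc: "conv ?z \<delta> = ?z"
    proof
      fix x
      have "x \<otimes> inv \<one> = x" if "x \<in> carrier G" using that by simp
      then show "conv ?z \<delta> x = ?z x"
        using fin by (simp add: conv_def \<delta>_def zf_def if_distrib[of "\<lambda>w. _ * w"] cong: if_cong)
    qed
    have key: "[(conv ?z ^^ l) \<delta> k = ?z k] (mod int l)" for k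
    proof -
      have "S.pe (?X ^ l) \<delta> = S.pe (((\<Prod>a\<in>S. [:- a, 1:]) * s + [:int l:] * t) + ?X) \<delta>"
        unfolding st[symmetric] by simp
      also have "\<dots> = (\<lambda>k. int l * S.pe t \<delta> k + ?z k)"
        using S(2) S.pe_supp[of \<delta> s] delta_sup supp
        by (simp add: S.pe_add S.pe_smult S.pe_mult X zc S.kills_def)
      finally have "(conv ?z ^^ l) \<delta> = (\<lambda>k. int l * S.pe t \<delta> k + ?z k)" using Xl by simp
      then show ?thesis by (simp add: cong_iff_dvd_diff)
    qed
    let ?x = "g [^] l"
    have x: "?x \<in> carrier G" using g by simp
    let ?Y = "{y \<in> carrier G. conj_to ?x (y [^] l)}" and ?C = "{k \<in> carrier G. conj_to ?x k}"
    have zn: "?z y \<ge> 0" "?z y \<le> 2" for y by (auto simp: zf_def)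
    have "[(\<Sum>k\<in>?C. ?z k) = (\<Sum>k\<in>?C. (conv ?z ^^ l) \<delta> k)] (mod int l)"
      by (rule cong_sym[OF cong_sum[OF key]])
    also have "[(\<Sum>k\<in>?C. (conv ?z ^^ l) \<delta> k) = (\<Sum>y\<in>?Y. ?z y)] (mod int l)"
      by (rule conv_power_prime[OF l(2) x])
    finally have cg: "[(\<Sum>k\<in>?C. ?z k) = (\<Sum>y\<in>?Y. ?z y)] (mod int l)" .
    have "(\<Sum>y\<in>?Y. ?z y) \<ge> ?z g"
      by (rule member_le_sum) (use g fin zn conj_to_refl[OF x] in auto)
    moreover have "?z g \<ge> 1" using conj_to_refl[OF g] g by (simp add: zf_def)
    ultimately have pos: "(\<Sum>y\<in>?Y. ?z y) \<ge> 1" by linarith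
    have "(\<Sum>y\<in>?Y. ?z y) \<le> (\<Sum>y\<in>carrier G. ?z y)"
      by (rule sum_mono2) (use fin zn in auto)
    also have "\<dots> \<le> (\<Sum>y\<in>carrier G. 2)" by (rule sum_mono) (use zn in auto)
    finally have "(\<Sum>y\<in>?Y. ?z y) < int l" using B1 l(1) by simp
    then have "\<not> int l dvd (\<Sum>y\<in>?Y. ?z y)" using pos zdvd_not_zless by simp
    then have "(\<Sum>k\<in>?C. ?z k) \<noteq> 0" using cg by (auto simp: cong_0_iff dest: cong_sym)
    then obtain k where k: "k \<in> ?C" "?z k \<noteq> 0" by (meson sum.neutral)
    then have "conj_to g k \<or> conj_to (inv g) k" by (auto simp: zf_def split: if_splits)
    moreover have "conj_to k ?x" using k(1) conj_to_sym[OF x] by simp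
    ultimately show ?thesis using conj_to_trans g by blast
  qed
  show ?thesis by (intro exI[of _ B] allI impI) (rule large)
qed

text \<open>The property passes from large prime exponents to their products, by composing powers.
  Each exponent prime to |G| is congruent modulo |G| to one that is also prime to B!, hence has only
  prime factors above B.\<close>

theorem inverse_semirational_if_units_torsion:
  assumes tors: "\<And>u u'. sup_on u \<Longrightarrow> sup_on u' \<Longrightarrow> class_fun u \<Longrightarrow> class_fun u' \<Longrightarrow> conv u u' = \<delta> \<Longrightarrow> conv u' u = \<delta> \<Longrightarrow>
      \<exists>j>0. (conv u ^^ j) \<delta> = \<delta>"
  shows "inverse_semirational G"
  unfolding inverse_semirational_def
proof (intro ballI allI impI)
  fix g and k :: nat assume g: "g \<in> carrier G" and k: "coprime k (Coset.order G)"
  have "\<exists>B::nat. \<forall>l>B. prime l \<longrightarrow> conj_to g (g [^] l) \<or> conj_to (inv g) (g [^] l)"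
    by (rule large_prime_power_conj[OF g]) (rule tors)
  then obtain B :: nat where B': "\<forall>l>B. prime l \<longrightarrow> conj_to g (g [^] l) \<or> conj_to (inv g) (g [^] l)" ..
  have B: "conj_to g (g [^] l) \<or> conj_to (inv g) (g [^] l)" if "l > B" "prime l" for l
    using B'[rule_format, OF that] .
  obtain k' where k': "[k' = k] (mod Coset.order G)" "coprime k' (fact B * Coset.order G)"
    using exists_cong_coprime[OF k, of "fact B * Coset.order G"] fin order_gt_0_iff_finite by auto
  have gk: "g [^] k = g [^] k'" by (rule pow_cong[OF g pow_order_eq_1[OF g] cong_sym[OF k'(1)]])
  have pm: "conj_to g (g [^] n) \<or> conj_to (inv g) (g [^] n)"
    if "n > 0" "\<And>q. prime q \<Longrightarrow> q dvd n \<Longrightarrow> q > B" for n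
    using that
  proof (induction n rule: less_induct)
    case (less n)
    show ?case
    proof (cases "n = 1")
      case True then show ?thesis using conj_to_refl[OF g] g by simp
    next
      case False
      then obtain q where q: "prime q" "q dvd n" using prime_factor_nat by blast
      then obtain m where m: "n = m * q" by (metis dvdE mult.commute)
      have mn: "m > 0" "m < n" using less.prems(1) m prime_gt_1_nat[OF q(1)] by auto
      have IH: "conj_to g (g [^] m) \<or> conj_to (inv g) (g [^] m)"
        by (rule less.IH[OF mn(2,1)]) (use less.prems(2) m in auto)
      have Bq: "conj_to g (g [^] q) \<or> conj_to (inv g) (g [^] q)" by (rule B[OF less.prems(2)[OF q] q(1)])
      have gq: "g [^] n = (g [^] m) [^] q" using g by (simp add: nat_pow_pow m)
      have inv_q: "conj_to (inv g) (inv g [^] q) \<or> conj_to g (inv g [^] q)"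
        using Bq conj_to_inv[of g "g [^] q"] conj_to_inv[of "inv g" "g [^] q"] g by (auto simp: nat_pow_inv)
      have ig: "inv g \<in> carrier G" using g by simp
      from IH show ?thesis unfolding gq
      proof
        assume "conj_to g (g [^] m)"
        then have "conj_to (g [^] q) ((g [^] m) [^] q)" by (rule conj_to_pow[OF g])
        then show "conj_to g ((g [^] m) [^] q) \<or> conj_to (inv g) ((g [^] m) [^] q)"
          using Bq conj_to_trans[OF g] conj_to_trans[OF ig] by blast
      next
        assume "conj_to (inv g) (g [^] m)"
        then have "conj_to (inv g [^] q) ((g [^] m) [^] q)" by (rule conj_to_pow[OF ig])
        then show "conj_to g ((g [^] m) [^] q) \<or> conj_to (inv g) ((g [^] m) [^] q)"
          using inv_q conj_to_trans[OF g] conj_to_trans[OF ig] by blast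
      qed
    qed
  qed
  show "\<exists>h\<in>carrier G. g [^] k = h \<otimes> g \<otimes> inv h \<or> g [^] k = h \<otimes> inv g \<otimes> inv h"
  \<comment> \<open>0 is prime to |G| only in the trivial group.\<close>
  proof (cases "k' = 0")
    case True
    then have "Coset.order G = 1" using k'(2) by simp
    then have "card (carrier G) = 1" by (simp add: Coset.order_def)
    then obtain a where "carrier G = {a}" by (rule card_1_singletonE)
    then have "g = \<one>" using g one_closed by simp
    then show ?thesis by (intro bexI[of _ \<one>]) auto
  next
    case False
    have "q > B" if "prime q" "q dvd k'" for q
    proof (rule ccontr)
      assume "\<not> q > B"
      then have "q dvd fact B" using dvd_fact prime_ge_1_nat[OF that(1)] by simp
      then have "q dvd fact B * Coset.order G" by simp
      then have "q dvd 1" using k'(2) that(2) coprime_common_divisor by blast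
      then show False using that(1) by simp
    qed
    then show ?thesis using pm[of k'] False unfolding gk conj_to_def by blast
  qed
qed

end

section \<open>Integral group rings of finite groups\<close>

context finite_group
begin

abbreviation "R \<equiv> int_group_ring G"

lemma keys_sup: "Poly_Mapping.keys x \<subseteq> carrier G \<longleftrightarrow> sup_on (Poly_Mapping.lookup x)"
  unfolding sup_on_def by (metis in_keys_iff subset_iff)

lemma carrier_R: "x \<in> carrier R \<longleftrightarrow> sup_on (Poly_Mapping.lookup x)"
  by (simp add: int_group_ring_def keys_sup)

lemma lookup_Abs: "sup_on u \<Longrightarrow> Poly_Mapping.lookup (Abs_poly_mapping u) = u"
  by (rule lookup_Abs_poly_mapping) (rule finite_subset[OF _ fin], auto simp: sup_on_def)

lemma lookup_mult:
  assumes x: "x \<in> carrier R" and y: "y \<in> carrier R"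
  shows "Poly_Mapping.lookup (x \<otimes>\<^bsub>R\<^esub> y) = conv (Poly_Mapping.lookup x) (Poly_Mapping.lookup y)"
proof
  fix k
  let ?x = "Poly_Mapping.lookup x" and ?y = "Poly_Mapping.lookup y"
  have kx: "Poly_Mapping.keys x \<subseteq> carrier G" and ky: "Poly_Mapping.keys y \<subseteq> carrier G"
    using x y carrier_R keys_sup by auto
  have "Poly_Mapping.lookup (x \<otimes>\<^bsub>R\<^esub> y) k
    = (\<Sum>g\<in>Poly_Mapping.keys x. ?x g * (\<Sum>h\<in>Poly_Mapping.keys y. ?y h * (if k = g \<otimes> h then 1 else 0)))"
    by (simp add: int_group_ring_def frag_extend_def lookup_sum)
  also have "\<dots> = (\<Sum>g\<in>carrier G. ?x g * (\<Sum>h\<in>Poly_Mapping.keys y. ?y h * (if k = g \<otimes> h then 1 else 0)))"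
    by (rule sum.mono_neutral_left[OF fin kx]) (auto simp: in_keys_iff)
  also have "\<dots> = (\<Sum>g\<in>carrier G. ?x g * (\<Sum>h\<in>carrier G. ?y h * (if k = g \<otimes> h then 1 else 0)))"
    by (intro sum.cong refl arg_cong[of _ _ "\<lambda>s. _ * s"] sum.mono_neutral_left[OF fin ky]) (auto simp: in_keys_iff)
  also have "\<dots> = (\<Sum>h\<in>carrier G. \<Sum>g\<in>carrier G. (if k = g \<otimes> h then ?x g else 0) * ?y h)"
    by (subst sum.swap) (simp add: sum_distrib_left if_distrib[of "\<lambda>z. _ * z"] if_distrib[of "\<lambda>z. z * _"] mult_ac cong: if_cong)
  also have "\<dots> = conv ?x ?y k"
  proof (cases "k \<in> carrier G")
    case True
    have "k = g \<otimes> h \<longleftrightarrow> g = k \<otimes> inv h" if "g \<in> carrier G" "h \<in> carrier G" for g h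
      using that True by (auto simp: m_assoc)
    then have "(\<Sum>g\<in>carrier G. (if k = g \<otimes> h then ?x g else 0) * ?y h) = ?x (k \<otimes> inv h) * ?y h" if "h \<in> carrier G" for h
      using that True fin by (simp add: sum_distrib_right[symmetric] cong: sum.cong if_cong)
    then show ?thesis using True by (simp add: conv_def)
  next
    case False
    then have "k \<noteq> g \<otimes> h" if "g \<in> carrier G" "h \<in> carrier G" for g h using that by auto
    then show ?thesis using False by (simp add: conv_def)
  qed
  finally show "Poly_Mapping.lookup (x \<otimes>\<^bsub>R\<^esub> y) k = conv ?x ?y k" .
qed

lemma lookup_one: "Poly_Mapping.lookup \<one>\<^bsub>R\<^esub> = \<delta>"
  by (auto simp: int_group_ring_def \<delta>_def)

lemma conv_comm:
  assumes u: "class_fun u" and v: "sup_on v"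
  shows "conv u v = conv v u"
proof
  fix x show "conv u v x = conv v u x"
  proof (cases "x \<in> carrier G")
    case x: True
    have "conv u v x = (\<Sum>y\<in>carrier G. u (inv y \<otimes> x) * v y)"
      unfolding conv_def using x
    proof (simp, intro sum.cong refl arg_cong[of _ _ "\<lambda>z. z * _"])
      fix y assume y: "y \<in> carrier G"
      have "u (inv y \<otimes> (x \<otimes> inv y) \<otimes> inv (inv y)) = u (x \<otimes> inv y)"
        by (rule u[unfolded class_fun_def, rule_format]) (use x y in auto)
      moreover have "inv y \<otimes> (x \<otimes> inv y) \<otimes> inv (inv y) = inv y \<otimes> x" using x y by (simp add: m_assoc)
      ultimately show "u (x \<otimes> inv y) = u (inv y \<otimes> x)" by simp
    qed
    also have "\<dots> = (\<Sum>z\<in>carrier G. v (x \<otimes> inv z) * u z)"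
      by (rule sum.reindex_bij_witness[of _ "\<lambda>z. x \<otimes> inv z" "\<lambda>y. inv y \<otimes> x"])
        (use x in \<open>auto simp: m_assoc inv_mult_group inv_mult_cancel\<close>)
    also have "\<dots> = conv v u x" using x by (simp add: conv_def)
    finally show ?thesis .
  qed (simp add: conv_def)
qed

lemma central_unitI:
  assumes u: "sup_on u" "sup_on u'" "class_fun u" "conv u u' = \<delta>" "conv u' u = \<delta>"
  shows "Abs_poly_mapping u \<in> central_units G"
proof -
  let ?u = "Abs_poly_mapping u" and ?u' = "Abs_poly_mapping u'"
  have c: "?u \<in> carrier R" "?u' \<in> carrier R" using u by (simp_all add: carrier_R lookup_Abs)
  have "?u' \<otimes>\<^bsub>R\<^esub> ?u = \<one>\<^bsub>R\<^esub>" "?u \<otimes>\<^bsub>R\<^esub> ?u' = \<one>\<^bsub>R\<^esub>"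
    by (rule poly_mapping_eqI, simp add: lookup_mult c lookup_one lookup_Abs u)+
  then have "?u \<in> Units R" using c unfolding Units_def by blast
  moreover have "?u \<otimes>\<^bsub>R\<^esub> v = v \<otimes>\<^bsub>R\<^esub> ?u" if "v \<in> Units R" for v
  proof -
    have v: "v \<in> carrier R" using that by (simp add: Units_def)
    show ?thesis
      by (rule poly_mapping_eqI) (use v c u conv_comm[OF u(3)] in \<open>simp add: lookup_mult lookup_Abs carrier_R\<close>)
  qed
  ultimately show ?thesis by (simp add: central_units_def center_def centralizer_def units_of_def)
qed

definition cpow :: "('a \<Rightarrow> int) \<Rightarrow> nat \<Rightarrow> 'a \<Rightarrow> int" where
  "cpow u n = (conv u ^^ n) \<delta>"

lemma cpow_sup: "sup_on (cpow u n)"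
  by (cases n) (simp_all add: cpow_def delta_sup conv_sup)

lemma cpow_conv: "sup_on v \<Longrightarrow> conv (cpow u m) v = (conv u ^^ m) v"
  by (induction m) (simp_all add: cpow_def conv_delta conv_assoc)

lemma cpow_add: "cpow u (m + n) = conv (cpow u m) (cpow u n)"
  unfolding cpow_conv[OF cpow_sup] by (simp add: cpow_def funpow_add)

lemma cpow_mult: "cpow u (m * n) = cpow (cpow u m) n"
proof (induction n)
  case (Suc n)
  have "cpow u (m * Suc n) = conv (cpow u m) (cpow u (m * n))" by (simp add: cpow_add[symmetric])
  then show ?case using Suc by (simp add: cpow_def)
qed (simp add: cpow_def)

lemma cpow_class: "class_fun u \<Longrightarrow> class_fun (cpow u n)"
  by (induction n) (simp_all add: cpow_def delta_class conv_class)

lemma conv_delta_right: "sup_on v \<Longrightarrow> conv v \<delta> = v"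
  using conv_comm[OF delta_class] conv_delta by metis

lemma cpow_inverse:
  assumes "sup_on u" "sup_on u'" "conv u u' = \<delta>" "conv u' u = \<delta>"
  shows "conv (cpow u n) (cpow u' n) = \<delta>"
proof (induction n)
  case 0 show ?case by (simp add: cpow_def conv_delta delta_sup)
next
  case (Suc n)
  have 1: "cpow u' (Suc n) = conv (cpow u' n) u'"
    using cpow_add[of u' n 1] assms(2) by (simp add: cpow_def conv_delta_right)
  have "conv (cpow u (Suc n)) (cpow u' (Suc n)) = conv u (conv (conv (cpow u n) (cpow u' n)) u')"
    unfolding 1 by (simp add: cpow_def conv_assoc)
  then show ?case using Suc assms by (simp add: conv_delta)
qed

lemma conv_cong:
  assumes "\<And>x. [u x = u' x] (mod M)" "\<And>x. [v x = v' x] (mod M)"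
  shows "[conv u v x = conv u' v' x] (mod M)"
  unfolding conv_def by (auto intro!: cong_sum cong_mult assms)

text \<open>The group ring modulo M is finite, so two powers of u coincide there, and the inverse of
  u cancels the smaller one.\<close>

lemma power_cong_delta:
  assumes "sup_on u" "sup_on u'" "conv u u' = \<delta>" "conv u' u = \<delta>" and M: "M > 0"
  obtains e y where "e > 0" "sup_on y" "cpow u e = (\<lambda>x. \<delta> x + M * y x)"
proof -
  define red where "red = (\<lambda>n. \<lambda>x\<in>carrier G. cpow u n x mod M)"
  have "range red \<subseteq> carrier G \<rightarrow>\<^sub>E {0..<M}" using M by (auto simp: red_def)
  then have "finite (range red)" by (rule finite_subset) (intro finite_PiE fin, simp)
  then have "\<not> inj red" using range_inj_infinite by blast
  then obtain i j where ij: "red i = red j" "i < j"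
    unfolding inj_def by (metis linorder_neqE_nat)
  define e where "e = j - i"
  have c: "[cpow u i x = cpow u j x] (mod M)" for x
  proof (cases "x \<in> carrier G")
    case True
    then have "red i x = red j x" using ij by simp
    then show ?thesis using True by (simp add: red_def cong_def)
  next
    case False then show ?thesis using cpow_sup by (simp add: sup_on_def)
  qed
  have "[conv (cpow u' i) (cpow u i) x = conv (cpow u' i) (cpow u j) x] (mod M)" for x
    by (rule conv_cong) (simp_all add: c)
  moreover have "conv (cpow u' i) (cpow u i) = \<delta>" by (rule cpow_inverse) (use assms in auto)
  moreover have "conv (cpow u' i) (cpow u j) = cpow u e"
  proof -
    have "cpow u j = conv (cpow u i) (cpow u e)" using ij(2) cpow_add[of u i e] by (simp add: e_def)
    then show ?thesis
      using cpow_inverse[OF assms(2,1,4,3), of i] conv_delta[OF cpow_sup] by (simp add: conv_assoc[symmetric])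
  qed
  ultimately have d: "M dvd cpow u e x - \<delta> x" for x
    using cong_sym cong_iff_dvd_diff by metis
  define y where "y = (\<lambda>x. (cpow u e x - \<delta> x) div M)"
  have "e > 0" using ij(2) by (simp add: e_def)
  moreover have "sup_on y" using cpow_sup delta_sup by (simp add: sup_on_def y_def)
  moreover have "cpow u e = (\<lambda>x. \<delta> x + M * y x)" using d by (simp add: y_def)
  ultimately show ?thesis using that by blast
qed

definition basis :: "'a \<Rightarrow> 'a \<Rightarrow> int" where "basis g = (\<lambda>x. if x = g then 1 else 0)"

lemma lookup_basis: "Poly_Mapping.lookup (frag_of g) = basis g"
  by (simp add: basis_def)

lemma conv_basis:
  assumes "g \<in> carrier G" "h \<in> carrier G"
  shows "conv (basis g) (basis h) = basis (g \<otimes> h)"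
proof
  fix x
  have "x \<otimes> inv h = g \<longleftrightarrow> x = g \<otimes> h" if "x \<in> carrier G" for x using that assms by (auto simp: m_assoc)
  then show "conv (basis g) (basis h) x = basis (g \<otimes> h) x"
    using assms fin by (auto simp: conv_def basis_def if_distrib[of "\<lambda>z. _ * z"] cong: if_cong)
qed

lemma cpow_basis: "g \<in> carrier G \<Longrightarrow> cpow (basis g) n = basis (g [^] n)"
proof (induction n)
  case 0 show ?case by (simp add: cpow_def \<delta>_def basis_def fun_eq_iff)
next
  case (Suc n)
  have "cpow (basis g) (Suc n) = conv (basis g) (cpow (basis g) n)" by (simp add: cpow_def)
  also have "\<dots> = basis (g \<otimes> g [^] n)" using Suc by (simp add: conv_basis)
  also have "g \<otimes> g [^] n = g [^] Suc n" by (rule nat_pow_Suc2[OF Suc.prems, symmetric])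
  finally show ?case .
qed

text \<open>The factor 2 in the exponent removes the sign, the order of G the group element.\<close>

lemma cpow_trivial_unit:
  assumes "u \<in> trivial_central_units G"
  shows "cpow (Poly_Mapping.lookup u) (2 * Coset.order G) = \<delta>"
proof -
  obtain z where z: "z \<in> center G" "u = frag_of z \<or> u = - frag_of z"
    using assms by (auto simp: trivial_central_units_def)
  have zc: "z \<in> carrier G" using z(1) by (simp add: center_def centralizer_def)
  let ?u = "Poly_Mapping.lookup u"
  have 2: "cpow ?u 2 = basis (z [^] (2::nat))"
  proof -
    have "conv ?u ?u = conv (basis z) (basis z)"
      using z(2) by (auto simp: lookup_basis[symmetric] conv_def fun_eq_iff simp del: lookup_frag_of)
    moreover have "cpow ?u 2 = conv ?u ?u"
    proof -
      have "sup_on ?u" using z(2) zc by (auto simp: sup_on_def)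
      then show ?thesis by (simp add: cpow_def numeral_2_eq_2 conv_delta_right)
    qed
    ultimately show ?thesis using zc by (simp add: conv_basis numeral_2_eq_2)
  qed
  have "cpow ?u (2 * Coset.order G) = basis ((z [^] (2::nat)) [^] Coset.order G)"
    unfolding cpow_mult 2 using zc by (simp add: cpow_basis)
  also have "\<dots> = \<delta>" using zc pow_order_eq_1[of "z [^] (2::nat)"] by (simp add: basis_def \<delta>_def)
  finally show ?thesis .
qed

end

section \<open>Central units and quotients\<close>

locale finite_quotient = H: finite_group H + Q: finite_group Q + p: group_hom H Q p
  for H :: "('a, 'm) monoid_scheme" and Q :: "('b, 'n) monoid_scheme" and p +
  assumes surj: "p ` carrier H = carrier Q"
begin

lemma lift: "q \<in> carrier Q \<Longrightarrow> \<exists>x. x \<in> carrier H \<and> p x = q"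
  unfolding surj[symmetric] by (elim imageE) (simp, blast)

text \<open>The ring homomorphism from Z[H] to Z[Q] induced by p, in terms of coefficients.\<close>

definition push :: "('a \<Rightarrow> int) \<Rightarrow> 'b \<Rightarrow> int" where
  "push v = (\<lambda>q. \<Sum>x\<in>{x \<in> carrier H. p x = q}. v x)"

lemma push_sup: "Q.sup_on (push v)"
  unfolding Q.sup_on_def push_def
proof (intro allI impI)
  fix q assume "q \<notin> carrier Q"
  then have "{x \<in> carrier H. p x = q} = {}" by auto
  then show "(\<Sum>x\<in>{x \<in> carrier H. p x = q}. v x) = 0" by (simp only: sum.empty)
qed

lemma push_delta: "push H.\<delta> = Q.\<delta>"
proof
  fix q
  have "push H.\<delta> q = (if \<one>\<^bsub>H\<^esub> \<in> {x \<in> carrier H. p x = q} then 1 else 0)"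
    unfolding push_def H.\<delta>_def using H.fin by (simp cong: if_cong)
  then show "push H.\<delta> q = Q.\<delta> q" by (auto simp: Q.\<delta>_def)
qed

lemma push_conv: "push (H.conv u v) = Q.conv (push u) (push v)"
proof
  fix q
  show "push (H.conv u v) q = Q.conv (push u) (push v) q"
  proof (cases "q \<in> carrier Q")
    case False then show ?thesis using push_sup by (simp add: Q.sup_on_def Q.conv_def)
  next
    case q: True
    have "push (H.conv u v) q = (\<Sum>x\<in>{x \<in> carrier H. p x = q}. \<Sum>y\<in>carrier H. u (x \<otimes>\<^bsub>H\<^esub> inv\<^bsub>H\<^esub> y) * v y)"
      unfolding push_def by (rule sum.cong) (auto simp: H.conv_def)
    also have "\<dots> = (\<Sum>y\<in>carrier H. (\<Sum>x\<in>{x \<in> carrier H. p x = q}. u (x \<otimes>\<^bsub>H\<^esub> inv\<^bsub>H\<^esub> y)) * v y)"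
      by (subst sum.swap) (simp add: sum_distrib_right)
    also have "\<dots> = (\<Sum>y\<in>carrier H. push u (q \<otimes>\<^bsub>Q\<^esub> inv\<^bsub>Q\<^esub> p y) * v y)"
    proof (intro sum.cong refl arg_cong[of _ _ "\<lambda>z. z * _"])
      fix y assume y: "y \<in> carrier H"
      show "(\<Sum>x\<in>{x \<in> carrier H. p x = q}. u (x \<otimes>\<^bsub>H\<^esub> inv\<^bsub>H\<^esub> y)) = push u (q \<otimes>\<^bsub>Q\<^esub> inv\<^bsub>Q\<^esub> p y)"
        unfolding push_def
        by (rule sum.reindex_bij_witness[of _ "\<lambda>x. x \<otimes>\<^bsub>H\<^esub> y" "\<lambda>x. x \<otimes>\<^bsub>H\<^esub> inv\<^bsub>H\<^esub> y"])
          (use y q in \<open>auto simp: H.m_assoc Q.m_assoc\<close>)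
    qed
    also have "\<dots> = (\<Sum>r\<in>carrier Q. \<Sum>y\<in>{y \<in> carrier H. p y = r}. push u (q \<otimes>\<^bsub>Q\<^esub> inv\<^bsub>Q\<^esub> p y) * v y)"
      by (rule sum.group[symmetric, OF H.fin Q.fin]) auto
    also have "\<dots> = (\<Sum>r\<in>carrier Q. push u (q \<otimes>\<^bsub>Q\<^esub> inv\<^bsub>Q\<^esub> r) * push v r)"
      unfolding push_def[of v] by (simp add: sum_distrib_left)
    also have "\<dots> = Q.conv (push u) (push v) q" using q by (simp add: Q.conv_def)
    finally show ?thesis .
  qed
qed

lemma push_class:
  assumes "H.class_fun u"
  shows "Q.class_fun (push u)"
  unfolding Q.class_fun_def
proof (intro ballI)
  fix r q assume r: "r \<in> carrier Q" and q: "q \<in> carrier Q"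
  obtain s where s: "s \<in> carrier H" "p s = r" using lift[OF r] by (elim exE conjE)
  have "(\<Sum>x\<in>{x \<in> carrier H. p x = r \<otimes>\<^bsub>Q\<^esub> q \<otimes>\<^bsub>Q\<^esub> inv\<^bsub>Q\<^esub> r}. u x) = (\<Sum>x\<in>{x \<in> carrier H. p x = q}. u (s \<otimes>\<^bsub>H\<^esub> x \<otimes>\<^bsub>H\<^esub> inv\<^bsub>H\<^esub> s))"
    by (rule sum.reindex_bij_witness[of _ "\<lambda>x. s \<otimes>\<^bsub>H\<^esub> x \<otimes>\<^bsub>H\<^esub> inv\<^bsub>H\<^esub> s" "\<lambda>x. inv\<^bsub>H\<^esub> s \<otimes>\<^bsub>H\<^esub> x \<otimes>\<^bsub>H\<^esub> s"])
      (use s q r in \<open>auto simp: H.m_assoc Q.m_assoc H.inv_mult_cancel Q.inv_mult_cancel\<close>)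
  also have "\<dots> = (\<Sum>x\<in>{x \<in> carrier H. p x = q}. u x)"
    using assms s by (intro sum.cong) (auto simp: H.class_fun_def)
  finally show "push u (r \<otimes>\<^bsub>Q\<^esub> q \<otimes>\<^bsub>Q\<^esub> inv\<^bsub>Q\<^esub> r) = push u q" by (simp add: push_def)
qed

lemma push_cpow: "push (H.cpow u n) = Q.cpow (push u) n"
  by (induction n) (simp_all add: H.cpow_def Q.cpow_def push_delta push_conv)

abbreviation "N \<equiv> kernel H Q p"

lemma kernel_pow:
  assumes "b \<in> N"
  shows "b [^]\<^bsub>H\<^esub> card N = \<one>\<^bsub>H\<^esub>"
proof -
  interpret N: group "H\<lparr>carrier := N\<rparr>" by (rule H.subgroup_imp_group[OF p.subgroup_kernel])
  have "b [^]\<^bsub>H\<lparr>carrier := N\<rparr>\<^esub> Coset.order (H\<lparr>carrier := N\<rparr>) = \<one>\<^bsub>H\<lparr>carrier := N\<rparr>\<^esub>"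
    by (rule N.pow_order_eq_1) (use assms in simp)
  then show ?thesis by (simp add: Coset.order_def H.nat_pow_consistent[symmetric])
qed

definition sec :: "'b \<Rightarrow> 'a" where "sec q = (SOME x. x \<in> carrier H \<and> p x = q)"

lemma sec: "q \<in> carrier Q \<Longrightarrow> sec q \<in> carrier H" "q \<in> carrier Q \<Longrightarrow> p (sec q) = q"
proof -
  assume "q \<in> carrier Q"
  then have "\<exists>x. x \<in> carrier H \<and> p x = q" by (rule lift)
  then have "sec q \<in> carrier H \<and> p (sec q) = q" unfolding sec_def by (rule someI_ex)
  then show "sec q \<in> carrier H" "p (sec q) = q" by auto
qed

lemma basis_expansion: "H.sup_on y \<Longrightarrow> y = (\<lambda>k. \<Sum>x\<in>carrier H. y x * H.basis x k)"
  using H.fin by (auto simp: H.sup_on_def H.basis_def fun_eq_iff if_distrib[of "\<lambda>z. _ * z"] cong: if_cong)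

text \<open>The reason is that \<open>card N * (b - 1) = (\<Sum>i<card N. 1 - b ^ i) * (b - 1)\<close> for \<open>b\<close> in \<open>N\<close>.\<close>

lemma kernel_multiple_in_product:
  assumes y: "H.sup_on y" and py: "push y = (\<lambda>q. 0)"
  shows "Abs_poly_mapping (\<lambda>x. int (card N) * y x)
    \<in> additive_product (int_group_ring H) (augmentation_ideal H) (augmentation_ideal (H\<lparr>carrier := N\<rparr>))"
proof -
  let ?R = "int_group_ring H" and ?M = "card N"
  let ?P = "additive_product ?R (augmentation_ideal H) (augmentation_ideal (H\<lparr>carrier := N\<rparr>))"
  \<comment> \<open>One representative is fixed in each fibre of p, so s depends only on p x, and x
    is the product of s x with the element b x of the kernel.\<close>
  define s where "s = (\<lambda>x. sec (p x))"
  define b where "b = (\<lambda>x. inv\<^bsub>H\<^esub> s x \<otimes>\<^bsub>H\<^esub> x)"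
  define X where "X = (\<lambda>x (i::nat). frag_cmul (y x) (frag_of (s x) - frag_of (s x \<otimes>\<^bsub>H\<^esub> b x [^]\<^bsub>H\<^esub> i)))"
  define Y where "Y = (\<lambda>x. frag_of (b x) - frag_of \<one>\<^bsub>H\<^esub>)"
  have sc: "s x \<in> carrier H" and bN: "b x \<in> N" and bc: "b x \<in> carrier H" and sb: "s x \<otimes>\<^bsub>H\<^esub> b x = x" if "x \<in> carrier H" for x
  proof -
    show 1: "s x \<in> carrier H" using that sec by (simp add: s_def)
    show 2: "b x \<in> carrier H" using that 1 by (simp add: b_def)
    show "b x \<in> N" using that sec 1 2 by (simp add: kernel_def b_def s_def)
    show "s x \<otimes>\<^bsub>H\<^esub> b x = x" using that 1 by (simp add: b_def H.inv_mult_cancel)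
  qed
  have aug: "augmentation (frag_cmul c (frag_of g - frag_of h)) = 0" for c and g h :: 'a
  proof -
    let ?z = "frag_cmul c (frag_of g - frag_of h)"
    have "Poly_Mapping.keys ?z \<subseteq> {g, h}" by (auto simp: in_keys_iff lookup_minus split: if_splits)
    then have "augmentation ?z = (\<Sum>k\<in>{g, h}. Poly_Mapping.lookup ?z k)"
      unfolding augmentation_def by (intro sum.mono_neutral_left) (auto simp: in_keys_iff)
    then show ?thesis by (cases "g = h") (simp_all add: lookup_minus)
  qed
  have car: "frag_cmul c (frag_of g - frag_of h) \<in> carrier (int_group_ring K)"
    if "g \<in> carrier K" "h \<in> carrier K" for c g h and K :: "('a, 'm) monoid_scheme"
    using that by (auto simp: int_group_ring_def in_keys_iff lookup_minus split: if_splits)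
  have XD: "X x i \<in> augmentation_ideal H" if "x \<in> carrier H" for x i
    unfolding augmentation_ideal_def X_def
  proof (intro CollectI conjI aug car)
    show "s x \<in> carrier H" by (rule sc[OF that])
    show "s x \<otimes>\<^bsub>H\<^esub> b x [^]\<^bsub>H\<^esub> i \<in> carrier H"
      by (rule H.m_closed[OF sc[OF that] H.nat_pow_closed[OF bc[OF that]]])
  qed
  have YD: "Y x \<in> augmentation_ideal (H\<lparr>carrier := N\<rparr>)" if "x \<in> carrier H" for x
    unfolding augmentation_ideal_def Y_def
    using aug[of 1] car[of _ "H\<lparr>carrier := N\<rparr>" _ 1] bN[OF that] subgroup.one_closed[OF p.subgroup_kernel] by simp
  have sumP: "(\<Sum>j\<in>J. f j) \<in> ?P" if "finite J" "\<And>j. j \<in> J \<Longrightarrow> f j \<in> ?P" for J :: "'j set" and f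
    using that
  proof (induction J rule: finite_induct)
    case empty
    have "\<one>\<^bsub>add_monoid ?R\<^esub> \<in> ?P" unfolding additive_product_def by (rule generate.one)
    then show ?case by (simp add: int_group_ring_def)
  next
    case (insert j J)
    have "f j \<otimes>\<^bsub>add_monoid ?R\<^esub> sum f J \<in> ?P"
      using insert unfolding additive_product_def by (intro generate.eng) auto
    then show ?case using insert by (simp add: int_group_ring_def)
  qed
  have "X x i \<otimes>\<^bsub>?R\<^esub> Y x \<in> ?P" if "x \<in> carrier H" for x i
    unfolding additive_product_def by (rule generate.incl) (use XD YD that in blast)
  then have inP: "(\<Sum>x\<in>carrier H. \<Sum>i<?M. X x i \<otimes>\<^bsub>?R\<^esub> Y x) \<in> ?P"
    by (intro sumP H.fin finite_lessThan) auto
  have prodterm: "Poly_Mapping.lookup (X x i \<otimes>\<^bsub>?R\<^esub> Y x) k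
      = y x * (H.basis x k - H.basis (s x) k - (H.basis (s x \<otimes>\<^bsub>H\<^esub> b x [^]\<^bsub>H\<^esub> Suc i) k - H.basis (s x \<otimes>\<^bsub>H\<^esub> b x [^]\<^bsub>H\<^esub> i) k))"
    if x: "x \<in> carrier H" for x i k
  proof -
    let ?s = "s x" and ?b = "b x"
    let ?sb = "?s \<otimes>\<^bsub>H\<^esub> ?b [^]\<^bsub>H\<^esub> i"
    note c = sc[OF x] bc[OF x]
    have lX: "Poly_Mapping.lookup (X x i) = (\<lambda>k. y x * (H.basis ?s k - H.basis ?sb k))"
      by (simp add: X_def lookup_minus H.basis_def fun_eq_iff)
    have lY: "Poly_Mapping.lookup (Y x) = (\<lambda>k. H.basis ?b k - H.basis \<one>\<^bsub>H\<^esub> k)"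
      by (simp add: Y_def lookup_minus H.basis_def fun_eq_iff)
    have R: "X x i \<in> carrier ?R" "Y x \<in> carrier ?R"
      using XD[OF x] car[of ?b H "\<one>\<^bsub>H\<^esub>" 1] c by (simp_all add: augmentation_ideal_def Y_def)
    have "H.conv (\<lambda>k. a * (u k - u' k)) (\<lambda>k. v k - v' k) k
      = a * (H.conv u v k - H.conv u v' k - (H.conv u' v k - H.conv u' v' k))" for a u u' v v'
      by (simp add: H.conv_def algebra_simps sum_subtractf sum.distrib sum_distrib_left)
    moreover have "?s \<otimes>\<^bsub>H\<^esub> \<one>\<^bsub>H\<^esub> = ?s" "?s \<otimes>\<^bsub>H\<^esub> ?b = x" "?sb \<otimes>\<^bsub>H\<^esub> \<one>\<^bsub>H\<^esub> = ?sb" "?sb \<otimes>\<^bsub>H\<^esub> ?b = ?s \<otimes>\<^bsub>H\<^esub> ?b [^]\<^bsub>H\<^esub> Suc i"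
      using c sb[OF x] by (simp_all add: H.m_assoc)
    ultimately show ?thesis
      unfolding H.lookup_mult[OF R] lX lY using c by (simp add: H.conv_basis del: H.nat_pow_Suc)
  qed
  have tele: "(\<Sum>i<?M. Poly_Mapping.lookup (X x i \<otimes>\<^bsub>?R\<^esub> Y x) k) = int ?M * (y x * (H.basis x k - H.basis (s x) k))"
    if x: "x \<in> carrier H" for x k
  proof -
    let ?F = "\<lambda>i::nat. H.basis (s x \<otimes>\<^bsub>H\<^esub> b x [^]\<^bsub>H\<^esub> i) k"
    have "(\<Sum>i<?M. Poly_Mapping.lookup (X x i \<otimes>\<^bsub>?R\<^esub> Y x) k)
      = (\<Sum>i<?M. y x * (H.basis x k - H.basis (s x) k - (?F (Suc i) - ?F i)))"
      using prodterm[OF x] by simp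
    also have "\<dots> = y x * (int ?M * (H.basis x k - H.basis (s x) k) - (\<Sum>i<?M. ?F (Suc i) - ?F i))"
      unfolding sum_distrib_left[symmetric] sum_subtractf[of _ "\<lambda>i. ?F (Suc i) - ?F i"] by simp
    also have "(\<Sum>i<?M. ?F (Suc i) - ?F i) = ?F ?M - ?F 0" by (rule sum_lessThan_telescope)
    also have "?F ?M - ?F 0 = 0" using kernel_pow[OF bN[OF x]] by simp
    finally show ?thesis by simp
  qed
  \<comment> \<open>The telescoping sum produces x - s x in place of x. The terms with s x are
    constant along fibres of p, where the coefficients of y add up to 0.\<close>
  have "(\<Sum>x\<in>carrier H. y x * H.basis (s x) k) = 0" for k
  proof -
    have "(\<Sum>x\<in>carrier H. y x * H.basis (s x) k) = (\<Sum>q\<in>carrier Q. \<Sum>x\<in>{x \<in> carrier H. p x = q}. y x * H.basis (s x) k)"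
      by (rule sum.group[symmetric, OF H.fin Q.fin]) auto
    also have "\<dots> = (\<Sum>q\<in>carrier Q. push y q * H.basis (sec q) k)"
      by (simp add: push_def sum_distrib_right s_def)
    also have "\<dots> = 0" by (simp add: py)
    finally show ?thesis .
  qed
  then have "Poly_Mapping.lookup (\<Sum>x\<in>carrier H. \<Sum>i<?M. X x i \<otimes>\<^bsub>?R\<^esub> Y x) k = int ?M * y k" for k
    using fun_cong[OF basis_expansion[OF y], of k]
    by (simp add: lookup_sum tele sum_distrib_left[symmetric] right_diff_distrib sum_subtractf)
  then have "(\<Sum>x\<in>carrier H. \<Sum>i<?M. X x i \<otimes>\<^bsub>?R\<^esub> Y x) = Abs_poly_mapping (\<lambda>x. int ?M * y x)"
    using y by (intro poly_mapping_eqI) (simp add: H.lookup_Abs H.sup_on_def)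
  then show ?thesis using inP by simp
qed

theorem inverse_semirational_of_trivial_units:
  assumes Q: "central_units Q \<subseteq> trivial_central_units Q"
    and HN: "central_units H \<inter> {\<one>\<^bsub>int_group_ring H\<^esub> \<oplus>\<^bsub>int_group_ring H\<^esub> y | y.
        y \<in> additive_product (int_group_ring H) (augmentation_ideal H) (augmentation_ideal (H\<lparr>carrier := N\<rparr>))}
      \<subseteq> trivial_central_units H"
  shows "inverse_semirational H"
proof (rule H.inverse_semirational_if_units_torsion)
  fix u u' assume u: "H.sup_on u" "H.sup_on u'" "H.class_fun u" "H.class_fun u'"
    "H.conv u u' = H.\<delta>" "H.conv u' u = H.\<delta>"
  have "Abs_poly_mapping (push u) \<in> central_units Q"
  proof (rule Q.central_unitI[OF push_sup push_sup])
    show "Q.class_fun (push u)" by (rule push_class[OF u(3)])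
    show "Q.conv (push u) (push u') = Q.\<delta>" "Q.conv (push u') (push u) = Q.\<delta>"
      using u(5,6) by (simp_all add: push_conv[symmetric] push_delta)
  qed
  then have "Abs_poly_mapping (push u) \<in> trivial_central_units Q" using Q by blast
  then have pu: "Q.cpow (push u) (2 * Coset.order Q) = Q.\<delta>"
    using Q.cpow_trivial_unit by (metis Q.lookup_Abs push_sup)
  \<comment> \<open>The image of u in Z[Q] is a trivial unit, and this exponent turns it into
    1.\<close>
  define w w' where "w = H.cpow u (2 * Coset.order Q)" and "w' = H.cpow u' (2 * Coset.order Q)"
  have w: "H.sup_on w" "H.sup_on w'" "H.class_fun w" "H.class_fun w'" "H.conv w w' = H.\<delta>" "H.conv w' w = H.\<delta>"
    using u by (simp_all add: w_def w'_def H.cpow_sup H.cpow_class H.cpow_inverse)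
  have pw: "push w = Q.\<delta>" unfolding w_def push_cpow by (rule pu)
  have M: "int (card N) > 0"
    using subgroup.one_closed[OF p.subgroup_kernel] finite_subset[OF subgroup.subset[OF p.subgroup_kernel] H.fin]
      card_gt_0_iff by fastforce
  obtain e y where e: "e > 0" "H.sup_on y" "H.cpow w e = (\<lambda>x. H.\<delta> x + int (card N) * y x)"
    by (rule H.power_cong_delta[OF w(1,2,5,6) M])
  define v where "v = H.cpow w e"
  have "Q.cpow Q.\<delta> e = Q.\<delta>" by (induction e) (simp_all add: Q.cpow_def Q.conv_delta[OF Q.delta_sup])
  then have pv: "push v = Q.\<delta>" unfolding v_def push_cpow pw .
  have "push y q = 0" for q
  proof -
    have "push v q = push H.\<delta> q + int (card N) * push y q"
      by (simp add: v_def e(3) push_def sum.distrib sum_distrib_left)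
    then show ?thesis using M by (simp add: pv push_delta)
  qed
  then have py: "push y = (\<lambda>q. 0)" by blast
  have vu: "Abs_poly_mapping v \<in> central_units H"
  proof (rule H.central_unitI)
    show "H.sup_on v" "H.sup_on (H.cpow w' e)" "H.class_fun v"
      using w by (simp_all add: v_def H.cpow_sup H.cpow_class)
    show "H.conv v (H.cpow w' e) = H.\<delta>" "H.conv (H.cpow w' e) v = H.\<delta>"
      unfolding v_def using w by (simp_all add: H.cpow_inverse)
  qed
  have sy: "H.sup_on (\<lambda>x. int (card N) * y x)" using e(2) by (simp add: H.sup_on_def)
  have "Abs_poly_mapping v = \<one>\<^bsub>int_group_ring H\<^esub> \<oplus>\<^bsub>int_group_ring H\<^esub> Abs_poly_mapping (\<lambda>x. int (card N) * y x)"
  proof (rule poly_mapping_eqI)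
    fix k
    have "Poly_Mapping.lookup (a \<oplus>\<^bsub>int_group_ring H\<^esub> b) k = Poly_Mapping.lookup a k + Poly_Mapping.lookup b k" for a b
      by (simp add: int_group_ring_def lookup_add)
    then show "Poly_Mapping.lookup (Abs_poly_mapping v) k
       = Poly_Mapping.lookup (\<one>\<^bsub>int_group_ring H\<^esub> \<oplus>\<^bsub>int_group_ring H\<^esub> Abs_poly_mapping (\<lambda>x. int (card N) * y x)) k"
      using H.lookup_Abs[OF sy] H.lookup_Abs[of v] H.cpow_sup[of w e] by (simp add: v_def H.lookup_one e(3))
  qed
  then have "Abs_poly_mapping v \<in> trivial_central_units H"
    using HN vu kernel_multiple_in_product[OF e(2) py] by blast
  then have "H.cpow v (2 * Coset.order H) = H.\<delta>"
    using H.cpow_trivial_unit H.lookup_Abs[of v] H.cpow_sup[of w e] by (metis v_def)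
  then have "H.cpow u (2 * Coset.order Q * e * (2 * Coset.order H)) = H.\<delta>"
    by (simp only: H.cpow_mult v_def w_def)
  moreover have "2 * Coset.order Q * e * (2 * Coset.order H) > 0"
    using e(1) H.fin Q.fin H.order_gt_0_iff_finite Q.order_gt_0_iff_finite by simp
  ultimately show "\<exists>j>0. (H.conv u ^^ j) H.\<delta> = H.\<delta>" unfolding H.cpow_def by blast
qed

end

section \<open>The semidirect product\<close>

lemma centralizer_normal:
  fixes G (structure)
  assumes "group G" "A \<lhd> G"
  shows "centralizer G A \<lhd> G"
proof -
  interpret group G by fact
  interpret A: normal A G by fact
  have AG: "a \<in> carrier G" if "a \<in> A" for a using that A.subset by blast
  show ?thesis
    unfolding normal_inv_iff
  proof (intro conjI ballI subgroupI)
    show "centralizer G A \<subseteq> carrier G" by (auto simp: centralizer_def)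
    have "\<one> \<in> centralizer G A" using AG by (simp add: centralizer_def)
    then show "centralizer G A \<noteq> {}" by blast
    fix c assume c: "c \<in> centralizer G A"
    then have cG: "c \<in> carrier G" and cc: "\<And>a. a \<in> A \<Longrightarrow> c \<otimes> a = a \<otimes> c" by (auto simp: centralizer_def)
    have "inv c \<otimes> a = a \<otimes> inv c" if a: "a \<in> A" for a
    proof -
      have "inv c \<otimes> a = inv c \<otimes> (a \<otimes> c) \<otimes> inv c" using cG AG[OF a] by (simp add: m_assoc)
      also have "\<dots> = a \<otimes> inv c" unfolding cc[OF a, symmetric] using cG AG[OF a] by (simp add: m_assoc inv_mult_cancel)
      finally show ?thesis .
    qed
    then show "inv c \<in> centralizer G A" using cG by (simp add: centralizer_def)
    show "c \<otimes> d \<in> centralizer G A" if d: "d \<in> centralizer G A" for d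
    proof -
      have dG: "d \<in> carrier G" and dc: "\<And>a. a \<in> A \<Longrightarrow> d \<otimes> a = a \<otimes> d" using d by (auto simp: centralizer_def)
      have "c \<otimes> d \<otimes> a = a \<otimes> (c \<otimes> d)" if a: "a \<in> A" for a
      proof -
        have "c \<otimes> d \<otimes> a = c \<otimes> (a \<otimes> d)" using cG dG AG[OF a] dc[OF a] by (simp add: m_assoc)
        also have "\<dots> = (a \<otimes> c) \<otimes> d" unfolding cc[OF a, symmetric] using cG dG AG[OF a] by (simp add: m_assoc)
        finally show ?thesis using cG dG AG[OF a] by (simp add: m_assoc)
      qed
      then show ?thesis using cG dG by (simp add: centralizer_def)
    qed
    fix g assume g: "g \<in> carrier G"
    have "g \<otimes> c \<otimes> inv g \<otimes> a = a \<otimes> (g \<otimes> c \<otimes> inv g)" if a: "a \<in> A" for a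
    proof -
      define b where "b = inv g \<otimes> a \<otimes> g"
      have b: "b \<in> A" using A.inv_op_closed1[OF g a] by (simp add: b_def)
      have e: "inv g \<otimes> a = b \<otimes> inv g" "a \<otimes> g = g \<otimes> b"
        using g AG[OF a] by (simp_all add: b_def m_assoc inv_mult_cancel)
      have "g \<otimes> c \<otimes> inv g \<otimes> a = g \<otimes> (c \<otimes> b) \<otimes> inv g" using g cG AG[OF a] AG[OF b] e(1) by (simp add: m_assoc)
      also have "\<dots> = a \<otimes> g \<otimes> c \<otimes> inv g" unfolding cc[OF b] e(2) using g cG AG[OF b] by (simp add: m_assoc)
      finally show ?thesis using g cG AG[OF a] by (simp add: m_assoc)
    qed
    then show "g \<otimes> c \<otimes> inv g \<in> centralizer G A" using g cG by (simp add: centralizer_def)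
  qed
qed

locale conj_semidirect_setup = group G + normal A G for G (structure) and A +
  assumes finA: "finite A"
begin

abbreviation "Z \<equiv> centralizer G A"
abbreviation "Q \<equiv> G Mod Z"
abbreviation "H \<equiv> conj_semidirect G A"
abbreviation "\<phi> \<equiv> coset_conj G"

declare mult_FactGroup [simp del] one_FactGroup [simp del]

lemma Z_normal: "Z \<lhd> G"
  by (rule centralizer_normal[OF is_group]) unfold_locales

sublocale Z: normal Z G
  by (rule Z_normal)

sublocale Q: group Q
  by (rule Z.factorgroup_is_group)

lemma AG: "a \<in> A \<Longrightarrow> a \<in> carrier G"
  using subset by blast

lemma Q_cases: "X \<in> carrier Q \<Longrightarrow> \<exists>g\<in>carrier G. X = Z #> g"
  by (auto simp: FactGroup_def RCOSETS_def)

lemma Q_mult: "g \<in> carrier G \<Longrightarrow> h \<in> carrier G \<Longrightarrow> (Z #> g) \<otimes>\<^bsub>Q\<^esub> (Z #> h) = Z #> (g \<otimes> h)"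
  by (simp add: FactGroup_def Z.rcos_sum)

lemma Q_one: "\<one>\<^bsub>Q\<^esub> = Z #> \<one>"
  using Z.subset by (simp add: FactGroup_def)

text \<open>Representatives of the coset differ by an element of the centralizer on the left, and
  this commutes with the conjugate of a, which lies in A again. So the set of conjugates has a
  single element.\<close>

lemma coset_conj_rep:
  assumes g: "g \<in> carrier G" and a: "a \<in> A"
  shows "\<phi> (Z #> g) a = g \<otimes> a \<otimes> inv g"
proof -
  let ?b = "g \<otimes> a \<otimes> inv g"
  have b: "?b \<in> A" by (rule inv_op_closed2[OF g a])
  have "h \<otimes> a \<otimes> inv h = ?b" if "h \<in> Z #> g" for h
  proof -
    have "\<exists>c\<in>Z. h = c \<otimes> g" using that by (simp add: r_coset_def)
    then obtain c where c: "c \<in> Z" "h = c \<otimes> g" by (elim bexE)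
    have cG: "c \<in> carrier G" and cb: "c \<otimes> ?b = ?b \<otimes> c" using c(1) b unfolding centralizer_def by blast+
    have "h \<otimes> a \<otimes> inv h = (c \<otimes> ?b) \<otimes> inv c" unfolding c(2) using cG g AG[OF a] by (simp add: inv_mult_group m_assoc)
    also have "\<dots> = ?b" unfolding cb using cG AG[OF b] by (simp only: m_assoc r_inv inv_closed r_one)
    finally show ?thesis .
  qed
  moreover have "g \<in> Z #> g" by (rule rcos_self[OF g Z.is_subgroup])
  ultimately have "(\<lambda>h. h \<otimes> a \<otimes> inv h) ` (Z #> g) = {?b}" by blast
  then show ?thesis by (simp add: coset_conj_def)
qed

lemma carrier_H: "carrier H = A \<times> carrier Q"
  by (simp add: conj_semidirect_def semidirect_product_def)

lemma mult_H: "x \<otimes>\<^bsub>H\<^esub> y = (fst x \<otimes> \<phi> (snd x) (fst y), snd x \<otimes>\<^bsub>Q\<^esub> snd y)"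
  by (simp add: conj_semidirect_def semidirect_product_def split_beta)

lemma one_H: "\<one>\<^bsub>H\<^esub> = (\<one>, \<one>\<^bsub>Q\<^esub>)"
  by (simp add: conj_semidirect_def semidirect_product_def)

lemma phi_closed: "X \<in> carrier Q \<Longrightarrow> a \<in> A \<Longrightarrow> \<phi> X a \<in> A"
  using Q_cases coset_conj_rep inv_op_closed2 by metis

lemma phi_one: "a \<in> A \<Longrightarrow> \<phi> \<one>\<^bsub>Q\<^esub> a = a"
  unfolding Q_one using coset_conj_rep[OF Group.group.is_monoid[OF is_group, THEN monoid.one_closed]] AG by simp

lemma phi_mult:
  assumes "X \<in> carrier Q" "Y \<in> carrier Q" "a \<in> A"
  shows "\<phi> (X \<otimes>\<^bsub>Q\<^esub> Y) a = \<phi> X (\<phi> Y a)"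
proof -
  obtain g h where gh: "g \<in> carrier G" "X = Z #> g" "h \<in> carrier G" "Y = Z #> h" using Q_cases assms by metis
  have ha: "h \<otimes> a \<otimes> inv h \<in> A" by (rule inv_op_closed2[OF gh(3) assms(3)])
  have "\<phi> (X \<otimes>\<^bsub>Q\<^esub> Y) a = (g \<otimes> h) \<otimes> a \<otimes> inv (g \<otimes> h)"
    unfolding gh Q_mult[OF gh(1,3)] by (rule coset_conj_rep) (use gh assms in auto)
  also have "\<dots> = g \<otimes> (h \<otimes> a \<otimes> inv h) \<otimes> inv g" using gh AG[OF assms(3)] by (simp add: inv_mult_group m_assoc)
  also have "\<dots> = \<phi> X (\<phi> Y a)" unfolding gh by (simp add: coset_conj_rep gh assms ha)
  finally show ?thesis .
qed

lemma phi_hom: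
  assumes "X \<in> carrier Q" "a \<in> A" "b \<in> A"
  shows "\<phi> X (a \<otimes> b) = \<phi> X a \<otimes> \<phi> X b"
proof -
  obtain g where g: "g \<in> carrier G" "X = Z #> g" using Q_cases assms by metis
  have "a \<otimes> b \<in> A" using assms by simp
  then show ?thesis using g AG assms by (simp add: coset_conj_rep m_assoc inv_mult_cancel)
qed

lemma group_H: "group H"
proof (rule groupI)
  fix x y assume xy: "x \<in> carrier H" "y \<in> carrier H"
  then show "x \<otimes>\<^bsub>H\<^esub> y \<in> carrier H" using phi_closed by (auto simp: carrier_H mult_H)
  fix z assume z: "z \<in> carrier H"
  obtain a X b Y c W where e: "x = (a, X)" "y = (b, Y)" "z = (c, W)" by (cases x, cases y, cases z)
  have m: "a \<in> A" "b \<in> A" "c \<in> A" "X \<in> carrier Q" "Y \<in> carrier Q" "W \<in> carrier Q" using xy z e by (auto simp: carrier_H)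
  then show "x \<otimes>\<^bsub>H\<^esub> y \<otimes>\<^bsub>H\<^esub> z = x \<otimes>\<^bsub>H\<^esub> (y \<otimes>\<^bsub>H\<^esub> z)"
    using phi_closed AG by (simp add: mult_H e phi_mult phi_hom m_assoc Q.m_assoc)
next
  show "\<one>\<^bsub>H\<^esub> \<in> carrier H" using one_closed by (simp add: carrier_H one_H)
next
  fix x assume "x \<in> carrier H"
  then obtain a X where e: "x = (a, X)" and m: "a \<in> A" "X \<in> carrier Q" by (auto simp: carrier_H)
  show "\<one>\<^bsub>H\<^esub> \<otimes>\<^bsub>H\<^esub> x = x" using m AG phi_one by (simp add: mult_H one_H e)
  let ?Y = "inv\<^bsub>Q\<^esub> X"
  have y: "\<phi> ?Y (inv a) \<in> A" "?Y \<in> carrier Q" using m phi_closed by simp_all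
  have "\<phi> ?Y (inv a) \<otimes> \<phi> ?Y a = \<phi> ?Y (inv a \<otimes> a)"
    by (rule phi_hom[symmetric]) (use m in simp_all)
  also have "inv a \<otimes> a = \<one>" using m AG by simp
  also have "\<phi> ?Y \<one> = \<one>"
  proof -
    obtain g where "g \<in> carrier G" "?Y = Z #> g" using Q_cases y(2) by metis
    then show ?thesis using coset_conj_rep[of g \<one>] one_closed by simp
  qed
  finally have "(\<phi> ?Y (inv a), ?Y) \<otimes>\<^bsub>H\<^esub> x = \<one>\<^bsub>H\<^esub>" using m by (simp add: mult_H one_H e)
  moreover have "(\<phi> ?Y (inv a), ?Y) \<in> carrier H" using y by (simp add: carrier_H)
  ultimately show "\<exists>y\<in>carrier H. y \<otimes>\<^bsub>H\<^esub> x = \<one>\<^bsub>H\<^esub>" by blast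
qed

text \<open>G itself may be infinite, but the elements of Q act on the finite set A by pairwise
  different maps, since the centralizer is the kernel of the action.\<close>

lemma finite_Q: "finite (carrier Q)"
proof -
  define F where "F = (\<lambda>X. \<lambda>a\<in>A. \<phi> X a)"
  have "inj_on F (carrier Q)"
  proof (rule inj_onI)
    fix X Y assume X: "X \<in> carrier Q" and Y: "Y \<in> carrier Q" and e: "F X = F Y"
    obtain g h where gh: "g \<in> carrier G" "X = Z #> g" "h \<in> carrier G" "Y = Z #> h" using Q_cases X Y by metis
    have "g \<otimes> inv h \<otimes> b = b \<otimes> (g \<otimes> inv h)" if b: "b \<in> A" for b
    proof -
      define a where "a = inv h \<otimes> b \<otimes> h"
      have a: "a \<in> A" using inv_op_closed1[OF gh(3) b] by (simp add: a_def)
      have "F X a = F Y a" using e by simp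
      then have "g \<otimes> a \<otimes> inv g = h \<otimes> a \<otimes> inv h" using a gh by (simp add: F_def coset_conj_rep)
      also have "\<dots> = b" using gh AG[OF b] by (simp add: a_def m_assoc inv_mult_cancel)
      finally have "b = g \<otimes> a \<otimes> inv g" ..
      then have gb: "b \<otimes> g = g \<otimes> a" using gh AG[OF a] by (simp add: m_assoc)
      have "g \<otimes> inv h \<otimes> b = g \<otimes> a \<otimes> inv h" using gh AG[OF b] by (simp add: a_def m_assoc)
      then show ?thesis unfolding gb[symmetric] using gh AG[OF b] by (simp add: m_assoc)
    qed
    moreover have "g \<otimes> inv h \<in> carrier G" using gh by simp
    ultimately have "g \<otimes> inv h \<in> Z" unfolding centralizer_def by blast
    then have "g \<in> Z #> h" using Z.rcos_module[OF is_group gh(3,1)] by simp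
    then show "X = Y" unfolding gh by (rule repr_independence[OF _ gh(3) Z.is_subgroup, symmetric])
  qed
  moreover have "F ` carrier Q \<subseteq> A \<rightarrow>\<^sub>E A" using phi_closed by (auto simp: F_def)
  moreover have "finite (A \<rightarrow>\<^sub>E A)" using finA by (intro finite_PiE) auto
  ultimately show ?thesis by (rule inj_on_finite)
qed

lemma snd_hom: "group_hom H Q snd"
  by (intro group_hom.intro group_hom_axioms.intro group_H Q.is_group)
    (auto simp: hom_def carrier_H mult_H)

lemma snd_surj: "snd ` carrier H = carrier Q"
proof -
  have "A \<noteq> {}" using one_closed by blast
  then show ?thesis by (simp add: carrier_H)
qed

lemma kernel_snd: "kernel H Q snd = conj_semidirect_base G A"
proof (intro equalityI subsetI)
  fix x assume "x \<in> kernel H Q snd"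
  then show "x \<in> conj_semidirect_base G A" by (simp add: kernel_def carrier_H conj_semidirect_base_def mem_Times_iff)
next
  fix x assume "x \<in> conj_semidirect_base G A"
  then have x: "fst x \<in> A" "snd x = \<one>\<^bsub>Q\<^esub>" by (simp_all add: conj_semidirect_base_def mem_Times_iff)
  show "x \<in> kernel H Q snd" unfolding kernel_def carrier_H
    using x(1) Q.one_closed by (simp only: x(2) mem_Collect_eq mem_Times_iff)
qed

lemma finite_H: "finite (carrier H)"
  using finA finite_Q by (simp add: carrier_H)

text \<open>H is an extension of Q by A, where A is a subgroup and Q a quotient of the solvable
  group G.\<close>

lemma solvable_H:
  assumes "solvable G"
  shows "solvable H"
proof (rule solvable_condition)
  let ?A = "G\<lparr>carrier := A\<rparr>"
  have gA: "group ?A" by (rule subgroup_imp_group[OF is_subgroup])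
  show "group_hom ?A H (\<lambda>a. (a, \<one>\<^bsub>Q\<^esub>))"
    by (intro group_hom.intro group_hom_axioms.intro gA group_H)
      (auto simp: hom_def carrier_H mult_H phi_one)
  show "group_hom H Q snd" by (rule snd_hom)
  show "snd ` carrier H = carrier Q" by (rule snd_surj)
  show "kernel H Q snd \<subseteq> (\<lambda>a. (a, \<one>\<^bsub>Q\<^esub>)) ` carrier ?A"
    by (auto simp: kernel_snd conj_semidirect_base_def)
  have "group_hom ?A G id"
    by (intro group_hom.intro group_hom_axioms.intro gA is_group) (use AG in \<open>auto simp: hom_def\<close>)
  moreover have "solvable_seq G (id ` carrier ?A)"
    using solvable_subgroup[OF is_subgroup] assms by (simp add: solvable_def)
  ultimately have "solvable_seq ?A (carrier ?A)"
    using group_hom.solvable_img_imp_solvable[of ?A G id "carrier ?A"] group.subgroup_self[OF gA] by simp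
  then show "solvable ?A" by (simp add: solvable_def)
  have "group_hom G Q (\<lambda>g. Z #> g)"
    by (intro group_hom.intro group_hom_axioms.intro is_group Q.is_group Z.r_coset_hom_Mod)
  then have "solvable_seq Q ((\<lambda>g. Z #> g) ` carrier G)"
    using group_hom.solvable_imp_solvable_img assms unfolding solvable_def by blast
  moreover have "(\<lambda>g. Z #> g) ` carrier G = carrier Q" by (auto simp: FactGroup_def RCOSETS_def)
  ultimately show "solvable Q" by (simp add: solvable_def)
qed

end

theorem corollary12:
  fixes G :: "('a, 'm) monoid_scheme" and A :: "'a set"
  defines "H \<equiv> conj_semidirect G A"
  defines "B \<equiv> H\<lparr>carrier := conj_semidirect_base G A\<rparr>"
  assumes "group G" and "solvable G"
    and "A \<lhd> G" and "finite A"
    and "central_units H \<inter>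
           {\<one>\<^bsub>int_group_ring H\<^esub> \<oplus>\<^bsub>int_group_ring H\<^esub> y | y.
              y \<in> additive_product (int_group_ring H) (augmentation_ideal H) (augmentation_ideal B)}
         \<subseteq> trivial_central_units H"
    and "cut_group (G Mod centralizer G A)"
  shows "order_primes (G\<lparr>carrier := A\<rparr>) \<subseteq> {2, 3, 5, 7}"
proof -
  interpret S: conj_semidirect_setup G A
    by (intro conj_semidirect_setup.intro conj_semidirect_setup_axioms.intro assms)
  interpret F: finite_quotient H S.Q snd
    unfolding H_def
    by (intro finite_quotient.intro finite_quotient_axioms.intro finite_group.intro finite_group_axioms.intro
        S.group_H S.Q.is_group S.finite_H S.finite_Q S.snd_hom S.snd_surj)
  have "inverse_semirational H"
  proof (rule F.inverse_semirational_of_trivial_units)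
    show "central_units S.Q \<subseteq> trivial_central_units S.Q"
      using \<open>cut_group (G Mod centralizer G A)\<close> by (simp add: cut_group_def)
    \<comment> \<open>The copy of A in H is the kernel of the projection to Q, so the assumption on
      units is the one demanded by the argument for quotients.\<close>
    have "B = H\<lparr>carrier := kernel H S.Q snd\<rparr>" by (simp add: B_def H_def S.kernel_snd)
    then show "central_units H \<inter> {\<one>\<^bsub>int_group_ring H\<^esub> \<oplus>\<^bsub>int_group_ring H\<^esub> y | y.
        y \<in> additive_product (int_group_ring H) (augmentation_ideal H) (augmentation_ideal (H\<lparr>carrier := kernel H S.Q snd\<rparr>))}
      \<subseteq> trivial_central_units H"
      using assms(7) by simp
  qed
  moreover have "solvable H" unfolding H_def by (rule S.solvable_H[OF \<open>solvable G\<close>])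
  ultimately have smooth: "primes_within {2, 3, 5, 7} (Coset.order H)"
    using solvable_inverse_semirational_primes[of H] S.group_H S.finite_H by (simp add: H_def)
  have dvd: "card A dvd Coset.order H" by (simp add: Coset.order_def H_def S.carrier_H card_cartesian_product)
  show ?thesis
  proof
    fix p assume "p \<in> order_primes (G\<lparr>carrier := A\<rparr>)"
    then obtain x where p: "prime p" and x: "x \<in> A" "group.ord (G\<lparr>carrier := A\<rparr>) x = p"
      by (auto simp: order_primes_def)
    interpret A: group "G\<lparr>carrier := A\<rparr>" by (rule S.subgroup_imp_group[OF S.is_subgroup])
    have "p dvd card A" using A.ord_dvd_group_order[of x] x by (simp add: Coset.order_def)
    then have "p dvd Coset.order H" using dvd dvd_trans by blast
    then show "p \<in> {2, 3, 5, 7}" using smooth p unfolding primes_within_def by blast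
  qed
qed

end
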